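(* Let $G$ be a separable topological group and let $\{K_\alpha\}_{\alpha\in\mathcal A}$, $K_\alpha\subset K\subset G$, be an exhaustive $\mathcal M$-family of subgroups. Let $\sigma$ be an action of $G$ by nonsingular transformations $\sigma(g)$ of a Lebesgue probability space $(Z,\zeta)$, and suppose that $K$ acts by measure preserving transformations. Let $K_{\gamma_1}\supset K_{\gamma_2}\supset\dots$ be a sequence of subgroups of the family as in condition 3) of the definition of an exhaustive $\mathcal M$-family. Assume that the unitary representation $T_{1/2+is}$ of $G$ in $L^2(Z)$, $g\mapsto T_{1/2+is}(\sigma(g))$, is admissible ($s\in\mathbb R$; this condition does not depend on $s$). Then a polymorphism $\mathfrak r\in\mathrm{Pol}(Z,Z)$ is contained in the closure of $G$ (that is, of $\sigma(G)$) in $\mathrm{Pol}(Z,Z)$ if and only if for all $k$ the element $$\mathfrak m_{\gamma_k}\diamond\mathfrak r\diamond\mathfrak m_{\gamma_k}$$ is contained in the closure of $G$ in $\mathrm{Pol}(Z,Z)$.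
   Context: **Polymorphisms.** $\mathbb R^\times$ denotes the multiplicative group of positive reals, with coordinate $t$. All measure spaces are Lebesgue spaces (equivalent to an interval together with at most countably many atoms of nonzero measure). For Lebesgue probability spaces $(X,\xi)$, $(Y,\upsilon)$, a polymorphism from $X$ to $Y$ is a measure $\mathfrak p$ on $X\times Y\times\mathbb R^\times$ such that the pushforward of $\mathfrak p$ to $X$ is $\xi$ and the pushforward of $t\cdot\mathfrak p$ to $Y$ is $\upsilon$. The set of these is $\mathrm{Pol}(X,Y)$. A sequence $\mathfrak p_j$ converges to $\mathfrak p$ in $\mathrm{Pol}(X,Y)$ if for all measurable $A\subset X$, $B\subset Y$ the pushforwards to $\mathbb R^\times$ of the restrictions to $A\times B\times\mathbb R^\times$ of $\mathfrak p_j$ and of $t\cdot\mathfrak p_j$ converge weakly (against bounded continuous functions on $\mathbb R^\times$) to the corresponding pushforwards for $\mathfrak p$ and $t\cdot\mathfrak p$. Closures in $\mathrm{Pol}(Z,Z)$ refer to the topology of this convergence. **Product.** Let $\mathfrak M^\triangledown$ be the set of finite positive Borel measures $s$ on $\mathbb R^\times$ with $\int t\,ds(t)<\infty$; it is a semigroup under the convolution $*$ on the group $\mathbb R^\times$. A polymorphism $\mathfrak s\in\mathrm{Pol}(X,Y)$ is continuous if there is a measurable function $(x,y)\mapsto s_{x,y}\in\mathfrak M^\triangledown$ with $\mathfrak s(A\times B\times C)=\int_{A\times B}s_{x,y}(C)\,d\xi(x)\,d\upsilon(y)$. If continuous $\mathfrak u\in\mathrm{Pol}(X,Y)$, $\mathfrak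 v\in\mathrm{Pol}(Y,W)$ are given by $u_{x,y}$, $v_{y,w}$, their product is the continuous polymorphism in $\mathrm{Pol}(X,W)$ given by $\int_Y u_{x,y}*v_{y,w}\,d\upsilon(y)$. Continuous polymorphisms are dense, and this product extends uniquely to a separately continuous, associative product $\mathrm{Pol}(X,Y)\times\mathrm{Pol}(Y,W)\to\mathrm{Pol}(X,W)$. Here products are written from left to right: $\mathfrak u\diamond\mathfrak v\in\mathrm{Pol}(X,W)$ means "first $\mathfrak u$, then $\mathfrak v$". **Nonsingular transformations.** A transformation $q$ of $(Z,\zeta)$ is nonsingular if $q$ and $q^{-1}$ send null sets to null sets; its Radon–Nikodym derivative $q'$ is defined by $\zeta(q(A))=\int_A q'(z)\,d\zeta(z)$. The group $\mathrm{Gms}(Z)$ of nonsingular transformations (up to null sets) has the product $q_1\diamond q_2=q_2(q_1(\cdot))$ and is embedded in $\mathrm{Pol}(Z,Z)$ by sending $q$ to the pushforward of $\zeta$ under $z\mapsto(z,q(z),q'(z))$. An action of $G$ by nonsingular transformations is a continuous homomorphism $\sigma:G\to\mathrm{Gms}(Z)$ (so $\sigma(gh)=\sigma(g)\diamond\sigma(h)$), where $\mathrm{Gms}(Z)$ carries the topology induced from $\mathrm{Pol}(Z,Z)$. For $q\in\mathrm{Gms}(Z)$ and $s\in\mathbb R$, $T_{1/2+is}(q)$ is the unitary operator in $L^2(Z)$ given by $T_{1/2+is}(q)\phi(z)=\phi(q(z))\,q'(z)^{1/2+is}$. **Reduced double cosets and $\mathcal M$-families.** Unitary representations $\rho$ of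 $G$ are (continuous) representations in separable Hilbert spaces $H$. For a closed subgroup $L\subset G$, $H^L$ is the subspace of $L$-fixed vectors and $P^L$ the orthogonal projection onto it. For closed subgroups $L,M\subset G$ let $\widehat\rho_{L,M}(g)=P^L\rho(g)|_{H^M}:H^M\to H^L$; it depends only on the double coset $LgM$. The set $[L\backslash G/M]$ of reduced double cosets is the quotient of $G$ by the equivalence: $g\sim g'$ iff $\widehat\rho_{L,M}(g)=\widehat\rho_{L,M}(g')$ for all unitary representations $\rho$ of $G$. Let $K\subset G$ be a closed subgroup and let $\{K_\alpha\}_{\alpha\in\mathcal A}$ be a family of closed subgroups of $K$ such that for any $\alpha,\alpha'$ there is $\alpha''$ with $K_{\alpha''}\subset K_\alpha\cap K_{\alpha'}$; the family includes $K=K_0$. Write $H_\alpha=H^{K_\alpha}$, $P_\alpha=P^{K_\alpha}$, $\widehat\rho_{\alpha,\beta}=\widehat\rho_{K_\alpha,K_\beta}$. The family is an $\mathcal M$-family if for all $\alpha,\beta,\gamma\in\mathcal A$, $\mathfrak g\in[K_\alpha\backslash G/K_\beta]$, $\mathfrak h\in[K_\beta\backslash G/K_\gamma]$ there is an element $\mathfrak g\circledcirc\mathfrak h\in[K_\alpha\backslash G/K_\gamma]$ such that $\widehat\rho_{\alpha,\beta}(\mathfrak g)\,\widehat\rho_{\beta,\gamma}(\mathfrak h)=\widehat\rho_{\alpha,\gamma}(\mathfrak g\circledcirc\mathfrak h)$ for every unitary representation $\rho$ of $G$. **Admissibility and exhaustive families.** For a unitary representation $\rho$ of $G$ in $H$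 put $H^\circ=\bigcup_{\alpha\in\mathcal A}H_\alpha$. The representation $\rho$ is admissible if $H^\circ$ is dense in $H$, and essentially admissible if no proper subrepresentation of $H$ contains $H^\circ$. An $\mathcal M$-family is exhaustive if: 1) any essentially admissible representation of $G$ is admissible; 2) for each $K_\alpha$ there is a sequence $\theta^{(\alpha)}_j\in K_\alpha$ such that for any unitary representation $\rho$ of $G$ the sequence $\rho(\theta^{(\alpha)}_j)$ converges to $P_\alpha$ in the weak operator topology; 3) there is a sequence of subgroups $K_{\gamma_1}\supset K_{\gamma_2}\supset\dots$ of the family such that for any admissible unitary representation of $G$ the subspace $\bigcup_j H_{\gamma_j}$ is dense in $H$. **The polymorphisms $\mathfrak m_\alpha$.** A measurable $A\subset Z$ is $K_\alpha$-invariant if $A\bigtriangleup\sigma(h)(A)$ is null for every $h\in K_\alpha$. Let $\Sigma_\alpha$ be the $\sigma$-algebra of $K_\alpha$-invariant sets. $(Z_\alpha,\zeta_\alpha)$ is the Lebesgue probability space that is the quotient of $(Z,\zeta)$ by the measurable partition corresponding to $\Sigma_\alpha$: there is a canonical measurable map $\pi_\alpha:Z\to Z_\alpha$ pushing $\zeta$ to $\zeta_\alpha$, and the preimages under $\pi_\alpha$ of measurable sets in $Z_\alpha$ form, modulo null sets, exactly $\Sigma_\alpha$. Let $\mathfrak l_\alpha\in\mathrm{Pol}(Z,Z_\alpha)$ be the pushforward of $\zeta$ under $z\mapsto(z,\pi_\alpha(z),1)$, and $\mathfrak l_\alpha^\star\in\mathrm{Pol}(Z_\alpha,Z)$ the pushforward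 of $\zeta$ under $z\mapsto(\pi_\alpha(z),z,1)$. Then $\mathfrak m_\alpha\in\mathrm{Pol}(Z,Z)$ is the product "first $\mathfrak l_\alpha$, then $\mathfrak l_\alpha^\star$", i.e. $\mathfrak m_\alpha=\mathfrak l_\alpha\diamond\mathfrak l_\alpha^\star$ in the left-to-right order. *)

theory Defs
  imports "HOL-Probability.Probability" "HOL-Algebra.Group"
begin

section \<open>Lebesgue spaces and polymorphisms\<close>

text \<open>Isomorphism modulo null sets.\<close>

definition iso_mod0 :: "'x measure \<Rightarrow> 'y measure \<Rightarrow> bool" where
  "iso_mod0 M N \<longleftrightarrow>
     (\<exists>M0 N0 f. M0 \<in> sets M \<and> space M - M0 \<in> null_sets M \<and>
        N0 \<in> sets N \<and> space N - N0 \<in> null_sets N \<and>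
        bij_betw f M0 N0 \<and>
        f \<in> measurable (restrict_space M M0) (restrict_space N N0) \<and>
        the_inv_into M0 f \<in> measurable (restrict_space N N0) (restrict_space M M0) \<and>
        distr (restrict_space M M0) (restrict_space N N0) f = restrict_space N N0)"

text \<open>The model measure is Lebesgue measure on the interval \<open>[0, a]\<close> together with point masses
  \<open>c n\<close> at the points \<open>-1 - n\<close>; indices with \<open>c n = 0\<close> contribute no atom. As usual for Lebesgue
  spaces, the \<open>\<sigma>\<close>-algebra is complete.\<close>

definition lebesgue_prob_space :: "'x measure \<Rightarrow> bool" where
  "lebesgue_prob_space M \<longleftrightarrow> prob_space M \<and> complete_measure M \<and>
     (\<exists>(N :: real measure) (a :: real) (c :: nat \<Rightarrow> ennreal). sets N = sets borel \<and>
        (\<forall>A\<in>sets borel. emeasure N A =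
            emeasure lborel (A \<inter> {0..a}) + (\<Sum>n. c n * indicator A (- 1 - real n))) \<and>
        iso_mod0 M (completion N))"

text \<open>The group of positive reals as a measurable space.\<close>

abbreviation Rpos :: "real measure" where
  "Rpos \<equiv> restrict_space borel {0<..}"

definition tmul :: "('x \<times> 'y \<times> real) measure \<Rightarrow> ('x \<times> 'y \<times> real) measure" where
  "tmul p = density p (\<lambda>(x, y, t). ennreal t)"

definition Pol :: "'x measure \<Rightarrow> 'y measure \<Rightarrow> ('x \<times> 'y \<times> real) measure set" where
  "Pol X Y = {p. sets p = sets (X \<Otimes>\<^sub>M Y \<Otimes>\<^sub>M Rpos) \<and>
     distr p X (\<lambda>(x, y, t). x) = X \<and> distr (tmul p) Y (\<lambda>(x, y, t). y) = Y}"

definition slice :: "'x set \<Rightarrow> 'y set \<Rightarrow> ('x \<times> 'y \<times> real) measure \<Rightarrow> real measure" where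
  "slice A B p = distr (restrict_space p (A \<times> B \<times> {0<..})) Rpos (\<lambda>(x, y, t). t)"

definition bounded_continuous :: "(real \<Rightarrow> real) \<Rightarrow> bool" where
  "bounded_continuous f \<longleftrightarrow> continuous_on {0<..} f \<and> bounded (f ` {0<..})"

text \<open>The topology of the convergence of polymorphisms is the initial topology of the integrals
  occurring in the definition of convergence; see \<open>limitin_pol_topology\<close>.\<close>

definition pol_topology ::
    "'x measure \<Rightarrow> 'y measure \<Rightarrow> ('x \<times> 'y \<times> real) measure topology" where
  "pol_topology X Y = topology_generated_by
     ({{p \<in> Pol X Y. (LINT t|slice A B p. f t) \<in> U} | A B f U.
         A \<in> sets X \<and> B \<in> sets Y \<and> bounded_continuous f \<and> open U} \<union>
      {{p \<in> Pol X Y. (LINT t|slice A B (tmul p). f t) \<in> U} | A B f U.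
         A \<in> sets X \<and> B \<in> sets Y \<and> bounded_continuous f \<and> open U})"

lemma limitin_topology_generated_by:
  "limitin (topology_generated_by S) f l F \<longleftrightarrow>
     l \<in> \<Union>S \<and> (\<forall>U\<in>S. l \<in> U \<longrightarrow> (\<forall>\<^sub>F n in F. f n \<in> U))"
proof
  assume L: "limitin (topology_generated_by S) f l F"
  show "l \<in> \<Union>S \<and> (\<forall>U\<in>S. l \<in> U \<longrightarrow> (\<forall>\<^sub>F n in F. f n \<in> U))"
    using L topology_generated_by_Basis[of _ S]
    unfolding limitin_def topology_generated_by_topspace by blast
next
  assume R: "l \<in> \<Union>S \<and> (\<forall>U\<in>S. l \<in> U \<longrightarrow> (\<forall>\<^sub>F n in F. f n \<in> U))"
  have "l \<in> U \<longrightarrow> (\<forall>\<^sub>F n in F. f n \<in> U)" if "generate_topology_on S U" for U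
    using that
  proof induction
    case (UN K)
    show ?case
    proof
      assume "l \<in> \<Union>K"
      then obtain k where "k \<in> K" "l \<in> k" by blast
      with UN have "\<forall>\<^sub>F n in F. f n \<in> k" by blast
      then show "\<forall>\<^sub>F n in F. f n \<in> \<Union>K"
        by (rule eventually_mono) (use \<open>k \<in> K\<close> in blast)
    qed
  qed (use R in \<open>auto simp: eventually_conj_iff\<close>)
  then show "limitin (topology_generated_by S) f l F"
    using R unfolding limitin_def topology_generated_by_topspace
      openin_topology_generated_by_iff by blast
qed

lemma limitin_pol_topology:
  fixes p :: "nat \<Rightarrow> ('a \<times> 'b \<times> real) measure"
  shows "limitin (pol_topology X Y) p q sequentially \<longleftrightarrow>
     q \<in> Pol X Y \<and> (\<forall>\<^sub>F j in sequentially. p j \<in> Pol X Y) \<and>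
     (\<forall>A\<in>sets X. \<forall>B\<in>sets Y. \<forall>f. bounded_continuous f \<longrightarrow>
        (\<lambda>j. LINT t|slice A B (p j). f t) \<longlonglongrightarrow> (LINT t|slice A B q. f t) \<and>
        (\<lambda>j. LINT t|slice A B (tmul (p j)). f t) \<longlonglongrightarrow> (LINT t|slice A B (tmul q). f t))"
proof -
  define a b where "a = (\<lambda>A B f (p :: ('a \<times> 'b \<times> real) measure). LINT t|slice A B p. (f t :: real))"
    and "b = (\<lambda>A B f (p :: ('a \<times> 'b \<times> real) measure). LINT t|slice A B (tmul p). (f t :: real))"
  define C where "C A B f \<longleftrightarrow> A \<in> sets X \<and> B \<in> sets Y \<and> bounded_continuous f" for A B f
  define P where "P = Pol X Y"
  have C0: "C {} {} (\<lambda>_. 0)"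
    by (simp add: C_def bounded_continuous_def image_constant_conv)
  have ball: "(\<forall>V\<in>{F A B f U | A B f U. D A B f U}. R V) \<longleftrightarrow>
      (\<forall>A B f U. D A B f U \<longrightarrow> R (F A B f U))"
    for F :: "'a set \<Rightarrow> 'b set \<Rightarrow> (real \<Rightarrow> real) \<Rightarrow> real set \<Rightarrow> ('a \<times> 'b \<times> real) measure set" and D R
    by blast
  have union: "q \<in> \<Union>({{p \<in> P. a A B f p \<in> U} | A B f U. C A B f \<and> open U} \<union>
      {{p \<in> P. b A B f p \<in> U} | A B f U. C A B f \<and> open U}) \<longleftrightarrow> q \<in> P"
    using C0 open_UNIV by blast
  have conv: "(\<forall>A B f U. C A B f \<and> open U \<longrightarrow> q \<in> {p \<in> P. h A B f p \<in> U} \<longrightarrow>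
        (\<forall>\<^sub>F j in sequentially. p j \<in> {p \<in> P. h A B f p \<in> U})) \<longleftrightarrow>
      (\<forall>\<^sub>F j in sequentially. p j \<in> P) \<and>
      (\<forall>A B f. C A B f \<longrightarrow> (\<lambda>j. h A B f (p j)) \<longlonglongrightarrow> h A B f q)" (is "?L \<longleftrightarrow> ?R")
    if q: "q \<in> P" for h :: "'a set \<Rightarrow> 'b set \<Rightarrow> (real \<Rightarrow> real) \<Rightarrow> ('a \<times> 'b \<times> real) measure \<Rightarrow> real"
  proof
    assume L: ?L
    have *: "\<forall>\<^sub>F j in sequentially. p j \<in> P \<and> h A B f (p j) \<in> U"
      if "C A B f" "open U" "h A B f q \<in> U" for A B f U
      using L[rule_format, of A B f U] that q by simp
    have "\<forall>\<^sub>F j in sequentially. p j \<in> P"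
      by (rule eventually_mono[OF *[OF C0 open_UNIV UNIV_I]]) simp
    moreover have "(\<lambda>j. h A B f (p j)) \<longlonglongrightarrow> h A B f q" if "C A B f" for A B f
      by (rule topological_tendstoI, rule eventually_mono[OF *[OF that]]) auto
    ultimately show ?R by simp
  next
    assume R: ?R
    show ?L
    proof (intro allI impI)
      fix A B f U assume "C A B f \<and> open U" "q \<in> {p \<in> P. h A B f p \<in> U}"
      then have "\<forall>\<^sub>F j in sequentially. h A B f (p j) \<in> U"
        using R topological_tendstoD[of "\<lambda>j. h A B f (p j)" "h A B f q"] by simp
      with R show "\<forall>\<^sub>F j in sequentially. p j \<in> {p \<in> P. h A B f p \<in> U}"
        by (simp add: eventually_conj_iff)
    qed
  qed
  have "pol_topology X Y = topology_generated_by
     ({{p \<in> P. a A B f p \<in> U} | A B f U. C A B f \<and> open U} \<union>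
      {{p \<in> P. b A B f p \<in> U} | A B f U. C A B f \<and> open U})"
    by (simp only: pol_topology_def a_def b_def C_def P_def conj_assoc)
  moreover have "limitin (topology_generated_by
     ({{p \<in> P. a A B f p \<in> U} | A B f U. C A B f \<and> open U} \<union>
      {{p \<in> P. b A B f p \<in> U} | A B f U. C A B f \<and> open U})) p q sequentially \<longleftrightarrow> q \<in> P \<and>
      (\<forall>\<^sub>F j in sequentially. p j \<in> P) \<and>
      (\<forall>A B f. C A B f \<longrightarrow> (\<lambda>j. a A B f (p j)) \<longlonglongrightarrow> a A B f q \<and> (\<lambda>j. b A B f (p j)) \<longlonglongrightarrow> b A B f q)"
    by (cases "q \<in> P")
      (simp_all only: limitin_topology_generated_by union ball_Un ball conv simp_thms, blast?)
  moreover have "(\<forall>A B f. C A B f \<longrightarrow> R A B f) \<longleftrightarrow>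
      (\<forall>A\<in>sets X. \<forall>B\<in>sets Y. \<forall>f. bounded_continuous f \<longrightarrow> R A B f)" for R
    by (auto simp: C_def)
  ultimately show ?thesis
    by (simp only: a_def b_def P_def)
qed


section \<open>The product of polymorphisms\<close>

definition Mtri :: "real measure set" where
  "Mtri = {s. sets s = sets Rpos \<and> finite_measure s \<and> (\<integral>\<^sup>+t. ennreal t \<partial>s) < \<infinity>}"

definition mult_conv :: "real measure \<Rightarrow> real measure \<Rightarrow> real measure" where
  "mult_conv s s' = distr (s \<Otimes>\<^sub>M s') Rpos (\<lambda>(a, b). a * b)"

text \<open>\<open>u\<close> is a continuous polymorphism, given by the function \<open>s\<close>.\<close>

definition given_by ::
    "'x measure \<Rightarrow> 'y measure \<Rightarrow> ('x \<times> 'y \<times> real) measure \<Rightarrow> ('x \<Rightarrow> 'y \<Rightarrow> real measure) \<Rightarrow> bool"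
where
  "given_by X Y u s \<longleftrightarrow> u \<in> Pol X Y \<and>
     (\<forall>x\<in>space X. \<forall>y\<in>space Y. s x y \<in> Mtri) \<and>
     (\<forall>C\<in>sets Rpos. (\<lambda>(x, y). emeasure (s x y) C) \<in> borel_measurable (X \<Otimes>\<^sub>M Y)) \<and>
     (\<forall>A\<in>sets X. \<forall>B\<in>sets Y. \<forall>C\<in>sets Rpos.
        emeasure u (A \<times> B \<times> C) = (\<integral>\<^sup>+z\<in>A \<times> B. (case z of (x, y) \<Rightarrow> emeasure (s x y) C) \<partial>(X \<Otimes>\<^sub>M Y)))"

definition is_pol_product ::
    "'x measure \<Rightarrow> 'y measure \<Rightarrow> 'w measure \<Rightarrow>
     (('x \<times> 'y \<times> real) measure \<Rightarrow> ('y \<times> 'w \<times> real) measure \<Rightarrow> ('x \<times> 'w \<times> real) measure) \<Rightarrow> bool"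
where
  "is_pol_product X Y W F \<longleftrightarrow>
     (\<forall>u v s s'. given_by X Y u s \<longrightarrow> given_by Y W v s' \<longrightarrow>
        F u v \<in> Pol X W \<and>
        (\<forall>A\<in>sets X. \<forall>B\<in>sets W. \<forall>C\<in>sets Rpos.
           emeasure (F u v) (A \<times> B \<times> C) =
             (\<integral>\<^sup>+z\<in>A \<times> B. (case z of (x, w) \<Rightarrow>
                \<integral>\<^sup>+y. emeasure (mult_conv (s x y) (s' y w)) C \<partial>Y) \<partial>(X \<Otimes>\<^sub>M W)))) \<and>
     (\<forall>v\<in>Pol Y W. continuous_map (pol_topology X Y) (pol_topology X W) (\<lambda>u. F u v)) \<and>
     (\<forall>u\<in>Pol X Y. continuous_map (pol_topology Y W) (pol_topology X W) (\<lambda>v. F u v))"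

text \<open>\<open>pol_prod X Y W u v\<close> is "first \<open>u\<close>, then \<open>v\<close>". The operation selected here is the separately
  continuous extension of the product of continuous polymorphisms; its values on
  \<open>Pol X Y \<times> Pol Y W\<close> are uniquely determined because continuous polymorphisms are dense.\<close>

definition pol_prod ::
    "'x measure \<Rightarrow> 'y measure \<Rightarrow> 'w measure \<Rightarrow>
     ('x \<times> 'y \<times> real) measure \<Rightarrow> ('y \<times> 'w \<times> real) measure \<Rightarrow> ('x \<times> 'w \<times> real) measure" where
  "pol_prod X Y W = (SOME F. is_pol_product X Y W F)"


section \<open>Nonsingular transformations\<close>

text \<open>Elements of \<open>Gms(Z)\<close> are classes of transformations modulo null sets. Every class contains a
  bijection of \<open>Z\<close>, and we work with such representatives.\<close>

definition nonsingular :: "'z measure \<Rightarrow> ('z \<Rightarrow> 'z) \<Rightarrow> bool" where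
  "nonsingular Z q \<longleftrightarrow> bij_betw q (space Z) (space Z) \<and>
     q \<in> measurable Z Z \<and> the_inv_into (space Z) q \<in> measurable Z Z \<and>
     (\<forall>N\<in>null_sets Z. q ` N \<in> null_sets Z \<and> q -` N \<inter> space Z \<in> null_sets Z)"

text \<open>The density of \<open>A \<mapsto> \<zeta>(q(A))\<close>, which is the image of \<open>\<zeta>\<close> under the inverse of \<open>q\<close>. It is
  positive and finite almost everywhere; on the exceptional null set it is replaced by 1.\<close>

definition rn_der :: "'z measure \<Rightarrow> ('z \<Rightarrow> 'z) \<Rightarrow> 'z \<Rightarrow> real" where
  "rn_der Z q z =
     (let d = enn2real (RN_deriv Z (distr Z Z (the_inv_into (space Z) q)) z)
      in if 0 < d then d else 1)"

definition pol_of :: "'z measure \<Rightarrow> ('z \<Rightarrow> 'z) \<Rightarrow> ('z \<times> 'z \<times> real) measure" where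
  "pol_of Z q = distr Z (Z \<Otimes>\<^sub>M Z \<Otimes>\<^sub>M Rpos) (\<lambda>z. (z, q z, rn_der Z q z))"

definition topological_group :: "('g, 'b) monoid_scheme \<Rightarrow> 'g topology \<Rightarrow> bool" where
  "topological_group G T \<longleftrightarrow> group G \<and> topspace T = carrier G \<and>
     continuous_map (prod_topology T T) T (\<lambda>(x, y). x \<otimes>\<^bsub>G\<^esub> y) \<and>
     continuous_map T T (\<lambda>x. inv\<^bsub>G\<^esub> x)"

text \<open>The product in \<open>Gms(Z)\<close> is \<open>q\<^sub>1 \<diamond> q\<^sub>2 = q\<^sub>2 \<circ> q\<^sub>1\<close>, and equality there is almost everywhere.\<close>

definition nonsingular_action ::
    "('g, 'b) monoid_scheme \<Rightarrow> 'g topology \<Rightarrow> 'z measure \<Rightarrow> ('g \<Rightarrow> 'z \<Rightarrow> 'z) \<Rightarrow> bool" where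
  "nonsingular_action G T Z \<sigma> \<longleftrightarrow>
     (\<forall>g\<in>carrier G. nonsingular Z (\<sigma> g)) \<and>
     (\<forall>g\<in>carrier G. \<forall>h\<in>carrier G. AE z in Z. \<sigma> (g \<otimes>\<^bsub>G\<^esub> h) z = \<sigma> h (\<sigma> g z)) \<and>
     continuous_map T (pol_topology Z Z) (\<lambda>g. pol_of Z (\<sigma> g))"


section \<open>Hilbert spaces and unitary representations\<close>

record 'h hilbert =
  hcarrier :: "'h set"
  hzero :: 'h
  hplus :: "'h \<Rightarrow> 'h \<Rightarrow> 'h"
  hscale :: "complex \<Rightarrow> 'h \<Rightarrow> 'h"
  hinner :: "'h \<Rightarrow> 'h \<Rightarrow> complex"

text \<open>The value outside the carrier only serves to make this a metric in the sense of
  \<open>Metric_space\<close>.\<close>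

definition hdist :: "'h hilbert \<Rightarrow> 'h \<Rightarrow> 'h \<Rightarrow> real" where
  "hdist H x y = (if x \<in> hcarrier H \<and> y \<in> hcarrier H
     then let d = hplus H x (hscale H (- 1) y) in sqrt (Re (hinner H d d)) else 0)"

abbreviation htopology :: "'h hilbert \<Rightarrow> 'h topology" where
  "htopology H \<equiv> Metric_space.mtopology (hcarrier H) (hdist H)"

definition separable_hilbert_space :: "'h hilbert \<Rightarrow> bool" where
  "separable_hilbert_space H \<longleftrightarrow>
     hzero H \<in> hcarrier H \<and>
     (\<forall>x\<in>hcarrier H. \<forall>y\<in>hcarrier H. hplus H x y \<in> hcarrier H) \<and>
     (\<forall>c. \<forall>x\<in>hcarrier H. hscale H c x \<in> hcarrier H) \<and>
     (\<forall>x\<in>hcarrier H. \<forall>y\<in>hcarrier H. \<forall>z\<in>hcarrier H.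
        hplus H (hplus H x y) z = hplus H x (hplus H y z)) \<and>
     (\<forall>x\<in>hcarrier H. \<forall>y\<in>hcarrier H. hplus H x y = hplus H y x) \<and>
     (\<forall>x\<in>hcarrier H. hplus H (hzero H) x = x) \<and>
     (\<forall>x\<in>hcarrier H. hplus H x (hscale H (- 1) x) = hzero H) \<and>
     (\<forall>c. \<forall>x\<in>hcarrier H. \<forall>y\<in>hcarrier H.
        hscale H c (hplus H x y) = hplus H (hscale H c x) (hscale H c y)) \<and>
     (\<forall>c d. \<forall>x\<in>hcarrier H. hscale H (c + d) x = hplus H (hscale H c x) (hscale H d x)) \<and>
     (\<forall>c d. \<forall>x\<in>hcarrier H. hscale H (c * d) x = hscale H c (hscale H d x)) \<and>
     (\<forall>x\<in>hcarrier H. hscale H 1 x = x) \<and>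
     (\<forall>x\<in>hcarrier H. \<forall>y\<in>hcarrier H. \<forall>z\<in>hcarrier H.
        hinner H (hplus H x y) z = hinner H x z + hinner H y z) \<and>
     (\<forall>c. \<forall>x\<in>hcarrier H. \<forall>y\<in>hcarrier H. hinner H (hscale H c x) y = c * hinner H x y) \<and>
     (\<forall>x\<in>hcarrier H. \<forall>y\<in>hcarrier H. hinner H y x = cnj (hinner H x y)) \<and>
     (\<forall>x\<in>hcarrier H. 0 \<le> Re (hinner H x x)) \<and>
     (\<forall>x\<in>hcarrier H. hinner H x x = 0 \<longrightarrow> x = hzero H) \<and>
     Metric_space.mcomplete (hcarrier H) (hdist H) \<and>
     separable_space (htopology H)"

definition unitary_rep ::
    "('g, 'b) monoid_scheme \<Rightarrow> 'g topology \<Rightarrow> 'h hilbert \<Rightarrow> ('g \<Rightarrow> 'h \<Rightarrow> 'h) \<Rightarrow> bool" where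
  "unitary_rep G T H \<rho> \<longleftrightarrow> separable_hilbert_space H \<and>
     (\<forall>g\<in>carrier G. bij_betw (\<rho> g) (hcarrier H) (hcarrier H) \<and>
        (\<forall>v\<in>hcarrier H. \<forall>w\<in>hcarrier H.
           \<rho> g (hplus H v w) = hplus H (\<rho> g v) (\<rho> g w) \<and>
           (\<forall>c. \<rho> g (hscale H c v) = hscale H c (\<rho> g v)) \<and>
           hinner H (\<rho> g v) (\<rho> g w) = hinner H v w)) \<and>
     (\<forall>g\<in>carrier G. \<forall>h\<in>carrier G. \<forall>v\<in>hcarrier H. \<rho> (g \<otimes>\<^bsub>G\<^esub> h) v = \<rho> g (\<rho> h v)) \<and>
     (\<forall>v\<in>hcarrier H. continuous_map T (htopology H) (\<lambda>g. \<rho> g v))"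

text \<open>A formula cannot quantify over the types of Hilbert space elements. Statements about all
  unitary representations therefore range over the Hilbert spaces whose carrier is an arbitrary
  subset of \<open>nat \<Rightarrow> complex\<close>, with arbitrary operations. Every separable Hilbert space is isomorphic
  to one of these (for instance to a closed subspace of \<open>\<ell>\<^sup>2\<close>), and all the
  notions below are invariant under isomorphism.\<close>

type_synonym hilb = "(nat \<Rightarrow> complex) hilbert"

definition fixed_vectors :: "'h hilbert \<Rightarrow> ('g \<Rightarrow> 'h \<Rightarrow> 'h) \<Rightarrow> 'g set \<Rightarrow> 'h set" where
  "fixed_vectors H \<rho> L = {v \<in> hcarrier H. \<forall>l\<in>L. \<rho> l v = v}"

definition orth_proj :: "'h hilbert \<Rightarrow> 'h set \<Rightarrow> 'h \<Rightarrow> 'h" where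
  "orth_proj H S v = (THE w. w \<in> S \<and> (\<forall>u\<in>S. hinner H (hplus H v (hscale H (- 1) w)) u = 0))"

text \<open>The operator from the \<open>M\<close>-fixed to the \<open>L\<close>-fixed vectors; only its values on
  \<open>fixed_vectors H \<rho> M\<close> are used.\<close>

definition rho_hat ::
    "'h hilbert \<Rightarrow> ('g \<Rightarrow> 'h \<Rightarrow> 'h) \<Rightarrow> 'g set \<Rightarrow> 'g \<Rightarrow> 'h \<Rightarrow> 'h" where
  "rho_hat H \<rho> L g v = orth_proj H (fixed_vectors H \<rho> L) (\<rho> g v)"

definition reduced_rel ::
    "('g, 'b) monoid_scheme \<Rightarrow> 'g topology \<Rightarrow> 'g set \<Rightarrow> 'g set \<Rightarrow> 'g rel" where
  "reduced_rel G T L M = {(g, g'). g \<in> carrier G \<and> g' \<in> carrier G \<and>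
     (\<forall>(H :: hilb) \<rho>. unitary_rep G T H \<rho> \<longrightarrow>
        (\<forall>v\<in>fixed_vectors H \<rho> M. rho_hat H \<rho> L g v = rho_hat H \<rho> L g' v))}"

definition reduced_cosets ::
    "('g, 'b) monoid_scheme \<Rightarrow> 'g topology \<Rightarrow> 'g set \<Rightarrow> 'g set \<Rightarrow> 'g set set" where
  "reduced_cosets G T L M = carrier G // reduced_rel G T L M"


section \<open>Exhaustive M-families\<close>

definition closed_subgroup :: "('g, 'b) monoid_scheme \<Rightarrow> 'g topology \<Rightarrow> 'g set \<Rightarrow> bool" where
  "closed_subgroup G T L \<longleftrightarrow> subgroup L G \<and> closedin T L"

text \<open>The operator of a reduced double coset is the operator of any of its elements.\<close>

definition M_family ::
    "('g, 'b) monoid_scheme \<Rightarrow> 'g topology \<Rightarrow> 'g set \<Rightarrow> 'a set \<Rightarrow> ('a \<Rightarrow> 'g set) \<Rightarrow> bool" where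
  "M_family G T K \<A> Kf \<longleftrightarrow>
     closed_subgroup G T K \<and>
     (\<forall>\<alpha>\<in>\<A>. closed_subgroup G T (Kf \<alpha>) \<and> Kf \<alpha> \<subseteq> K) \<and>
     (\<forall>\<alpha>\<in>\<A>. \<forall>\<alpha>'\<in>\<A>. \<exists>\<alpha>''\<in>\<A>. Kf \<alpha>'' \<subseteq> Kf \<alpha> \<inter> Kf \<alpha>') \<and>
     (\<exists>\<alpha>\<in>\<A>. Kf \<alpha> = K) \<and>
     (\<forall>\<alpha>\<in>\<A>. \<forall>\<beta>\<in>\<A>. \<forall>\<gamma>\<in>\<A>.
        \<forall>\<gg>\<in>reduced_cosets G T (Kf \<alpha>) (Kf \<beta>). \<forall>\<hh>\<in>reduced_cosets G T (Kf \<beta>) (Kf \<gamma>).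
        \<exists>\<kk>\<in>reduced_cosets G T (Kf \<alpha>) (Kf \<gamma>).
          \<forall>(H :: hilb) \<rho>. unitary_rep G T H \<rho> \<longrightarrow>
            (\<forall>g\<in>\<gg>. \<forall>h\<in>\<hh>. \<forall>k\<in>\<kk>. \<forall>v\<in>fixed_vectors H \<rho> (Kf \<gamma>).
               rho_hat H \<rho> (Kf \<alpha>) g (rho_hat H \<rho> (Kf \<beta>) h v) = rho_hat H \<rho> (Kf \<alpha>) k v))"

definition circ_space ::
    "'a set \<Rightarrow> ('a \<Rightarrow> 'g set) \<Rightarrow> 'h hilbert \<Rightarrow> ('g \<Rightarrow> 'h \<Rightarrow> 'h) \<Rightarrow> 'h set" where
  "circ_space \<A> Kf H \<rho> = (\<Union>\<alpha>\<in>\<A>. fixed_vectors H \<rho> (Kf \<alpha>))"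

definition admissible ::
    "'a set \<Rightarrow> ('a \<Rightarrow> 'g set) \<Rightarrow> 'h hilbert \<Rightarrow> ('g \<Rightarrow> 'h \<Rightarrow> 'h) \<Rightarrow> bool" where
  "admissible \<A> Kf H \<rho> \<longleftrightarrow> htopology H closure_of circ_space \<A> Kf H \<rho> = hcarrier H"

definition subrep ::
    "('g, 'b) monoid_scheme \<Rightarrow> 'h hilbert \<Rightarrow> ('g \<Rightarrow> 'h \<Rightarrow> 'h) \<Rightarrow> 'h set \<Rightarrow> bool" where
  "subrep G H \<rho> S \<longleftrightarrow> S \<subseteq> hcarrier H \<and> closedin (htopology H) S \<and> hzero H \<in> S \<and>
     (\<forall>v\<in>S. \<forall>w\<in>S. hplus H v w \<in> S) \<and> (\<forall>c. \<forall>v\<in>S. hscale H c v \<in> S) \<and>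
     (\<forall>g\<in>carrier G. \<forall>v\<in>S. \<rho> g v \<in> S)"

definition essentially_admissible ::
    "('g, 'b) monoid_scheme \<Rightarrow> 'a set \<Rightarrow> ('a \<Rightarrow> 'g set) \<Rightarrow> 'h hilbert \<Rightarrow> ('g \<Rightarrow> 'h \<Rightarrow> 'h) \<Rightarrow> bool"
where
  "essentially_admissible G \<A> Kf H \<rho> \<longleftrightarrow>
     (\<forall>S. subrep G H \<rho> S \<and> circ_space \<A> Kf H \<rho> \<subseteq> S \<longrightarrow> S = hcarrier H)"

definition exhausting_seq ::
    "('g, 'b) monoid_scheme \<Rightarrow> 'g topology \<Rightarrow> 'a set \<Rightarrow> ('a \<Rightarrow> 'g set) \<Rightarrow> (nat \<Rightarrow> 'a) \<Rightarrow> bool" where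
  "exhausting_seq G T \<A> Kf \<gamma> \<longleftrightarrow>
     (\<forall>j. \<gamma> j \<in> \<A> \<and> Kf (\<gamma> (Suc j)) \<subseteq> Kf (\<gamma> j)) \<and>
     (\<forall>(H :: hilb) \<rho>. unitary_rep G T H \<rho> \<longrightarrow> admissible \<A> Kf H \<rho> \<longrightarrow>
        htopology H closure_of (\<Union>j. fixed_vectors H \<rho> (Kf (\<gamma> j))) = hcarrier H)"

definition exhaustive ::
    "('g, 'b) monoid_scheme \<Rightarrow> 'g topology \<Rightarrow> 'a set \<Rightarrow> ('a \<Rightarrow> 'g set) \<Rightarrow> bool" where
  "exhaustive G T \<A> Kf \<longleftrightarrow>
     (\<forall>(H :: hilb) \<rho>. unitary_rep G T H \<rho> \<longrightarrow> essentially_admissible G \<A> Kf H \<rho> \<longrightarrow>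
        admissible \<A> Kf H \<rho>) \<and>
     (\<forall>\<alpha>\<in>\<A>. \<exists>\<theta> :: nat \<Rightarrow> 'g. (\<forall>j. \<theta> j \<in> Kf \<alpha>) \<and>
        (\<forall>(H :: hilb) \<rho>. unitary_rep G T H \<rho> \<longrightarrow>
           (\<forall>v\<in>hcarrier H. \<forall>w\<in>hcarrier H.
              (\<lambda>j. hinner H (\<rho> (\<theta> j) v) w)
                \<longlonglongrightarrow> hinner H (orth_proj H (fixed_vectors H \<rho> (Kf \<alpha>)) v) w))) \<and>
     (\<exists>\<gamma>. exhausting_seq G T \<A> Kf \<gamma>)"


section \<open>The representation in \<open>L\<^sup>2\<close>\<close>

definition L2_fun :: "'z measure \<Rightarrow> ('z \<Rightarrow> complex) set" where
  "L2_fun Z = {f \<in> borel_measurable Z. integrable Z (\<lambda>z. (cmod (f z))\<^sup>2)}"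

definition L2_class :: "'z measure \<Rightarrow> ('z \<Rightarrow> complex) \<Rightarrow> ('z \<Rightarrow> complex) set" where
  "L2_class Z f = {g \<in> L2_fun Z. AE z in Z. g z = f z}"

definition L2_repr :: "('z \<Rightarrow> complex) set \<Rightarrow> 'z \<Rightarrow> complex" where
  "L2_repr \<Phi> = (SOME f. f \<in> \<Phi>)"

definition L2 :: "'z measure \<Rightarrow> ('z \<Rightarrow> complex) set hilbert" where
  "L2 Z = \<lparr>hcarrier = L2_class Z ` L2_fun Z,
     hzero = L2_class Z (\<lambda>_. 0),
     hplus = (\<lambda>\<Phi> \<Psi>. L2_class Z (\<lambda>z. L2_repr \<Phi> z + L2_repr \<Psi> z)),
     hscale = (\<lambda>c \<Phi>. L2_class Z (\<lambda>z. c * L2_repr \<Phi> z)),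
     hinner = (\<lambda>\<Phi> \<Psi>. LINT z|Z. L2_repr \<Phi> z * cnj (L2_repr \<Psi> z))\<rparr>"

definition T_op ::
    "'z measure \<Rightarrow> real \<Rightarrow> ('z \<Rightarrow> 'z) \<Rightarrow> ('z \<Rightarrow> complex) set \<Rightarrow> ('z \<Rightarrow> complex) set" where
  "T_op Z s q \<Phi> = L2_class Z (\<lambda>z. L2_repr \<Phi> (q z) *
     complex_of_real (rn_der Z q z) powr (1 / 2 + \<i> * complex_of_real s))"


section \<open>The polymorphisms associated with the subgroups of the family\<close>

definition invariant_sets :: "'z measure \<Rightarrow> ('g \<Rightarrow> 'z \<Rightarrow> 'z) \<Rightarrow> 'g set \<Rightarrow> 'z set set" where
  "invariant_sets Z \<sigma> L =
     {A \<in> sets Z. \<forall>h\<in>L. (A - \<sigma> h ` A) \<union> (\<sigma> h ` A - A) \<in> null_sets Z}"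

definition is_quotient ::
    "'z measure \<Rightarrow> 'z set set \<Rightarrow> 'w measure \<Rightarrow> ('z \<Rightarrow> 'w) \<Rightarrow> bool" where
  "is_quotient Z \<Sigma> Q \<pi> \<longleftrightarrow> lebesgue_prob_space Q \<and> \<pi> \<in> measurable Z Q \<and> distr Z Q \<pi> = Q \<and>
     (\<forall>B\<in>sets Q. \<pi> -` B \<inter> space Z \<in> \<Sigma>) \<and>
     (\<forall>A\<in>\<Sigma>. \<exists>B\<in>sets Q.
        (A - (\<pi> -` B \<inter> space Z)) \<union> ((\<pi> -` B \<inter> space Z) - A) \<in> null_sets Z)"

definition l_pol :: "'z measure \<Rightarrow> 'w measure \<Rightarrow> ('z \<Rightarrow> 'w) \<Rightarrow> ('z \<times> 'w \<times> real) measure" where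
  "l_pol Z Q \<pi> = distr Z (Z \<Otimes>\<^sub>M Q \<Otimes>\<^sub>M Rpos) (\<lambda>z. (z, \<pi> z, 1))"

definition l_star :: "'z measure \<Rightarrow> 'w measure \<Rightarrow> ('z \<Rightarrow> 'w) \<Rightarrow> ('w \<times> 'z \<times> real) measure" where
  "l_star Z Q \<pi> = distr Z (Q \<Otimes>\<^sub>M Z \<Otimes>\<^sub>M Rpos) (\<lambda>z. (\<pi> z, z, 1))"

definition m_pol :: "'z measure \<Rightarrow> 'w measure \<Rightarrow> ('z \<Rightarrow> 'w) \<Rightarrow> ('z \<times> 'z \<times> real) measure" where
  "m_pol Z Q \<pi> = pol_prod Z Q Z (l_pol Z Q \<pi>) (l_star Z Q \<pi>)"

end

theory Submission
  imports Defs
begin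

text \<open>
  Two facts carry the proof. First, \<open>\<mm>\<^sub>\<alpha>\<close> acts on polymorphisms by replacing indicators of sets with their
  conditional expectations relative to \<open>\<Sigma>\<^sub>\<alpha>\<close>; on \<open>L\<^sup>2(Z)\<close> this is the projection to the
  \<open>K\<^sub>\<alpha>\<close>-fixed vectors, so admissibility makes it converge strongly to the identity along \<open>\<gamma>\<^sub>k\<close>, and
  \<open>\<mm>\<^sub>\<gamma>\<^sub>k \<diamond> \<rr> \<diamond> \<mm>\<^sub>\<gamma>\<^sub>k\<close> converges to \<open>\<rr>\<close>. Second, since \<open>T(\<theta>\<^sub>j)\<close> converges weakly to that projection
  for suitable \<open>\<theta>\<^sub>j \<in> K\<^sub>\<alpha>\<close>, the elements \<open>g \<theta>\<^sub>j\<close> and \<open>\<theta>\<^sub>j g\<close> converge to \<open>g \<diamond> \<mm>\<^sub>\<alpha>\<close> and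
  \<open>\<mm>\<^sub>\<alpha> \<diamond> g\<close>; separate continuity extends this from \<open>G\<close> to its closure. The product itself is
  realised by randomization: a polymorphism from \<open>Y\<close> to \<open>W\<close> is the image of a random map on
  \<open>Y \<times> (0,1)\<close>, and composing with random maps is separately continuous.\<close>

section \<open>Integrals against polymorphisms\<close>

text \<open>The product is fixed only by a choice operator, so nothing can be said about it before
  an operation with the required properties is exhibited and shown to be unique. A general
  polymorphism has no density, and its spaces are standard only modulo null sets; a random map on a
  real model replaces the missing disintegration. That map depends on the second factor in an
  arbitrary way, so continuity cannot be read off from it: the test function
  \<open>f (t * s)\<close> is split into a finite sum of products in \<open>t\<close> and
  \<open>s\<close>, up to a uniform error, after which each factor enters only through integrals of
  its own. The splitting needs compact support in \<open>t\<close>. This may be assumed because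
  \<open>1 + t\<close> has integral 2 against every polymorphism, so no mass escapes to 0 or
  infinity in a limit. A second obstacle is that the conditions on representations speak of Hilbert
  spaces with carrier in \<open>nat \<Rightarrow> complex\<close>, while \<open>L2 Z\<close>
  consists of classes of functions; it is therefore handled through an abstract model that has both
  as instances.\<close>

abbreviation "ind \<equiv> indicator"
abbreviation yc :: "'x \<times> 'y \<times> 't \<Rightarrow> 'y" where "yc z \<equiv> fst (snd z)"
abbreviation tc :: "'x \<times> 'y \<times> 't \<Rightarrow> 't" where "tc z \<equiv> snd (snd z)"
abbreviation pair_meas (infixr "><" 80) where "M >< N \<equiv> pair_measure M N"
abbreviation "triple X Y \<equiv> X >< Y >< Rpos"
abbreviation "yo z \<equiv> (yc (fst z), snd z)"
abbreviation "subbasis X Y g \<equiv> {{p \<in> Pol X Y. (LINT t|slice A B (g p). f t) \<in> U} | A B f U.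
   A \<in> sets X \<and> B \<in> sets Y \<and> bounded_continuous f \<and> open U}"

text \<open>A trilinear form in \<open>a\<close>, \<open>b\<close>, \<open>f\<close>. For indicators
  \<open>a\<close>, \<open>b\<close> and bounded continuous \<open>f\<close>, its values at
  \<open>f\<close> and at \<open>t * f t\<close> are the integrals that generate the topology; more
  general \<open>a\<close> and \<open>b\<close> arise as conditional expectations and
  densities.\<close>

definition pform ::
    "('x \<Rightarrow> real) \<Rightarrow> ('y \<Rightarrow> real) \<Rightarrow> (real \<Rightarrow> real) \<Rightarrow> ('x \<times> 'y \<times> real) measure \<Rightarrow> real" where
  "pform a b f p = (LINT z|p. a (fst z) * b (yc z) * f (tc z))"

abbreviation "sform A B \<equiv> pform (ind A) (ind B)"

definition bfun :: "'x measure \<Rightarrow> ('x \<Rightarrow> real) \<Rightarrow> bool" where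
  "bfun X a \<longleftrightarrow> a \<in> borel_measurable X \<and> (\<exists>M. \<forall>x\<in>space X. \<bar>a x\<bar> \<le> M)"

text \<open>The growth \<open>1 + t\<close> is natural here: \<open>p\<close> and
  \<open>t * p\<close> are both probability measures, so such functions are integrable against every
  polymorphism.\<close>

definition lfun :: "(real \<Rightarrow> real) \<Rightarrow> bool" where
  "lfun f \<longleftrightarrow> f \<in> borel_measurable Rpos \<and> (\<exists>C. \<forall>t>0. \<bar>f t\<bar> \<le> C * (1 + t))"

definition lcont :: "(real \<Rightarrow> real) \<Rightarrow> bool" where
  "lcont f \<longleftrightarrow> continuous_on {0<..} f \<and> (\<exists>C. \<forall>t>0. \<bar>f t\<bar> \<le> C * (1 + t))"

text \<open>The support is compact in the open half-line, hence away from 0 as well as from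
  infinity; such a function is bounded both by a constant and by a multiple of
  \<open>t\<close>.\<close>

definition ccont :: "(real \<Rightarrow> real) \<Rightarrow> bool" where
  "ccont f \<longleftrightarrow> continuous_on {0<..} f \<and>
     (\<exists>l u. 0 < l \<and> l < u \<and> (\<forall>t>0. t \<notin> {l..u} \<longrightarrow> f t = 0))"

lemma bfunD:
  assumes "bfun X a"
  shows "\<exists>M. 0 \<le> M \<and> (\<forall>x\<in>space X. \<bar>a x\<bar> \<le> M) \<and> a \<in> borel_measurable X"
proof -
  obtain M where M: "\<forall>x\<in>space X. \<bar>a x\<bar> \<le> M" and m: "a \<in> borel_measurable X"
    using assms by (auto simp: bfun_def)
  show ?thesis
    by (rule exI[of _ "\<bar>M\<bar>"]) (use M m in force)
qed

lemma bfun_measurable [measurable_dest]: "bfun X a \<Longrightarrow> a \<in> borel_measurable X"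
  by (simp add: bfun_def)

lemma bfunI: "a \<in> borel_measurable X \<Longrightarrow> (\<And>x. x \<in> space X \<Longrightarrow> \<bar>a x\<bar> \<le> M) \<Longrightarrow> bfun X a"
  by (auto simp: bfun_def)

lemma bfun_const: "bfun X (\<lambda>_. c)"
  by (auto simp: bfun_def)

lemma bfun_indicator: "A \<in> sets X \<Longrightarrow> bfun X (ind A)"
  by (rule bfunI[of _ _ 1]) (auto simp: indicator_def)

lemma bfun_mult:
  assumes "bfun X a" "bfun X b" shows "bfun X (\<lambda>x. a x * b x)"
proof -
  obtain M where M: "0 \<le> M" "\<And>x. x \<in> space X \<Longrightarrow> \<bar>a x\<bar> \<le> M" and [measurable]: "a \<in> borel_measurable X"
    using bfunD[OF assms(1)] by blast
  obtain N where N: "0 \<le> N" "\<And>x. x \<in> space X \<Longrightarrow> \<bar>b x\<bar> \<le> N" and [measurable]: "b \<in> borel_measurable X"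
    using bfunD[OF assms(2)] by blast
  show ?thesis
    by (rule bfunI[of _ _ "M * N"]) (auto simp: abs_mult intro!: mult_mono M N)
qed

lemma bfun_diff:
  assumes "bfun X a" "bfun X b" shows "bfun X (\<lambda>x. a x - b x)"
proof -
  obtain M where M: "0 \<le> M" "\<And>x. x \<in> space X \<Longrightarrow> \<bar>a x\<bar> \<le> M" and [measurable]: "a \<in> borel_measurable X"
    using bfunD[OF assms(1)] by blast
  obtain N where N: "0 \<le> N" "\<And>x. x \<in> space X \<Longrightarrow> \<bar>b x\<bar> \<le> N" and [measurable]: "b \<in> borel_measurable X"
    using bfunD[OF assms(2)] by blast
  show ?thesis
    by (rule bfunI[of _ _ "M + N"]) (auto intro!: order_trans[OF abs_triangle_ineq4] add_mono M N)
qed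

lemma bfun_comp:
  assumes "bfun Y b" "f \<in> measurable X Y" shows "bfun X (\<lambda>x. b (f x))"
proof -
  obtain M where M: "0 \<le> M" "\<And>x. x \<in> space Y \<Longrightarrow> \<bar>b x\<bar> \<le> M" and [measurable]: "b \<in> borel_measurable Y"
    using bfunD[OF assms(1)] by blast
  show ?thesis
    by (rule bfunI[of _ _ M]) (use assms(2) M in \<open>auto simp: measurable_space\<close>)
qed

lemma bfun_integrable:
  assumes "finite_measure X" "bfun X a" shows "integrable X a"
proof -
  interpret finite_measure X by fact
  obtain M where M: "0 \<le> M" "\<And>x. x \<in> space X \<Longrightarrow> \<bar>a x\<bar> \<le> M" and [measurable]: "a \<in> borel_measurable X"
    using bfunD[OF assms(2)] by blast
  show ?thesis by (rule integrable_const_bound[of _ M]) (auto simp: M)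
qed

lemma space_Rpos [simp]: "space Rpos = {0<..}"
  by (simp add: space_restrict_space)

lemma id_Rpos_borel [measurable]: "(\<lambda>t. t) \<in> measurable Rpos borel"
  by (rule measurable_restrict_space1) simp

lemma measurable_Rpos_iff:
  "f \<in> measurable M Rpos \<longleftrightarrow> f \<in> borel_measurable M \<and> (\<forall>x\<in>space M. 0 < f x)"
  by (auto simp: measurable_restrict_space2_iff)

lemma measurable_RposD [measurable_dest]: "f \<in> measurable M Rpos \<Longrightarrow> f \<in> borel_measurable M"
  by (simp add: measurable_Rpos_iff)

lemma lcont_lfun: "lcont f \<Longrightarrow> lfun f"
  unfolding lcont_def lfun_def by (auto intro!: borel_measurable_continuous_on_restrict)

lemma bounded_continuous_iff:
  "bounded_continuous f \<longleftrightarrow> continuous_on {0<..} f \<and> (\<exists>C. \<forall>t>0. \<bar>f t\<bar> \<le> C)"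
  unfolding bounded_continuous_def bounded_iff by auto

text \<open>With these two facts the integrals against \<open>p\<close> and against
  \<open>t * p\<close> become values of \<open>pform\<close> on one class of test functions.\<close>

lemma lcont_bounded:
  assumes "bounded_continuous f" shows "lcont f" "lcont (\<lambda>t. t * f t)"
proof -
  obtain C where C: "\<And>t. t > 0 \<Longrightarrow> \<bar>f t\<bar> \<le> C" and c: "continuous_on {0<..} f"
    using assms by (auto simp: bounded_continuous_iff)
  have C0: "0 \<le> C" using C[of 1] by simp
  have "\<bar>f t\<bar> \<le> C * (1 + t)" if "t > 0" for t
    using C[OF that] mult_left_mono[of 1 "1 + t" C] C0 that by simp
  then show "lcont f" using c by (auto simp: lcont_def)
  have "\<bar>t * f t\<bar> \<le> C * (1 + t)" if "t > 0" for t
  proof -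
    have "t * \<bar>f t\<bar> \<le> t * C" using C[OF that] that by (intro mult_left_mono) auto
    moreover have "\<bar>t * f t\<bar> = t * \<bar>f t\<bar>" using that by (simp add: abs_mult)
    moreover have "t * C \<le> C * (1 + t)" using C0 by (simp add: algebra_simps)
    ultimately show ?thesis by linarith
  qed
  then show "lcont (\<lambda>t. t * f t)" using c by (auto simp: lcont_def intro!: continuous_intros)
qed

lemma ccontE:
  assumes "ccont f"
  obtains M l u where "0 \<le> M" "\<And>t. 0 < t \<Longrightarrow> \<bar>f t\<bar> \<le> M" "0 < l" "l < u"
    "\<And>t. 0 < t \<Longrightarrow> t \<notin> {l..u} \<Longrightarrow> f t = 0" "continuous_on {0<..} f"
proof -
  obtain l u where lu: "0 < l" "l < u" "\<And>t. 0 < t \<Longrightarrow> t \<notin> {l..u} \<Longrightarrow> f t = 0"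
    and c: "continuous_on {0<..} f"
    using assms by (auto simp: ccont_def)
  have "continuous_on {l..u} f" using c lu by (auto intro: continuous_on_subset)
  then have "bounded (f ` {l..u})"
    by (intro compact_imp_bounded compact_continuous_image) auto
  then obtain M where M: "M > 0" "\<And>t. t \<in> {l..u} \<Longrightarrow> \<bar>f t\<bar> \<le> M"
    unfolding bounded_pos by auto
  have "\<bar>f t\<bar> \<le> M" if "0 < t" for t
    using M lu(3)[OF that] by (cases "t \<in> {l..u}") auto
  then show thesis using that[of M l u] M lu c by auto
qed

lemma ccont_bounded_continuous: "ccont f \<Longrightarrow> bounded_continuous f"
  by (erule ccontE) (auto simp: bounded_continuous_iff)

lemma ccont_lcont: "ccont f \<Longrightarrow> lcont f"
  by (intro lcont_bounded ccont_bounded_continuous)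

lemma bounded_continuous_bfun: "bounded_continuous f \<Longrightarrow> bfun Rpos f"
  unfolding bounded_continuous_iff bfun_def by (auto intro!: borel_measurable_continuous_on_restrict)

lemma bfun_lfun:
  assumes "bfun Rpos f" shows "lfun f"
proof -
  obtain M where M: "0 \<le> M" "\<And>x. x \<in> space Rpos \<Longrightarrow> \<bar>f x\<bar> \<le> M" and [measurable]: "f \<in> borel_measurable Rpos"
    using bfunD[OF assms] by blast
  have "\<bar>f t\<bar> \<le> M * (1 + t)" if "t > 0" for t
    using M(2)[of t] mult_left_mono[of 1 "1 + t" M] M(1) that by simp
  then show ?thesis by (auto simp: lfun_def)
qed

lemma ccont_mult:
  assumes "ccont f" "continuous_on {0<..} g" shows "ccont (\<lambda>t. f t * g t)" "ccont (\<lambda>t. g t * f t)"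
  using assms unfolding ccont_def by (auto intro!: continuous_intros)

section \<open>Marginals, integrability and bounds for one polymorphism\<close>

context
  fixes X :: "'x measure" and Y :: "'y measure" and p :: "('x \<times> 'y \<times> real) measure"
  assumes X: "prob_space X" and Y: "prob_space Y" and p: "p \<in> Pol X Y"
begin

lemma Pol_sets [measurable_cong]: "sets p = sets (triple X Y)"
  using p by (simp add: Pol_def)

lemma Pol_space: "space p = space X \<times> space Y \<times> {0<..}"
  using sets_eq_imp_space_eq[OF Pol_sets] by (simp add: space_pair_measure)

lemma Pol_fst [measurable]: "fst \<in> measurable p X" by measurable
lemma Pol_snd [measurable]: "(\<lambda>z. yc z) \<in> measurable p Y" by measurable
lemma Pol_t [measurable]: "(\<lambda>z. tc z) \<in> measurable p Rpos" by measurable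

lemma Pol_tmul: "tmul p = density p (\<lambda>z. ennreal (tc z))"
  by (simp add: tmul_def case_prod_beta')

lemma Pol_distr1: "distr p X fst = X"
  using p by (simp add: Pol_def case_prod_beta')

lemma Pol_distr2: "distr (tmul p) Y (\<lambda>z. yc z) = Y"
  using p by (simp add: Pol_def case_prod_beta')

lemma Pol_prob: "prob_space p"
  using prob_space_distrD[OF Pol_fst] X Pol_distr1 by simp

lemma Pol_nn1: "a \<in> borel_measurable X \<Longrightarrow> (\<integral>\<^sup>+z. a (fst z) \<partial>p) = (\<integral>\<^sup>+x. a x \<partial>X)"
  using nn_integral_distr[OF Pol_fst, of a] Pol_distr1 by simp

lemma Pol_nn2:
  assumes [measurable]: "b \<in> borel_measurable Y"
  shows "(\<integral>\<^sup>+z. ennreal (tc z) * b (yc z) \<partial>p) = (\<integral>\<^sup>+y. b y \<partial>Y)"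
proof -
  have "(\<integral>\<^sup>+y. b y \<partial>Y) = (\<integral>\<^sup>+y. b y \<partial>distr (tmul p) Y (\<lambda>z. yc z))"
    by (simp add: Pol_distr2)
  also have "\<dots> = (\<integral>\<^sup>+z. b (yc z) \<partial>tmul p)"
    by (rule nn_integral_distr) (simp_all add: Pol_tmul)
  also have "\<dots> = (\<integral>\<^sup>+z. ennreal (tc z) * b (yc z) \<partial>p)"
    unfolding Pol_tmul by (rule nn_integral_density) auto
  finally show ?thesis by simp
qed

text \<open>The mean of \<open>t\<close> is the total mass of the second marginal of
  \<open>t * p\<close>, that is, the mass of \<open>Y\<close>.\<close>

lemma Pol_t_integrable: "integrable p (\<lambda>z. tc z)" and Pol_t_integral: "(LINT z|p. tc z) = 1"
proof -
  interpret Y: prob_space Y by fact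
  have eq: "(\<integral>\<^sup>+z. ennreal (tc z) \<partial>p) = 1"
    using Pol_nn2[of "\<lambda>_. 1"] by (simp add: Y.emeasure_space_1)
  have pos: "AE z in p. 0 \<le> tc z" by (auto simp: Pol_space)
  show "integrable p (\<lambda>z. tc z)"
    using eq pos by (intro integrableI_nonneg) auto
  show "(LINT z|p. tc z) = 1"
    using eq pos by (subst integral_eq_nn_integral) auto
qed

lemma Pol_lfun_integrable:
  assumes "bfun X a" "bfun Y b" "lfun f"
  shows "integrable p (\<lambda>z. a (fst z) * b (yc z) * f (tc z))"
proof -
  interpret p: prob_space p by (rule Pol_prob)
  obtain M where M: "0 \<le> M" "\<And>x. x \<in> space X \<Longrightarrow> \<bar>a x\<bar> \<le> M" and [measurable]: "a \<in> borel_measurable X"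
    using bfunD[OF assms(1)] by blast
  obtain N where N: "0 \<le> N" "\<And>x. x \<in> space Y \<Longrightarrow> \<bar>b x\<bar> \<le> N" and [measurable]: "b \<in> borel_measurable Y"
    using bfunD[OF assms(2)] by blast
  obtain C where C: "\<And>t. 0 < t \<Longrightarrow> \<bar>f t\<bar> \<le> C * (1 + t)" and [measurable]: "f \<in> borel_measurable Rpos"
    using assms(3) by (auto simp: lfun_def)
  show ?thesis
  proof (rule Bochner_Integration.integrable_bound)
    show "integrable p (\<lambda>z. M * N * (C * (1 + tc z)))"
      using Pol_t_integrable by simp
    show "AE z in p. norm (a (fst z) * b (yc z) * f (tc z))
        \<le> norm (M * N * (C * (1 + tc z)))"
    proof (rule AE_I2)
      fix z assume z: "z \<in> space p"
      have "\<bar>a (fst z)\<bar> * \<bar>b (yc z)\<bar> * \<bar>f (tc z)\<bar> \<le> M * N * (C * (1 + tc z))"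
        using z by (intro mult_mono M N C) (auto simp: Pol_space intro!: M N mult_nonneg_nonneg)
      also have "\<dots> \<le> norm (M * N * (C * (1 + tc z)))"
        unfolding real_norm_def by (rule abs_ge_self)
      finally show "norm (a (fst z) * b (yc z) * f (tc z)) \<le> norm (M * N * (C * (1 + tc z)))"
        unfolding real_norm_def abs_mult .
    qed
  qed measurable
qed

text \<open>The factor 2 is the integral of \<open>1 + t\<close>, the same for all polymorphisms;
  the bound is therefore uniform in \<open>p\<close>.\<close>

lemma pform_bound:
  assumes "bfun X a" "bfun Y b" "lfun f"
    and a: "\<And>x. x \<in> space X \<Longrightarrow> \<bar>a x\<bar> \<le> M" and b: "\<And>x. x \<in> space Y \<Longrightarrow> \<bar>b x\<bar> \<le> N"
    and f: "\<And>t. 0 < t \<Longrightarrow> \<bar>f t\<bar> \<le> C * (1 + t)"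
  shows "\<bar>pform a b f p\<bar> \<le> 2 * M * N * C"
proof -
  interpret p: prob_space p by (rule Pol_prob)
  note i = Pol_lfun_integrable[OF assms(1-3)]
  have "\<bar>pform a b f p\<bar> \<le> (LINT z|p. \<bar>a (fst z) * b (yc z) * f (tc z)\<bar>)"
    unfolding pform_def by (rule integral_abs_bound)
  also have "\<dots> \<le> (LINT z|p. M * N * (C * (1 + tc z)))"
  proof (rule integral_mono_AE)
    show "AE z in p. \<bar>a (fst z) * b (yc z) * f (tc z)\<bar> \<le> M * N * (C * (1 + tc z))"
    proof (rule AE_I2)
      fix z assume z: "z \<in> space p"
      have "0 \<le> M" "0 \<le> N" using a[of "fst z"] b[of "yc z"] z by (auto simp: Pol_space)
      then have "\<bar>a (fst z)\<bar> * \<bar>b (yc z)\<bar> * \<bar>f (tc z)\<bar> \<le> M * N * (C * (1 + tc z))"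
        using z by (intro mult_mono a b f) (auto simp: Pol_space)
      then show "\<bar>a (fst z) * b (yc z) * f (tc z)\<bar> \<le> M * N * (C * (1 + tc z))"
        by (simp add: abs_mult)
    qed
  qed (use i Pol_t_integrable in auto)
  also have "\<dots> = 2 * M * N * C"
    using Pol_t_integral Pol_t_integrable by (simp add: p.prob_space)
  finally show ?thesis .
qed

lemma pform_diff1:
  assumes "bfun X a" "bfun X a'" "bfun Y b" "lfun f"
  shows "pform a b f p - pform a' b f p = pform (\<lambda>x. a x - a' x) b f p"
  unfolding pform_def
  by (subst Bochner_Integration.integral_diff[symmetric])
    (use Pol_lfun_integrable assms in \<open>auto simp: algebra_simps\<close>)

lemma pform_diff2:
  assumes "bfun X a" "bfun Y b'" "bfun Y b" "lfun f"
  shows "pform a b f p - pform a b' f p = pform a (\<lambda>x. b x - b' x) f p"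
  unfolding pform_def
  by (subst Bochner_Integration.integral_diff[symmetric])
    (use Pol_lfun_integrable assms in \<open>auto simp: algebra_simps\<close>)

lemma pform_diff3:
  assumes "bfun X a" "bfun Y b" "lfun f" "lfun f'"
  shows "pform a b f p - pform a b f' p = pform a b (\<lambda>x. f x - f' x) p"
  unfolding pform_def
  by (subst Bochner_Integration.integral_diff[symmetric])
    (use Pol_lfun_integrable assms in \<open>auto simp: algebra_simps\<close>)

lemma pform_sum1:
  assumes "\<And>i. i \<in> I \<Longrightarrow> bfun X (a i)" "bfun Y b" "lfun f"
  shows "pform (\<lambda>x. \<Sum>i\<in>I. c i * a i x) b f p = (\<Sum>i\<in>I. c i * pform (a i) b f p)"
proof -
  have "(\<Sum>i\<in>I. c i * pform (a i) b f p) =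
      (\<Sum>i\<in>I. (LINT z|p. c i * (a i (fst z) * b (yc z) * f (tc z))))"
    by (simp add: pform_def)
  also have "\<dots> = (LINT z|p. (\<Sum>i\<in>I. c i * (a i (fst z) * b (yc z) * f (tc z))))"
    using assms by (intro Bochner_Integration.integral_sum[symmetric] integrable_mult_right Pol_lfun_integrable)
  also have "\<dots> = pform (\<lambda>x. \<Sum>i\<in>I. c i * a i x) b f p"
    unfolding pform_def by (simp add: sum_distrib_right mult.assoc)
  finally show ?thesis by simp
qed

lemma pform_sum2:
  assumes "bfun X a" "\<And>i. i \<in> I \<Longrightarrow> bfun Y (b i)" "lfun f"
  shows "pform a (\<lambda>x. \<Sum>i\<in>I. c i * b i x) f p = (\<Sum>i\<in>I. c i * pform a (b i) f p)"
proof -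
  have "(\<Sum>i\<in>I. c i * pform a (b i) f p) =
      (\<Sum>i\<in>I. (LINT z|p. c i * (a (fst z) * b i (yc z) * f (tc z))))"
    by (simp add: pform_def)
  also have "\<dots> = (LINT z|p. (\<Sum>i\<in>I. c i * (a (fst z) * b i (yc z) * f (tc z))))"
    using assms by (intro Bochner_Integration.integral_sum[symmetric] integrable_mult_right Pol_lfun_integrable)
  also have "\<dots> = pform a (\<lambda>x. \<Sum>i\<in>I. c i * b i x) f p"
    unfolding pform_def
    by (intro Bochner_Integration.integral_cong refl) (simp add: sum_distrib_right sum_distrib_left mult_ac)
  finally show ?thesis by simp
qed

lemma pform_cong:
  assumes "\<And>x. x \<in> space X \<Longrightarrow> a x = a' x" "\<And>y. y \<in> space Y \<Longrightarrow> b y = b' y" "\<And>t. 0 < t \<Longrightarrow> f t = f' t"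
  shows "pform a b f p = pform a' b' f' p"
  unfolding pform_def using assms by (intro Bochner_Integration.integral_cong) (auto simp: Pol_space)

text \<open>The bridge from the definition of the topology to \<open>pform\<close>: weighting the
  measure by \<open>t\<close> becomes multiplying the test function by \<open>t\<close>.\<close>

lemma slice_pform:
  assumes [measurable]: "A \<in> sets X" "B \<in> sets Y" "f \<in> borel_measurable Rpos"
  shows "(LINT t|slice A B p. f t) = sform A B f p"
    and "(LINT t|slice A B (tmul p). f t) = sform A B (\<lambda>t. t * f t) p"
proof -
  have s: "A \<times> B \<times> {0<..} \<in> sets (triple X Y)"
    by (intro pair_measureI assms) (auto simp: sets_restrict_space)
  have *: "(LINT t|slice A B q. f t) = (LINT z|q. ind A (fst z) * ind B (yc z) * f (tc z))"
    if q[measurable_cong]: "sets q = sets (triple X Y)" for q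
  proof -
    have sp: "space q = space X \<times> space Y \<times> {0<..}"
      using sets_eq_imp_space_eq[OF q] by (simp add: space_pair_measure)
    have s': "(A \<times> B \<times> {0<..}) \<inter> space q \<in> sets q" using s q by auto
    have m: "(\<lambda>z. tc z) \<in> measurable (restrict_space q (A \<times> B \<times> {0<..})) Rpos"
      by (rule measurable_restrict_space1) measurable
    have "(LINT t|slice A B q. f t) = (LINT z|restrict_space q (A \<times> B \<times> {0<..}). f (tc z))"
      unfolding slice_def case_prod_beta' by (rule integral_distr[OF m]) simp
    also have "\<dots> = (LINT z|q. ind (A \<times> B \<times> {0<..}) z *\<^sub>R f (tc z))"
      by (rule integral_restrict_space[OF s'])
    also have "\<dots> = (LINT z|q. ind A (fst z) * ind B (yc z) * f (tc z))"
      by (intro Bochner_Integration.integral_cong refl) (auto simp: sp indicator_def)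
    finally show ?thesis .
  qed
  show "(LINT t|slice A B p. f t) = sform A B f p"
    using *[OF Pol_sets] by (simp add: pform_def)
  have "(LINT t|slice A B (tmul p). f t) = (LINT z|tmul p. ind A (fst z) * ind B (yc z) * f (tc z))" (is "?L0 = _")
    by (rule *) (simp add: Pol_tmul Pol_sets)
  also have "\<dots> = (LINT z|p. tc z *\<^sub>R (ind A (fst z) * ind B (yc z) * f (tc z)))"
    unfolding Pol_tmul
    by (rule integral_density) (auto simp: Pol_space)
  finally show "?L0 = sform A B (\<lambda>t. t * f t) p"
    unfolding pform_def by (simp add: mult_ac)
qed

end

text \<open>Rounding \<open>a\<close> down to multiples of \<open>e\<close> leaves finitely many
  levels; the level sets are indexed by the integer part of \<open>a x / e\<close>.\<close>

lemma bfun_simple_approx: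
  assumes "bfun X a" "e > 0"
  obtains I :: "int set" and c A where "finite I" "\<And>i. i \<in> I \<Longrightarrow> A i \<in> sets X"
    "\<And>x. x \<in> space X \<Longrightarrow> \<bar>a x - (\<Sum>i\<in>I. c i * ind (A i) x)\<bar> \<le> e"
proof -
  obtain M where M: "0 \<le> M" "\<And>x. x \<in> space X \<Longrightarrow> \<bar>a x\<bar> \<le> M" and [measurable]: "a \<in> borel_measurable X"
    using bfunD[OF assms(1)] by blast
  define I where "I = {- (\<lceil>M / e\<rceil> + 1) .. \<lceil>M / e\<rceil> + 1}"
  define A where "A i = {x\<in>space X. \<lfloor>a x / e\<rfloor> = i}" for i
  have "\<bar>a x - (\<Sum>i\<in>I. (e * of_int i) * ind (A i) x)\<bar> \<le> e" if x: "x \<in> space X" for x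
  proof -
    have "a x / e \<le> M / e" "- (M / e) \<le> a x / e" using M(2)[OF x] assms(2) by (auto simp: field_simps)
    then have "\<lfloor>a x / e\<rfloor> \<in> I" unfolding I_def atLeastAtMost_iff by linarith
    moreover have "(\<Sum>i\<in>I. (e * of_int i) * ind (A i) x) = (\<Sum>i\<in>I. if i = \<lfloor>a x / e\<rfloor> then e * of_int i else 0)"
      by (intro sum.cong) (auto simp: A_def x)
    ultimately have "(\<Sum>i\<in>I. (e * of_int i) * ind (A i) x) = e * of_int \<lfloor>a x / e\<rfloor>"
      by (simp add: I_def)
    moreover have "\<bar>a x / e - of_int \<lfloor>a x / e\<rfloor>\<bar> \<le> 1" by linarith
    then have "e * \<bar>a x / e - of_int \<lfloor>a x / e\<rfloor>\<bar> \<le> e" using assms(2) by simp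
    moreover have "e * \<bar>a x / e - of_int \<lfloor>a x / e\<rfloor>\<bar> = \<bar>e * (a x / e - of_int \<lfloor>a x / e\<rfloor>)\<bar>"
      unfolding abs_mult using assms(2) by simp
    moreover have "e * (a x / e - of_int \<lfloor>a x / e\<rfloor>) = a x - e * of_int \<lfloor>a x / e\<rfloor>"
      using assms(2) by (simp add: right_diff_distrib)
    ultimately show ?thesis by simp
  qed
  moreover have "A i \<in> sets X" for i unfolding A_def by measurable
  ultimately show thesis by (intro that[of I A "\<lambda>i. e * of_int i"]) (auto simp: I_def)
qed

section \<open>The topology of the space of polymorphisms\<close>

text \<open>The comparison family and its limit may depend on \<open>e\<close>. Three errors of at
  most \<open>e / 4\<close> each stay below \<open>e\<close>.\<close>

lemma tendsto_approx:
  fixes f :: "'i \<Rightarrow> real"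
  assumes "\<And>e. e > 0 \<Longrightarrow> \<exists>g L. (g \<longlongrightarrow> L) F \<and> (\<forall>\<^sub>F j in F. \<bar>f j - g j\<bar> \<le> e) \<and> \<bar>l - L\<bar> \<le> e"
  shows "(f \<longlongrightarrow> l) F"
proof (rule tendstoI)
  fix e :: real assume "e > 0"
  then obtain g L where g: "(g \<longlongrightarrow> L) F" "\<forall>\<^sub>F j in F. \<bar>f j - g j\<bar> \<le> e / 4" "\<bar>l - L\<bar> \<le> e / 4"
    using assms[of "e / 4"] by auto
  have "\<forall>\<^sub>F j in F. dist (g j) L < e / 4" using g(1) \<open>e > 0\<close> by (intro tendstoD) auto
  with g(2) show "\<forall>\<^sub>F j in F. dist (f j) l < e"
    proof eventually_elim
    case (elim j)
    then show ?case using g(3) \<open>e > 0\<close> unfolding dist_real_def by arith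
  qed
qed

text \<open>Bounded linear functionals on bounded measurable functions, reduced to what uniform
  approximation by simple functions uses. The index type of the sums is that of
  \<open>bfun_simple_approx\<close>.\<close>

definition blin :: "'y measure \<Rightarrow> real \<Rightarrow> (('y \<Rightarrow> real) \<Rightarrow> real) \<Rightarrow> bool" where
  "blin Y K L \<longleftrightarrow> 0 \<le> K \<and>
     (\<forall>b b'. bfun Y b \<longrightarrow> bfun Y b' \<longrightarrow> L b - L b' = L (\<lambda>y. b y - b' y)) \<and>
     (\<forall>(I :: int set) c B. finite I \<longrightarrow> (\<forall>i\<in>I. B i \<in> sets Y) \<longrightarrow>
        L (\<lambda>y. \<Sum>i\<in>I. c i * ind (B i) y) = (\<Sum>i\<in>I. c i * L (ind (B i)))) \<and>
     (\<forall>b N. bfun Y b \<longrightarrow> 0 \<le> N \<longrightarrow> (\<forall>y\<in>space Y. \<bar>b y\<bar> \<le> N) \<longrightarrow> \<bar>L b\<bar> \<le> K * N)"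

lemma bfun_simple:
  assumes "finite (I :: 'i set)" "\<forall>i\<in>I. B i \<in> sets Y"
  shows "bfun Y (\<lambda>y. \<Sum>i\<in>I. c i * ind (B i) y :: real)"
proof (rule bfunI[of _ _ "\<Sum>i\<in>I. \<bar>c i\<bar>"])
  show "(\<lambda>y. \<Sum>i\<in>I. c i * ind (B i) y) \<in> borel_measurable Y"
    using assms by (intro borel_measurable_sum) auto
  show "\<bar>\<Sum>i\<in>I. c i * ind (B i) x\<bar> \<le> (\<Sum>i\<in>I. \<bar>c i\<bar>)" for x
    by (rule order_trans[OF sum_abs], rule sum_mono) (auto simp: indicator_def)
qed

text \<open>A common bound \<open>K\<close> makes the error of replacing \<open>b\<close> by a
  simple function uniform along the filter, so convergence on indicators spreads to all bounded
  functions.\<close>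

lemma blin_tendsto:
  assumes L: "\<forall>\<^sub>F j in F. blin Y K (L j)" and L': "blin Y K L'" and b: "bfun Y b"
    and ind: "\<And>B. B \<in> sets Y \<Longrightarrow> ((\<lambda>j. L j (ind B)) \<longlongrightarrow> L' (ind B)) F"
  shows "((\<lambda>j. L j b) \<longlongrightarrow> L' b) F"
proof (rule tendsto_approx)
  fix e :: real assume e: "e > 0"
  \<comment> \<open>\<open>d\<close> is the sup distance to a simple function that costs at most
    \<open>e\<close> after multiplication by \<open>K\<close>; adding 1 keeps the denominator
    positive.\<close>
  define d where "d = e / (\<bar>K\<bar> + 1)"
  have d: "d > 0" "K * d \<le> e"
    proof -
    have "K * e \<le> \<bar>K\<bar> * e" using e by (intro mult_right_mono) auto
    moreover have "\<bar>K\<bar> * e = e * \<bar>K\<bar>" by (rule mult.commute)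
    ultimately have "K * e \<le> e + e * \<bar>K\<bar>" using e by linarith
    then show "K * d \<le> e" using e by (simp add: d_def pos_divide_le_eq field_simps)
  qed (use e in \<open>simp add: d_def add_nonneg_pos\<close>)
  obtain I :: "int set" and c B where I: "finite I" and B: "\<And>i. i \<in> I \<Longrightarrow> B i \<in> sets Y"
    and le: "\<And>x. x \<in> space Y \<Longrightarrow> \<bar>b x - (\<Sum>i\<in>I. c i * ind (B i) x)\<bar> \<le> d"
    by (rule bfun_simple_approx[OF b d(1)]) blast
  define b' where "b' = (\<lambda>y. \<Sum>i\<in>I. c i * ind (B i) y)"
  have b': "bfun Y b'" unfolding b'_def using I B by (intro bfun_simple) auto
  have le': "\<bar>M b - M b'\<bar> \<le> e" and eq: "M b' = (\<Sum>i\<in>I. c i * M (ind (B i)))" if "blin Y K M" for M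
  proof -
    have "M b - M b' = M (\<lambda>y. b y - b' y)" using that b b' by (simp add: blin_def)
    moreover have "\<bar>M (\<lambda>y. b y - b' y)\<bar> \<le> K * d"
      using that le bfun_diff[OF b b'] d(1) by (simp add: blin_def b'_def)
    ultimately show "\<bar>M b - M b'\<bar> \<le> e" using d by simp
    show "M b' = (\<Sum>i\<in>I. c i * M (ind (B i)))"
      using that I B by (simp add: blin_def b'_def)
  qed
  have "((\<lambda>j. \<Sum>i\<in>I. c i * L j (ind (B i))) \<longlongrightarrow> (\<Sum>i\<in>I. c i * L' (ind (B i)))) F"
    by (intro tendsto_sum tendsto_mult_left ind B)
  moreover have "\<forall>\<^sub>F j in F. \<bar>L j b - (\<Sum>i\<in>I. c i * L j (ind (B i)))\<bar> \<le> e"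
    using L by eventually_elim (use le' eq in metis)
  moreover have "\<bar>L' b - (\<Sum>i\<in>I. c i * L' (ind (B i)))\<bar> \<le> e"
    using le' eq L' by metis
  ultimately show "\<exists>g L'a. (g \<longlongrightarrow> L'a) F \<and> (\<forall>\<^sub>F j in F. \<bar>L j b - g j\<bar> \<le> e) \<and> \<bar>L' b - L'a\<bar> \<le> e"
    by blast
qed

text \<open>The convergence statement applied to a constant family; the two bounds are merged into
  their maximum.\<close>

lemma blin_eq:
  assumes "blin Y K L" "blin Y K' L'" "bfun Y b"
    and "\<And>B. B \<in> sets Y \<Longrightarrow> L (ind B) = L' (ind B)"
  shows "L b = L' b"
proof -
  have mono: "blin Y (max K K') M" if M: "blin Y k M" and k: "k \<in> {K, K'}" for M k
  proof -
    have "\<bar>M b\<bar> \<le> max K K' * N" if "bfun Y b" "0 \<le> N" "\<forall>y\<in>space Y. \<bar>b y\<bar> \<le> N" for b N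
    proof -
      have "\<bar>M b\<bar> \<le> k * N" using that M unfolding blin_def by blast
      also have "\<dots> \<le> max K K' * N" using that k by (intro mult_right_mono) auto
      finally show ?thesis .
    qed
    moreover have "0 \<le> max K K'" using M k unfolding blin_def by auto
    ultimately show ?thesis using M unfolding blin_def by blast
  qed
  have "((\<lambda>j::nat. L b) \<longlonglongrightarrow> L' b)"
    by (rule blin_tendsto[where K = "max K K'" and L = "\<lambda>_. L"])
      (use mono assms in auto)
  then show ?thesis by (simp add: LIMSEQ_const_iff)
qed

lemma blin_pform1:
  assumes X: "prob_space X" and Y: "prob_space Y" and p: "p \<in> Pol X Y"
    and b: "bfun Y b" "\<And>y. y \<in> space Y \<Longrightarrow> \<bar>b y\<bar> \<le> N" and f: "lfun f" "\<And>t. 0 < t \<Longrightarrow> \<bar>f t\<bar> \<le> C * (1 + t)"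
  shows "blin X (2 * N * C) (\<lambda>a. pform a b f p)"
  unfolding blin_def
proof (intro conjI allI impI)
  show "0 \<le> 2 * N * C"
  proof -
    obtain y where "y \<in> space Y" using prob_space.not_empty[OF Y] by blast
    then have "0 \<le> N" using b(2)[of y] by simp
    then show ?thesis using f(2)[of 1] by simp
  qed
  show "pform (\<lambda>y. \<Sum>i\<in>I. c i * ind (B i) y) b f p = (\<Sum>i\<in>I. c i * pform (ind (B i)) b f p)"
    if "finite I" "\<forall>i\<in>I. B i \<in> sets X" for I :: "int set" and c B
    by (rule pform_sum1[OF X Y p]) (use that b f in \<open>auto intro!: bfun_indicator\<close>)
  fix a M assume "bfun X a" "0 \<le> M" "\<forall>y\<in>space X. \<bar>a y\<bar> \<le> M"
  then show "\<bar>pform a b f p\<bar> \<le> 2 * N * C * M"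
    using pform_bound[OF X Y p, of a b f M N C] b f by (simp add: mult_ac)
qed (use pform_diff1[OF X Y p] b f in auto)

lemma blin_pform2:
  assumes X: "prob_space X" and Y: "prob_space Y" and p: "p \<in> Pol X Y"
    and a: "bfun X a" "\<And>y. y \<in> space X \<Longrightarrow> \<bar>a y\<bar> \<le> N" and f: "lfun f" "\<And>t. 0 < t \<Longrightarrow> \<bar>f t\<bar> \<le> C * (1 + t)"
  shows "blin Y (2 * N * C) (\<lambda>b. pform a b f p)"
  unfolding blin_def
proof (intro conjI allI impI)
  show "0 \<le> 2 * N * C"
  proof -
    obtain y where "y \<in> space X" using prob_space.not_empty[OF X] by blast
    then have "0 \<le> N" using a(2)[of y] by simp
    then show ?thesis using f(2)[of 1] by simp
  qed
  show "pform a (\<lambda>y. \<Sum>i\<in>I. c i * ind (B i) y) f p = (\<Sum>i\<in>I. c i * pform a (ind (B i)) f p)"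
    if "finite I" "\<forall>i\<in>I. B i \<in> sets Y" for I :: "int set" and c B
    by (rule pform_sum2[OF X Y p]) (use that a f in \<open>auto intro!: bfun_indicator\<close>)
  fix b M assume "bfun Y b" "0 \<le> M" "\<forall>y\<in>space Y. \<bar>b y\<bar> \<le> M"
  then show "\<bar>pform a b f p\<bar> \<le> 2 * N * C * M"
    using pform_bound[OF X Y p, of a b f N M C] a f by (simp add: mult_ac)
qed (use pform_diff2[OF X Y p] a f in auto)

lemma blin_integral:
  assumes "finite_measure Y" "bfun Y g" "0 \<le> M" "\<And>y. y \<in> space Y \<Longrightarrow> \<bar>g y\<bar> \<le> M"
  shows "blin Y (M * measure Y (space Y)) (\<lambda>b. LINT y|Y. g y * b y)"
  unfolding blin_def
proof (intro conjI allI impI)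
  interpret finite_measure Y by fact
  have int: "integrable Y (\<lambda>y. g y * b y)" if "bfun Y b" for b
    using that assms by (intro bfun_integrable bfun_mult)
  show "(LINT y|Y. g y * b y) - (LINT y|Y. g y * b' y) = (LINT y|Y. g y * (b y - b' y))"
    if "bfun Y b" "bfun Y b'" for b b'
    by (subst Bochner_Integration.integral_diff[symmetric]) (use that int in \<open>auto simp: algebra_simps\<close>)
  show "(LINT y|Y. g y * (\<Sum>i\<in>I. c i * ind (B i) y)) = (\<Sum>i\<in>I. c i * (LINT y|Y. g y * ind (B i) y))"
    if "finite I" "\<forall>i\<in>I. B i \<in> sets Y" for I :: "int set" and c B
  proof -
    have "(\<Sum>i\<in>I. c i * (LINT y|Y. g y * ind (B i) y)) = (\<Sum>i\<in>I. (LINT y|Y. c i * (g y * ind (B i) y)))"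
      by simp
    also have "\<dots> = (LINT y|Y. (\<Sum>i\<in>I. c i * (g y * ind (B i) y)))"
      using that by (intro Bochner_Integration.integral_sum[symmetric] integrable_mult_right int bfun_indicator) auto
    finally show ?thesis by (simp add: sum_distrib_left mult_ac)
  qed
  show "0 \<le> M * measure Y (space Y)" using assms(3) by simp
  fix b N assume b: "bfun Y b" "0 \<le> N" "\<forall>y\<in>space Y. \<bar>b y\<bar> \<le> N"
  have "\<bar>LINT y|Y. g y * b y\<bar> \<le> (LINT y|Y. \<bar>g y * b y\<bar>)" (is "?L1 \<le> _") by (rule integral_abs_bound)
  also have "\<dots> \<le> (LINT y|Y. M * N)"
  proof (rule integral_mono)
    show "integrable Y (\<lambda>y. \<bar>g y * b y\<bar>)" using int[OF b(1)] by simp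
    show "\<bar>g y * b y\<bar> \<le> M * N" if "y \<in> space Y" for y
      using assms(4)[OF that] b(3) that assms(3) b(2) abs_ge_zero[of "g y"] unfolding abs_mult by (intro mult_mono) (auto intro: order_trans)
  qed simp
  finally show "?L1 \<le> M * measure Y (space Y) * N" by (simp add: mult_ac)
qed

text \<open>For positive \<open>n\<close> a trapezoid: 0 for \<open>t \<le> 1 / n\<close> and for
  \<open>t \<ge> n + 1\<close>, and 1 for \<open>2 / n \<le> t \<le> n\<close>. For
  \<open>n = 0\<close> it vanishes identically.\<close>

definition cutoff :: "nat \<Rightarrow> real \<Rightarrow> real" where
  "cutoff n t = max 0 (min 1 (min (real n * t - 1) (real n + 1 - t)))"

lemma cutoff_bounds: "0 \<le> cutoff n t" "cutoff n t \<le> 1"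
  by (auto simp: cutoff_def)

lemma cutoff_continuous: "continuous_on S (cutoff n)"
  unfolding cutoff_def by (intro continuous_intros)

lemma cutoff_measurable [measurable]: "cutoff n \<in> borel_measurable borel"
  by (intro borel_measurable_continuous_onI cutoff_continuous)

lemma cutoff_ccont: "ccont (cutoff n)"
  unfolding ccont_def
proof (intro conjI exI allI impI)
  \<comment> \<open>The interval exceeds the support so that its end points are meaningful and
    distinct for \<open>n = 0\<close> as well.\<close>
  fix t :: real assume t: "0 < t" "t \<notin> {1 / (real n + 2) .. real n + 2}"
  have "real n * t \<le> 1 \<or> t \<ge> real n + 1"
  proof (cases "t < 1 / (real n + 2)")
    case True
    then have "t * (real n + 2) < 1" by (simp add: field_simps)
    then show ?thesis using t by (simp add: algebra_simps)
  qed (use t in auto)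
  then show "cutoff n t = 0" by (auto simp: cutoff_def)
qed (auto intro: cutoff_continuous simp: field_simps, smt (verit) of_nat_0_le_iff mult_nonneg_nonneg)

lemma cutoff_lim:
  assumes "t > 0" shows "(\<lambda>n. cutoff n t) \<longlonglongrightarrow> 1"
proof (rule tendsto_eventually)
  obtain N :: nat where N: "real N \<ge> max (2 / t) t" using real_arch_simple by blast
  show "\<forall>\<^sub>F n in sequentially. cutoff n t = 1"
  proof (rule eventually_sequentiallyI)
    fix n assume "N \<le> n"
    then have "real n \<ge> 2 / t" "real n \<ge> t" using N by auto
    then show "cutoff n t = 1" using assms by (auto simp: cutoff_def field_simps)
  qed
qed

context
  fixes X :: "'x measure" and Y :: "'y measure"
  assumes X: "prob_space X" and Y: "prob_space Y"
begin

lemma lfun_one_plus: "lfun (\<lambda>t. 1 + t)"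
  unfolding lfun_def by (auto intro!: exI[of _ 1])

lemma pform_one_plus:
  assumes p: "p \<in> Pol X Y" shows "pform (\<lambda>_. 1) (\<lambda>_. 1) (\<lambda>t. 1 + t) p = 2"
proof -
  interpret p: prob_space p by (rule Pol_prob[OF X Y p])
  show ?thesis using Pol_t_integrable[OF X Y p] Pol_t_integral[OF X Y p]
    by (simp add: pform_def p.prob_space)
qed

text \<open>Dominated convergence with majorant \<open>1 + t\<close>: the truncated mass of a fixed
  polymorphism tends to the full value 2.\<close>

lemma cutoff_tight:
  assumes p: "p \<in> Pol X Y"
  shows "(\<lambda>n. pform (\<lambda>_. 1) (\<lambda>_. 1) (\<lambda>t. (1 + t) * cutoff n t) p) \<longlonglongrightarrow> 2"
proof -
  note [measurable] = Pol_t[OF X Y p]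
  have "(\<lambda>n. pform (\<lambda>_. 1) (\<lambda>_. 1) (\<lambda>t. (1 + t) * cutoff n t) p)
      \<longlonglongrightarrow> pform (\<lambda>_. 1) (\<lambda>_. 1) (\<lambda>t. 1 + t) p"
    unfolding pform_def
  proof (rule integral_dominated_convergence[where w = "\<lambda>z. 1 + tc z"])
    interpret p: prob_space p by (rule Pol_prob[OF X Y p])
    show "integrable p (\<lambda>z. 1 + tc z)" using Pol_t_integrable[OF X Y p] by simp
    show "AE z in p. (\<lambda>n. 1 * 1 * ((1 + tc z) * cutoff n (tc z))) \<longlonglongrightarrow> 1 * 1 * (1 + tc z)"
      by (rule AE_I2) (auto simp: Pol_space[OF X Y p] intro!: tendsto_eq_intros cutoff_lim)
    show "AE z in p. norm (1 * 1 * ((1 + tc z) * cutoff n (tc z))) \<le> 1 + tc z" for n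
    proof (rule AE_I2)
      fix z assume "z \<in> space p"
      then have "0 < tc z" by (auto simp: Pol_space[OF X Y p])
      then show "norm (1 * 1 * ((1 + tc z) * cutoff n (tc z))) \<le> 1 + tc z"
        using mult_left_mono[OF cutoff_bounds(2)[of n "tc z"], of "1 + tc z"] cutoff_bounds(1)[of n "tc z"]
        by (simp add: abs_mult)
    qed
  qed measurable
  then show ?thesis using pform_one_plus[OF p] by simp
qed

text \<open>The error is at most \<open>C\<close> times the mass of \<open>1 + t\<close> that the
  cutoff removes, and this missing mass is 2 minus a value of \<open>pform\<close> at a compactly
  supported function. It can therefore be controlled along a convergent family.\<close>

lemma cutoff_error:
  assumes p: "p \<in> Pol X Y" and a: "bfun X a" "\<And>x. x \<in> space X \<Longrightarrow> \<bar>a x\<bar> \<le> 1"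
    and b: "bfun Y b" "\<And>x. x \<in> space Y \<Longrightarrow> \<bar>b x\<bar> \<le> 1"
    and f: "lcont f" "\<And>t. 0 < t \<Longrightarrow> \<bar>f t\<bar> \<le> C * (1 + t)"
  shows "\<bar>pform a b f p - pform a b (\<lambda>t. f t * cutoff n t) p\<bar>
    \<le> C * (2 - pform (\<lambda>_. 1) (\<lambda>_. 1) (\<lambda>t. (1 + t) * cutoff n t) p)"
proof -
  have C: "0 \<le> C" using f(2)[of 1] by simp
  have m [measurable]: "f \<in> borel_measurable Rpos" using lcont_lfun[OF f(1)] by (simp add: lfun_def)
  have l: "lfun (\<lambda>t. g t * cutoff n t)" "lfun (\<lambda>t. g t - g t * cutoff n t)" if g: "lfun g" for g
  proof -
    obtain D where D: "\<And>t. 0 < t \<Longrightarrow> \<bar>g t\<bar> \<le> D * (1 + t)" and [measurable]: "g \<in> borel_measurable Rpos"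
      using g unfolding lfun_def by blast
    have *: "\<bar>g t * c\<bar> \<le> D * (1 + t)" if "0 < t" "0 \<le> c" "c \<le> 1" for t c
    proof -
      have "\<bar>g t\<bar> * \<bar>c\<bar> \<le> \<bar>g t\<bar> * 1" using that by (intro mult_left_mono) auto
      then show ?thesis using D[OF that(1)] by (simp add: abs_mult)
    qed
    show "lfun (\<lambda>t. g t * cutoff n t)"
      unfolding lfun_def using * cutoff_bounds by (auto intro!: exI[of _ D])
    have "lfun (\<lambda>t. g t * (1 - cutoff n t))"
      unfolding lfun_def using * cutoff_bounds[of n] by (auto intro!: exI[of _ D])
    then show "lfun (\<lambda>t. g t - g t * cutoff n t)" by (simp add: right_diff_distrib)
  qed
  note lf = lcont_lfun[OF f(1)]
  have "\<bar>pform a b f p - pform a b (\<lambda>t. f t * cutoff n t) p\<bar> = \<bar>pform a b (\<lambda>t. f t - f t * cutoff n t) p\<bar>"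
    by (subst pform_diff3[OF X Y p a(1) b(1)]) (use l lf in auto)
  also have "\<dots> \<le> (LINT z|p. \<bar>a (fst z) * b (yc z) * (f (tc z) - f (tc z) * cutoff n (tc z))\<bar>)"
    unfolding pform_def by (rule integral_abs_bound)
  also have "\<dots> \<le> (LINT z|p. C * (1 * 1 * ((1 + tc z) - (1 + tc z) * cutoff n (tc z))))"
  proof (rule integral_mono_AE)
    show "integrable p (\<lambda>z. C * (1 * 1 * ((1 + tc z) - (1 + tc z) * cutoff n (tc z))))"
      by (rule integrable_mult_right, rule Pol_lfun_integrable[OF X Y p bfun_const bfun_const], rule l, rule lfun_one_plus)
    show "integrable p (\<lambda>z. \<bar>a (fst z) * b (yc z) * (f (tc z) - f (tc z) * cutoff n (tc z))\<bar>)"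
      by (rule integrable_abs, rule Pol_lfun_integrable[OF X Y p a(1) b(1)], rule l, rule lf)
    show "AE z in p. \<bar>a (fst z) * b (yc z) * (f (tc z) - f (tc z) * cutoff n (tc z))\<bar>
        \<le> C * (1 * 1 * ((1 + tc z) - (1 + tc z) * cutoff n (tc z)))"
    proof (rule AE_I2)
      fix z assume z: "z \<in> space p"
      let ?x = "fst z" and ?y = "yc z" and ?t = "tc z"
      have z': "?x \<in> space X" "?y \<in> space Y" "0 < ?t" using z by (auto simp: Pol_space[OF X Y p])
      have "\<bar>a ?x\<bar> * \<bar>b ?y\<bar> * (\<bar>f ?t\<bar> * \<bar>1 - cutoff n ?t\<bar>) \<le> 1 * 1 * ((C * (1 + ?t)) * (1 - cutoff n ?t))"
        using cutoff_bounds[of n ?t] z' C by (intro mult_mono a b f) auto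
      then show "\<bar>a ?x * b ?y * (f ?t - f ?t * cutoff n ?t)\<bar> \<le> C * (1 * 1 * ((1 + ?t) - (1 + ?t) * cutoff n ?t))"
        by (simp add: abs_mult[symmetric] algebra_simps)
    qed
  qed
  also have "\<dots> = C * pform (\<lambda>_. 1) (\<lambda>_. 1) (\<lambda>t. (1 + t) - (1 + t) * cutoff n t) p"
    unfolding pform_def by simp
  also have "pform (\<lambda>_. 1) (\<lambda>_. 1) (\<lambda>t. (1 + t) - (1 + t) * cutoff n t) p
      = 2 - pform (\<lambda>_. 1) (\<lambda>_. 1) (\<lambda>t. (1 + t) * cutoff n t) p"
    by (subst pform_diff3[OF X Y p bfun_const bfun_const lfun_one_plus l(1)[OF lfun_one_plus], symmetric])
      (simp add: pform_one_plus[OF p])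
  finally show ?thesis .
qed

text \<open>No mass is lost because the limit \<open>q\<close> has the same total 2 as every
  \<open>p j\<close>: if \<open>R n q\<close> is close to 2, then so is \<open>R n (p j)\<close>
  eventually, and the tails of the \<open>p j\<close> are small together.\<close>

lemma limitin_pol_lcont:
  assumes q: "q \<in> Pol X Y" and ev: "\<forall>\<^sub>F j in F. p j \<in> Pol X Y"
    and H: "\<And>A B f. A \<in> sets X \<Longrightarrow> B \<in> sets Y \<Longrightarrow> ccont f \<Longrightarrow>
      ((\<lambda>j. sform A B f (p j)) \<longlongrightarrow> sform A B f q) F"
    and A: "A \<in> sets X" and B: "B \<in> sets Y" and f: "lcont f"
  shows "((\<lambda>j. sform A B f (p j)) \<longlongrightarrow> sform A B f q) F"
proof (rule tendsto_approx)
  fix e :: real assume e: "e > 0"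
  obtain C where C: "\<And>t. 0 < t \<Longrightarrow> \<bar>f t\<bar> \<le> C * (1 + t)" and fc: "continuous_on {0<..} f"
    using f by (auto simp: lcont_def)
  have C0: "0 \<le> C" using C[of 1] by simp
  define R where "R n p = pform (\<lambda>_. 1) (\<lambda>_. 1) (\<lambda>t. (1 + t) * cutoff n t) p" for n and p :: "('x \<times> 'y \<times> real) measure"
  \<comment> \<open>Chosen so that a deficit of \<open>d\<close> in the mass costs at most
    \<open>e\<close> after multiplication by \<open>C\<close>.\<close>
  define d where "d = e / (C + 1)"
  have d: "d > 0" "C * d \<le> e" using e C0 by (auto simp: d_def field_simps)
  have "\<forall>\<^sub>F n in sequentially. \<bar>R n q - 2\<bar> < d"
    using tendstoD[OF cutoff_tight[OF q] d(1)] by (simp add: R_def dist_real_def)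
  then obtain n where n: "\<bar>R n q - 2\<bar> < d" by (auto simp: eventually_sequentially)
  have err: "\<bar>sform A B f p - sform A B (\<lambda>t. f t * cutoff n t) p\<bar> \<le> C * (2 - R n p)"
    if "p \<in> Pol X Y" for p
    unfolding R_def using f C by (intro cutoff_error[OF that] bfun_indicator A B) (auto simp: indicator_def)
  \<comment> \<open>The hypothesis speaks of indicators, so the constant function 1 is written as
    the indicator of the whole space.\<close>
  have "((\<lambda>j. sform (space X) (space Y) (\<lambda>t. (1 + t) * cutoff n t) (p j)) \<longlongrightarrow>
      sform (space X) (space Y) (\<lambda>t. (1 + t) * cutoff n t) q) F"
    by (intro H sets.top ccont_mult cutoff_ccont continuous_intros)
  moreover have R: "sform (space X) (space Y) (\<lambda>t. (1 + t) * cutoff n t) p = R n p"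
    if "p \<in> Pol X Y" for p
    unfolding R_def by (rule pform_cong[OF X Y that]) auto
  ultimately have "((\<lambda>j. sform (space X) (space Y) (\<lambda>t. (1 + t) * cutoff n t) (p j)) \<longlongrightarrow> R n q) F"
    using q by simp
  then have "((\<lambda>j. R n (p j)) \<longlongrightarrow> R n q) F"
    by (rule Lim_transform_eventually) (use ev R in \<open>auto elim: eventually_mono\<close>)
  then have "\<forall>\<^sub>F j in F. 2 - d < R n (p j)"
    using order_tendstoD(1)[of "\<lambda>j. R n (p j)" "R n q" F "2 - d"] n by auto
  then have 1: "\<forall>\<^sub>F j in F. \<bar>sform A B f (p j) - sform A B (\<lambda>t. f t * cutoff n t) (p j)\<bar> \<le> e"
    using ev
  proof eventually_elim
    case (elim j)
    have "C * (2 - R n (p j)) \<le> C * d" using elim C0 by (intro mult_left_mono) auto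
    then show ?case using err[OF elim(2)] d by linarith
  qed
  have "C * (2 - R n q) \<le> C * d" using n C0 by (intro mult_left_mono) auto
  then have 2: "\<bar>sform A B f q - sform A B (\<lambda>t. f t * cutoff n t) q\<bar> \<le> e"
    using err[OF q] d by linarith
  have "((\<lambda>j. sform A B (\<lambda>t. f t * cutoff n t) (p j)) \<longlongrightarrow> sform A B (\<lambda>t. f t * cutoff n t) q) F"
    by (intro H A B ccont_mult cutoff_ccont fc)
  with 1 2 show "\<exists>g L. (g \<longlongrightarrow> L) F \<and>
      (\<forall>\<^sub>F j in F. \<bar>sform A B f (p j) - g j\<bar> \<le> e) \<and>
      \<bar>sform A B f q - L\<bar> \<le> e" by blast
qed

text \<open>Empty sets and the zero function with \<open>U = UNIV\<close> make all of
  \<open>Pol X Y\<close> a subbasic set.\<close>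

lemma topspace_pol_topology: "topspace (pol_topology X Y) = Pol X Y"
proof
  show "topspace (pol_topology X Y) \<subseteq> Pol X Y"
    unfolding pol_topology_def topology_generated_by_topspace by blast
  have "bounded_continuous (\<lambda>_. 0)" by (simp add: bounded_continuous_def image_constant_conv)
  then have "{p \<in> Pol X Y. (LINT t|slice {} {} p. 0) \<in> (UNIV :: real set)} \<in>
      subbasis X Y (\<lambda>p. p)"
    by (intro CollectI exI[of _ "{}"] exI[of _ "\<lambda>_. 0"] exI[of _ UNIV]) auto
  then show "Pol X Y \<subseteq> topspace (pol_topology X Y)"
    unfolding pol_topology_def topology_generated_by_topspace
    by (intro subsetI UnionI[OF UnI1]) auto
qed

text \<open>Two families of bounded test integrals, for \<open>p\<close> and for
  \<open>t * p\<close>, become one family with linear growth. The filter is arbitrary, so that the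
  statement also serves continuity at a point.\<close>

lemma limitin_pol_iff:
  "limitin (pol_topology X Y) p q F \<longleftrightarrow> q \<in> Pol X Y \<and> (\<forall>\<^sub>F j in F. p j \<in> Pol X Y) \<and>
     (\<forall>A\<in>sets X. \<forall>B\<in>sets Y. \<forall>f. lcont f \<longrightarrow>
        ((\<lambda>j. sform A B f (p j)) \<longlongrightarrow> sform A B f q) F)"
  (is "?L \<longleftrightarrow> ?R")
proof
  assume L: ?L
  have q: "q \<in> Pol X Y" using L topspace_pol_topology by (auto simp: limitin_def)
  note S = L[unfolded pol_topology_def limitin_topology_generated_by, THEN conjunct2, rule_format]
  have ev: "\<forall>\<^sub>F j in F. p j \<in> Pol X Y"
  proof -
    have "openin (pol_topology X Y) (Pol X Y)" using topspace_pol_topology openin_topspace by metis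
    then show ?thesis using L q unfolding limitin_def by blast
  qed
  have 1: "((\<lambda>j. sform A B f (p j)) \<longlongrightarrow> sform A B f q) F"
    and 2: "((\<lambda>j. sform A B (\<lambda>t. t * f t) (p j)) \<longlongrightarrow> sform A B (\<lambda>t. t * f t) q) F"
    if A: "A \<in> sets X" and B: "B \<in> sets Y" and f: "bounded_continuous f" for A B f
  proof -
    have fm: "f \<in> borel_measurable Rpos" using bounded_continuous_bfun[OF f] by (simp add: bfun_def)
    show "((\<lambda>j. sform A B f (p j)) \<longlongrightarrow> sform A B f q) F"
    proof (rule topological_tendstoI)
      fix U :: "real set" assume U: "open U" "sform A B f q \<in> U"
      have "\<forall>\<^sub>F j in F. p j \<in> {p \<in> Pol X Y. (LINT t|slice A B p. f t) \<in> U}"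
        by (rule S) (use A B f U q slice_pform[OF X Y q A B fm] in auto)
      then show "\<forall>\<^sub>F j in F. sform A B f (p j) \<in> U"
        by (rule eventually_mono) (use slice_pform[OF X Y _ A B fm] in auto)
    qed
    show "((\<lambda>j. sform A B (\<lambda>t. t * f t) (p j)) \<longlongrightarrow> sform A B (\<lambda>t. t * f t) q) F"
    proof (rule topological_tendstoI)
      fix U :: "real set" assume U: "open U" "sform A B (\<lambda>t. t * f t) q \<in> U"
      have "\<forall>\<^sub>F j in F. p j \<in> {p \<in> Pol X Y. (LINT t|slice A B (tmul p). f t) \<in> U}"
        by (rule S) (use A B f U q slice_pform[OF X Y q A B fm] in auto)
      then show "\<forall>\<^sub>F j in F. sform A B (\<lambda>t. t * f t) (p j) \<in> U"
        by (rule eventually_mono) (use slice_pform[OF X Y _ A B fm] in auto)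
    qed
  qed
  have "((\<lambda>j. sform A B f (p j)) \<longlongrightarrow> sform A B f q) F"
    if A: "A \<in> sets X" and B: "B \<in> sets Y" and f: "lcont f" for A B f
  proof -
    obtain C where C: "\<And>t. 0 < t \<Longrightarrow> \<bar>f t\<bar> \<le> C * (1 + t)" and fc: "continuous_on {0<..} f"
      using f by (auto simp: lcont_def)
    \<comment> \<open>\<open>g\<close> is bounded and \<open>f t = g t + t * g t\<close>, which
      splits the integral of \<open>f\<close> into one of each kind.\<close>
    define g where "g t = f t / (1 + t)" for t
    have g: "bounded_continuous g"
      unfolding bounded_continuous_iff
    proof (intro conjI exI allI impI)
      show "continuous_on {0<..} g" unfolding g_def by (intro continuous_intros fc) auto
      show "\<bar>g t\<bar> \<le> C" if "0 < t" for t using C[OF that] that by (simp add: g_def abs_mult field_simps)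
    qed
    have *: "sform A B f p = sform A B g p + sform A B (\<lambda>t. t * g t) p"
      if p: "p \<in> Pol X Y" for p
    proof -
      have "sform A B f p - sform A B g p = sform A B (\<lambda>t. f t - g t) p"
        by (intro pform_diff3[OF X Y p] bfun_indicator A B lcont_lfun[OF f] lcont_lfun[OF lcont_bounded(1)[OF g]])
      also have "\<dots> = sform A B (\<lambda>t. t * g t) p"
        by (rule pform_cong[OF X Y p]) (auto simp: g_def field_simps)
      finally show ?thesis by simp
    qed
    have "((\<lambda>j. sform A B g (p j) + sform A B (\<lambda>t. t * g t) (p j)) \<longlongrightarrow> sform A B f q) F"
      unfolding *[OF q] by (intro tendsto_add 1 2 A B g)
    then show ?thesis
      by (rule Lim_transform_eventually) (use ev * in \<open>auto elim: eventually_mono\<close>)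
  qed
  then show ?R using q ev by blast
next
  assume R: ?R
  then have q: "q \<in> Pol X Y" and ev: "\<forall>\<^sub>F j in F. p j \<in> Pol X Y" by auto
  have R1: "\<forall>\<^sub>F j in F. p j \<in> {p \<in> Pol X Y. (LINT t|slice A B p. f t) \<in> U}"
    if "A \<in> sets X" "B \<in> sets Y" "bounded_continuous f" "open U" "(LINT t|slice A B q. f t) \<in> U" for A B f U
  proof -
    have fm: "f \<in> borel_measurable Rpos" using bounded_continuous_bfun[OF that(3)] by (simp add: bfun_def)
    note sl = slice_pform[OF X Y _ that(1,2) fm]
    have "((\<lambda>j. sform A B f (p j)) \<longlongrightarrow> sform A B f q) F"
      using R that lcont_bounded by blast
    then have "\<forall>\<^sub>F j in F. sform A B f (p j) \<in> U"
      using that sl q by (intro topological_tendstoD) auto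
    with ev show ?thesis by eventually_elim (use sl in auto)
  qed
  have R2: "\<forall>\<^sub>F j in F. p j \<in> {p \<in> Pol X Y. (LINT t|slice A B (tmul p). f t) \<in> U}"
    if "A \<in> sets X" "B \<in> sets Y" "bounded_continuous f" "open U" "(LINT t|slice A B (tmul q). f t) \<in> U" for A B f U
  proof -
    have fm: "f \<in> borel_measurable Rpos" using bounded_continuous_bfun[OF that(3)] by (simp add: bfun_def)
    note sl = slice_pform[OF X Y _ that(1,2) fm]
    have "((\<lambda>j. sform A B (\<lambda>t. t * f t) (p j)) \<longlongrightarrow> sform A B (\<lambda>t. t * f t) q) F"
      using R that lcont_bounded by blast
    then have "\<forall>\<^sub>F j in F. sform A B (\<lambda>t. t * f t) (p j) \<in> U"
      using that sl q by (intro topological_tendstoD) auto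
    with ev show ?thesis by eventually_elim (use sl in auto)
  qed
  have "q \<in> topspace (pol_topology X Y)" using q topspace_pol_topology by simp
  then show ?L
    unfolding pol_topology_def limitin_topology_generated_by topology_generated_by_topspace
  proof (intro conjI ballI impI)
    fix U assume U: "U \<in> subbasis X Y (\<lambda>p. p) \<union>
      subbasis X Y tmul" "q \<in> U"
    show "\<forall>\<^sub>F j in F. p j \<in> U"
      using U(1)
    proof
      assume "U \<in> subbasis X Y (\<lambda>p. p)"
      then obtain A B f V where "U = {p \<in> Pol X Y. (LINT t|slice A B p. f t) \<in> V}"
          "A \<in> sets X" "B \<in> sets Y" "bounded_continuous f" "open V" by blast
      then show ?thesis using R1[of A B f V] U(2) by simp
    next
      assume "U \<in> subbasis X Y tmul"
      then obtain A B f V where "U = {p \<in> Pol X Y. (LINT t|slice A B (tmul p). f t) \<in> V}"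
          "A \<in> sets X" "B \<in> sets Y" "bounded_continuous f" "open V" by blast
      then show ?thesis using R2[of A B f V] U(2) by simp
    qed
  qed
qed

lemma limitin_polI:
  assumes "q \<in> Pol X Y" "\<forall>\<^sub>F j in F. p j \<in> Pol X Y"
    and "\<And>A B f. A \<in> sets X \<Longrightarrow> B \<in> sets Y \<Longrightarrow> ccont f \<Longrightarrow>
      ((\<lambda>j. sform A B f (p j)) \<longlongrightarrow> sform A B f q) F"
  shows "limitin (pol_topology X Y) p q F"
  unfolding limitin_pol_iff using limitin_pol_lcont[OF assms] assms by blast

lemma limitin_pol_tendsto:
  assumes L: "limitin (pol_topology X Y) p q F" and a: "bfun X a" and b: "bfun Y b" and f: "lcont f"
  shows "((\<lambda>j. pform a b f (p j)) \<longlongrightarrow> pform a b f q) F"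
proof -
  have q: "q \<in> Pol X Y" and ev: "\<forall>\<^sub>F j in F. p j \<in> Pol X Y"
    and H: "\<And>A B. A \<in> sets X \<Longrightarrow> B \<in> sets Y \<Longrightarrow>
      ((\<lambda>j. sform A B f (p j)) \<longlongrightarrow> sform A B f q) F"
    using L f unfolding limitin_pol_iff by auto
  obtain C where C: "\<And>t. 0 < t \<Longrightarrow> \<bar>f t\<bar> \<le> C * (1 + t)" using f by (auto simp: lcont_def)
  obtain M where M: "0 \<le> M" "\<And>x. x \<in> space X \<Longrightarrow> \<bar>a x\<bar> \<le> M" using bfunD[OF a] by blast
  have *: "((\<lambda>j. pform a (ind B) f (p j)) \<longlongrightarrow> pform a (ind B) f q) F" if B: "B \<in> sets Y" for B
  proof (rule blin_tendsto[where Y = X and K = "2 * 1 * C"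
      and L = "\<lambda>j a. pform a (ind B) f (p j)" and L' = "\<lambda>a. pform a (ind B) f q"])
    show "blin X (2 * 1 * C) (\<lambda>a. pform a (ind B) f q)"
      by (intro blin_pform1[OF X Y q] bfun_indicator[OF B] lcont_lfun f C) (auto simp: indicator_def)
    show "\<forall>\<^sub>F j in F. blin X (2 * 1 * C) (\<lambda>a. pform a (ind B) f (p j))"
      using ev by eventually_elim (intro blin_pform1[OF X Y] bfun_indicator[OF B] lcont_lfun f C, auto simp: indicator_def)
  qed (use a H B in auto)
  show ?thesis
  proof (rule blin_tendsto[where Y = Y and K = "2 * M * C"
      and L = "\<lambda>j b. pform a b f (p j)" and L' = "\<lambda>b. pform a b f q"])
    show "blin Y (2 * M * C) (\<lambda>b. pform a b f q)"
      by (intro blin_pform2[OF X Y q a] M lcont_lfun f C) auto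
    show "\<forall>\<^sub>F j in F. blin Y (2 * M * C) (\<lambda>b. pform a b f (p j))"
      using ev by eventually_elim (intro blin_pform2[OF X Y _ a] M lcont_lfun f C, auto)
  qed (use b * in auto)
qed

text \<open>Compactly supported test functions suffice because tightness is automatic in
  \<open>Pol X Y\<close>.\<close>

lemma continuous_map_polI:
  assumes F: "\<And>s. s \<in> topspace S \<Longrightarrow> F s \<in> Pol X Y"
    and H: "\<And>s A B f. s \<in> topspace S \<Longrightarrow> A \<in> sets X \<Longrightarrow> B \<in> sets Y \<Longrightarrow> ccont f \<Longrightarrow>
      ((\<lambda>s'. sform A B f (F s')) \<longlongrightarrow> sform A B f (F s)) (atin S s)"
  shows "continuous_map S (pol_topology X Y) F"
  unfolding continuous_map_atin
proof
  fix s assume s: "s \<in> topspace S"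
  have "\<forall>\<^sub>F s' in atin S s. F s' \<in> Pol X Y"
    unfolding eventually_atin using F s openin_topspace by (metis DiffE)
  then show "limitin (pol_topology X Y) F (F s) (atin S s)"
    by (intro limitin_polI F s H)
qed

end

section \<open>Measures determined by boxes and polymorphisms determined by test values\<close>

lemma finite_measure_pair_eqI:
  assumes fin: "finite_measure p" and sp: "sets p = sets (X >< N)" and sq: "sets q = sets (X >< N)"
    and eq: "\<And>A D. A \<in> sets X \<Longrightarrow> D \<in> sets N \<Longrightarrow> emeasure p (A \<times> D) = emeasure q (A \<times> D)"
  shows "p = q"
proof (rule measure_eqI_generator_eq[where \<Omega> = "space X \<times> space N"
      and E = "{A \<times> D | A D. A \<in> sets X \<and> D \<in> sets N}" and A = "\<lambda>_. space X \<times> space N"])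
  show "Int_stable {A \<times> D | A D. A \<in> sets X \<and> D \<in> sets N}" by (rule Int_stable_pair_measure_generator)
  show "{A \<times> D | A D. A \<in> sets X \<and> D \<in> sets N} \<subseteq> Pow (space X \<times> space N)"
    by (rule pair_measure_closed)
  show "sets p = sigma_sets (space X \<times> space N) {A \<times> D | A D. A \<in> sets X \<and> D \<in> sets N}"
    "sets q = sigma_sets (space X \<times> space N) {A \<times> D | A D. A \<in> sets X \<and> D \<in> sets N}"
    by (simp_all add: sp sq sets_pair_measure)
  show "emeasure p (space X \<times> space N) \<noteq> \<infinity>" for i :: nat
    using finite_measure.emeasure_finite[OF fin] by simp
qed (use eq in auto)

lemma finite_measure_triple_eqI:
  assumes fin: "finite_measure p" and sp: "sets p = sets (X >< Y >< N)" and sq: "sets q = sets (X >< Y >< N)"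
    and eq: "\<And>A B C. A \<in> sets X \<Longrightarrow> B \<in> sets Y \<Longrightarrow> C \<in> sets N \<Longrightarrow> emeasure p (A \<times> B \<times> C) = emeasure q (A \<times> B \<times> C)"
  shows "p = q"
proof (rule finite_measure_pair_eqI[OF fin sp sq])
  fix A D assume A: "A \<in> sets X" and D: "D \<in> sets (Y >< N)"
  \<comment> \<open>The image on \<open>Y >< N\<close> of the part of \<open>r\<close> over
    \<open>A\<close>; this reduces the threefold product to the twofold one.\<close>
  define R where "R r = distr (density r (ind (A \<times> space (Y >< N)))) (Y >< N) snd" for r :: "('a \<times> 'b \<times> 'c) measure"
  have R: "emeasure (R r) E = emeasure r (A \<times> E)" if r: "sets r = sets (X >< Y >< N)" and E: "E \<in> sets (Y >< N)" for r E
  proof -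
    note [measurable_cong] = r
    have sr: "space r = space X \<times> space (Y >< N)" using sets_eq_imp_space_eq[OF r] by (simp add: space_pair_measure)
    have m: "A \<times> space (Y >< N) \<in> sets r" using A r by auto
    have pre: "snd -` E \<inter> space r \<in> sets r" using E by measurable
    have "emeasure (R r) E = emeasure (density r (ind (A \<times> space (Y >< N)))) (snd -` E \<inter> space r)"
      unfolding R_def using E by (subst emeasure_distr) auto
    also have "\<dots> = emeasure r ((A \<times> space (Y >< N)) \<inter> (snd -` E \<inter> space r))"
      using m pre by (simp add: emeasure_density nn_integral_indicator' flip: indicator_inter_arith)
    also have "(A \<times> space (Y >< N)) \<inter> (snd -` E \<inter> space r) = A \<times> E"
      using sets.sets_into_space[OF A] sets.sets_into_space[OF E] by (auto simp: sr)
    finally show ?thesis .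
  qed
  have "R p = R q"
  proof (rule finite_measure_pair_eqI)
    show "finite_measure (R p)"
    proof (rule finite_measureI)
      have "emeasure (R p) (space (Y >< N)) = emeasure p (A \<times> space (Y >< N))"
        by (intro R sp) auto
      then show "emeasure (R p) (space (R p)) \<noteq> \<infinity>"
        using finite_measure.emeasure_finite[OF fin] by (simp add: R_def)
    qed
    show "sets (R p) = sets (Y >< N)" "sets (R q) = sets (Y >< N)" by (simp_all add: R_def)
    show "emeasure (R p) (B \<times> C) = emeasure (R q) (B \<times> C)" if "B \<in> sets Y" "C \<in> sets N" for B C
      using eq[OF A that] R[OF sp] R[OF sq] that by simp
  qed
  then show "emeasure p (A \<times> D) = emeasure q (A \<times> D)" using R[OF sp D] R[OF sq D] by simp
qed

text \<open>Trapezoids converge to indicators of open intervals, which generate the Borel sets and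
  are stable under intersection; so the test values determine the law of \<open>t\<close> over each
  \<open>A \<times> B\<close>.\<close>

lemma Pol_eqI:
  assumes X: "prob_space X" and Y: "prob_space Y" and p: "p \<in> Pol X Y" and q: "q \<in> Pol X Y"
    and eq: "\<And>A B f. A \<in> sets X \<Longrightarrow> B \<in> sets Y \<Longrightarrow> ccont f \<Longrightarrow>
      sform A B f p = sform A B f q"
  shows "p = q"
proof -
  interpret p: prob_space p by (rule Pol_prob[OF X Y p])
  have interval: "sform A B (ind ({l<..<u} \<inter> {0<..})) p =
      sform A B (ind ({l<..<u} \<inter> {0<..})) q"
    if A: "A \<in> sets X" and B: "B \<in> sets Y" for A B l u
  proof -
    \<comment> \<open>The left end is moved to \<open>k \<ge> 0\<close>; then \<open>g n\<close>
      vanishes for \<open>t\<close> below \<open>k + 1 / n\<close>, so its support stays away from 0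
      even if \<open>l\<close> is negative.\<close>
    define k where "k = max l 0"
    define g where "g n t = max 0 (min 1 (min (real n * (t - k) - 1) (real n * (u - t))))" for n t
    have gc: "continuous_on S (g n)" for n S unfolding g_def by (intro continuous_intros)
    have g01: "0 \<le> g n t" "g n t \<le> 1" for n t by (auto simp: g_def)
    have cc: "ccont (g n)" for n
      unfolding ccont_def
    proof (intro conjI exI allI impI)
      \<comment> \<open>Dividing by \<open>n + 1\<close> admits \<open>n = 0\<close>; the right end
        is raised by \<open>max\<close> and by 1 so that the interval is nondegenerate also when
        \<open>u\<close> is small.\<close>
      show "0 < k + 1 / (real n + 1)" by (simp add: k_def add_nonneg_pos)
      show "k + 1 / (real n + 1) < max u (k + 1 / (real n + 1)) + 1" by auto
      fix t :: real assume t: "0 < t" "t \<notin> {k + 1 / (real n + 1)..max u (k + 1 / (real n + 1)) + 1}"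
      show "g n t = 0"
      proof (cases "t < k + 1 / (real n + 1)")
        case True
        then have "(t - k) * (real n + 1) < 1" by (simp add: field_simps)
        moreover have "real n * (t - k) \<le> 0 \<or> real n * (t - k) \<le> (t - k) * (real n + 1)"
        proof (cases "t \<ge> k")
          case True
          then show ?thesis by (simp add: algebra_simps)
        next
          case False
          then show ?thesis by (simp add: mult_nonneg_nonpos)
        qed
        ultimately show ?thesis by (auto simp: g_def)
      next
        case False
        then have "u \<le> t" using t by auto
        then have "real n * (u - t) \<le> 0" by (simp add: mult_nonneg_nonpos)
        then show ?thesis by (auto simp: g_def)
      qed
    qed (rule gc)
    have lim: "(\<lambda>n. g n t) \<longlonglongrightarrow> ind ({l<..<u} \<inter> {0<..}) t" if t: "t > 0" for t
    proof (cases "t \<in> {l<..<u}")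
      case True
      then have kt: "k < t" "t < u" using t by (auto simp: k_def)
      obtain N :: nat where N: "real N \<ge> max (2 / (t - k)) (1 / (u - t))" using real_arch_simple by blast
      have "\<forall>\<^sub>F n in sequentially. g n t = 1"
      proof (rule eventually_sequentiallyI)
        fix n assume "N \<le> n"
        then have "real n \<ge> 2 / (t - k)" "real n \<ge> 1 / (u - t)" using N by auto
        then have "real n * (t - k) \<ge> 2" "real n * (u - t) \<ge> 1" using kt by (auto simp: field_simps)
        then show "g n t = 1" by (auto simp: g_def)
      qed
      then show ?thesis using True t by (auto intro: tendsto_eventually)
    next
      case False
      then have "t \<le> k \<or> u \<le> t" using t by (auto simp: k_def)
      then have z: "g n t = 0" for n
      proof
        assume "t \<le> k"
        then have "real n * (t - k) \<le> 0" by (simp add: mult_nonneg_nonpos)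
        then show ?thesis by (auto simp: g_def)
      next
        assume "u \<le> t"
        then have "real n * (u - t) \<le> 0" by (simp add: mult_nonneg_nonpos)
        then show ?thesis by (auto simp: g_def)
      qed
      have i0: "ind ({l<..<u} \<inter> {0<..}) t = (0::real)" using False by (auto simp: indicator_def)
      show ?thesis unfolding z i0 by (rule tendsto_const)
    qed
    have conv: "(\<lambda>n. sform A B (g n) r) \<longlonglongrightarrow>
        sform A B (ind ({l<..<u} \<inter> {0<..})) r" if r: "r \<in> Pol X Y" for r
      unfolding pform_def
    proof (rule integral_dominated_convergence[where w = "\<lambda>_. 1"])
      interpret r: prob_space r by (rule Pol_prob[OF X Y r])
      note [measurable] = Pol_fst[OF X Y r] Pol_snd[OF X Y r] Pol_t[OF X Y r] A B
      have [measurable]: "g n \<in> borel_measurable borel" for n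
        by (intro borel_measurable_continuous_onI gc)
      show "(\<lambda>z. ind A (fst z) * ind B (yc z) * g n (tc z)) \<in> borel_measurable r" for n
        by measurable
      show "(\<lambda>z. ind A (fst z) * ind B (yc z) * ind ({l<..<u} \<inter> {0<..}) (tc z) :: real) \<in> borel_measurable r"
        by measurable
      show "integrable r (\<lambda>_. 1 :: real)" by simp
      show "AE z in r. (\<lambda>n. ind A (fst z) * ind B (yc z) * g n (tc z)) \<longlonglongrightarrow>
          ind A (fst z) * ind B (yc z) * ind ({l<..<u} \<inter> {0<..}) (tc z)"
        by (rule AE_I2) (auto simp: Pol_space[OF X Y r] intro!: tendsto_mult_left lim)
      show "AE z in r. norm (ind A (fst z) * ind B (yc z) * g n (tc z)) \<le> 1" for n
        by (rule AE_I2) (use g01[of n] in \<open>auto simp: indicator_def abs_le_iff intro: order_trans[of _ 0]\<close>)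
    qed
    have "(\<lambda>n. sform A B (g n) p) \<longlonglongrightarrow>
        sform A B (ind ({l<..<u} \<inter> {0<..})) q"
      using conv[OF q] eq[OF A B cc] by simp
    then show ?thesis using conv[OF p] LIMSEQ_unique by blast
  qed
  define R where "R A B r = distr (density r (\<lambda>z. ind A (fst z) * ind B (yc z))) borel (\<lambda>z. tc z)"
    for A B and r :: "('a \<times> 'b \<times> real) measure"
  have R: "emeasure (R A B r) C = emeasure r (A \<times> B \<times> (C \<inter> {0<..}))"
    if r: "r \<in> Pol X Y" and A: "A \<in> sets X" and B: "B \<in> sets Y" and C: "C \<in> sets borel" for A B C r
  proof -
    note [measurable] = Pol_fst[OF X Y r] Pol_snd[OF X Y r] measurable_RposD[OF Pol_t[OF X Y r]] A B C
    have s: "A \<times> B \<times> (C \<inter> {0<..}) \<in> sets r"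
      unfolding Pol_sets[OF X Y r] by (intro pair_measureI A B) (use C in \<open>auto simp: sets_restrict_space\<close>)
    have "emeasure (R A B r) C = (\<integral>\<^sup>+z. ind A (fst z) * ind B (yc z) *
        ind ((\<lambda>z. tc z) -` C \<inter> space r) z \<partial>r)"
      unfolding R_def by (subst emeasure_distr) (simp_all add: emeasure_density)
    also have "\<dots> = (\<integral>\<^sup>+z. ind (A \<times> B \<times> (C \<inter> {0<..})) z \<partial>r)"
      by (intro nn_integral_cong) (auto simp: indicator_def Pol_space[OF X Y r])
    finally show ?thesis using s by simp
  qed
  have borel_gen: "sets (borel :: real measure) = sigma_sets UNIV (range (\<lambda>(a, b). {a<..<b}))"
    by (subst borel_eq_box) (simp add: case_prod_beta' box_real)
  have Req: "R A B p = R A B q" if A: "A \<in> sets X" and B: "B \<in> sets Y" for A B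
  proof (rule measure_eqI_generator_eq[where \<Omega> = UNIV and E = "range (\<lambda>(a, b). {a<..<b::real})"
        and A = "\<lambda>n::nat. {- real n<..<real n}"])
    show "Int_stable (range (\<lambda>(a, b). {a<..<b::real}))"
    proof (rule Int_stableI)
      fix a b assume "a \<in> range (\<lambda>(a, b). {a<..<b::real})" "b \<in> range (\<lambda>(a, b). {a<..<b::real})"
      then obtain l u l' u' where "a = {l<..<u}" "b = {l'<..<u'}" by auto
      then have "a \<inter> b = (\<lambda>(a, b). {a<..<b}) (max l l', min u u')" by auto
      then show "a \<inter> b \<in> range (\<lambda>(a, b). {a<..<b::real})" by blast
    qed
    show "sets (R A B p) = sigma_sets UNIV (range (\<lambda>(a, b). {a<..<b::real}))"
      "sets (R A B q) = sigma_sets UNIV (range (\<lambda>(a, b). {a<..<b::real}))"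
      using borel_gen by (simp_all add: R_def)
    have "x \<in> (\<Union>n. {- real n<..<real n})" for x :: real
    proof -
      obtain n :: nat where "\<bar>x\<bar> < real n" using reals_Archimedean2 by blast
      then show ?thesis by (auto simp: abs_less_iff intro!: exI[of _ n])
    qed
    then show "(\<Union>n. {- real n<..<real n}) = UNIV" by blast
    show "emeasure (R A B p) {- real n<..<real n} \<noteq> \<infinity>" for n
      using R[OF p A B, of "{- real n<..<real n}"] p.emeasure_finite by simp
    fix I assume "I \<in> range (\<lambda>(a, b). {a<..<b::real})"
    then obtain l u where I: "I = {l<..<u}" by auto
    have "emeasure (R A B r) I = ennreal (sform A B (ind ({l<..<u} \<inter> {0<..})) r)"
      if r: "r \<in> Pol X Y" for r
    proof -
      interpret r: prob_space r by (rule Pol_prob[OF X Y r])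
      have s: "A \<times> B \<times> ({l<..<u} \<inter> {0<..}) \<in> sets r"
        unfolding Pol_sets[OF X Y r] by (intro pair_measureI A B) (auto simp: sets_restrict_space)
      have "sform A B (ind ({l<..<u} \<inter> {0<..})) r = (LINT z|r. ind (A \<times> B \<times> ({l<..<u} \<inter> {0<..})) z)"
        unfolding pform_def by (intro Bochner_Integration.integral_cong refl) (auto simp: indicator_def)
      also have "\<dots> = measure r (A \<times> B \<times> ({l<..<u} \<inter> {0<..}))"
        using s by simp
      finally show ?thesis using R[OF r A B, of I] I by (simp add: r.emeasure_eq_measure)
    qed
    then show "emeasure (R A B p) I = emeasure (R A B q) I"
      using interval[OF A B] p q by simp
  qed auto
  show ?thesis
  proof (rule finite_measure_triple_eqI[OF _ Pol_sets[OF X Y p] Pol_sets[OF X Y q]])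
    show "finite_measure p" by unfold_locales
    fix A B C assume A: "A \<in> sets X" and B: "B \<in> sets Y" and C: "C \<in> sets Rpos"
    have "C \<in> sets borel" "C \<inter> {0<..} = C" using C by (auto simp: sets_restrict_space_iff)
    then show "emeasure p (A \<times> B \<times> C) = emeasure q (A \<times> B \<times> C)"
      using R[OF p A B, of C] R[OF q A B, of C] Req[OF A B] by simp
  qed
qed

text \<open>A basic open set restricts finitely many slices, and the slice over
  \<open>A \<times> B\<close> is determined by the numbers
  \<open>emeasure p (A \<times> B \<times> C)\<close>. Hence exact agreement on finitely many
  rectangles forces membership in \<open>U\<close>, and approximation can be replaced by
  equality.\<close>

lemma pol_topology_nbhd:
  assumes X: "prob_space X" and Y: "prob_space Y" and U: "openin (pol_topology X Y) U" and u: "u \<in> U"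
  shows "\<exists>\<A> \<B>. finite \<A> \<and> finite \<B> \<and> \<A> \<subseteq> sets X \<and> \<B> \<subseteq> sets Y \<and>
    (\<forall>p\<in>Pol X Y. (\<forall>A\<in>\<A>. \<forall>B\<in>\<B>. \<forall>C\<in>sets Rpos. emeasure p (A \<times> B \<times> C) = emeasure u (A \<times> B \<times> C)) \<longrightarrow> p \<in> U)"
    (is "?P U")
proof -
  have uP: "u \<in> Pol X Y"
    using openin_subset[OF U] u topspace_pol_topology[OF X Y] by auto
  have slice_eq: "slice A B p = slice A B u"
    if p: "p \<in> Pol X Y" and A: "A \<in> sets X" and B: "B \<in> sets Y"
      and eq: "\<forall>C\<in>sets Rpos. emeasure p (A \<times> B \<times> C) = emeasure u (A \<times> B \<times> C)" for p A B
  proof (rule measure_eqI)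
    fix C assume "C \<in> sets (slice A B p)"
    then have C: "C \<in> sets Rpos" by (simp add: slice_def)
    have C': "C \<subseteq> {0<..}" using C by (auto simp: sets_restrict_space)
    have *: "emeasure (slice A B r) C = emeasure r (A \<times> B \<times> C)" if r: "r \<in> Pol X Y" for r
    proof -
      have s: "A \<times> B \<times> {0<..} \<in> sets r"
        unfolding Pol_sets[OF X Y r] by (intro pair_measureI A B) (auto simp: sets_restrict_space)
      have m: "(\<lambda>(x, y, t). t) \<in> measurable (restrict_space r (A \<times> B \<times> {0<..})) Rpos"
        unfolding case_prod_beta' by (intro measurable_restrict_space1 Pol_t[OF X Y r])
      have sp: "space r \<inter> A \<times> B \<times> {0<..} = A \<times> B \<times> {0<..}"
        using sets.sets_into_space[OF s] by blast
      have "emeasure (slice A B r) C = emeasure (restrict_space r (A \<times> B \<times> {0<..})) ((\<lambda>(x, y, t). t) -` C \<inter> space (restrict_space r (A \<times> B \<times> {0<..})))"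
        unfolding slice_def by (rule emeasure_distr[OF m C])
      also have "(\<lambda>(x, y, t). t) -` C \<inter> space (restrict_space r (A \<times> B \<times> {0<..})) = A \<times> B \<times> C"
        using C' sp by (auto simp: space_restrict_space)
      also have "emeasure (restrict_space r (A \<times> B \<times> {0<..})) (A \<times> B \<times> C) = emeasure r (A \<times> B \<times> C)"
        using s C' by (intro emeasure_restrict_space) (auto simp: sets.Int)
      finally show ?thesis .
    qed
    show "emeasure (slice A B p) C = emeasure (slice A B u) C"
      using *[OF p] *[OF uP] eq C by simp
  qed (simp add: slice_def)
  have gen: "generate_topology_on
     (subbasis X Y (\<lambda>p. p) \<union>
      subbasis X Y tmul) U"
    using U unfolding pol_topology_def openin_topology_generated_by_iff .
  \<comment> \<open>Agreement with \<open>u\<close> on all rectangles from two finite families.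
    Enlarging the families strengthens agreement, so intersections of open sets are handled by
    unions of families.\<close>
  define ag where "ag \<A> \<B> p \<longleftrightarrow> (\<forall>A\<in>\<A>. \<forall>B\<in>\<B>. \<forall>C\<in>sets Rpos. emeasure p (A \<times> B \<times> C) = emeasure u (A \<times> B \<times> C))"
    for \<A> \<B> and p :: "('a \<times> 'b \<times> real) measure"
  have ag_Un: "ag \<A> \<B> p \<and> ag \<A>' \<B>' p" if "ag (\<A> \<union> \<A>') (\<B> \<union> \<B>') p" for \<A> \<A>' \<B> \<B>' p
    using that unfolding ag_def by blast
  from gen u have "\<exists>\<A> \<B>. finite \<A> \<and> finite \<B> \<and> \<A> \<subseteq> sets X \<and> \<B> \<subseteq> sets Y \<and>
    (\<forall>p\<in>Pol X Y. ag \<A> \<B> p \<longrightarrow> p \<in> U)"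
  proof induction
    case Empty
    then show ?case by simp
  next
    case (Int a b)
    have "u \<in> a" "u \<in> b" using Int.prems by auto
    obtain \<A> \<B> where 1: "finite \<A>" "finite \<B>" "\<A> \<subseteq> sets X" "\<B> \<subseteq> sets Y"
      "\<forall>p\<in>Pol X Y. ag \<A> \<B> p \<longrightarrow> p \<in> a"
      using Int.IH(1)[OF \<open>u \<in> a\<close>] by blast
    obtain \<A>' \<B>' where 2: "finite \<A>'" "finite \<B>'" "\<A>' \<subseteq> sets X" "\<B>' \<subseteq> sets Y"
      "\<forall>p\<in>Pol X Y. ag \<A>' \<B>' p \<longrightarrow> p \<in> b"
      using Int.IH(2)[OF \<open>u \<in> b\<close>] by blast
    have "\<forall>p\<in>Pol X Y. ag (\<A> \<union> \<A>') (\<B> \<union> \<B>') p \<longrightarrow> p \<in> a \<inter> b"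
      using 1(5) 2(5) ag_Un by blast
    then show ?case using 1(1-4) 2(1-4) by (intro exI[of _ "\<A> \<union> \<A>'"] exI[of _ "\<B> \<union> \<B>'"]) simp
  next
    case (UN K)
    then obtain k where k: "k \<in> K" "u \<in> k" by blast
    from UN.IH[OF k] show ?case using k(1) by blast
  next
    case (Basis s)
    from Basis(1) show ?case
    proof
      assume "s \<in> subbasis X Y (\<lambda>p. p)"
      then obtain A B f V where 1: "s = {p \<in> Pol X Y. (LINT t|slice A B p. f t) \<in> V}"
        "A \<in> sets X" "B \<in> sets Y" "bounded_continuous f" "open V" by blast
      have "p \<in> s" if "p\<in>Pol X Y" "\<forall>C\<in>sets Rpos. emeasure p (A \<times> B \<times> C) = emeasure u (A \<times> B \<times> C)" for p
        using slice_eq[OF that(1) 1(2,3) that(2)] Basis(2) 1 that by simp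
      then show ?thesis using 1
        by (intro exI[of _ "{A}"] exI[of _ "{B}"]) (auto simp: ag_def)
    next
      assume "s \<in> subbasis X Y tmul"
      then obtain A B f V where 2: "s = {p \<in> Pol X Y. (LINT t|slice A B (tmul p). f t) \<in> V}"
        "A \<in> sets X" "B \<in> sets Y" "bounded_continuous f" "open V" by blast
      have fm: "f \<in> borel_measurable Rpos" using bounded_continuous_bfun[OF 2(4)] by (simp add: bfun_def)
      \<comment> \<open>The weighted slice is read as the plain slice with test function
        \<open>t * f t\<close>, so the same rectangles control it.\<close>
      then have tfm: "(\<lambda>t. t * f t) \<in> borel_measurable Rpos" by measurable
      have "p \<in> s" if "p\<in>Pol X Y" "\<forall>C\<in>sets Rpos. emeasure p (A \<times> B \<times> C) = emeasure u (A \<times> B \<times> C)" for p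
      proof -
        have "(LINT t|slice A B (tmul p). f t) = (LINT t|slice A B p. t * f t)"
          using slice_pform[OF X Y that(1) 2(2,3) fm] slice_pform[OF X Y that(1) 2(2,3) tfm] by simp
        also have "\<dots> = (LINT t|slice A B u. t * f t)"
          using slice_eq[OF that(1) 2(2,3) that(2)] by simp
        also have "\<dots> = (LINT t|slice A B (tmul u). f t)"
          using slice_pform[OF X Y uP 2(2,3) fm] slice_pform[OF X Y uP 2(2,3) tfm] by simp
        finally show ?thesis using Basis(2) 2 that by simp
      qed
      then show ?thesis using 2
        by (intro exI[of _ "{A}"] exI[of _ "{B}"]) (auto simp: ag_def)
    qed
  qed
  then show ?thesis unfolding ag_def .
qed

section \<open>Density of continuous polymorphisms\<close>

lemma Pol_AE1:
  assumes X: "prob_space X" and Y: "prob_space Y" and p: "p \<in> Pol X Y" and P: "AE x in X. P x"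
  shows "AE z in p. P (fst z)"
proof -
  obtain N where N: "{x \<in> space X. \<not> P x} \<subseteq> N" "emeasure X N = 0" "N \<in> sets X" using P by (rule AE_E)
  have "AE x in X. x \<notin> N" using N by (intro AE_not_in null_setsI)
  then have "AE x in distr p X fst. x \<notin> N" unfolding Pol_distr1[OF X Y p] .
  then have "AE z in p. fst z \<notin> N"
    using N by (subst (asm) AE_distr_iff[OF Pol_fst[OF X Y p]]) auto
  moreover have "AE z in p. fst z \<in> space X" by (rule AE_I2) (auto simp: Pol_space[OF X Y p])
  ultimately show ?thesis by eventually_elim (use N in blast)
qed

text \<open>A null set of \<open>Y\<close> is null for \<open>t * p\<close>, and since
  \<open>t > 0\<close> also for \<open>p\<close> itself.\<close>

lemma Pol_AE2:
  assumes X: "prob_space X" and Y: "prob_space Y" and p: "p \<in> Pol X Y" and P: "AE y in Y. P y"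
  shows "AE z in p. P (yc z)"
proof -
  note [measurable] = Pol_snd[OF X Y p] Pol_t[OF X Y p]
  obtain N where N: "{x \<in> space Y. \<not> P x} \<subseteq> N" "emeasure Y N = 0" "N \<in> sets Y" using P by (rule AE_E)
  have "AE x in Y. x \<notin> N" using N by (intro AE_not_in null_setsI)
  then have "AE x in distr (tmul p) Y (\<lambda>z. yc z). x \<notin> N" unfolding Pol_distr2[OF X Y p] .
  moreover have "(\<lambda>z. yc z) \<in> measurable (tmul p) Y"
    by (simp add: Pol_tmul[OF X Y p])
  ultimately have "AE z in tmul p. yc z \<notin> N"
    using N by (subst (asm) AE_distr_iff) auto
  then have "AE z in p. 0 < ennreal (tc z) \<longrightarrow> yc z \<notin> N"
    unfolding Pol_tmul[OF X Y p] by (subst (asm) AE_density) auto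
  moreover have "AE z in p. yc z \<in> space Y \<and> 0 < ennreal (tc z)"
    by (rule AE_I2) (auto simp: Pol_space[OF X Y p])
  ultimately show ?thesis by eventually_elim (use N in blast)
qed

lemma PolI:
  assumes s: "sets p = sets (triple X Y)"
    and 1: "\<And>A. A \<in> sets X \<Longrightarrow> (\<integral>\<^sup>+z. ind A (fst z) \<partial>p) = emeasure X A"
    and 2: "\<And>B. B \<in> sets Y \<Longrightarrow> (\<integral>\<^sup>+z. ennreal (tc z) * ind B (yc z) \<partial>p) = emeasure Y B"
  shows "p \<in> Pol X Y"
proof -
  note [measurable_cong] = s
  have sp: "space p = space X \<times> space Y \<times> {0<..}"
    using sets_eq_imp_space_eq[OF s] by (simp add: space_pair_measure)
  have m1: "fst \<in> measurable p X" by (subst measurable_cong_sets[OF s refl]) measurable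
  have m2: "(\<lambda>z. yc z) \<in> measurable p Y" by (subst measurable_cong_sets[OF s refl]) measurable
  have [measurable]: "(\<lambda>z. tc z) \<in> measurable p Rpos" by (subst measurable_cong_sets[OF s refl]) measurable
  have "distr p X fst = X"
  proof (rule measure_eqI)
    fix A assume "A \<in> sets (distr p X fst)"
    then have A: "A \<in> sets X" by simp
    have "emeasure (distr p X fst) A = (\<integral>\<^sup>+x. ind A x \<partial>distr p X fst)" (is "?L2 = _") using A by simp
    also have "\<dots> = (\<integral>\<^sup>+z. ind A (fst z) \<partial>p)" using A m1 by (intro nn_integral_distr) auto
    finally show "?L2 = emeasure X A" using 1[OF A] by simp
  qed simp
  moreover have "distr (tmul p) Y (\<lambda>z. yc z) = Y"
  proof (rule measure_eqI)
    fix A assume "A \<in> sets (distr (tmul p) Y (\<lambda>z. yc z))"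
    then have A: "A \<in> sets Y" by simp
    have t: "tmul p = density p (\<lambda>z. ennreal (tc z))" by (simp add: tmul_def case_prod_beta')
    have "emeasure (distr (tmul p) Y (\<lambda>z. yc z)) A = (\<integral>\<^sup>+x. ind A x \<partial>distr (tmul p) Y (\<lambda>z. yc z))" (is "?L3 = _") using A by simp
    also have "\<dots> = (\<integral>\<^sup>+z. ind A (yc z) \<partial>tmul p)" using A m2 by (intro nn_integral_distr) (auto simp: t)
    also have "\<dots> = (\<integral>\<^sup>+z. ennreal (tc z) * ind A (yc z) \<partial>p)"
      unfolding t using A m2 by (intro nn_integral_density) auto
    finally show "?L3 = emeasure Y A" using 2[OF A] by simp
  qed simp
  ultimately show ?thesis using s by (simp add: Pol_def case_prod_beta')
qed

text \<open>The density of a symmetric Markov kernel that preserves \<open>X\<close>. The bound is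
  asked for every \<open>x\<close>, not only almost everywhere, because \<open>given_by\<close>
  wants values in \<open>Mtri\<close> at every point.\<close>

definition markov_density :: "'x measure \<Rightarrow> ('x \<Rightarrow> 'x \<Rightarrow> ennreal) \<Rightarrow> bool" where
  "markov_density X J \<longleftrightarrow> (\<lambda>z. J (fst z) (snd z)) \<in> borel_measurable (X >< X) \<and>
     (\<forall>x x'. J x x' = J x' x) \<and> (AE x in X. (\<integral>\<^sup>+x'. J x x' \<partial>X) = 1) \<and>
     (\<forall>x. \<exists>c<\<infinity>. \<forall>x'. J x x' \<le> c)"

text \<open>Averaging over the atoms of the finite algebra generated by \<open>\<A>\<close>
  reproduces the indicators of its members.\<close>

lemma partition_kernel:
  assumes X: "prob_space X" and fin: "finite \<A>" and \<A>: "\<A> \<subseteq> sets X"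
  shows "\<exists>J. markov_density X J \<and> (\<forall>A\<in>\<A>. AE x in X. (\<integral>\<^sup>+x'. J x x' * ind A x' \<partial>X) = ind A x)"
proof -
  interpret prob_space X by fact
  \<comment> \<open>The atom of points that lie in exactly those members of \<open>\<A>\<close> that
    belong to \<open>T\<close>.\<close>
  define C where "C T = {x\<in>space X. \<forall>A\<in>\<A>. (x \<in> A) = (A \<in> T)}" for T
  have C [measurable]: "C T \<in> sets X" for T
  proof -
    have "Measurable.pred X (\<lambda>x. \<forall>A\<in>\<A>. (x \<in> A) = (A \<in> T))"
      using \<A> by (intro pred_intros_finite fin pred_intros_logic) auto
    then show ?thesis unfolding C_def by measurable
  qed
  \<comment> \<open>For a null atom the real quotient \<open>1 / 0\<close> is 0, so \<open>J\<close>
    vanishes there; almost no point lies in such an atom.\<close>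
  define w where "w T = ennreal (1 / measure X (C T))" for T
  define J where "J x x' = (\<Sum>T\<in>Pow \<A>. ind (C T) x * ind (C T) x' * w T)" for x x'
  have J_eq: "J x x' = ind (C {A\<in>\<A>. x \<in> A}) x' * w {A\<in>\<A>. x \<in> A}" if x: "x \<in> space X" for x x'
  proof -
    have "ind (C T) x = (if T = {A\<in>\<A>. x \<in> A} then 1 else 0 :: ennreal)" if "T \<in> Pow \<A>" for T
      using that x by (auto simp: C_def indicator_def)
    then have "J x x' = (\<Sum>T\<in>Pow \<A>. if T = {A\<in>\<A>. x \<in> A} then ind (C T) x' * w T else 0)"
      unfolding J_def by (intro sum.cong) auto
    also have "\<dots> = ind (C {A\<in>\<A>. x \<in> A}) x' * w {A\<in>\<A>. x \<in> A}"
      using fin by (subst sum.delta) auto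
    finally show ?thesis .
  qed
  have "AE x in X. \<forall>T\<in>Pow \<A>. measure X (C T) = 0 \<longrightarrow> x \<notin> C T"
  proof (subst AE_ball_countable)
    show "countable (Pow \<A>)" using fin by (simp add: countable_finite)
    show "\<forall>T\<in>Pow \<A>. AE x in X. measure X (C T) = 0 \<longrightarrow> x \<notin> C T"
    proof
      fix T
      show "AE x in X. measure X (C T) = 0 \<longrightarrow> x \<notin> C T"
      proof (cases "measure X (C T) = 0")
        case True
        then have "C T \<in> null_sets X" by (intro null_setsI) (auto simp: emeasure_eq_measure)
        then show ?thesis using AE_not_in by auto
      qed simp
    qed
  qed
  then have pos: "AE x in X. measure X (C {A\<in>\<A>. x \<in> A}) > 0"
  proof (rule AE_mp[OF _ AE_I2], intro impI)
    fix x assume x: "x \<in> space X" and *: "\<forall>T\<in>Pow \<A>. measure X (C T) = 0 \<longrightarrow> x \<notin> C T"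
    have "x \<in> C {A\<in>\<A>. x \<in> A}" using x by (auto simp: C_def)
    then have "measure X (C {A\<in>\<A>. x \<in> A}) \<noteq> 0" using * by blast
    then show "measure X (C {A\<in>\<A>. x \<in> A}) > 0" by (simp add: zero_less_measure_iff)
  qed
  have one: "emeasure X (C T) * w T = 1" if "measure X (C T) > 0" for T
    using that by (simp add: w_def emeasure_eq_measure ennreal_mult[symmetric])
  have "markov_density X J"
    unfolding markov_density_def
  proof (intro conjI allI)
    show "(\<lambda>z. J (fst z) (snd z)) \<in> borel_measurable (X >< X)" unfolding J_def by measurable
    show "J x x' = J x' x" for x x' unfolding J_def by (simp add: mult_ac)
    show "AE x in X. (\<integral>\<^sup>+x'. J x x' \<partial>X) = 1"
      using pos by (rule AE_mp, intro AE_I2 impI) (simp add: J_eq nn_integral_multc one)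
    show "\<exists>c<\<infinity>. \<forall>x'. J x x' \<le> c" for x
    proof (intro exI conjI allI)
      show "(\<Sum>T\<in>Pow \<A>. w T) < \<infinity>" using fin by (simp add: w_def)
      show "J x x' \<le> (\<Sum>T\<in>Pow \<A>. w T)" for x'
        unfolding J_def by (intro sum_mono) (auto simp: indicator_def)
    qed
  qed
  moreover have "AE x in X. (\<integral>\<^sup>+x'. J x x' * ind A x' \<partial>X) = ind A x" if A: "A \<in> \<A>" for A
    using pos
  proof (rule AE_mp, intro AE_I2 impI)
    fix x assume x: "x \<in> space X" and p: "measure X (C {A\<in>\<A>. x \<in> A}) > 0"
    have Am [measurable]: "A \<in> sets X" using A \<A> by auto
    have "(\<integral>\<^sup>+x'. J x x' * ind A x' \<partial>X) = (\<integral>\<^sup>+x'. ind A x * (ind (C {A\<in>\<A>. x \<in> A}) x' * w {A\<in>\<A>. x \<in> A}) \<partial>X)" (is "?L4 = _")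
      by (intro nn_integral_cong) (use A x in \<open>auto simp: J_eq C_def indicator_def\<close>)
    also have "\<dots> = ind A x" using one[OF p] by (simp add: nn_integral_cmult nn_integral_multc)
    finally show "?L4 = ind A x" .
  qed
  ultimately show ?thesis by blast
qed

text \<open>Run \<open>J\<close> on the first coordinate and \<open>J'\<close> on the second,
  leaving \<open>t\<close> alone. The result has a density relative to \<open>X >< Y\<close>, hence
  is continuous, and the symmetry of the kernels preserves both marginals.\<close>

lemma smoothing:
  assumes X: "prob_space X" and Y: "prob_space Y" and u: "u \<in> Pol X Y"
    and J: "markov_density X J" and J': "markov_density Y J'"
  shows "\<exists>v s. given_by X Y v s \<and> (\<forall>A\<in>sets X. \<forall>B\<in>sets Y. \<forall>C\<in>sets Rpos. emeasure v (A \<times> B \<times> C) =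
    (\<integral>\<^sup>+z. ind C (tc z) * ((\<integral>\<^sup>+x'. J (fst z) x' * ind A x' \<partial>X) *
      (\<integral>\<^sup>+y'. J' (yc z) y' * ind B y' \<partial>Y)) \<partial>u))"
proof -
  interpret X: prob_space X by fact
  interpret Y: prob_space Y by fact
  interpret u: prob_space u by (rule Pol_prob[OF X Y u])
  interpret XY: pair_prob_space X Y ..
  interpret uXY: pair_sigma_finite u "X >< Y" ..
  interpret XX: pair_sigma_finite X X ..
  interpret YY: pair_sigma_finite Y Y ..
  note [measurable] = Pol_fst[OF X Y u] Pol_snd[OF X Y u] Pol_t[OF X Y u]
  note su = Pol_sets[OF X Y u]
  have Jm: "(\<lambda>z. J (fst z) (snd z)) \<in> borel_measurable (X >< X)"
    and Js: "\<And>x x'. J x x' = J x' x" and J1: "AE x in X. (\<integral>\<^sup>+x'. J x x' \<partial>X) = 1"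
    and Jb: "\<And>x. \<exists>c<\<infinity>. \<forall>x'. J x x' \<le> c"
    using J by (auto simp: markov_density_def)
  have J'm: "(\<lambda>z. J' (fst z) (snd z)) \<in> borel_measurable (Y >< Y)"
    and J's: "\<And>x x'. J' x x' = J' x' x" and J'1: "AE x in Y. (\<integral>\<^sup>+x'. J' x x' \<partial>Y) = 1"
    and J'b: "\<And>x. \<exists>c<\<infinity>. \<forall>x'. J' x x' \<le> c"
    using J' by (auto simp: markov_density_def)
  have Jm2: "(\<lambda>z. J (snd z) (fst z)) \<in> borel_measurable (X >< X)" using Jm by (subst Js)
  have J'm2: "(\<lambda>z. J' (snd z) (fst z)) \<in> borel_measurable (Y >< Y)" using J'm by (subst J's)
  define k where "k z w = J (fst z) (fst w) * J' (yc z) (snd w)" for z :: "'a \<times> 'b \<times> real" and w :: "'a \<times> 'b"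
  have km [measurable]: "(\<lambda>z. k (fst z) (snd z)) \<in> borel_measurable (u >< (X >< Y))"
  proof -
    have "(\<lambda>z. J (fst (fst z)) (yc z)) \<in> borel_measurable (u >< (X >< Y))"
      using measurable_compose[OF measurable_Pair Jm, of "\<lambda>z. fst (fst z)" "u >< (X >< Y)" "\<lambda>z. yc z"] by simp
    moreover have "(\<lambda>z. J' (yc (fst z)) (tc z)) \<in> borel_measurable (u >< (X >< Y))"
      using measurable_compose[OF measurable_Pair J'm, of "\<lambda>z. yc (fst z)" "u >< (X >< Y)" "\<lambda>z. tc z"] by simp
    ultimately show ?thesis unfolding k_def by measurable
  qed
  have km1: "(\<lambda>z. k z w) \<in> borel_measurable u" if "w \<in> space (X >< Y)" for w
    using measurable_compose[OF measurable_Pair2'[OF that, of u] km] by simp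
  have mm: "(\<lambda>z. (yc z, tc z, tc (fst z))) \<in> measurable (u >< (X >< Y)) (triple X Y)"
    by measurable
  \<comment> \<open>The law of the new pair of points together with the old \<open>t\<close>, where
    \<open>k\<close> is the joint transition density.\<close>
  define v where "v = distr (density (u >< (X >< Y)) (\<lambda>z. k (fst z) (snd z))) (triple X Y)
      (\<lambda>z. (yc z, tc z, tc (fst z)))"
  have sv: "sets v = sets (triple X Y)" by (simp add: v_def)
  have int: "(\<integral>\<^sup>+z. h z \<partial>v) = (\<integral>\<^sup>+z. k (fst z) (snd z) * h (yc z, tc z, tc (fst z)) \<partial>(u >< (X >< Y)))"
    if [measurable]: "h \<in> borel_measurable (triple X Y)" for h
  proof -
    have "(\<integral>\<^sup>+z. h z \<partial>v) = (\<integral>\<^sup>+z. h (yc z, tc z, tc (fst z)) \<partial>density (u >< (X >< Y)) (\<lambda>z. k (fst z) (snd z)))"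
      unfolding v_def by (rule nn_integral_distr) (simp_all add: mm that)
    also have "\<dots> = (\<integral>\<^sup>+z. k (fst z) (snd z) * h (yc z, tc z, tc (fst z)) \<partial>(u >< (X >< Y)))"
      by (rule nn_integral_density) measurable
    finally show ?thesis .
  qed
  have prodJ: "(\<integral>\<^sup>+w. k z w * (a (fst w) * b (snd w)) \<partial>(X >< Y)) =
      (\<integral>\<^sup>+x'. J (fst z) x' * a x' \<partial>X) * (\<integral>\<^sup>+y'. J' (yc z) y' * b y' \<partial>Y)"
    if z: "z \<in> space u" and [measurable]: "a \<in> borel_measurable X" "b \<in> borel_measurable Y" for z a b
  proof -
    have zz: "fst z \<in> space X" "yc z \<in> space Y" using z by (auto simp: Pol_space[OF X Y u])
    have [measurable]: "(\<lambda>x'. J (fst z) x') \<in> borel_measurable X" "(\<lambda>y'. J' (yc z) y') \<in> borel_measurable Y"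
      using measurable_compose[OF measurable_Pair1'[OF zz(1)] Jm] measurable_compose[OF measurable_Pair1'[OF zz(2)] J'm] by simp_all
    have "(\<integral>\<^sup>+w. k z w * (a (fst w) * b (snd w)) \<partial>(X >< Y)) =
        (\<integral>\<^sup>+w. (\<lambda>(x, y). (J (fst z) x * a x) * (J' (yc z) y * b y)) w \<partial>(X >< Y))"
      by (intro nn_integral_cong) (auto simp: k_def mult_ac)
    also have "\<dots> = (\<integral>\<^sup>+x. (\<integral>\<^sup>+y. (J (fst z) x * a x) * (J' (yc z) y * b y) \<partial>Y) \<partial>X)"
      by (subst Y.nn_integral_fst[symmetric]) auto
    also have "\<dots> = (\<integral>\<^sup>+x'. J (fst z) x' * a x' \<partial>X) * (\<integral>\<^sup>+y'. J' (yc z) y' * b y' \<partial>Y)"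
      by (simp add: nn_integral_cmult nn_integral_multc)
    finally show ?thesis .
  qed
  have int2: "(\<integral>\<^sup>+z. f (tc z) * (a (fst z) * b (yc z)) \<partial>v) =
      (\<integral>\<^sup>+z. f (tc z) * ((\<integral>\<^sup>+x'. J (fst z) x' * a x' \<partial>X) * (\<integral>\<^sup>+y'. J' (yc z) y' * b y' \<partial>Y)) \<partial>u)"
    if [measurable]: "a \<in> borel_measurable X" "b \<in> borel_measurable Y" "f \<in> borel_measurable Rpos" for a b f
  proof -
    have "(\<integral>\<^sup>+z. f (tc z) * (a (fst z) * b (yc z)) \<partial>v) =
      (\<integral>\<^sup>+z. k (fst z) (snd z) * (f (tc (fst z)) * (a (yc z) * b (tc z))) \<partial>(u >< (X >< Y)))"
      by (subst int) auto
    also have "\<dots> = (\<integral>\<^sup>+z. (\<integral>\<^sup>+w. k z w * (f (tc z) * (a (fst w) * b (snd w))) \<partial>(X >< Y)) \<partial>u)"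
      by (subst XY.P.nn_integral_fst[symmetric]) auto
    also have "\<dots> = (\<integral>\<^sup>+z. f (tc z) * (\<integral>\<^sup>+w. k z w * (a (fst w) * b (snd w)) \<partial>(X >< Y)) \<partial>u)"
    proof (intro nn_integral_cong)
      fix z assume z: "z \<in> space u"
      have [measurable]: "k z \<in> borel_measurable (X >< Y)"
        using measurable_compose[OF measurable_Pair1'[OF z] km] by simp
      show "(\<integral>\<^sup>+w. k z w * (f (tc z) * (a (fst w) * b (snd w))) \<partial>(X >< Y)) =
          f (tc z) * (\<integral>\<^sup>+w. k z w * (a (fst w) * b (snd w)) \<partial>(X >< Y))"
        by (subst nn_integral_cmult[symmetric]) (auto simp: mult_ac)
    qed
    also have "\<dots> = (\<integral>\<^sup>+z. f (tc z) * ((\<integral>\<^sup>+x'. J (fst z) x' * a x' \<partial>X) * (\<integral>\<^sup>+y'. J' (yc z) y' * b y' \<partial>Y)) \<partial>u)"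
      by (intro nn_integral_cong) (simp add: prodJ)
    finally show ?thesis .
  qed
  \<comment> \<open>Symmetry turns integration over the starting point into integration of
    \<open>J x'\<close>, whose total is 1 for almost every \<open>x'\<close>.\<close>
  have sym: "(\<integral>\<^sup>+x. (\<integral>\<^sup>+x'. J x x' * ind A x' \<partial>X) \<partial>X) = emeasure X A" if [measurable]: "A \<in> sets X" for A
  proof -
    have "(\<integral>\<^sup>+x. (\<integral>\<^sup>+x'. J x x' * ind A x' \<partial>X) \<partial>X) = (\<integral>\<^sup>+x'. (\<integral>\<^sup>+x. J x x' * ind A x' \<partial>X) \<partial>X)"
      by (rule XX.Fubini') (use Jm2 in \<open>simp add: case_prod_beta'\<close>)
    also have "\<dots> = (\<integral>\<^sup>+x'. (\<integral>\<^sup>+x. J x' x \<partial>X) * ind A x' \<partial>X)"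
    proof (intro nn_integral_cong)
      fix x' assume x': "x' \<in> space X"
      have "J x' \<in> borel_measurable X" using measurable_compose[OF measurable_Pair1'[OF x'] Jm] by simp
      then show "(\<integral>\<^sup>+x. J x x' * ind A x' \<partial>X) = (\<integral>\<^sup>+x. J x' x \<partial>X) * ind A x'"
        by (subst nn_integral_multc[symmetric]) (auto simp: Js[of _ x'])
    qed
    also have "\<dots> = (\<integral>\<^sup>+x'. ind A x' \<partial>X)"
      by (intro nn_integral_cong_AE) (use J1 in eventually_elim, simp)
    finally show ?thesis by simp
  qed
  have sym': "(\<integral>\<^sup>+x. (\<integral>\<^sup>+x'. J' x x' * ind A x' \<partial>Y) \<partial>Y) = emeasure Y A" if [measurable]: "A \<in> sets Y" for A
  proof -
    have "(\<integral>\<^sup>+x. (\<integral>\<^sup>+x'. J' x x' * ind A x' \<partial>Y) \<partial>Y) = (\<integral>\<^sup>+x'. (\<integral>\<^sup>+x. J' x x' * ind A x' \<partial>Y) \<partial>Y)"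
      by (rule YY.Fubini') (use J'm2 in \<open>simp add: case_prod_beta'\<close>)
    also have "\<dots> = (\<integral>\<^sup>+x'. (\<integral>\<^sup>+x. J' x' x \<partial>Y) * ind A x' \<partial>Y)"
    proof (intro nn_integral_cong)
      fix x' assume x': "x' \<in> space Y"
      have "J' x' \<in> borel_measurable Y" using measurable_compose[OF measurable_Pair1'[OF x'] J'm] by simp
      then show "(\<integral>\<^sup>+x. J' x x' * ind A x' \<partial>Y) = (\<integral>\<^sup>+x. J' x' x \<partial>Y) * ind A x'"
        by (subst nn_integral_multc[symmetric]) (auto simp: J's[of _ x'])
    qed
    also have "\<dots> = (\<integral>\<^sup>+x'. ind A x' \<partial>Y)"
      by (intro nn_integral_cong_AE) (use J'1 in eventually_elim, simp)
    finally show ?thesis by simp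
  qed
  have v: "v \<in> Pol X Y"
  proof (rule PolI[OF sv])
    fix A assume A [measurable]: "A \<in> sets X"
    have mm: "(\<lambda>x. \<integral>\<^sup>+x'. J x x' * ind A x' \<partial>X) \<in> borel_measurable X"
      using Jm by (intro X.borel_measurable_nn_integral) (simp add: case_prod_beta')
    have "(\<integral>\<^sup>+z. ind A (fst z) \<partial>v) = (\<integral>\<^sup>+z. (\<integral>\<^sup>+x'. J (fst z) x' * ind A x' \<partial>X) * (\<integral>\<^sup>+y'. J' (yc z) y' \<partial>Y) \<partial>u)" (is "?L5 = _")
      using int2[of "ind A" "\<lambda>_. 1" "\<lambda>_. 1", OF borel_measurable_indicator[OF A] borel_measurable_const borel_measurable_const]
      by (simp only: mult_1_left mult_1_right)
    also have "\<dots> = (\<integral>\<^sup>+z. (\<integral>\<^sup>+x'. J (fst z) x' * ind A x' \<partial>X) \<partial>u)"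
      by (intro nn_integral_cong_AE) (use Pol_AE2[OF X Y u J'1] in eventually_elim, simp)
    also have "\<dots> = emeasure X A"
      using sym[OF A] Pol_nn1[OF X Y u mm] by simp
    finally show "?L5 = emeasure X A" .
  next
    fix B assume B [measurable]: "B \<in> sets Y"
    have mm: "(\<lambda>x. \<integral>\<^sup>+x'. J' x x' * ind B x' \<partial>Y) \<in> borel_measurable Y"
      using J'm by (intro Y.borel_measurable_nn_integral) (simp add: case_prod_beta')
    have "(\<integral>\<^sup>+z. ennreal (tc z) * ind B (yc z) \<partial>v) = (\<integral>\<^sup>+z. ennreal (tc z) * ((\<integral>\<^sup>+x'. J (fst z) x' \<partial>X) * (\<integral>\<^sup>+y'. J' (yc z) y' * ind B y' \<partial>Y)) \<partial>u)" (is "?L6 = _")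
      using int2[of "\<lambda>_. 1" "ind B" "\<lambda>t. ennreal t", OF borel_measurable_const borel_measurable_indicator[OF B]]
      by (simp only: mult_1_left mult_1_right measurable_ident measurable_compose[OF id_Rpos_borel measurable_ennreal] simp_thms)
    also have "\<dots> = (\<integral>\<^sup>+z. ennreal (tc z) * (\<integral>\<^sup>+x'. J' (yc z) x' * ind B x' \<partial>Y) \<partial>u)"
      by (intro nn_integral_cong_AE) (use Pol_AE1[OF X Y u J1] in eventually_elim, simp)
    also have "\<dots> = emeasure Y B"
      using sym'[OF B] Pol_nn2[OF X Y u mm] by simp
    finally show "?L6 = emeasure Y B" .
  qed
  \<comment> \<open>The disintegration of \<open>v\<close> over the end point: \<open>(x, y)\<close>
    is fixed and the start \<open>z\<close> is integrated out.\<close>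
  define s where "s x y = distr (density u (\<lambda>z. k z (x, y))) Rpos (\<lambda>z. tc z)" for x y
  have se: "(\<integral>\<^sup>+t. h t \<partial>s x y) = (\<integral>\<^sup>+z. k z (x, y) * h (tc z) \<partial>u)"
    if "x \<in> space X" "y \<in> space Y" and [measurable]: "h \<in> borel_measurable Rpos" for x y h
  proof -
    have [measurable]: "(\<lambda>z. k z (x, y)) \<in> borel_measurable u" using that by (intro km1) (simp add: space_pair_measure)
    have "(\<integral>\<^sup>+t. h t \<partial>s x y) = (\<integral>\<^sup>+z. h (tc z) \<partial>density u (\<lambda>z. k z (x, y)))"
      unfolding s_def by (rule nn_integral_distr) simp_all
    also have "\<dots> = (\<integral>\<^sup>+z. k z (x, y) * h (tc z) \<partial>u)" by (rule nn_integral_density) measurable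
    finally show ?thesis .
  qed
  have em: "emeasure (s x y) C = (\<integral>\<^sup>+z. k z (x, y) * ind C (tc z) \<partial>u)"
    if "x \<in> space X" "y \<in> space Y" and C: "C \<in> sets Rpos" for x y C
    using se[OF that(1,2), of "ind C"] C by (simp add: s_def)
  have "given_by X Y v s"
    unfolding given_by_def
  proof (intro conjI ballI)
    show "v \<in> Pol X Y" by fact
    fix x y assume x: "x \<in> space X" and y: "y \<in> space Y"
    obtain c where c: "c < \<infinity>" "\<And>x'. J x x' \<le> c" using Jb[of x] by blast
    obtain c' where c': "c' < \<infinity>" "\<And>y'. J' y y' \<le> c'" using J'b[of y] by blast
    \<comment> \<open>The bounds are available with \<open>x\<close> and \<open>y\<close> as first
      arguments; symmetry transfers them to \<open>k\<close>, where they are second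
      arguments.\<close>
    have kb: "k z (x, y) \<le> c * c'" for z
      unfolding k_def using c(2) c'(2) Js[of _ x] J's[of _ y] by (auto intro!: mult_mono)
    have cc: "c * c' < \<infinity>" using c c' by (simp add: ennreal_mult_less_top)
    have "emeasure (s x y) {0<..} = (\<integral>\<^sup>+t. 1 \<partial>s x y)" by (simp add: s_def)
    also have "\<dots> = (\<integral>\<^sup>+z. k z (x, y) \<partial>u)" using se[OF x y, of "\<lambda>_. 1"] by simp
    also have "\<dots> \<le> (\<integral>\<^sup>+z. c * c' \<partial>u)" by (intro nn_integral_mono kb)
    also have "\<dots> < \<infinity>" using cc by (simp add: u.emeasure_space_1)
    finally have 1: "emeasure (s x y) {0<..} < \<infinity>" .
    have "(\<integral>\<^sup>+t. ennreal t \<partial>s x y) = (\<integral>\<^sup>+z. k z (x, y) * ennreal (tc z) \<partial>u)" by (rule se[OF x y]) auto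
    also have "\<dots> \<le> (\<integral>\<^sup>+z. (c * c') * ennreal (tc z) \<partial>u)" by (intro nn_integral_mono mult_right_mono kb) auto
    also have "\<dots> = c * c' * (\<integral>\<^sup>+z. ennreal (tc z) \<partial>u)" by (rule nn_integral_cmult) auto
    also have "\<dots> < \<infinity>" using cc Pol_nn2[OF X Y u, of "\<lambda>_. 1"] by (simp add: Y.emeasure_space_1)
    finally show "s x y \<in> Mtri"
      using 1 by (auto simp: Mtri_def s_def intro!: finite_measureI)
  next
    fix C assume C [measurable]: "C \<in> sets Rpos"
    have "(\<lambda>w. \<integral>\<^sup>+z. k z w * ind C (tc z) \<partial>u) \<in> borel_measurable (X >< Y)"
    proof (rule u.borel_measurable_nn_integral)
      have "(\<lambda>z. k (snd z) (fst z)) \<in> borel_measurable ((X >< Y) >< u)"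
        using measurable_compose[OF measurable_pair_swap' km] by (simp add: case_prod_beta')
      then show "(\<lambda>(w, z). k z w * ind C (tc z)) \<in> borel_measurable ((X >< Y) >< u)"
        by (simp add: case_prod_beta')
    qed
    then show "(\<lambda>(x, y). emeasure (s x y) C) \<in> borel_measurable (X >< Y)"
      by (rule measurable_cong[THEN iffD1, rotated]) (auto simp: em[OF _ _ C] space_pair_measure)
  next
    fix A B C assume [measurable]: "A \<in> sets X" "B \<in> sets Y" and C [measurable]: "C \<in> sets Rpos"
    have "A \<times> B \<times> C \<in> sets v" unfolding sv by (intro pair_measureI) auto
    then have "emeasure v (A \<times> B \<times> C) = (\<integral>\<^sup>+z. ind (A \<times> B \<times> C) z \<partial>v)" (is "?L8 = _") by simp
    also have "\<dots> = (\<integral>\<^sup>+z. k (fst z) (snd z) * ind (A \<times> B \<times> C) (yc z, tc z, tc (fst z)) \<partial>(u >< (X >< Y)))"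
      by (rule int) measurable
    also have "\<dots> = (\<integral>\<^sup>+w. (\<integral>\<^sup>+z. k z w * ind (A \<times> B \<times> C) (fst w, snd w, tc z) \<partial>u) \<partial>(X >< Y))"
      by (subst uXY.nn_integral_snd[symmetric]) (auto simp: case_prod_beta')
    also have "\<dots> = (\<integral>\<^sup>+w\<in>A \<times> B. (case w of (x, y) \<Rightarrow> emeasure (s x y) C) \<partial>(X >< Y))"
    proof (intro nn_integral_cong)
      fix w assume w: "w \<in> space (X >< Y)"
      have [measurable]: "(\<lambda>z. k z w) \<in> borel_measurable u" by (rule km1[OF w])
      have "(\<integral>\<^sup>+z. k z w * ind (A \<times> B \<times> C) (fst w, snd w, tc z) \<partial>u) =
          (\<integral>\<^sup>+z. (k z w * ind C (tc z)) * ind (A \<times> B) w \<partial>u)" (is "?L7 = _")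
        by (intro nn_integral_cong) (cases w, auto simp: indicator_def)
      also have "\<dots> = (\<integral>\<^sup>+z. k z w * ind C (tc z) \<partial>u) * ind (A \<times> B) w"
        by (rule nn_integral_multc) measurable
      also have "\<dots> = (case w of (x, y) \<Rightarrow> emeasure (s x y) C) * ind (A \<times> B) w"
        using w em[OF _ _ C, of "fst w" "snd w"] by (auto simp: space_pair_measure case_prod_beta')
      finally show "?L7 =
          (case w of (x, y) \<Rightarrow> emeasure (s x y) C) * ind (A \<times> B) w" .
    qed
    finally show "?L8 = (\<integral>\<^sup>+w\<in>A \<times> B. (case w of (x, y) \<Rightarrow> emeasure (s x y) C) \<partial>(X >< Y))" .
  qed
  moreover have "emeasure v (A \<times> B \<times> C) =
    (\<integral>\<^sup>+z. ind C (tc z) * ((\<integral>\<^sup>+x'. J (fst z) x' * ind A x' \<partial>X) *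
      (\<integral>\<^sup>+y'. J' (yc z) y' * ind B y' \<partial>Y)) \<partial>u)"
    if [measurable]: "A \<in> sets X" "B \<in> sets Y" "C \<in> sets Rpos" for A B C
  proof -
    have "A \<times> B \<times> C \<in> sets v" unfolding sv by (intro pair_measureI) auto
    then have "emeasure v (A \<times> B \<times> C) = (\<integral>\<^sup>+z. ind (A \<times> B \<times> C) z \<partial>v)" by simp
    also have "\<dots> = (\<integral>\<^sup>+z. ind C (tc z) * (ind A (fst z) * ind B (yc z)) \<partial>v)"
      by (intro nn_integral_cong) (auto simp: indicator_def)
    also have "\<dots> = (\<integral>\<^sup>+z. ind C (tc z) * ((\<integral>\<^sup>+x'. J (fst z) x' * ind A x' \<partial>X) *
      (\<integral>\<^sup>+y'. J' (yc z) y' * ind B y' \<partial>Y)) \<partial>u)" by (rule int2) auto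
    finally show ?thesis .
  qed
  ultimately show ?thesis by blast
qed

text \<open>Smoothing over the partitions generated by the finitely many sets that describe a
  neighbourhood of \<open>u\<close> does not change the measures of their rectangles, so the
  continuous polymorphism obtained stays in \<open>U\<close>.\<close>

lemma continuous_dense:
  assumes X: "prob_space X" and Y: "prob_space Y" and U: "openin (pol_topology X Y) U" and u: "u \<in> U"
  shows "\<exists>v\<in>U. \<exists>s. given_by X Y v s"
proof -
  have uP: "u \<in> Pol X Y"
    using openin_subset[OF U] u topspace_pol_topology[OF X Y] by auto
  obtain \<A> \<B> where fin: "finite \<A>" "finite \<B>" "\<A> \<subseteq> sets X" "\<B> \<subseteq> sets Y"
    and H: "\<And>p. p\<in>Pol X Y \<Longrightarrow> (\<forall>A\<in>\<A>. \<forall>B\<in>\<B>. \<forall>C\<in>sets Rpos. emeasure p (A \<times> B \<times> C) = emeasure u (A \<times> B \<times> C)) \<Longrightarrow> p \<in> U"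
    using pol_topology_nbhd[OF assms] by metis
  obtain J where J: "markov_density X J" "\<And>A. A \<in> \<A> \<Longrightarrow> AE x in X. (\<integral>\<^sup>+x'. J x x' * ind A x' \<partial>X) = ind A x"
    using partition_kernel[OF X fin(1,3)] by blast
  obtain J' where J': "markov_density Y J'" "\<And>A. A \<in> \<B> \<Longrightarrow> AE x in Y. (\<integral>\<^sup>+x'. J' x x' * ind A x' \<partial>Y) = ind A x"
    using partition_kernel[OF Y fin(2,4)] by blast
  obtain v s where vs: "given_by X Y v s \<and> (\<forall>A\<in>sets X. \<forall>B\<in>sets Y. \<forall>C\<in>sets Rpos. emeasure v (A \<times> B \<times> C) =
    (\<integral>\<^sup>+z. ind C (tc z) * ((\<integral>\<^sup>+x'. J (fst z) x' * ind A x' \<partial>X) *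
      (\<integral>\<^sup>+y'. J' (yc z) y' * ind B y' \<partial>Y)) \<partial>u))"
    using smoothing[OF X Y uP J(1) J'(1)] by (elim exE)
  note v = vs[THEN conjunct1] and e = vs[THEN conjunct2, rule_format]
  have "v \<in> U"
  proof (rule H, use v in \<open>simp add: given_by_def\<close>, intro ballI)
    fix A B C assume A: "A \<in> \<A>" and B: "B \<in> \<B>" and C: "C \<in> sets Rpos"
    have A': "A \<in> sets X" and B': "B \<in> sets Y" using A B fin by auto
    have "emeasure v (A \<times> B \<times> C) = (\<integral>\<^sup>+z. ind C (tc z) * (ind A (fst z) * ind B (yc z)) \<partial>u)" (is "?L9 = _")
      unfolding e[OF A' B' C]
      by (intro nn_integral_cong_AE) (use Pol_AE1[OF X Y uP J(2)[OF A]] Pol_AE2[OF X Y uP J'(2)[OF B]] in eventually_elim, simp)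
    also have "\<dots> = (\<integral>\<^sup>+z. ind (A \<times> B \<times> C) z \<partial>u)"
      by (intro nn_integral_cong) (auto simp: indicator_def)
    also have "\<dots> = emeasure u (A \<times> B \<times> C)"
      using A' B' C by (intro nn_integral_indicator) (auto simp: Pol_sets[OF X Y uP])
    finally show "?L9 = emeasure u (A \<times> B \<times> C)" .
  qed
  then show ?thesis using v by blast
qed

section \<open>Randomization and the product\<close>

abbreviation unit_unif :: "real measure" where
  "unit_unif \<equiv> uniform_measure lborel {0<..<1}"

lemma prob_space_unit_unif: "prob_space unit_unif"
  by (rule prob_space_uniform_measure) auto

lemma emeasure_unit_unif_less:
  assumes "c \<le> 1" shows "emeasure unit_unif {a. ennreal a < c} = c"
proof -
  obtain r where r: "c = ennreal r" "0 \<le> r" using assms by (cases c) (auto simp: top_unique)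
  have "{0<..<1} \<inter> {a. ennreal a < c} = {0<..<r}"
    using assms r by (auto simp: ennreal_less_iff)
  then show ?thesis using r divide_ennreal[of r 1] by simp
qed

text \<open>The conditional probability of \<open>D\<close> given the first coordinate, as a
  Radon-Nikodym derivative; the hypothesis on the first marginal gives absolute continuity.\<close>

lemma marginal_density:
  assumes M: "prob_space M" and \<mu>: "prob_space \<mu>" and s: "sets \<mu> = sets (M >< borel)"
    and d: "distr \<mu> M fst = M" and D: "D \<in> sets borel"
  shows "\<exists>F\<in>borel_measurable M. \<forall>A\<in>sets M. (\<integral>\<^sup>+x\<in>A. F x \<partial>M) = emeasure \<mu> (A \<times> D)"
proof -
  interpret M: prob_space M by fact
  interpret \<mu>: prob_space \<mu> by fact
  have sp: "space \<mu> = space M \<times> UNIV" using sets_eq_imp_space_eq[OF s] by (simp add: space_pair_measure)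
  have m: "fst \<in> measurable \<mu> M" by (subst measurable_cong_sets[OF s refl]) measurable
  have MD: "space M \<times> D \<in> sets \<mu>" using s D by auto
  define \<nu> where "\<nu> = distr (density \<mu> (ind (space M \<times> D))) M fst"
  have e: "emeasure \<nu> A = emeasure \<mu> (A \<times> D)" if A: "A \<in> sets M" for A
  proof -
    have "emeasure \<nu> A = emeasure (density \<mu> (ind (space M \<times> D))) (fst -` A \<inter> space \<mu>)"
      unfolding \<nu>_def using A m by (subst emeasure_distr) auto
    also have "\<dots> = emeasure \<mu> ((space M \<times> D) \<inter> (fst -` A \<inter> space \<mu>))"
      using MD measurable_sets[OF m A] by (simp add: emeasure_density nn_integral_indicator' flip: indicator_inter_arith)
    also have "(space M \<times> D) \<inter> (fst -` A \<inter> space \<mu>) = A \<times> D"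
      using sets.sets_into_space[OF A] by (auto simp: sp)
    finally show ?thesis .
  qed
  have "absolutely_continuous M \<nu>"
    unfolding absolutely_continuous_def
  proof
    fix N assume N: "N \<in> null_sets M"
    then have Ns: "N \<in> sets M" by auto
    have "emeasure \<mu> (N \<times> D) \<le> emeasure \<mu> (fst -` N \<inter> space \<mu>)"
      using measurable_sets[OF m Ns] sets.sets_into_space[OF Ns] by (intro emeasure_mono) (auto simp: sp)
    also have "\<dots> = emeasure (distr \<mu> M fst) N" using m Ns by (simp add: emeasure_distr)
    also have "\<dots> = 0" using N d by auto
    finally show "N \<in> null_sets \<nu>" using Ns e by (intro null_setsI) (auto simp: \<nu>_def)
  qed
  then obtain F where F: "F \<in> borel_measurable M" "density M F = \<nu>"
    using M.Radon_Nikodym[of \<nu>] by (auto simp: \<nu>_def)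
  have "(\<integral>\<^sup>+x\<in>A. F x \<partial>M) = emeasure \<mu> (A \<times> D)" if A: "A \<in> sets M" for A
    using e[OF A] F A by (simp add: emeasure_density[symmetric])
  then show ?thesis using F by blast
qed

lemma AE_eq_of_nn_integral:
  assumes "sigma_finite_measure M" "f \<in> borel_measurable M" "g \<in> borel_measurable M"
    and "\<And>A. A \<in> sets M \<Longrightarrow> (\<integral>\<^sup>+x\<in>A. f x \<partial>M) = (\<integral>\<^sup>+x\<in>A. g x \<partial>M)"
  shows "AE x in M. f x = g x"
proof -
  interpret sigma_finite_measure M by fact
  have "density M f = density M g"
    by (rule measure_eqI) (use assms in \<open>auto simp: emeasure_density\<close>)
  then show ?thesis using assms by (simp add: density_unique_iff)
qed

text \<open>Running minima make the sequence decreasing, which monotone convergence of the tail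
  probabilities will require.\<close>

lemma rat_seq_decreasing:
  fixes r :: real
  shows "\<exists>Q :: nat \<Rightarrow> rat. (\<forall>n. r < of_rat (Q n) \<and> Q (Suc n) \<le> Q n) \<and>
    (\<forall>x>r. \<exists>n. of_rat (Q n) < x)"
proof -
  have "\<exists>q :: rat. r < of_rat q \<and> of_rat q < r + 1 / real (Suc n)" for n
    by (rule of_rat_dense) simp
  then obtain R :: "nat \<Rightarrow> rat" where R: "\<And>n. r < of_rat (R n)" "\<And>n. of_rat (R n) < r + 1 / real (Suc n)" by metis
  define Q where "Q n = Min (R ` {..n})" for n
  have "Q n \<in> R ` {..n}" for n unfolding Q_def by (rule Min_in) auto
  then have 1: "r < of_rat (Q n)" for n using R(1) by (metis imageE)
  have 2: "Q (Suc n) \<le> Q n" for n unfolding Q_def by (intro Min_antimono image_mono) auto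
  have "\<exists>n. of_rat (Q n) < x" if x: "x > r" for x
  proof -
    obtain n where n: "1 / real (Suc n) < x - r" using x nat_approx_posE[of "x - r"] by auto
    have "Q n \<le> R n" unfolding Q_def by (intro Min_le) auto
    then have "of_rat (Q n) \<le> (of_rat (R n) :: real)" by (simp add: of_rat_less_eq)
    also have "\<dots> < r + 1 / real (Suc n)" by (rule R)
    finally show ?thesis using n by (intro exI[of _ n]) linarith
  qed
  then show ?thesis using 1 2 by blast
qed

text \<open>The function \<open>g\<close> is the conditional quantile function of the second coordinate.\<close>

lemma randomization:
  assumes M: "prob_space M" and \<mu>: "prob_space \<mu>" and s: "sets \<mu> = sets (M >< borel)"
    and d: "distr \<mu> M fst = M"
  shows "\<exists>g\<in>borel_measurable (M >< borel). \<mu> = distr (M >< unit_unif) (M >< borel) (\<lambda>z. (fst z, g z :: real))"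
proof -
  interpret M: prob_space M by fact
  interpret \<mu>: prob_space \<mu> by fact
  interpret U: prob_space unit_unif by (rule prob_space_unit_unif)
  interpret MU: pair_prob_space M unit_unif ..
  have sp: "space \<mu> = space M \<times> UNIV" using sets_eq_imp_space_eq[OF s] by (simp add: space_pair_measure)
  note mdens = marginal_density[OF assms]
  \<comment> \<open>A version of the conditional probability for each single \<open>D\<close>.
    Additivity and monotonicity hold only almost everywhere, so only the countably many tails at
    rational levels will be compared simultaneously.\<close>
  obtain G where Gm: "\<And>D. D \<in> sets borel \<Longrightarrow> G D \<in> borel_measurable M"
    and G: "\<And>D A. D \<in> sets borel \<Longrightarrow> A \<in> sets M \<Longrightarrow> (\<integral>\<^sup>+x\<in>A. G D x \<partial>M) = emeasure \<mu> (A \<times> D)"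
    using mdens by metis
  have \<mu>s: "A \<times> D \<in> sets \<mu>" if "A \<in> sets M" "D \<in> sets borel" for A D using that s by auto
  have G_add: "AE x in M. G (D \<union> D') x = G D x + G D' x"
    if [measurable]: "D \<in> sets borel" "D' \<in> sets borel" and "D \<inter> D' = {}" for D D'
  proof (rule AE_eq_of_nn_integral)
    note [measurable] = Gm
    show "G (D \<union> D') \<in> borel_measurable M" "(\<lambda>x. G D x + G D' x) \<in> borel_measurable M" by measurable
    fix A assume A [measurable]: "A \<in> sets M"
    have "(\<integral>\<^sup>+x\<in>A. (G D x + G D' x) \<partial>M) = (\<integral>\<^sup>+x. G D x * ind A x + G D' x * ind A x \<partial>M)"
      by (simp add: distrib_right)
    also have "\<dots> = (\<integral>\<^sup>+x\<in>A. G D x \<partial>M) + (\<integral>\<^sup>+x\<in>A. G D' x \<partial>M)"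
      by (rule nn_integral_add) measurable
    also have "\<dots> = emeasure \<mu> (A \<times> D \<union> A \<times> D')"
      using that A by (simp add: G) (rule plus_emeasure, auto intro: \<mu>s)
    also have "A \<times> D \<union> A \<times> D' = A \<times> (D \<union> D')" by auto
    finally show "(\<integral>\<^sup>+x\<in>A. G (D \<union> D') x \<partial>M) = (\<integral>\<^sup>+x\<in>A. (G D x + G D' x) \<partial>M)"
      using A by (simp add: G)
  qed unfold_locales
  have G_UNIV: "AE x in M. G UNIV x = 1"
  proof (rule AE_eq_of_nn_integral)
    show "(\<integral>\<^sup>+x\<in>A. G UNIV x \<partial>M) = (\<integral>\<^sup>+x\<in>A. 1 \<partial>M)" if A: "A \<in> sets M" for A
    proof -
      have m: "fst \<in> measurable \<mu> M" by (subst measurable_cong_sets[OF s refl]) measurable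
      have "emeasure M A = emeasure (distr \<mu> M fst) A" by (simp add: d)
      also have "\<dots> = emeasure \<mu> (fst -` A \<inter> space \<mu>)" using m A by (rule emeasure_distr)
      also have "fst -` A \<inter> space \<mu> = A \<times> UNIV" using sets.sets_into_space[OF A] by (auto simp: sp)
      finally show ?thesis using A by (simp add: G)
    qed
  qed (use Gm in \<open>auto intro: M.sigma_finite_measure_axioms\<close>)
  have G_mono: "AE x in M. G D x \<le> G D' x" if "D \<in> sets borel" "D' \<in> sets borel" "D \<subseteq> D'" for D D'
  proof -
    have "AE x in M. G (D \<union> (D' - D)) x = G D x + G (D' - D) x" by (rule G_add) (use that in auto)
    moreover have "D \<union> (D' - D) = D'" using that by auto
    ultimately have "AE x in M. G D' x = G D x + G (D' - D) x" by simp
    then show ?thesis by eventually_elim simp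
  qed
  define F where "F q = G {of_rat q<..}" for q :: rat
  have Fm [measurable]: "F q \<in> borel_measurable M" for q unfolding F_def by (rule Gm) simp
  have good: "AE x in M. (\<forall>q q'. q \<le> q' \<longrightarrow> F q' x \<le> F q x) \<and> (\<forall>q. F q x \<le> 1)"
  proof -
    have "AE x in M. q \<le> q' \<longrightarrow> F q' x \<le> F q x" for q q'
    proof (cases "q \<le> q'")
      case True
      then have "AE x in M. F q' x \<le> F q x"
        unfolding F_def by (intro G_mono) (auto simp: of_rat_less_eq intro: order.strict_trans1)
      then show ?thesis by simp
    qed simp
    moreover have "AE x in M. F q x \<le> 1" for q
    proof -
      have "AE x in M. F q x \<le> G UNIV x" unfolding F_def by (intro G_mono) auto
      then show ?thesis using G_UNIV by eventually_elim simp
    qed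
    ultimately show ?thesis by (simp add: AE_all_countable)
  qed
  \<comment> \<open>The quantile of the conditional tails at rational levels. It is built in
    \<open>ereal\<close> since the supremum may be infinite at exceptional points;
    \<open>- \<infinity>\<close> results when no level qualifies.\<close>
  define ge :: "'a \<times> real \<Rightarrow> ereal" where
    "ge z = (SUP q::rat. if ennreal (snd z) < F q (fst z) then ereal (of_rat q) else - \<infinity>)" for z
  have gem [measurable]: "ge \<in> borel_measurable (M >< borel)" unfolding ge_def by measurable
  have sMU: "sets (M >< unit_unif) = sets (M >< borel)"
    by (intro sets_pair_measure_cong) simp_all
  have gem' [measurable]: "ge \<in> borel_measurable (M >< unit_unif)"
    using gem by (subst measurable_cong_sets[OF sMU refl])
  have ge_less: "emeasure (M >< unit_unif) {z \<in> space (M >< unit_unif). fst z \<in> A \<and> ereal r < ge z} = emeasure \<mu> (A \<times> {r<..})"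
    if A [measurable]: "A \<in> sets M" for A r
  proof -
    obtain Q :: "nat \<Rightarrow> rat" where Q: "\<And>n. r < of_rat (Q n)" "\<And>n. Q (Suc n) \<le> Q n" "\<And>x. x > r \<Longrightarrow> \<exists>n. of_rat (Q n) < x"
      using rat_seq_decreasing[of r] by metis
    let ?S = "{z \<in> space (M >< unit_unif). fst z \<in> A \<and> ereal r < ge z}"
    have S [measurable]: "?S \<in> sets (M >< unit_unif)" by measurable
    have sec: "AE x in M. emeasure unit_unif (Pair x -` ?S) = (SUP n. F (Q n) x * ind A x)"
      using good AE_space
    proof eventually_elim
      case (elim x)
      have "(SUP n. F (Q n) x) \<le> 1" using elim by (auto intro: SUP_least)
      \<comment> \<open>The strict inequality is witnessed by a rational level above
        \<open>r\<close>, and monotonicity of the tails lets the sequence \<open>Q\<close> stand for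
        all such levels.\<close>
      have "ereal r < ge (x, a) \<longleftrightarrow> ennreal a < (SUP n. F (Q n) x)" for a
      proof
        assume "ereal r < ge (x, a)"
        then obtain q where "ereal r < (if ennreal a < F q x then ereal (of_rat q) else - \<infinity>)"
          unfolding ge_def less_SUP_iff by auto
        then have q: "ennreal a < F q x" "r < of_rat q" by (auto split: if_splits)
        obtain n where "of_rat (Q n) < (of_rat q :: real)" using Q(3)[OF q(2)] by auto
        then have "F q x \<le> F (Q n) x" using elim by (auto simp: of_rat_less)
        then show "ennreal a < (SUP n. F (Q n) x)" using q by (auto simp: less_SUP_iff intro: less_le_trans)
      next
        assume "ennreal a < (SUP n. F (Q n) x)"
        then obtain n where n: "ennreal a < F (Q n) x" by (auto simp: less_SUP_iff)
        then show "ereal r < ge (x, a)"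
          unfolding ge_def less_SUP_iff using Q(1)[of n] by (intro bexI[of _ "Q n"]) auto
      qed
      then have eq: "Pair x -` ?S = (if x \<in> A then {a. ennreal a < (SUP n. F (Q n) x)} else {})"
        using elim by (auto simp: space_pair_measure)
      show ?case
      proof (cases "x \<in> A")
        case True
        then show ?thesis unfolding eq using emeasure_unit_unif_less[OF \<open>(SUP n. F (Q n) x) \<le> 1\<close>] by simp
      next
        case False
        then show ?thesis unfolding eq by simp
      qed
    qed
    have "emeasure (M >< unit_unif) ?S = (\<integral>\<^sup>+x. emeasure unit_unif (Pair x -` ?S) \<partial>M)"
      by (rule U.emeasure_pair_measure_alt[OF S])
    also have "\<dots> = (\<integral>\<^sup>+x. (SUP n. F (Q n) x * ind A x) \<partial>M)"
      by (rule nn_integral_cong_AE[OF sec])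
    also have "\<dots> = (SUP n. (\<integral>\<^sup>+x. F (Q n) x * ind A x \<partial>M))"
    proof (rule nn_integral_monotone_convergence_SUP_AE)
      show "AE x in M. F (Q n) x * ind A x \<le> F (Q (Suc n)) x * ind A x" for n
        using good by eventually_elim (use Q(2) in \<open>auto intro!: mult_right_mono\<close>)
    qed measurable
    also have "\<dots> = (SUP n. emeasure \<mu> (A \<times> {of_rat (Q n)<..}))"
      unfolding F_def by (simp add: G A)
    also have "\<dots> = emeasure \<mu> (\<Union>n. A \<times> {of_rat (Q n)<..})"
    proof (rule SUP_emeasure_incseq)
      show "incseq (\<lambda>n. A \<times> {real_of_rat (Q n)<..})"
      proof (rule incseq_SucI)
        fix n
        have "real_of_rat (Q (Suc n)) \<le> real_of_rat (Q n)" using Q(2) by (simp add: of_rat_less_eq)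
        then show "A \<times> {real_of_rat (Q n)<..} \<subseteq> A \<times> {real_of_rat (Q (Suc n))<..}" by auto
      qed
    qed (auto intro: \<mu>s)
    also have "(\<Union>n. A \<times> {real_of_rat (Q n)<..}) = A \<times> {r<..}"
      using Q(1,3) by (auto intro: less_trans)
    finally show ?thesis .
  qed
  define g where "g z = real_of_ereal (ge z)" for z
  have gm [measurable]: "g \<in> borel_measurable (M >< borel)" unfolding g_def by measurable
  have gm' [measurable]: "g \<in> borel_measurable (M >< unit_unif)" unfolding g_def by measurable
  \<comment> \<open>\<open>ge\<close> has the tails of \<open>\<mu>\<close>, whose second coordinate
    is a real number: the tails at \<open>- n\<close> increase to full mass, and in
    \<open>fin2\<close> those at \<open>n\<close> decrease to 0.\<close>
  have fin1: "AE z in M >< unit_unif. ge z \<noteq> - \<infinity>"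
  proof -
    let ?S = "\<lambda>n::nat. {z \<in> space (M >< unit_unif). fst z \<in> space M \<and> ereal (- real n) < ge z}"
    have "(SUP n. emeasure (M >< unit_unif) (?S n)) = (SUP n. emeasure \<mu> (space M \<times> {- real n<..}))"
      by (simp only: ge_less[OF sets.top])
    also have "\<dots> = emeasure \<mu> (\<Union>n. space M \<times> {- real n<..})"
      by (intro SUP_emeasure_incseq) (auto intro!: incseq_SucI \<mu>s)
    also have "(\<Union>n. space M \<times> {- real n<..}) = space \<mu>"
    proof -
      have "\<exists>n. - real n < x" for x :: real using reals_Archimedean2[of "- x"] by (metis minus_less_iff)
      then show ?thesis by (auto simp: sp)
    qed
    also have "emeasure \<mu> (space \<mu>) = 1" by (rule \<mu>.emeasure_space_1)
    also have "(SUP n. emeasure (M >< unit_unif) (?S n)) = emeasure (M >< unit_unif) (\<Union>n. ?S n)"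
    proof (rule SUP_emeasure_incseq)
      show "incseq ?S"
        by (intro incseq_SucI Collect_mono) (auto elim: less_trans[rotated])
      show "range ?S \<subseteq> sets (M >< unit_unif)" by (rule image_subsetI) measurable
    qed
    finally have "AE z in M >< unit_unif. z \<in> (\<Union>n. ?S n)"
      by (intro MU.AE_prob_1) (simp add: MU.emeasure_eq_measure)
    then show ?thesis by eventually_elim auto
  qed
  have fin2: "AE z in M >< unit_unif. ge z \<noteq> \<infinity>"
  proof -
    let ?S = "\<lambda>n::nat. {z \<in> space (M >< unit_unif). fst z \<in> space M \<and> ereal (real n) < ge z}"
    have S: "?S n \<in> sets (M >< unit_unif)" for n by measurable
    have "emeasure (M >< unit_unif) (\<Inter>n. ?S n) \<le> (INF n. emeasure (M >< unit_unif) (?S n))" (is "?L10 \<le> _")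
      by (intro INF_greatest emeasure_mono S INF_lower UNIV_I)
    also have "\<dots> = (INF n. emeasure \<mu> (space M \<times> {real n<..}))"
      by (simp only: ge_less[OF sets.top])
    also have "\<dots> = emeasure \<mu> (\<Inter>n. space M \<times> {real n<..})"
      by (intro INF_emeasure_decseq) (auto intro!: decseq_SucI \<mu>s)
    also have "(\<Inter>n. space M \<times> {real n<..}) = {}"
    proof -
      have "\<exists>n. \<not> real n < x" for x :: real using real_arch_simple[of x] by (auto simp: not_less)
      then show ?thesis by auto
    qed
    finally have "?L10 = 0" by simp
    moreover have "(\<Inter>n. ?S n) \<in> sets (M >< unit_unif)" by measurable
    ultimately have "(\<Inter>n. ?S n) \<in> null_sets (M >< unit_unif)" by (rule null_setsI)
    then have "AE z in M >< unit_unif. z \<notin> (\<Inter>n. ?S n)" by (rule AE_not_in)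
    then show ?thesis using AE_space by eventually_elim (auto simp: space_pair_measure)
  qed
  let ?\<mu>' = "distr (M >< unit_unif) (M >< borel) (\<lambda>z. (fst z, g z))"
  have e': "emeasure ?\<mu>' (A \<times> {r<..}) = emeasure \<mu> (A \<times> {r<..})" if A [measurable]: "A \<in> sets M" for A r
  proof -
    have "emeasure ?\<mu>' (A \<times> {r<..}) = emeasure (M >< unit_unif) {z \<in> space (M >< unit_unif). fst z \<in> A \<and> r < g z}"
      by (subst emeasure_distr) (auto intro!: arg_cong[where f = "emeasure _"])
    also have "\<dots> = emeasure (M >< unit_unif) {z \<in> space (M >< unit_unif). fst z \<in> A \<and> ereal r < ge z}"
    proof (rule emeasure_eq_AE)
      show "AE z in M >< unit_unif. (z \<in> {z \<in> space (M >< unit_unif). fst z \<in> A \<and> r < g z}) \<longleftrightarrow>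
          (z \<in> {z \<in> space (M >< unit_unif). fst z \<in> A \<and> ereal r < ge z})"
        using fin1 fin2
      proof eventually_elim
        case (elim z)
        then obtain c where "ge z = ereal c" by (cases "ge z") auto
        then show ?case by (simp add: g_def)
      qed
    qed measurable
    finally show ?thesis using ge_less[OF A] by simp
  qed
  have "\<mu> = ?\<mu>'"
  proof (rule finite_measure_pair_eqI[OF _ s])
    show "finite_measure \<mu>" by unfold_locales
    fix A D assume A: "A \<in> sets M" and D: "D \<in> sets (borel :: real measure)"
    define R where "R r = distr (density r (ind (A \<times> UNIV))) borel snd" for r :: "('a \<times> real) measure"
    have R: "emeasure (R r) E = emeasure r (A \<times> E)" if r: "sets r = sets (M >< borel)" and E: "E \<in> sets borel" for r E
    proof -
      note [measurable_cong] = r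
      have sr: "space r = space M \<times> UNIV" using sets_eq_imp_space_eq[OF r] by (simp add: space_pair_measure)
      have m: "A \<times> UNIV \<in> sets r" using A r by auto
      have pre: "snd -` E \<inter> space r \<in> sets r" using E by measurable
      have "emeasure (R r) E = emeasure (density r (ind (A \<times> UNIV))) (snd -` E \<inter> space r)"
        unfolding R_def using E by (subst emeasure_distr) auto
      also have "\<dots> = emeasure r ((A \<times> UNIV) \<inter> (snd -` E \<inter> space r))"
        using m pre by (simp add: emeasure_density nn_integral_indicator' flip: indicator_inter_arith)
      also have "(A \<times> UNIV) \<inter> (snd -` E \<inter> space r) = A \<times> E"
        using sets.sets_into_space[OF A] by (auto simp: sr)
      finally show ?thesis .
    qed
    \<comment> \<open>Over a fixed \<open>A\<close> it remains to compare two finite measures on the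
      line by their tails.\<close>
    have "R \<mu> = R ?\<mu>'"
    proof (rule measure_eqI_lessThan)
      show "sets (R \<mu>) = sets borel" "sets (R ?\<mu>') = sets borel" by (simp_all add: R_def)
      show "emeasure (R \<mu>) {x<..} < \<infinity>" for x
        using R[OF s, of "{x<..}"] \<mu>.emeasure_finite by (simp add: less_top[symmetric])
      show "emeasure (R \<mu>) {x<..} = emeasure (R ?\<mu>') {x<..}" for x
        using R[OF s, of "{x<..}"] R[of ?\<mu>' "{x<..}"] e'[OF A, of x] by simp
    qed
    then show "emeasure \<mu> (A \<times> D) = emeasure ?\<mu>' (A \<times> D)"
      using R[OF s D] R[of ?\<mu>' D] D by simp
  qed simp
  then show ?thesis using gm by blast
qed

text \<open>Only an almost everywhere invertible real coordinate is kept from the definition of a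
  Lebesgue space. Since the isomorphism there is with a completed measure, the inverse
  \<open>\<psi>\<close> is measurable only for the completion of the image measure.\<close>

lemma lebesgue_borel_model:
  assumes "lebesgue_prob_space W"
  obtains \<phi> :: "'w \<Rightarrow> real" and \<psi> where "\<phi> \<in> borel_measurable W"
    "\<psi> \<in> measurable (completion (distr W borel \<phi>)) W"
    "AE w in W. \<psi> (\<phi> w) = w" "AE r in distr W borel \<phi>. \<phi> (\<psi> r) = r"
proof -
  interpret W: prob_space W using assms by (simp add: lebesgue_prob_space_def)
  obtain N :: "real measure" where sN: "sets N = sets borel" and iso: "iso_mod0 W (completion N)"
    using assms by (auto simp: lebesgue_prob_space_def)
  have spN: "space N = UNIV" using sets_eq_imp_space_eq[OF sN] by simp
  obtain M0 N0 f where M0: "M0 \<in> sets W" "space W - M0 \<in> null_sets W"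
    and N0: "N0 \<in> sets (completion N)" "space (completion N) - N0 \<in> null_sets (completion N)"
    and f: "bij_betw f M0 N0" "f \<in> measurable (restrict_space W M0) (restrict_space (completion N) N0)"
      "the_inv_into M0 f \<in> measurable (restrict_space (completion N) N0) (restrict_space W M0)"
      "distr (restrict_space W M0) (restrict_space (completion N) N0) f = restrict_space (completion N) N0"
    using iso unfolding iso_mod0_def by blast
  have spM0: "M0 \<subseteq> space W" using M0 sets.sets_into_space by auto
  \<comment> \<open>Outside the sets of full measure the value 0 here and the value
    \<open>w0\<close> for \<open>\<psi>\<close> below are arbitrary defaults.\<close>
  define \<phi> where "\<phi> w = (if w \<in> M0 then f w else 0)" for w
  obtain w0 where w0: "w0 \<in> space W" using W.not_empty by auto
  define \<psi> where "\<psi> r = (if r \<in> N0 then the_inv_into M0 f r else w0)" for r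
  have fb: "f \<in> measurable (restrict_space W M0) borel"
  proof (rule measurableI)
    fix A :: "real set" assume A: "A \<in> sets borel"
    have "A \<inter> N0 \<in> sets (restrict_space (completion N) N0)"
      using A N0 sN by (auto simp: sets_restrict_space_iff spN)
    then have "f -` (A \<inter> N0) \<inter> space (restrict_space W M0) \<in> sets (restrict_space W M0)"
      by (rule measurable_sets[OF f(2)])
    moreover have "f -` (A \<inter> N0) \<inter> space (restrict_space W M0) = f -` A \<inter> space (restrict_space W M0)"
      using f(1) by (auto simp: space_restrict_space bij_betw_def)
    ultimately show "f -` A \<inter> space (restrict_space W M0) \<in> sets (restrict_space W M0)" by simp
  qed simp
  have \<phi>: "\<phi> \<in> borel_measurable W"
    unfolding \<phi>_def using fb M0 by (intro measurable_If_restrict_space_iff[THEN iffD2]) auto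
  have dN: "distr W borel \<phi> = N"
  proof (rule measure_eqI)
    fix A assume "A \<in> sets (distr W borel \<phi>)"
    then have A: "A \<in> sets borel" by simp
    have AN: "A \<inter> N0 \<in> sets (restrict_space (completion N) N0)" "A \<inter> N0 \<in> sets (completion N)"
      using A N0 sN by (auto simp: sets_restrict_space_iff spN)
    have "emeasure (distr W borel \<phi>) A = emeasure W (\<phi> -` A \<inter> space W)" (is "?L11 = _") using \<phi> A by (simp add: emeasure_distr)
    also have "\<dots> = emeasure W (f -` (A \<inter> N0) \<inter> M0)"
    proof (rule emeasure_eq_AE)
      show "AE x in W. (x \<in> \<phi> -` A \<inter> space W) = (x \<in> f -` (A \<inter> N0) \<inter> M0)"
        using AE_not_in[OF M0(2)] AE_space by eventually_elim (use f(1) in \<open>auto simp: \<phi>_def bij_betw_def\<close>)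
      show "\<phi> -` A \<inter> space W \<in> sets W" using \<phi> A by (rule measurable_sets)
      have "f -` (A \<inter> N0) \<inter> space (restrict_space W M0) \<in> sets (restrict_space W M0)"
        by (rule measurable_sets[OF f(2) AN(1)])
      then show "f -` (A \<inter> N0) \<inter> M0 \<in> sets W"
        using M0 spM0 by (auto simp: sets_restrict_space_iff space_restrict_space Int_absorb1 Int_absorb2)
    qed
    also have "\<dots> = emeasure (restrict_space W M0) (f -` (A \<inter> N0) \<inter> space (restrict_space W M0))"
      using M0 spM0 by (subst emeasure_restrict_space) (auto simp: space_restrict_space Int_absorb2 sets.Int)
    also have "\<dots> = emeasure (distr (restrict_space W M0) (restrict_space (completion N) N0) f) (A \<inter> N0)"
      using AN(1) f(2) by (simp add: emeasure_distr)
    also have "\<dots> = emeasure (completion N) (A \<inter> N0)"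
      unfolding f(4) using N0 by (subst emeasure_restrict_space) (auto simp: sets.Int)
    also have "\<dots> = emeasure (completion N) A"
    proof (rule emeasure_eq_AE)
      show "AE x in completion N. (x \<in> A \<inter> N0) = (x \<in> A)"
        using AE_not_in[OF N0(2)] AE_space by eventually_elim auto
    qed (use AN A sN in auto)
    also have "\<dots> = emeasure N A" using A sN by simp
    finally show "?L11 = emeasure N A" .
  qed (simp add: sN)
  have gW: "the_inv_into M0 f \<in> measurable (restrict_space (completion N) N0) W"
    using f(3) measurable_restrict_space2_iff by blast
  have N0eq: "{r \<in> space N. r \<in> N0} = N0" using sets.sets_into_space[OF N0(1)] by auto
  have \<psi>: "\<psi> \<in> measurable (completion N) W"
    unfolding \<psi>_def using gW N0 w0 by (intro measurable_If_restrict_space_iff[THEN iffD2]) (auto simp: N0eq)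
  have 1: "AE w in W. \<psi> (\<phi> w) = w"
    using AE_not_in[OF M0(2)] AE_space
  proof eventually_elim
    case (elim w)
    then have "w \<in> M0" by auto
    then show ?case using f(1) by (auto simp: \<phi>_def \<psi>_def bij_betw_def the_inv_into_f_f)
  qed
  have "AE r in completion N. \<phi> (\<psi> r) = r"
    using AE_not_in[OF N0(2)] AE_space
  proof eventually_elim
    case (elim r)
    then have "r \<in> N0" by auto
    moreover have "the_inv_into M0 f r \<in> M0"
      using f(1) \<open>r \<in> N0\<close> by (intro the_inv_into_into) (auto simp: bij_betw_def)
    ultimately show ?case using f(1) by (auto simp: \<phi>_def \<psi>_def bij_betw_def f_the_inv_into_f)
  qed
  then have 2: "AE r in N. \<phi> (\<psi> r) = r" by (simp add: AE_completion_iff)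
  show thesis by (rule that[of \<phi> \<psi>]) (use \<phi> \<psi> 1 2 dN in auto)
qed

text \<open>The preimage of \<open>B\<close> under \<open>\<psi>\<close> is measurable only up to
  completion; its main part is a Borel set that describes \<open>B\<close> in the real coordinate
  modulo null sets.\<close>

lemma borel_model_sets:
  assumes \<phi>: "\<phi> \<in> borel_measurable W" and \<psi>: "\<psi> \<in> measurable (completion (distr W borel (\<phi> :: 'w \<Rightarrow> real))) W"
    and AE: "AE w in W. \<psi> (\<phi> w) = w" and B: "B \<in> sets W"
  obtains B' where "B' \<in> sets borel" "AE w in W. w \<in> B \<longleftrightarrow> \<phi> w \<in> B'" "AE r in distr W borel \<phi>. \<psi> r \<in> B \<longleftrightarrow> r \<in> B'"
proof -
  let ?N = "distr W borel \<phi>"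
  have S: "\<psi> -` B \<inter> space ?N \<in> sets (completion ?N)"
    using measurable_sets[OF \<psi> B] by simp
  define B' where "B' = main_part ?N (\<psi> -` B \<inter> space ?N)"
  have B': "B' \<in> sets borel" using main_part_sets[OF S] by (simp add: B'_def)
  have "AE r in ?N. r \<notin> null_part ?N (\<psi> -` B \<inter> space ?N)"
    using AE_notin_null_part[OF S] by simp
  then have 1: "AE r in ?N. \<psi> r \<in> B \<longleftrightarrow> r \<in> B'"
  proof eventually_elim
    case (elim r)
    have "\<psi> -` B = B' \<union> null_part ?N (\<psi> -` B \<inter> space ?N)"
      using main_part_null_part_Un[OF S] by (simp add: B'_def)
    then show ?case using elim by blast
  qed
  have "AE w in W. \<psi> (\<phi> w) \<in> B \<longleftrightarrow> \<phi> w \<in> B'"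
    by (rule AE_distrD[OF \<phi> 1])
  then have "AE w in W. w \<in> B \<longleftrightarrow> \<phi> w \<in> B'" using AE by eventually_elim simp
  then show thesis using that B' 1 by blast
qed

text \<open>Applying \<open>\<psi>\<close> to the real coordinate turns a polymorphism into the
  model into one into \<open>W\<close>. Since \<open>\<psi>\<close> is measurable only for the
  completion, the map is taken on \<open>completion q\<close>.\<close>

lemma Pol_lift:
  assumes X: "prob_space X" and W: "prob_space W" and \<phi>: "(\<phi> :: 'w \<Rightarrow> real) \<in> borel_measurable W"
    and \<psi>: "\<psi> \<in> measurable (completion (distr W borel \<phi>)) W"
    and AE: "AE w in W. \<psi> (\<phi> w) = w" and AE': "AE r in distr W borel \<phi>. \<phi> (\<psi> r) = r"
    and q: "q \<in> Pol X (distr W borel \<phi>)"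
  shows "\<exists>p\<in>Pol X W. distr p (triple X borel) (\<lambda>z. (fst z, \<phi> (yc z), tc z)) = q"
proof -
  let ?N = "distr W borel \<phi>"
  interpret X: prob_space X by fact
  interpret W: prob_space W by fact
  have N: "prob_space ?N" by (rule W.prob_space_distr[OF \<phi>])
  interpret q: prob_space q by (rule Pol_prob[OF X N q])
  have cq: "complete_measure (completion q)" by unfold_locales
  note [measurable] = \<phi> Pol_fst[OF X N q] Pol_snd[OF X N q] Pol_t[OF X N q]
  have sq: "sets q = sets (triple X borel)"
    using Pol_sets[OF X N q] by (simp cong: sets_pair_measure_cong)
  \<comment> \<open>A null set of the model is null for the second coordinate of \<open>q\<close>
    because \<open>t > 0\<close>, so this coordinate is measurable between the completions.\<close>
  have y: "(\<lambda>z. yc z) \<in> measurable (completion q) (completion ?N)"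
  proof (rule complete_measure.measurable_completion2[OF cq])
    show ym: "(\<lambda>z. yc z) \<in> measurable (completion q) ?N" by (rule measurable_completion) measurable
    show "null_sets ?N \<subseteq> null_sets (distr (completion q) ?N (\<lambda>z. yc z))"
    proof
    fix A assume A: "A \<in> null_sets ?N"
    have "AE z in q. yc z \<notin> A" using Pol_AE2[OF X N q AE_not_in[OF A]] .
    moreover have "(\<lambda>z. yc z) -` A \<inter> space q \<in> sets q"
      using A by (intro measurable_sets[OF Pol_snd[OF X N q]]) auto
    ultimately have "(\<lambda>z. yc z) -` A \<inter> space q \<in> null_sets q"
      by (subst AE_iff_null_sets) (auto elim: AE_mp)
    then have "(\<lambda>z. yc z) -` A \<inter> space (completion q) \<in> null_sets (completion q)"
      by (simp add: null_sets_completionI)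
    then show "A \<in> null_sets (distr (completion q) ?N (\<lambda>z. yc z))"
      using A ym by (subst null_sets_distr_iff) auto
    qed
  qed
  define h where "h z = (fst z, \<psi> (yc z), tc z)" for z :: "'a \<times> real \<times> real"
  have hm: "h \<in> measurable (completion q) (triple X W)"
    unfolding h_def
    by (intro measurable_Pair measurable_compose[OF y \<psi>]) (auto intro: measurable_completion)
  define p where "p = distr (completion q) (triple X W) h"
  have sp: "sets p = sets (triple X W)" by (simp add: p_def)
  have AEh: "AE z in completion q. \<phi> (\<psi> (yc z)) = yc z"
    using Pol_AE2[OF X N q AE'] by (rule AE_completion)
  have pint: "(\<integral>\<^sup>+z. k z \<partial>p) = (\<integral>\<^sup>+z. k (h z) \<partial>completion q)" if "k \<in> borel_measurable (triple X W)" for k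
    unfolding p_def using that by (intro nn_integral_distr hm) simp
  have "p \<in> Pol X W"
  proof (rule PolI[OF sp])
    fix A assume [measurable]: "A \<in> sets X"
    have "(\<integral>\<^sup>+z. ind A (fst z) \<partial>p) = (\<integral>\<^sup>+z. ind A (fst z) \<partial>q)" (is "?L12 = _")
      by (subst pint) (auto simp: h_def nn_integral_completion)
    also have "\<dots> = emeasure X A" using Pol_nn1[OF X N q, of "ind A"] by simp
    finally show "?L12 = emeasure X A" .
  next
    fix B assume B [measurable]: "B \<in> sets W"
    obtain B' where B': "B' \<in> sets borel" "AE w in W. w \<in> B \<longleftrightarrow> \<phi> w \<in> B'" "AE r in distr W borel \<phi>. \<psi> r \<in> B \<longleftrightarrow> r \<in> B'"
      by (rule borel_model_sets[OF \<phi> \<psi> AE B])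
    note [measurable] = B'(1)
    have "(\<integral>\<^sup>+z. ennreal (tc z) * ind B (yc z) \<partial>p) = (\<integral>\<^sup>+z. ennreal (tc z) * ind B (\<psi> (yc z)) \<partial>q)" (is "?L13 = _")
      by (subst pint) (auto simp: h_def nn_integral_completion)
    also have "\<dots> = (\<integral>\<^sup>+z. ennreal (tc z) * ind B' (yc z) \<partial>q)"
      by (intro nn_integral_cong_AE) (use Pol_AE2[OF X N q B'(3)] in eventually_elim, auto simp: indicator_def)
    also have "\<dots> = emeasure ?N B'" using Pol_nn2[OF X N q, of "ind B'"] B' by simp
    also have "\<dots> = emeasure W (\<phi> -` B' \<inter> space W)" using B' by (simp add: emeasure_distr)
    also have "\<dots> = emeasure W B"
      by (rule emeasure_eq_AE) (use B'(2) AE_space in eventually_elim, auto)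
    finally show "?L13 = emeasure W B" .
  qed
  moreover have "distr p (triple X borel) (\<lambda>z. (fst z, \<phi> (yc z), tc z)) = q"
  proof -
    have m: "(\<lambda>z. (fst z, \<phi> (yc z), tc z)) \<in> measurable (triple X W) (triple X borel)"
      by measurable
    have i: "(\<lambda>z. z) \<in> measurable q (triple X borel)" by (rule measurable_ident_sets[OF sq])
    have "distr p (triple X borel) (\<lambda>z. (fst z, \<phi> (yc z), tc z)) =
        distr (completion q) (triple X borel) ((\<lambda>z. (fst z, \<phi> (yc z), tc z)) \<circ> h)"
      unfolding p_def by (rule distr_distr[OF m hm])
    also have "\<dots> = distr (completion q) (triple X borel) (\<lambda>z. z)"
      by (rule distr_cong_AE[OF refl refl _ measurable_comp[OF hm m] measurable_completion[OF i]])
        (use AEh in eventually_elim, simp add: h_def)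
    also have "\<dots> = distr q (triple X borel) (\<lambda>z. z)" by (rule distr_completion[OF i])
    also have "\<dots> = q" by (rule distr_id2) (simp add: sq)
    finally show ?thesis .
  qed
  ultimately show ?thesis by blast
qed

section \<open>Composition by randomization\<close>

abbreviation Om :: "(real \<times> real) measure" where
  "Om \<equiv> unit_unif >< unit_unif"

lemma prob_space_Om: "prob_space Om"
proof -
  interpret prob_space unit_unif by (rule prob_space_unit_unif)
  interpret pair_prob_space unit_unif unit_unif ..
  show ?thesis by unfold_locales
qed

text \<open>A random map from \<open>Y\<close> to \<open>W\<close> driven by \<open>Om\<close>:
  \<open>s\<close> is its derivative and \<open>Q B\<close> the event that it lands in
  \<open>B\<close>. Only events are recorded, since the map itself is built in a real coordinate of
  \<open>W\<close>.\<close>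

definition is_rand ::
    "'y measure \<Rightarrow> 'w measure \<Rightarrow> ('y \<times> 'w \<times> real) measure \<Rightarrow> ('y \<times> real \<times> real \<Rightarrow> real) \<Rightarrow>
     ('w set \<Rightarrow> ('y \<times> real \<times> real) set) \<Rightarrow> bool" where
  "is_rand Y W v s Q \<longleftrightarrow> s \<in> measurable (Y >< Om) Rpos \<and>
     (\<forall>B\<in>sets W. Q B \<in> sets (Y >< Om) \<and> (\<forall>h\<in>borel_measurable (Y >< Rpos).
        (\<integral>\<^sup>+z. h (fst z, tc z) * ind B (yc z) \<partial>v) =
        (\<integral>\<^sup>+z. h (fst z, s z) * ind (Q B) z \<partial>(Y >< Om))))"

text \<open>The law of going along \<open>u\<close> and then along the random map: the derivatives
  multiply, and the randomness is independent of \<open>u\<close>.\<close>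

definition is_comp ::
    "'x measure \<Rightarrow> 'w measure \<Rightarrow> ('x \<times> 'y \<times> real) measure \<Rightarrow> ('y \<times> real \<times> real \<Rightarrow> real) \<Rightarrow>
     ('w set \<Rightarrow> ('y \<times> real \<times> real) set) \<Rightarrow> ('x \<times> 'w \<times> real) measure \<Rightarrow> bool" where
  "is_comp X W u s Q p \<longleftrightarrow> (\<forall>B\<in>sets W. \<forall>h\<in>borel_measurable (X >< Rpos).
     (\<integral>\<^sup>+z. h (fst z, tc z) * ind B (yc z) \<partial>p) =
     (\<integral>\<^sup>+z. h (fst (fst z), tc (fst z) * s (yo z)) *
        ind (Q B) (yo z) \<partial>(u >< Om)))"

text \<open>Of the two uniform variables in \<open>Om\<close> one draws the real coordinate of the
  point of \<open>W\<close> and the other draws the derivative given that point. The randomization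
  is found before \<open>u\<close> and serves all \<open>u\<close>.\<close>

lemma comp_exists:
  fixes X :: "'x measure" and Y :: "'y measure" and W :: "'w measure"
  assumes X: "prob_space X" and Y: "prob_space Y" and leb: "lebesgue_prob_space W" and v: "v \<in> Pol Y W"
  shows "\<exists>s Q. is_rand Y W v s Q \<and> (\<forall>u\<in>Pol X Y. \<exists>p\<in>Pol X W. is_comp X W u s Q p)"
proof -
  have W: "prob_space W" using leb by (simp add: lebesgue_prob_space_def)
  interpret X: prob_space X by fact
  interpret Y: prob_space Y by fact
  interpret W: prob_space W by fact
  interpret v: prob_space v by (rule Pol_prob[OF Y W v])
  interpret U: prob_space unit_unif by (rule prob_space_unit_unif)
  interpret Om: prob_space Om by (rule prob_space_Om)
  interpret UU: pair_prob_space unit_unif unit_unif ..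
  obtain \<phi> :: "'w \<Rightarrow> real" and \<psi> where \<phi>: "\<phi> \<in> borel_measurable W"
    and \<psi>: "\<psi> \<in> measurable (completion (distr W borel \<phi>)) W"
    and AE: "AE w in W. \<psi> (\<phi> w) = w" and AE': "AE r in distr W borel \<phi>. \<phi> (\<psi> r) = r"
    using lebesgue_borel_model[OF leb] by blast
  let ?N = "distr W borel \<phi>"
  have N: "prob_space ?N" by (rule W.prob_space_distr[OF \<phi>])
  note [measurable] = \<phi> Pol_fst[OF Y W v] Pol_snd[OF Y W v] Pol_t[OF Y W v]
  define \<mu>1 where "\<mu>1 = distr v (Y >< borel) (\<lambda>z. (fst z, \<phi> (yc z)))"
  define \<mu>2 where "\<mu>2 = distr v ((Y >< borel) >< borel) (\<lambda>z. ((fst z, \<phi> (yc z)), tc z))"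
  have p1: "prob_space \<mu>1" unfolding \<mu>1_def by (rule v.prob_space_distr) measurable
  have p2: "prob_space \<mu>2" unfolding \<mu>2_def by (rule v.prob_space_distr) measurable
  have d1: "distr \<mu>1 Y fst = Y"
    unfolding \<mu>1_def by (subst distr_distr) (auto simp: comp_def Pol_distr1[OF Y W v])
  have s1: "sets \<mu>1 = sets (Y >< borel)" by (simp add: \<mu>1_def)
  note [measurable_cong] = s1
  have s2: "sets \<mu>2 = sets (\<mu>1 >< borel)" unfolding \<mu>2_def by (simp add: s1 cong: sets_pair_measure_cong)
  have d2: "distr \<mu>2 \<mu>1 fst = \<mu>1"
  proof -
    have "distr \<mu>2 \<mu>1 fst = distr \<mu>2 (Y >< borel) fst" by (rule distr_cong) (simp_all add: s1)
    also have "\<dots> = \<mu>1" unfolding \<mu>2_def \<mu>1_def by (subst distr_distr) (auto simp: comp_def)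
    finally show ?thesis .
  qed
  obtain g1 where g1: "g1 \<in> borel_measurable (Y >< borel)" "\<mu>1 = distr (Y >< unit_unif) (Y >< borel) (\<lambda>z. (fst z, g1 z :: real))"
    using randomization[OF Y p1 s1 d1] by blast
  obtain g2 where g2: "g2 \<in> borel_measurable (\<mu>1 >< borel)" "\<mu>2 = distr (\<mu>1 >< unit_unif) (\<mu>1 >< borel) (\<lambda>z. (fst z, g2 z :: real))"
    using randomization[OF p1 p2 s2 d2] by blast
  have sU: "sets unit_unif = sets borel" by simp
  have g1m [measurable]: "g1 \<in> borel_measurable (Y >< unit_unif)"
    using g1(1) by (subst measurable_cong_sets[OF sets_pair_measure_cong[OF refl sU] refl])
  have g2m [measurable]: "g2 \<in> borel_measurable ((Y >< borel) >< unit_unif)"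
    using g2(1) by (subst measurable_cong_sets[OF sets_pair_measure_cong[OF s1[symmetric] sU] refl])
  define r where "r z = g1 (fst z, yc z)" for z :: "'y \<times> real \<times> real"
  define s0 where "s0 z = g2 ((fst z, r z), tc z)" for z :: "'y \<times> real \<times> real"
  have rm [measurable]: "r \<in> borel_measurable (Y >< Om)" unfolding r_def by measurable
  have s0m [measurable]: "s0 \<in> borel_measurable (Y >< Om)" unfolding s0_def by measurable
  \<comment> \<open>The quantile function is guaranteed to be positive only almost everywhere; the
    default 1 makes \<open>s\<close> positive at every point.\<close>
  define pos :: "real \<Rightarrow> real" where "pos t = (if t > 0 then t else 1)" for t
  have posm [measurable]: "pos \<in> measurable borel Rpos" unfolding measurable_Rpos_iff by (auto simp: pos_def[abs_def])
  define s where "s z = pos (s0 z)" for z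
  have sm [measurable]: "s \<in> measurable (Y >< Om) Rpos" unfolding s_def by measurable
  have spos: "0 < s z" for z by (simp add: s_def pos_def)
  have int2: "(\<integral>\<^sup>+z. h ((fst z, \<phi> (yc z)), tc z) \<partial>v) = (\<integral>\<^sup>+z. h ((fst z, r z), s0 z) \<partial>(Y >< Om))"
    if h [measurable]: "h \<in> borel_measurable ((Y >< borel) >< borel)" for h
  proof -
    have "(\<integral>\<^sup>+z. h ((fst z, \<phi> (yc z)), tc z) \<partial>v) = (\<integral>\<^sup>+z. h z \<partial>\<mu>2)"
      unfolding \<mu>2_def by (subst nn_integral_distr) auto
    also have "\<dots> = (\<integral>\<^sup>+z. h (fst z, g2 z) \<partial>(\<mu>1 >< unit_unif))"
    proof -
      have "(\<lambda>z. (fst z, g2 z)) \<in> measurable (\<mu>1 >< unit_unif) (\<mu>1 >< borel)" by measurable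
      moreover have "h \<in> borel_measurable (\<mu>1 >< borel)" by measurable
      ultimately show ?thesis by (subst g2(2)) (simp add: nn_integral_distr)
    qed
    also have "\<dots> = (\<integral>\<^sup>+q. (\<integral>\<^sup>+b. h (q, g2 (q, b)) \<partial>unit_unif) \<partial>\<mu>1)"
      by (subst U.nn_integral_fst[symmetric]) auto
    also have "\<dots> = (\<integral>\<^sup>+z. (\<integral>\<^sup>+b. h ((fst z, g1 z), g2 ((fst z, g1 z), b)) \<partial>unit_unif) \<partial>(Y >< unit_unif))"
      by (subst g1(2), subst nn_integral_distr) auto
    also have "\<dots> = (\<integral>\<^sup>+y. (\<integral>\<^sup>+a. (\<integral>\<^sup>+b. h ((y, g1 (y, a)), g2 ((y, g1 (y, a)), b)) \<partial>unit_unif) \<partial>unit_unif) \<partial>Y)"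
      by (subst U.nn_integral_fst[symmetric]) auto
    also have "\<dots> = (\<integral>\<^sup>+y. (\<integral>\<^sup>+\<omega>. h ((y, g1 (y, fst \<omega>)), g2 ((y, g1 (y, fst \<omega>)), snd \<omega>)) \<partial>Om) \<partial>Y)"
    proof (intro nn_integral_cong)
      fix y assume y [measurable]: "y \<in> space Y"
      show "(\<integral>\<^sup>+a. (\<integral>\<^sup>+b. h ((y, g1 (y, a)), g2 ((y, g1 (y, a)), b)) \<partial>unit_unif) \<partial>unit_unif) =
          (\<integral>\<^sup>+\<omega>. h ((y, g1 (y, fst \<omega>)), g2 ((y, g1 (y, fst \<omega>)), snd \<omega>)) \<partial>Om)"
        by (subst U.nn_integral_fst[symmetric]) auto
    qed
    also have "\<dots> = (\<integral>\<^sup>+z. h ((fst z, r z), s0 z) \<partial>(Y >< Om))"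
      unfolding s0_def r_def by (subst Om.nn_integral_fst[symmetric]) auto
    finally show ?thesis .
  qed
  have "\<exists>B'. B' \<in> sets borel \<and> (AE w in W. w \<in> B \<longleftrightarrow> \<phi> w \<in> B')" if "B \<in> sets W" for B
    using borel_model_sets[OF \<phi> \<psi> AE that] by metis
  then obtain b where b: "\<And>B. B \<in> sets W \<Longrightarrow> b B \<in> sets borel" "\<And>B. B \<in> sets W \<Longrightarrow> AE w in W. w \<in> B \<longleftrightarrow> \<phi> w \<in> b B"
    by metis
  \<comment> \<open>The event that the drawn coordinate lies in a Borel set representing
    \<open>B\<close>.\<close>
  define Q where "Q B = {z\<in>space (Y >< Om). r z \<in> b B}" for B
  have "is_rand Y W v s Q"
    unfolding is_rand_def
  proof (intro conjI ballI)
    show "s \<in> measurable (Y >< Om) Rpos" by (rule sm)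
    fix B assume B: "B \<in> sets W"
    note [measurable] = b(1)[OF B]
    show "Q B \<in> sets (Y >< Om)" unfolding Q_def by measurable
    fix h :: "_ \<Rightarrow> ennreal" assume h [measurable]: "h \<in> borel_measurable (Y >< Rpos)"
    have "(\<integral>\<^sup>+z. h (fst z, tc z) * ind B (yc z) \<partial>v) =
        (\<integral>\<^sup>+z. h (fst z, tc z) * ind (b B) (\<phi> (yc z)) \<partial>v)" (is "?L14 = _")
      by (intro nn_integral_cong_AE) (use Pol_AE2[OF Y W v b(2)[OF B]] in eventually_elim, auto simp: indicator_def)
    \<comment> \<open>Inserting \<open>pos\<close> changes nothing where \<open>t > 0\<close> and
      makes the integrand measurable on the whole line, as \<open>int2\<close> requires.\<close>
    also have "\<dots> = (\<integral>\<^sup>+z. (\<lambda>q. h (fst (fst q), pos (snd q)) * ind (b B) (snd (fst q))) ((fst z, \<phi> (yc z)), tc z) \<partial>v)"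
      by (intro nn_integral_cong) (auto simp: Pol_space[OF Y W v] pos_def)
    also have "\<dots> = (\<integral>\<^sup>+z. (\<lambda>q. h (fst (fst q), pos (snd q)) * ind (b B) (snd (fst q))) ((fst z, r z), s0 z) \<partial>(Y >< Om))"
      by (rule int2) measurable
    also have "\<dots> = (\<integral>\<^sup>+z. h (fst z, s z) * ind (Q B) z \<partial>(Y >< Om))"
      by (intro nn_integral_cong) (auto simp: Q_def s_def indicator_def)
    finally show "?L14 =
        (\<integral>\<^sup>+z. h (fst z, s z) * ind (Q B) z \<partial>(Y >< Om))" .
  qed
  moreover have "\<exists>p\<in>Pol X W. is_comp X W u s Q p" if u: "u \<in> Pol X Y" for u
  proof -
    interpret u: prob_space u by (rule Pol_prob[OF X Y u])
    note [measurable] = Pol_fst[OF X Y u] Pol_snd[OF X Y u] Pol_t[OF X Y u]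
    \<comment> \<open>The composition with a real coordinate in place of the point of
      \<open>W\<close>; it is lifted to \<open>W\<close> afterwards.\<close>
    define H where "H z = (fst (fst z), r (yo z), tc (fst z) * s (yo z))"
      for z :: "('x \<times> 'y \<times> real) \<times> real \<times> real"
    have tm [measurable]: "(\<lambda>z. tc (fst z) * s (yo z)) \<in> measurable (u >< Om) Rpos"
      unfolding measurable_Rpos_iff by (auto simp: space_pair_measure Pol_space[OF X Y u] spos)
    have Hm: "H \<in> measurable (u >< Om) (triple X borel)" unfolding H_def by measurable
    define q where "q = distr (u >< Om) (triple X borel) H"
    have sq: "sets q = sets (X >< ?N >< Rpos)" unfolding q_def by (simp cong: sets_pair_measure_cong)
    have qint: "(\<integral>\<^sup>+z. k z \<partial>q) = (\<integral>\<^sup>+z. k (H z) \<partial>(u >< Om))" if "k \<in> borel_measurable (triple X borel)" for k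
      unfolding q_def using that by (intro nn_integral_distr Hm) simp
    have "q \<in> Pol X ?N"
    proof (rule PolI[OF sq])
      fix A assume A [measurable]: "A \<in> sets X"
      have "(\<integral>\<^sup>+z. ind A (fst z) \<partial>q) = (\<integral>\<^sup>+z. ind A (fst (fst z)) \<partial>(u >< Om))" (is "?L15 = _")
        by (subst qint) (auto simp: H_def)
      also have "\<dots> = (\<integral>\<^sup>+z. (\<integral>\<^sup>+\<omega>. ind A (fst z) \<partial>Om) \<partial>u)"
        by (subst Om.nn_integral_fst[symmetric]) auto
      also have "\<dots> = (\<integral>\<^sup>+z. ind A (fst z) \<partial>u)" by (simp add: Om.emeasure_space_1)
      also have "\<dots> = emeasure X A" using Pol_nn1[OF X Y u, of "ind A"] by simp
      finally show "?L15 = emeasure X A" .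
    next
      fix D assume "D \<in> sets ?N"
      then have D [measurable]: "D \<in> sets borel" by simp
      have m: "(\<lambda>y. \<integral>\<^sup>+\<omega>. ennreal (s (y, \<omega>)) * ind D (r (y, \<omega>)) \<partial>Om) \<in> borel_measurable Y"
        by (rule Om.borel_measurable_nn_integral) measurable
      have "(\<integral>\<^sup>+z. ennreal (tc z) * ind D (yc z) \<partial>q) =
          (\<integral>\<^sup>+z. ennreal (tc (fst z) * s (yo z)) * ind D (r (yo z)) \<partial>(u >< Om))" (is "?L17 = _")
        by (subst qint) (auto simp: H_def)
      also have "\<dots> = (\<integral>\<^sup>+z. (\<integral>\<^sup>+\<omega>. ennreal (tc z * s (yc z, \<omega>)) * ind D (r (yc z, \<omega>)) \<partial>Om) \<partial>u)"
        by (subst Om.nn_integral_fst[symmetric]) auto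
      also have "\<dots> = (\<integral>\<^sup>+z. ennreal (tc z) * (\<integral>\<^sup>+\<omega>. ennreal (s (yc z, \<omega>)) * ind D (r (yc z, \<omega>)) \<partial>Om) \<partial>u)"
      proof (intro nn_integral_cong)
        fix z assume z: "z \<in> space u"
        then have y [measurable]: "yc z \<in> space Y" and t: "0 < tc z" by (auto simp: Pol_space[OF X Y u])
        have "(\<integral>\<^sup>+\<omega>. ennreal (tc z * s (yc z, \<omega>)) * ind D (r (yc z, \<omega>)) \<partial>Om) =
            (\<integral>\<^sup>+\<omega>. ennreal (tc z) * (ennreal (s (yc z, \<omega>)) * ind D (r (yc z, \<omega>))) \<partial>Om)" (is "?L16 = _")
          by (intro nn_integral_cong) (use t spos in \<open>auto simp: ennreal_mult less_imp_le mult.assoc\<close>)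
        also have "\<dots> = ennreal (tc z) * (\<integral>\<^sup>+\<omega>. ennreal (s (yc z, \<omega>)) * ind D (r (yc z, \<omega>)) \<partial>Om)"
          by (rule nn_integral_cmult) measurable
        finally show "?L16 = \<dots>" .
      qed
      \<comment> \<open>The second marginal of \<open>t * u\<close> is \<open>Y\<close>, which
        leaves an integral that concerns \<open>v\<close> alone.\<close>
      also have "\<dots> = (\<integral>\<^sup>+y. (\<integral>\<^sup>+\<omega>. ennreal (s (y, \<omega>)) * ind D (r (y, \<omega>)) \<partial>Om) \<partial>Y)"
        by (rule Pol_nn2[OF X Y u m])
      also have "\<dots> = (\<integral>\<^sup>+z. (\<lambda>q. ennreal (pos (snd q)) * ind D (snd (fst q))) ((fst z, r z), s0 z) \<partial>(Y >< Om))"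
        by (subst Om.nn_integral_fst[symmetric]) (auto simp: s_def)
      also have "\<dots> = (\<integral>\<^sup>+z. (\<lambda>q. ennreal (pos (snd q)) * ind D (snd (fst q))) ((fst z, \<phi> (yc z)), tc z) \<partial>v)"
        by (rule int2[symmetric]) measurable
      also have "\<dots> = (\<integral>\<^sup>+z. ennreal (tc z) * ind D (\<phi> (yc z)) \<partial>v)"
        by (intro nn_integral_cong) (auto simp: Pol_space[OF Y W v] pos_def)
      also have "\<dots> = (\<integral>\<^sup>+w. ind D (\<phi> w) \<partial>W)"
        using Pol_nn2[OF Y W v, of "\<lambda>w. ind D (\<phi> w)"] by simp
      also have "\<dots> = emeasure ?N D"
        using nn_integral_distr[OF \<phi>, of "ind D"] by simp
      finally show "?L17 = emeasure ?N D" .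
    qed
    then obtain p where p: "p \<in> Pol X W" and pq: "distr p (triple X borel) (\<lambda>z. (fst z, \<phi> (yc z), tc z)) = q"
      using Pol_lift[OF X W \<phi> \<psi> AE AE'] by blast
    note [measurable] = Pol_fst[OF X W p] Pol_snd[OF X W p] Pol_t[OF X W p]
    have "is_comp X W u s Q p"
      unfolding is_comp_def
    proof (intro ballI)
      fix B and h :: "_ \<Rightarrow> ennreal" assume B: "B \<in> sets W" and h [measurable]: "h \<in> borel_measurable (X >< Rpos)"
      note [measurable] = b(1)[OF B]
      have "(\<integral>\<^sup>+z. h (fst z, tc z) * ind B (yc z) \<partial>p) =
          (\<integral>\<^sup>+z. h (fst z, tc z) * ind (b B) (\<phi> (yc z)) \<partial>p)" (is "?L18 = _")
        by (intro nn_integral_cong_AE) (use Pol_AE2[OF X W p b(2)[OF B]] in eventually_elim, auto simp: indicator_def)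
      also have "\<dots> = (\<integral>\<^sup>+z. h (fst z, tc z) * ind (b B) (yc z) \<partial>q)"
        unfolding pq[symmetric] by (subst nn_integral_distr) auto
      also have "\<dots> = (\<integral>\<^sup>+z. h (fst (H z), snd (snd (H z))) * ind (b B) (fst (snd (H z))) \<partial>(u >< Om))"
        by (rule qint) measurable
      also have "\<dots> = (\<integral>\<^sup>+z. h (fst (fst z), tc (fst z) * s (yo z)) *
        ind (Q B) (yo z) \<partial>(u >< Om))"
        by (intro nn_integral_cong) (auto simp: H_def Q_def indicator_def space_pair_measure Pol_space[OF X Y u])
      finally show "?L18 =
        (\<integral>\<^sup>+z. h (fst (fst z), tc (fst z) * s (yo z)) *
          ind (Q B) (yo z) \<partial>(u >< Om))" .
    qed
    then show ?thesis using p by blast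
  qed
  ultimately show ?thesis by blast
qed

section \<open>Measure-valued kernels and agreement with the product of continuous
  polymorphisms\<close>

lemma MtriD:
  assumes "s \<in> Mtri"
  shows "sets s = sets Rpos" "finite_measure s" "space s = {0<..}" "sigma_finite_measure s"
proof -
  show 1: "sets s = sets Rpos" and 2: "finite_measure s" using assms by (auto simp: Mtri_def)
  show "space s = {0<..}" using sets_eq_imp_space_eq[OF 1] by simp
  interpret finite_measure s by fact
  show "sigma_finite_measure s" by unfold_locales
qed

text \<open>Scaling to total mass at most 1 makes the theory of subprobability kernels available;
  the summand 1 keeps the divisor positive for the zero measure.\<close>

definition normalized :: "real measure \<Rightarrow> real measure" where
  "normalized s = scale_measure (inverse (1 + emeasure s {0<..})) s"

lemma normalized:
  assumes s: "s \<in> Mtri"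
  shows "subprob_space (normalized s)" "sets (normalized s) = sets Rpos"
    "h \<in> borel_measurable Rpos \<Longrightarrow> (\<integral>\<^sup>+t. h t \<partial>s) = (1 + emeasure s {0<..}) * (\<integral>\<^sup>+t. h t \<partial>normalized s)"
    "emeasure (normalized s) C = inverse (1 + emeasure s {0<..}) * emeasure s C"
proof -
  note M = MtriD[OF s]
  let ?c = "1 + emeasure s {0<..}"
  have fin: "?c \<noteq> 0" "?c \<noteq> \<top>" using finite_measure.emeasure_finite[OF M(2)] by auto
  have inv2: "?c * inverse ?c = 1"
    using ennreal_divide_self[of ?c] fin by (simp add: divide_ennreal_def less_top[symmetric])
  then have inv: "inverse ?c * ?c = 1" "?c * inverse ?c = 1" by (simp_all add: mult.commute)
  show 3: "emeasure (normalized s) C = inverse ?c * emeasure s C" for C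
    by (simp add: normalized_def emeasure_scale_measure)
  show 4: "sets (normalized s) = sets Rpos" by (simp add: normalized_def M)
  show "subprob_space (normalized s)"
  proof (rule subprob_spaceI)
    have sp: "space (normalized s) = {0<..}" using sets_eq_imp_space_eq[OF 4] by simp
    have "emeasure (normalized s) (space (normalized s)) = inverse ?c * emeasure s {0<..}" (is "?L19 = _") by (simp add: sp 3)
    also have "\<dots> \<le> inverse ?c * ?c" by (intro mult_left_mono) auto
    finally show "?L19 \<le> 1" using inv by simp
    show "space (normalized s) \<noteq> {}" by (simp add: sp)
  qed
  show "(\<integral>\<^sup>+t. h t \<partial>s) = ?c * (\<integral>\<^sup>+t. h t \<partial>normalized s)" if h: "h \<in> borel_measurable Rpos"
  proof -
    have "h \<in> borel_measurable s" using h by (simp cong: measurable_cong_sets add: M)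
    then have "(\<integral>\<^sup>+t. h t \<partial>normalized s) = inverse ?c * (\<integral>\<^sup>+t. h t \<partial>s)"
      unfolding normalized_def by (intro nn_integral_scale_measure)
    then show ?thesis using inv by (simp add: mult.assoc[symmetric])
  qed
qed

definition Mkernel :: "'m measure \<Rightarrow> ('m \<Rightarrow> real measure) \<Rightarrow> bool" where
  "Mkernel M \<kappa> \<longleftrightarrow> (\<forall>x\<in>space M. \<kappa> x \<in> Mtri) \<and>
     (\<forall>C\<in>sets Rpos. (\<lambda>x. emeasure (\<kappa> x) C) \<in> borel_measurable M)"

lemma Mkernel_normalized:
  assumes "Mkernel M \<kappa>" shows "(\<lambda>x. normalized (\<kappa> x)) \<in> measurable M (subprob_algebra Rpos)"
proof (rule measurable_subprob_algebra)
  fix x assume "x \<in> space M"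
  then have "\<kappa> x \<in> Mtri" using assms by (simp add: Mkernel_def)
  then show "subprob_space (normalized (\<kappa> x))" "sets (normalized (\<kappa> x)) = sets Rpos" by (rule normalized)+
next
  fix A assume A: "A \<in> sets Rpos"
  have [measurable]: "(\<lambda>x. emeasure (\<kappa> x) C) \<in> borel_measurable M" if "C \<in> sets Rpos" for C
    using assms that by (simp add: Mkernel_def)
  have [measurable]: "(\<lambda>x. emeasure (\<kappa> x) {0<..}) \<in> borel_measurable M"
    using sets.top[of Rpos] by (simp del: sets.top)
  have "(\<lambda>x. inverse (1 + emeasure (\<kappa> x) {0<..}) * emeasure (\<kappa> x) A) \<in> borel_measurable M"
    using A by measurable
  then show "(\<lambda>x. emeasure (normalized (\<kappa> x)) A) \<in> borel_measurable M"
    by (rule measurable_cong[THEN iffD1, rotated]) (use assms in \<open>simp add: Mkernel_def normalized(4)\<close>)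
qed

lemma Mkernel_total:
  assumes "Mkernel M \<kappa>" shows "(\<lambda>x. emeasure (\<kappa> x) {0<..}) \<in> borel_measurable M"
  using assms sets.top[of Rpos] by (simp add: Mkernel_def del: sets.top)

text \<open>Measurability comes from the normalized kernel and survives multiplication by the
  measurable normalizing factor.\<close>

lemma Mkernel_nn_integral:
  assumes \<kappa>: "Mkernel M \<kappa>" and k: "k \<in> borel_measurable (M >< Rpos)"
  shows "(\<lambda>x. \<integral>\<^sup>+t. k (x, t) \<partial>\<kappa> x) \<in> borel_measurable M"
proof -
  note [measurable] = k Mkernel_normalized[OF \<kappa>] Mkernel_total[OF \<kappa>]
  have "(\<lambda>x. (1 + emeasure (\<kappa> x) {0<..}) * (\<integral>\<^sup>+t. k (x, t) \<partial>normalized (\<kappa> x))) \<in> borel_measurable M"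
    by (intro borel_measurable_times_ennreal nn_integral_measurable_subprob_algebra2[where N = Rpos]) measurable
  then show ?thesis
    by (rule measurable_cong[THEN iffD1, rotated])
      (use \<kappa> in \<open>auto simp: Mkernel_def intro!: normalized(3)[symmetric] measurable_compose[OF measurable_Pair1' k]\<close>)
qed

lemma Mkernel_comp:
  assumes "Mkernel M \<kappa>" "f \<in> measurable N M" shows "Mkernel N (\<lambda>x. \<kappa> (f x))"
  using assms measurable_compose[OF assms(2)] unfolding Mkernel_def by (auto simp: measurable_space)

lemma given_by_kernel:
  assumes "given_by X Y u s" shows "Mkernel (X >< Y) (\<lambda>z. s (fst z) (snd z))"
  using assms unfolding given_by_def Mkernel_def by (auto simp: space_pair_measure case_prod_beta')

text \<open>The defining identity covers boxes only. The measure \<open>u2\<close> built from the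
  kernel satisfies the integral formula by construction and agrees with \<open>u\<close> on boxes,
  hence equals it.\<close>

lemma given_by_nn_integral:
  assumes X: "prob_space X" and Y: "prob_space Y" and g: "given_by X Y u s"
    and k: "k \<in> borel_measurable (triple X Y)"
  shows "(\<integral>\<^sup>+z. k z \<partial>u) = (\<integral>\<^sup>+z. (\<integral>\<^sup>+t. k (fst z, snd z, t) \<partial>s (fst z) (snd z)) \<partial>(X >< Y))"
proof -
  interpret X: prob_space X by fact
  interpret Y: prob_space Y by fact
  interpret XY: pair_prob_space X Y ..
  define \<kappa> where "\<kappa> z = s (fst z) (snd z)" for z
  have \<kappa>: "Mkernel (X >< Y) \<kappa>" unfolding \<kappa>_def by (rule given_by_kernel[OF g])
  have u: "u \<in> Pol X Y" using g by (simp add: given_by_def)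
  note [measurable] = Mkernel_normalized[OF \<kappa>] Mkernel_total[OF \<kappa>]
  define K where "K z = distr (normalized (\<kappa> z)) (triple X Y) (\<lambda>t. (fst z, snd z, t))" for z
  have K: "K \<in> measurable (X >< Y) (subprob_algebra (triple X Y))"
    unfolding K_def by (rule measurable_distr2[where M = Rpos]) measurable
  define c where "c z = 1 + emeasure (\<kappa> z) {0<..}" for z
  have [measurable]: "c \<in> borel_measurable (X >< Y)" unfolding c_def by measurable
  define B where "B = (X >< Y) \<bind> K"
  have ne: "space (X >< Y) \<noteq> {}" by (rule XY.P.not_empty)
  have sB: "sets B = sets (triple X Y)" unfolding B_def by (rule sets_bind[OF _ ne]) (simp add: K_def)
  note [measurable_cong] = sB
  \<comment> \<open>The density \<open>c\<close> undoes the normalization fibre by fibre.\<close>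
  define u2 where "u2 = density B (\<lambda>z. c (fst z, yc z))"
  have int: "(\<integral>\<^sup>+z. k z \<partial>u2) = (\<integral>\<^sup>+z. (\<integral>\<^sup>+t. k (fst z, snd z, t) \<partial>\<kappa> z) \<partial>(X >< Y))"
    if k [measurable]: "k \<in> borel_measurable (triple X Y)" for k
  proof -
    have "(\<integral>\<^sup>+z. k z \<partial>u2) = (\<integral>\<^sup>+z. c (fst z, yc z) * k z \<partial>B)"
      unfolding u2_def by (rule nn_integral_density; subst measurable_cong_sets[OF sB refl]; measurable)
    also have "\<dots> = (\<integral>\<^sup>+q. (\<integral>\<^sup>+z. c (fst z, yc z) * k z \<partial>K q) \<partial>(X >< Y))"
      unfolding B_def by (rule nn_integral_bind[OF _ K]) measurable
    also have "\<dots> = (\<integral>\<^sup>+z. (\<integral>\<^sup>+t. k (fst z, snd z, t) \<partial>\<kappa> z) \<partial>(X >< Y))"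
    proof (intro nn_integral_cong)
      fix q assume q: "q \<in> space (X >< Y)"
      then have \<kappa>q: "\<kappa> q \<in> Mtri" using \<kappa> by (simp add: Mkernel_def)
      have q': "fst q \<in> space X" "snd q \<in> space Y" using q by (auto simp: space_pair_measure)
      have m: "(\<lambda>t. (fst q, snd q, t)) \<in> measurable Rpos (triple X Y)" using q' by measurable
      have km: "(\<lambda>t. k (fst q, snd q, t)) \<in> borel_measurable Rpos" by (rule measurable_compose[OF m k])
      have "(\<integral>\<^sup>+z. c (fst z, yc z) * k z \<partial>K q) = (\<integral>\<^sup>+t. c q * k (fst q, snd q, t) \<partial>normalized (\<kappa> q))" (is "?L20 = _")
      proof -
        have mn: "(\<lambda>t. (fst q, snd q, t)) \<in> measurable (normalized (\<kappa> q)) (triple X Y)"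
          using m by (subst measurable_cong_sets[OF normalized(2)[OF \<kappa>q] refl])
        have ck: "(\<lambda>z. c (fst z, yc z) * k z) \<in> borel_measurable (triple X Y)" by measurable
        show ?thesis unfolding K_def by (subst nn_integral_distr[OF mn]) (use ck in simp_all)
      qed
      also have "\<dots> = c q * (\<integral>\<^sup>+t. k (fst q, snd q, t) \<partial>normalized (\<kappa> q))"
        by (rule nn_integral_cmult) (subst measurable_cong_sets[OF normalized(2)[OF \<kappa>q] refl], rule km)
      also have "\<dots> = (\<integral>\<^sup>+t. k (fst q, snd q, t) \<partial>\<kappa> q)"
        unfolding c_def by (rule normalized(3)[OF \<kappa>q km, symmetric])
      finally show "?L20 = (\<integral>\<^sup>+t. k (fst q, snd q, t) \<partial>\<kappa> q)" .
    qed
    finally show ?thesis .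
  qed
  interpret u: prob_space u by (rule Pol_prob[OF X Y u])
  have "u = u2"
  proof (rule finite_measure_triple_eqI)
    show "finite_measure u" by unfold_locales
    show "sets u = sets (triple X Y)" by (rule Pol_sets[OF X Y u])
    show s2: "sets u2 = sets (triple X Y)" by (simp add: u2_def sB)
    fix A B C assume A: "A \<in> sets X" and B: "B \<in> sets Y" and C: "C \<in> sets Rpos"
    have ABC: "A \<times> B \<times> C \<in> sets (triple X Y)" using A B C by auto
    have "emeasure u2 (A \<times> B \<times> C) = (\<integral>\<^sup>+z. ind (A \<times> B \<times> C) z \<partial>u2)" using ABC s2 by simp
    also have "\<dots> = (\<integral>\<^sup>+z. (\<integral>\<^sup>+t. ind (A \<times> B \<times> C) (fst z, snd z, t) \<partial>\<kappa> z) \<partial>(X >< Y))"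
      by (rule int) (use ABC in simp)
    also have "\<dots> = (\<integral>\<^sup>+z\<in>A \<times> B. (case z of (x, y) \<Rightarrow> emeasure (s x y) C) \<partial>(X >< Y))"
    proof (intro nn_integral_cong)
      fix q assume q: "q \<in> space (X >< Y)"
      then have \<kappa>q: "\<kappa> q \<in> Mtri" using \<kappa> by (simp add: Mkernel_def)
      have "(\<integral>\<^sup>+t. ind (A \<times> B \<times> C) (fst q, snd q, t) \<partial>\<kappa> q) = (\<integral>\<^sup>+t. ind (A \<times> B) q * ind C t \<partial>\<kappa> q)" (is "?L21 = _")
        by (intro nn_integral_cong) (cases q, auto simp: indicator_def)
      also have "\<dots> = ind (A \<times> B) q * emeasure (\<kappa> q) C"
      proof -
        have "C \<in> sets (\<kappa> q)" using C MtriD(1)[OF \<kappa>q] by simp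
        then show ?thesis by (subst nn_integral_cmult) auto
      qed
      finally show "?L21 =
          (case q of (x, y) \<Rightarrow> emeasure (s x y) C) * ind (A \<times> B) q"
        by (simp add: \<kappa>_def case_prod_beta' mult.commute)
    qed
    also have "\<dots> = emeasure u (A \<times> B \<times> C)"
      using g A B C by (simp add: given_by_def)
    finally show "emeasure u (A \<times> B \<times> C) = emeasure u2 (A \<times> B \<times> C)" by simp
  qed
  then show ?thesis using int[OF k] by (simp add: \<kappa>_def)
qed

lemma emeasure_mult_conv:
  assumes s: "s \<in> Mtri" and s': "s' \<in> Mtri" and C: "C \<in> sets Rpos"
  shows "emeasure (mult_conv s s') C = (\<integral>\<^sup>+b. (\<integral>\<^sup>+a. ind C (a * b) \<partial>s) \<partial>s')"
proof -
  interpret s: finite_measure s by (rule MtriD[OF s])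
  interpret s': finite_measure s' by (rule MtriD[OF s'])
  interpret P: pair_sigma_finite s s' ..
  have sets: "sets (s >< s') = sets (Rpos >< Rpos)"
    by (intro sets_pair_measure_cong MtriD s s')
  have "(\<lambda>z. fst z * snd z) \<in> measurable (Rpos >< Rpos) Rpos"
    unfolding measurable_Rpos_iff by (auto simp: space_pair_measure)
  then have m: "(\<lambda>(a, b). a * b) \<in> measurable (s >< s') Rpos"
    by (subst measurable_cong_sets[OF sets refl]) (simp add: case_prod_beta')
  have mi: "(\<lambda>z. ind C (fst z * snd z) :: ennreal) \<in> borel_measurable (s >< s')"
    using measurable_compose[OF m, of "ind C" borel] C by (simp add: case_prod_beta')
  have "emeasure (mult_conv s s') C = (\<integral>\<^sup>+z. ind C z \<partial>mult_conv s s')"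
    using C by (simp add: mult_conv_def)
  also have "\<dots> = (\<integral>\<^sup>+z. ind C (fst z * snd z) \<partial>(s >< s'))"
    unfolding mult_conv_def by (subst nn_integral_distr[OF m]) (use C in \<open>auto simp: case_prod_beta'\<close>)
  also have "\<dots> = (\<integral>\<^sup>+b. (\<integral>\<^sup>+a. ind C (a * b) \<partial>s) \<partial>s')"
    using P.nn_integral_snd[of "\<lambda>z. ind C (fst z * snd z)"] mi by (simp add: case_prod_beta')
  finally show ?thesis .
qed

text \<open>A chain of exchanges of integrals: open \<open>u\<close> by its kernel, integrate out
  its \<open>t\<close> to obtain \<open>H\<close>, trade the randomization for \<open>v\<close> by
  \<open>is_rand\<close>, and open \<open>v\<close> by its kernel.\<close>

lemma comp_continuous:
  assumes X: "prob_space X" and Y: "prob_space Y" and W: "prob_space W"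
    and u: "given_by X Y u s" and v: "given_by Y W v s'"
    and r: "is_rand Y W v \<sigma> Q" and c: "is_comp X W u \<sigma> Q p" and p: "p \<in> Pol X W"
    and A: "A \<in> sets X" and B: "B \<in> sets W" and C: "C \<in> sets Rpos"
  shows "emeasure p (A \<times> B \<times> C) =
    (\<integral>\<^sup>+z\<in>A \<times> B. (case z of (x, w) \<Rightarrow>
                \<integral>\<^sup>+y. emeasure (mult_conv (s x y) (s' y w)) C \<partial>Y) \<partial>(X >< W))"
proof -
  interpret X: prob_space X by fact
  interpret Y: prob_space Y by fact
  interpret W: prob_space W by fact
  interpret Om: prob_space Om by (rule prob_space_Om)
  interpret XY: pair_prob_space X Y ..
  interpret YW: pair_prob_space Y W ..
  interpret XW: pair_prob_space X W ..
  have uP: "u \<in> Pol X Y" and vP: "v \<in> Pol Y W" using u v by (auto simp: given_by_def)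
  interpret u: prob_space u by (rule Pol_prob[OF X Y uP])
  note [measurable] = A B C Pol_fst[OF X Y uP] Pol_snd[OF X Y uP] Pol_t[OF X Y uP]
  have \<sigma>m [measurable]: "\<sigma> \<in> measurable (Y >< Om) Rpos" and [measurable]: "Q B \<in> sets (Y >< Om)"
    and rB: "\<And>h. h\<in>borel_measurable (Y >< Rpos) \<Longrightarrow>
        (\<integral>\<^sup>+z. h (fst z, tc z) * ind B (yc z) \<partial>v) =
        (\<integral>\<^sup>+z. h (fst z, \<sigma> z) * ind (Q B) z \<partial>(Y >< Om))"
    using r B unfolding is_rand_def by blast+
  define \<kappa> where "\<kappa> z = s (fst z) (snd z)" for z
  define \<kappa>' where "\<kappa>' z = s' (fst z) (snd z)" for z
  have \<kappa>: "Mkernel (X >< Y) \<kappa>" unfolding \<kappa>_def by (rule given_by_kernel[OF u])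
  have \<kappa>': "Mkernel (Y >< W) \<kappa>'" unfolding \<kappa>'_def by (rule given_by_kernel[OF v])
  \<comment> \<open>The mass that the kernel of \<open>u\<close> at a pair of points gives to those
    \<open>a\<close> with \<open>a * b\<close> in \<open>C\<close>, as a function of the pair and of
    \<open>b\<close>.\<close>
  define H where "H z = (\<integral>\<^sup>+a. ind C (a * snd z) \<partial>\<kappa> (fst z))" for z
  have H [measurable]: "H \<in> borel_measurable ((X >< Y) >< Rpos)"
  proof -
    have 1: "Mkernel ((X >< Y) >< Rpos) (\<lambda>z. \<kappa> (fst z))" by (rule Mkernel_comp[OF \<kappa>]) measurable
    have "(\<lambda>q. snd q * snd (fst q)) \<in> measurable (((X >< Y) >< Rpos) >< Rpos) Rpos"
      unfolding measurable_Rpos_iff by (auto simp: space_pair_measure)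
    then have 2: "(\<lambda>q. ind C (snd q * snd (fst q)) :: ennreal) \<in> borel_measurable (((X >< Y) >< Rpos) >< Rpos)"
      using C by measurable
    show ?thesis unfolding H_def using Mkernel_nn_integral[OF 1 2] by simp
  qed
  have tm [measurable]: "(\<lambda>z. tc (fst z) * \<sigma> (yo z)) \<in> measurable (u >< Om) Rpos"
  proof -
    have "(\<lambda>z. tc (fst z)) \<in> measurable (u >< Om) Rpos" "(\<lambda>z. \<sigma> (yo z)) \<in> measurable (u >< Om) Rpos"
      by measurable
    then show ?thesis unfolding measurable_Rpos_iff by auto
  qed
  have tm' [measurable]: "(\<lambda>z. tc (fst z) * \<sigma> (yo z)) \<in> measurable ((triple X Y) >< Om) Rpos"
  proof -
    have "(\<lambda>z. tc (fst z)) \<in> measurable ((triple X Y) >< Om) Rpos" "(\<lambda>z. \<sigma> (yo z)) \<in> measurable ((triple X Y) >< Om) Rpos"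
      by measurable
    then show ?thesis unfolding measurable_Rpos_iff by auto
  qed
  have ABC: "A \<times> B \<times> C \<in> sets p" unfolding Pol_sets[OF X W p] by auto
  have "emeasure p (A \<times> B \<times> C) = (\<integral>\<^sup>+z. ind (A \<times> B \<times> C) z \<partial>p)" using ABC by simp
  also have "\<dots> = (\<integral>\<^sup>+z. (\<lambda>q. ind A (fst q) * ind C (snd q)) (fst z, tc z) * ind B (yc z) \<partial>p)"
    by (intro nn_integral_cong) (auto simp: indicator_def)
  also have "\<dots> = (\<integral>\<^sup>+z. (\<lambda>q. ind A (fst q) * ind C (snd q)) (fst (fst z), tc (fst z) * \<sigma> (yo z)) *
        ind (Q B) (yo z) \<partial>(u >< Om))"
    by (rule c[unfolded is_comp_def, rule_format, OF B, of "\<lambda>q. ind A (fst q) * ind C (snd q)"]) measurable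
  also have "\<dots> = (\<integral>\<^sup>+z. (\<integral>\<^sup>+\<omega>. ind A (fst z) * ind C (tc z * \<sigma> (yc z, \<omega>)) *
        ind (Q B) (yc z, \<omega>) \<partial>Om) \<partial>u)"
    by (subst Om.nn_integral_fst[symmetric]) auto
  also have "\<dots> = (\<integral>\<^sup>+q. (\<integral>\<^sup>+t. (\<integral>\<^sup>+\<omega>. ind A (fst q) * ind C (t * \<sigma> (snd q, \<omega>)) *
        ind (Q B) (snd q, \<omega>) \<partial>Om) \<partial>\<kappa> q) \<partial>(X >< Y))"
    unfolding \<kappa>_def by (subst given_by_nn_integral[OF X Y u]) (auto intro!: Om.borel_measurable_nn_integral simp: case_prod_beta')
  also have "\<dots> = (\<integral>\<^sup>+q. ind A (fst q) * (\<integral>\<^sup>+\<omega>. H (q, \<sigma> (snd q, \<omega>)) * ind (Q B) (snd q, \<omega>) \<partial>Om) \<partial>(X >< Y))"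
  proof (intro nn_integral_cong)
    fix q assume q: "q \<in> space (X >< Y)"
    then have \<kappa>q: "\<kappa> q \<in> Mtri" using \<kappa> by (simp add: Mkernel_def)
    have y [measurable]: "snd q \<in> space Y" using q by (auto simp: space_pair_measure)
    interpret k: sigma_finite_measure "\<kappa> q" by (rule MtriD[OF \<kappa>q])
    interpret kO: pair_sigma_finite "\<kappa> q" Om ..
    have sp: "sets (\<kappa> q >< Om) = sets (Rpos >< Om)"
      by (rule sets_pair_measure_cong[OF MtriD(1)[OF \<kappa>q] refl])
    have jm: "(\<lambda>z. ind A (fst q) * ind C (fst z * \<sigma> (snd q, snd z)) * ind (Q B) (snd q, snd z) :: ennreal)
        \<in> borel_measurable (\<kappa> q >< Om)"
    proof (subst measurable_cong_sets[OF sp refl])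
      have "fst \<in> measurable (Rpos >< Om) Rpos" "(\<lambda>z. \<sigma> (snd q, snd z)) \<in> measurable (Rpos >< Om) Rpos"
        by measurable
      then have [measurable]: "(\<lambda>z. fst z * \<sigma> (snd q, snd z)) \<in> measurable (Rpos >< Om) Rpos"
        unfolding measurable_Rpos_iff by auto
      show "(\<lambda>z. ind A (fst q) * ind C (fst z * \<sigma> (snd q, snd z)) * ind (Q B) (snd q, snd z) :: ennreal)
        \<in> borel_measurable (Rpos >< Om)" by measurable
    qed
    have "(\<integral>\<^sup>+t. (\<integral>\<^sup>+\<omega>. ind A (fst q) * ind C (t * \<sigma> (snd q, \<omega>)) * ind (Q B) (snd q, \<omega>) \<partial>Om) \<partial>\<kappa> q) =
        (\<integral>\<^sup>+\<omega>. (\<integral>\<^sup>+t. ind A (fst q) * ind C (t * \<sigma> (snd q, \<omega>)) * ind (Q B) (snd q, \<omega>) \<partial>\<kappa> q) \<partial>Om)" (is "?L23 = _")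
      by (rule kO.Fubini'[symmetric]) (use jm in \<open>simp add: case_prod_beta'\<close>)
    also have "\<dots> = (\<integral>\<^sup>+\<omega>. ind A (fst q) * (H (q, \<sigma> (snd q, \<omega>)) * ind (Q B) (snd q, \<omega>)) \<partial>Om)"
    proof (intro nn_integral_cong)
      fix \<omega> assume \<omega>: "\<omega> \<in> space Om"
      have "0 < \<sigma> (snd q, \<omega>)"
        using measurable_space[OF \<sigma>m, of "(snd q, \<omega>)"] by (simp add: space_pair_measure y \<omega>)
      then have "(\<lambda>t. t * \<sigma> (snd q, \<omega>)) \<in> measurable Rpos Rpos"
        unfolding measurable_Rpos_iff by auto
      then have "(\<lambda>t. ind C (t * \<sigma> (snd q, \<omega>)) :: ennreal) \<in> borel_measurable Rpos" by measurable
      then have im: "(\<lambda>t. ind C (t * \<sigma> (snd q, \<omega>)) :: ennreal) \<in> borel_measurable (\<kappa> q)"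
        by (subst measurable_cong_sets[OF MtriD(1)[OF \<kappa>q] refl])
      have "(\<integral>\<^sup>+t. ind A (fst q) * ind C (t * \<sigma> (snd q, \<omega>)) * ind (Q B) (snd q, \<omega>) \<partial>\<kappa> q) =
          (\<integral>\<^sup>+t. ind C (t * \<sigma> (snd q, \<omega>)) * (ind A (fst q) * ind (Q B) (snd q, \<omega>)) \<partial>\<kappa> q)" (is "?L22 = _")
        by (simp add: mult_ac)
      also have "\<dots> = H (q, \<sigma> (snd q, \<omega>)) * (ind A (fst q) * ind (Q B) (snd q, \<omega>))"
        unfolding H_def by (subst nn_integral_multc[OF im]) simp
      finally show "?L22 =
         ind A (fst q) * (H (q, \<sigma> (snd q, \<omega>)) * ind (Q B) (snd q, \<omega>))" by (simp add: mult_ac)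
    qed
    also have "\<dots> = ind A (fst q) * (\<integral>\<^sup>+\<omega>. H (q, \<sigma> (snd q, \<omega>)) * ind (Q B) (snd q, \<omega>) \<partial>Om)"
      using q by (intro nn_integral_cmult) measurable
    finally show "?L23 = \<dots>" .
  qed
  also have "\<dots> = (\<integral>\<^sup>+x. (\<integral>\<^sup>+y. ind A x * (\<integral>\<^sup>+\<omega>. H ((x, y), \<sigma> (y, \<omega>)) * ind (Q B) (y, \<omega>) \<partial>Om) \<partial>Y) \<partial>X)"
    by (subst Y.nn_integral_fst[symmetric]) (auto intro!: borel_measurable_times_ennreal Om.borel_measurable_nn_integral simp: case_prod_beta')
  \<comment> \<open>For fixed \<open>x\<close>, the integral over \<open>y\<close> and the
    randomness is an integral over \<open>v\<close>, restricted to second coordinate in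
    \<open>B\<close>.\<close>
  also have "\<dots> = (\<integral>\<^sup>+x. ind A x * (\<integral>\<^sup>+z. H ((x, fst z), tc z) * ind B (yc z) \<partial>v) \<partial>X)"
  proof (intro nn_integral_cong)
    fix x assume x [measurable]: "x \<in> space X"
    have "(\<integral>\<^sup>+y. ind A x * (\<integral>\<^sup>+\<omega>. H ((x, y), \<sigma> (y, \<omega>)) * ind (Q B) (y, \<omega>) \<partial>Om) \<partial>Y) =
        ind A x * (\<integral>\<^sup>+y. (\<integral>\<^sup>+\<omega>. H ((x, y), \<sigma> (y, \<omega>)) * ind (Q B) (y, \<omega>) \<partial>Om) \<partial>Y)" (is "?L24 = _")
      by (rule nn_integral_cmult) (auto intro!: Om.borel_measurable_nn_integral simp: case_prod_beta')
    also have "(\<integral>\<^sup>+y. (\<integral>\<^sup>+\<omega>. H ((x, y), \<sigma> (y, \<omega>)) * ind (Q B) (y, \<omega>) \<partial>Om) \<partial>Y) =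
        (\<integral>\<^sup>+z. (\<lambda>q. H ((x, fst q), snd q)) (fst z, \<sigma> z) * ind (Q B) z \<partial>(Y >< Om))"
      by (subst Om.nn_integral_fst[symmetric]) auto
    also have "\<dots> = (\<integral>\<^sup>+z. (\<lambda>q. H ((x, fst q), snd q)) (fst z, tc z) * ind B (yc z) \<partial>v)"
      by (rule rB[symmetric]) measurable
    finally show "?L24 =
        ind A x * (\<integral>\<^sup>+z. H ((x, fst z), tc z) * ind B (yc z) \<partial>v)" by simp
  qed
  also have "\<dots> = (\<integral>\<^sup>+x. ind A x * (\<integral>\<^sup>+q. (\<integral>\<^sup>+b. H ((x, fst q), b) * ind B (snd q) \<partial>\<kappa>' q) \<partial>(Y >< W)) \<partial>X)"
  proof (intro nn_integral_cong arg_cong2[where f = "(*)"] refl)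
    fix x assume x [measurable]: "x \<in> space X"
    show "(\<integral>\<^sup>+z. H ((x, fst z), tc z) * ind B (yc z) \<partial>v) =
        (\<integral>\<^sup>+q. (\<integral>\<^sup>+b. H ((x, fst q), b) * ind B (snd q) \<partial>\<kappa>' q) \<partial>(Y >< W))"
      unfolding \<kappa>'_def by (subst given_by_nn_integral[OF Y W v]) auto
  qed
  also have "\<dots> = (\<integral>\<^sup>+x. (\<integral>\<^sup>+w. (\<integral>\<^sup>+y. ind A x * (ind B w * (\<integral>\<^sup>+b. H ((x, y), b) \<partial>\<kappa>' (y, w))) \<partial>Y) \<partial>W) \<partial>X)"
  proof (intro nn_integral_cong)
    fix x assume x [measurable]: "x \<in> space X"
    have m: "(\<lambda>q. \<integral>\<^sup>+b. H ((x, fst q), b) \<partial>\<kappa>' q) \<in> borel_measurable (Y >< W)"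
      using Mkernel_nn_integral[OF \<kappa>', of "\<lambda>z. H ((x, fst (fst z)), snd z)"] by simp
    then have m': "(\<lambda>q. ind A x * (ind B (snd q) * (\<integral>\<^sup>+b. H ((x, fst q), b) \<partial>\<kappa>' q))) \<in> borel_measurable (Y >< W)"
      by measurable
    have "ind A x * (\<integral>\<^sup>+q. (\<integral>\<^sup>+b. H ((x, fst q), b) * ind B (snd q) \<partial>\<kappa>' q) \<partial>(Y >< W)) =
        ind A x * (\<integral>\<^sup>+q. ind B (snd q) * (\<integral>\<^sup>+b. H ((x, fst q), b) \<partial>\<kappa>' q) \<partial>(Y >< W))" (is "?L25 = _")
    proof (intro arg_cong2[where f = "(*)"] refl nn_integral_cong)
      fix q assume q: "q \<in> space (Y >< W)"
      then have \<kappa>q: "\<kappa>' q \<in> Mtri" using \<kappa>' by (simp add: Mkernel_def)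
      have y [measurable]: "fst q \<in> space Y" using q by (auto simp: space_pair_measure)
      have "(\<lambda>b. H ((x, fst q), b)) \<in> borel_measurable Rpos" by measurable
      then have "(\<lambda>b. H ((x, fst q), b)) \<in> borel_measurable (\<kappa>' q)"
        by (subst measurable_cong_sets[OF MtriD(1)[OF \<kappa>q] refl])
      then show "(\<integral>\<^sup>+b. H ((x, fst q), b) * ind B (snd q) \<partial>\<kappa>' q) = ind B (snd q) * (\<integral>\<^sup>+b. H ((x, fst q), b) \<partial>\<kappa>' q)"
        by (subst nn_integral_multc) (auto simp: mult.commute)
    qed
    also have "\<dots> = (\<integral>\<^sup>+q. ind A x * (ind B (snd q) * (\<integral>\<^sup>+b. H ((x, fst q), b) \<partial>\<kappa>' q)) \<partial>(Y >< W))"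
      by (rule nn_integral_cmult[symmetric]) (use m in measurable)
    also have "\<dots> = (\<integral>\<^sup>+w. (\<integral>\<^sup>+y. ind A x * (ind B w * (\<integral>\<^sup>+b. H ((x, y), b) \<partial>\<kappa>' (y, w))) \<partial>Y) \<partial>W)"
      by (subst YW.nn_integral_snd[symmetric]) (use m' in \<open>auto simp: case_prod_beta'\<close>)
    finally show "?L25 = \<dots>" .
  qed
  also have "\<dots> = (\<integral>\<^sup>+q. (\<integral>\<^sup>+y. ind A (fst q) * (ind B (snd q) * (\<integral>\<^sup>+b. H ((fst q, y), b) \<partial>\<kappa>' (y, snd q))) \<partial>Y) \<partial>(X >< W))"
  proof -
    have "(\<lambda>z. \<integral>\<^sup>+b. H ((fst (fst z), snd z), b) \<partial>\<kappa>' (snd z, snd (fst z))) \<in> borel_measurable ((X >< W) >< Y)"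
    proof -
      have 1: "Mkernel ((X >< W) >< Y) (\<lambda>z. \<kappa>' (snd z, snd (fst z)))"
        by (rule Mkernel_comp[OF \<kappa>', of "\<lambda>z. (snd z, snd (fst z))"]) measurable
      have 2: "(\<lambda>q. H ((fst (fst (fst q)), snd (fst q)), snd q)) \<in> borel_measurable (((X >< W) >< Y) >< Rpos)"
        by measurable
      show ?thesis using Mkernel_nn_integral[OF 1 2] by simp
    qed
    then have "(\<lambda>q. \<integral>\<^sup>+y. ind A (fst q) * (ind B (snd q) * (\<integral>\<^sup>+b. H ((fst q, y), b) \<partial>\<kappa>' (y, snd q))) \<partial>Y) \<in> borel_measurable (X >< W)"
      by (intro Y.borel_measurable_nn_integral) (auto simp: case_prod_beta')
    then show ?thesis by (subst W.nn_integral_fst[symmetric]) auto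
  qed
  also have "\<dots> = (\<integral>\<^sup>+z\<in>A \<times> B. (case z of (x, w) \<Rightarrow>
                \<integral>\<^sup>+y. emeasure (mult_conv (s x y) (s' y w)) C \<partial>Y) \<partial>(X >< W))"
  proof (intro nn_integral_cong)
    fix q assume q: "q \<in> space (X >< W)"
    have "(\<integral>\<^sup>+b. H ((fst q, y), b) \<partial>\<kappa>' (y, snd q)) = emeasure (mult_conv (s (fst q) y) (s' y (snd q))) C"
      if y: "y \<in> space Y" for y
    proof -
      have "s (fst q) y \<in> Mtri" "s' y (snd q) \<in> Mtri" using u v q y by (auto simp: given_by_def space_pair_measure)
      then show ?thesis by (simp add: emeasure_mult_conv C H_def \<kappa>_def \<kappa>'_def)
    qed
    then have "(\<integral>\<^sup>+y. ind A (fst q) * (ind B (snd q) * (\<integral>\<^sup>+b. H ((fst q, y), b) \<partial>\<kappa>' (y, snd q))) \<partial>Y) =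
        (\<integral>\<^sup>+y. ind A (fst q) * (ind B (snd q) * emeasure (mult_conv (s (fst q) y) (s' y (snd q))) C) \<partial>Y)" (is "?L26 = _")
      by (intro nn_integral_cong) simp
    also have "\<dots> = (case q of (x, w) \<Rightarrow> \<integral>\<^sup>+y. emeasure (mult_conv (s x y) (s' y w)) C \<partial>Y) * ind (A \<times> B) q"
      by (cases q) (auto simp: indicator_def)
    finally show "?L26 = \<dots>" .
  qed
  finally show ?thesis .
qed

section \<open>Signed integrals of a composition\<close>

lemma distr_density_indicator:
  assumes F: "F \<in> measurable M K" and S: "S \<in> sets M"
  shows "A \<in> sets K \<Longrightarrow> emeasure (distr (density M (\<lambda>z. ennreal (ind S z))) K F) A = (\<integral>\<^sup>+z. ind A (F z) * ind S z \<partial>M)"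
    and "(k :: _ \<Rightarrow> real) \<in> borel_measurable K \<Longrightarrow>
      (LINT z|distr (density M (\<lambda>z. ennreal (ind S z))) K F. k z) = (LINT z|M. k (F z) * ind S z)"
proof -
  assume A: "A \<in> sets K"
  have FA: "F -` A \<inter> space M \<in> sets M" using F A by (rule measurable_sets)
  have "emeasure (distr (density M (\<lambda>z. ennreal (ind S z))) K F) A = emeasure (density M (\<lambda>z. ennreal (ind S z))) (F -` A \<inter> space M)" (is "?L27 = _")
    using A F by (subst emeasure_distr) auto
  also have "\<dots> = (\<integral>\<^sup>+z. ennreal (ind S z) * ind (F -` A \<inter> space M) z \<partial>M)"
    using FA S by (subst emeasure_density) auto
  also have "\<dots> = (\<integral>\<^sup>+z. ind A (F z) * ind S z \<partial>M)"
    by (intro nn_integral_cong) (auto simp: indicator_def)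
  finally show "?L27 = (\<integral>\<^sup>+z. ind A (F z) * ind S z \<partial>M)" .
next
  assume k: "k \<in> borel_measurable K"
  have "(LINT z|distr (density M (\<lambda>z. ennreal (ind S z))) K F. k z) = (LINT z|density M (\<lambda>z. ennreal (ind S z)). k (F z))" (is "?L28 = _")
    using F k by (intro integral_distr) auto
  also have "\<dots> = (LINT z|M. ind S z *\<^sub>R k (F z))"
    using measurable_compose[OF F k] S by (intro integral_density) auto
  finally show "?L28 = (LINT z|M. k (F z) * ind S z)"
    by (simp add: mult.commute)
qed

text \<open>Equality for all nonnegative integrands says that two image measures coincide; signed
  integrands follow.\<close>

lemma integral_eq_of_nn_integral:
  assumes F: "F \<in> measurable M K" and G: "G \<in> measurable N K" and S: "S \<in> sets M" and S': "S' \<in> sets N"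
    and eq: "\<And>h. h \<in> borel_measurable K \<Longrightarrow> (\<integral>\<^sup>+z. h (F z) * ind S z \<partial>M) = (\<integral>\<^sup>+z. h (G z) * ind S' z \<partial>N)"
    and k: "(k :: _ \<Rightarrow> real) \<in> borel_measurable K"
  shows "(LINT z|M. k (F z) * ind S z) = (LINT z|N. k (G z) * ind S' z)"
proof -
  have "distr (density M (\<lambda>z. ennreal (ind S z))) K F = distr (density N (\<lambda>z. ennreal (ind S' z))) K G"
    by (rule measure_eqI) (use eq in \<open>auto simp: distr_density_indicator[OF F S] distr_density_indicator[OF G S']\<close>)
  then show ?thesis
    using distr_density_indicator(2)[OF F S k] distr_density_indicator(2)[OF G S' k] by simp
qed

text \<open>The conditional expectation, given \<open>y\<close>, of \<open>k\<close> at the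
  derivative on the event \<open>S\<close>. By \<open>cdens_integral\<close> it is the density in
  \<open>y\<close> of the functional that sends \<open>h\<close> to
  \<open>pform h (ind B) k v\<close>, when \<open>S\<close> is \<open>Q B\<close>.\<close>

definition cdens :: "('y \<times> real \<times> real \<Rightarrow> real) \<Rightarrow> ('y \<times> real \<times> real) set \<Rightarrow> (real \<Rightarrow> real) \<Rightarrow> 'y \<Rightarrow> real" where
  "cdens \<sigma> S k y = (LINT \<omega>|Om. k (\<sigma> (y, \<omega>)) * ind S (y, \<omega>))"

context
  fixes X :: "'x measure" and Y :: "'y measure" and W :: "'w measure"
    and v :: "('y \<times> 'w \<times> real) measure" and \<sigma> Q
  assumes X: "prob_space X" and Y: "prob_space Y" and W: "prob_space W"
    and v: "v \<in> Pol Y W" and r: "is_rand Y W v \<sigma> Q"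
begin

lemma rand_measurable [measurable]: "\<sigma> \<in> measurable (Y >< Om) Rpos" "B \<in> sets W \<Longrightarrow> Q B \<in> sets (Y >< Om)"
  using r unfolding is_rand_def by auto

lemma rand_pos: "y \<in> space Y \<Longrightarrow> \<omega> \<in> space Om \<Longrightarrow> 0 < \<sigma> (y, \<omega>)"
  using measurable_space[OF rand_measurable(1), of "(y, \<omega>)"] by (simp add: space_pair_measure)

lemma cdens_bound:
  assumes k: "bfun Rpos k" "\<And>t. 0 < t \<Longrightarrow> \<bar>k t\<bar> \<le> M" and B: "B \<in> sets W"
  shows "bfun Y (cdens \<sigma> (Q B) k)" "\<And>y. y \<in> space Y \<Longrightarrow> \<bar>cdens \<sigma> (Q B) k y\<bar> \<le> M"
proof -
  interpret Om: prob_space Om by (rule prob_space_Om)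
  note [measurable] = bfun_measurable[OF k(1)] B
  have M: "0 \<le> M" using k(2)[of 1] by simp
  have m: "cdens \<sigma> (Q B) k \<in> borel_measurable Y"
    unfolding cdens_def[abs_def] by (rule Om.borel_measurable_lebesgue_integral) measurable
  have b: "\<bar>cdens \<sigma> (Q B) k y\<bar> \<le> M" if y: "y \<in> space Y" for y
  proof -
    have le: "\<bar>k (\<sigma> (y, \<omega>)) * ind (Q B) (y, \<omega>)\<bar> \<le> M" if "\<omega> \<in> space Om" for \<omega>
      using k(2)[OF rand_pos[OF y that]] M by (auto simp: indicator_def)
    have "\<bar>cdens \<sigma> (Q B) k y\<bar> \<le> (LINT \<omega>|Om. \<bar>k (\<sigma> (y, \<omega>)) * ind (Q B) (y, \<omega>)\<bar>)"
      unfolding cdens_def by (rule integral_abs_bound)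
    also have "\<dots> \<le> (LINT \<omega>|Om. M)"
    proof (rule integral_mono)
      have "(\<lambda>\<omega>. k (\<sigma> (y, \<omega>)) * ind (Q B) (y, \<omega>)) \<in> borel_measurable Om" using y by measurable
      then show "integrable Om (\<lambda>\<omega>. \<bar>k (\<sigma> (y, \<omega>)) * ind (Q B) (y, \<omega>)\<bar>)"
        using le by (intro Om.integrable_const_bound[of _ M]) auto
    qed (use le in auto)
    finally show ?thesis by (simp add: Om.prob_space)
  qed
  show "bfun Y (cdens \<sigma> (Q B) k)" using m b by (rule bfunI)
  show "\<And>y. y \<in> space Y \<Longrightarrow> \<bar>cdens \<sigma> (Q B) k y\<bar> \<le> M" by (rule b)
qed

lemma cdens_integral:
  assumes h: "bfun Y h" and k: "bfun Rpos k" and B: "B \<in> sets W"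
  shows "(LINT y|Y. h y * cdens \<sigma> (Q B) k y) = pform h (ind B) k v"
proof -
  interpret Y: prob_space Y by (rule Y)
  interpret Om: prob_space Om by (rule prob_space_Om)
  interpret YO: pair_prob_space Y Om ..
  note [measurable] = bfun_measurable[OF k(1)] bfun_measurable[OF h] B Pol_fst[OF Y W v] Pol_snd[OF Y W v] Pol_t[OF Y W v]
  have km: "(\<lambda>q. h (fst q) * k (snd q)) \<in> borel_measurable (Y >< Rpos)" by measurable
  have S: "{z\<in>space v. yc z \<in> B} \<in> sets v" by measurable
  have "pform h (ind B) k v = (LINT z|v. (\<lambda>q. h (fst q) * k (snd q)) (fst z, tc z) * ind {z\<in>space v. yc z \<in> B} z)"
    unfolding pform_def by (intro Bochner_Integration.integral_cong) (auto simp: indicator_def)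
  also have "\<dots> = (LINT z|(Y >< Om). (\<lambda>q. h (fst q) * k (snd q)) (fst z, \<sigma> z) * ind (Q B) z)"
  proof (rule integral_eq_of_nn_integral[OF _ _ S _ _ km])
    show "(\<integral>\<^sup>+z. g (fst z, tc z) * ind {z\<in>space v. yc z \<in> B} z \<partial>v) = (\<integral>\<^sup>+z. g (fst z, \<sigma> z) * ind (Q B) z \<partial>(Y >< Om))"
      if "g \<in> borel_measurable (Y >< Rpos)" for g
    proof -
      have "(\<integral>\<^sup>+z. g (fst z, tc z) * ind {z\<in>space v. yc z \<in> B} z \<partial>v) = (\<integral>\<^sup>+z. g (fst z, tc z) * ind B (yc z) \<partial>v)"
        by (intro nn_integral_cong) (auto simp: indicator_def)
      then show ?thesis using r B that unfolding is_rand_def by simp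
    qed
  qed measurable
  also have "\<dots> = (LINT y|Y. (LINT \<omega>|Om. h y * k (\<sigma> (y, \<omega>)) * ind (Q B) (y, \<omega>)))"
  proof -
    have "bfun (Y >< Om) (\<lambda>z. h (fst z) * k (\<sigma> z) * ind (Q B) z)"
      by (intro bfun_mult bfun_comp[OF h] bfun_comp[OF k] bfun_indicator) measurable
    then have "integrable (Y >< Om) (\<lambda>z. h (fst z) * k (\<sigma> z) * ind (Q B) z)"
      by (intro bfun_integrable) unfold_locales
    from YO.integral_fst'[OF this] show ?thesis by simp
  qed
  also have "\<dots> = (LINT y|Y. h y * cdens \<sigma> (Q B) k y)"
    unfolding cdens_def by (simp add: mult.assoc)
  finally show ?thesis by simp
qed

context
  fixes u :: "('x \<times> 'y \<times> real) measure" and p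
  assumes u: "u \<in> Pol X Y" and p: "p \<in> Pol X W" and c: "is_comp X W u \<sigma> Q p"
begin

lemma scale_measurable:
  "(\<lambda>z. (yo z)) \<in> measurable (u >< Om) (Y >< Om)"
  "(\<lambda>z. tc (fst z) * \<sigma> (yo z)) \<in> measurable (u >< Om) Rpos"
  "(\<lambda>z. tc (fst z)) \<in> measurable (u >< Om) Rpos"
  "(\<lambda>z. \<sigma> (yo z)) \<in> measurable (u >< Om) Rpos"
  "(\<lambda>z. fst (fst z)) \<in> measurable (u >< Om) X"
proof -
  note [measurable] = Pol_fst[OF X Y u] Pol_snd[OF X Y u] Pol_t[OF X Y u]
  show 1: "(\<lambda>z. (yo z)) \<in> measurable (u >< Om) (Y >< Om)" by measurable
  show 2: "(\<lambda>z. \<sigma> (yo z)) \<in> measurable (u >< Om) Rpos"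
    using measurable_compose[OF 1 rand_measurable(1)] by simp
  show 3: "(\<lambda>z. tc (fst z)) \<in> measurable (u >< Om) Rpos" by measurable
  show "(\<lambda>z. fst (fst z)) \<in> measurable (u >< Om) X" by measurable
  show "(\<lambda>z. tc (fst z) * \<sigma> (yo z)) \<in> measurable (u >< Om) Rpos"
    using 2 3 unfolding measurable_Rpos_iff by auto
qed

lemma pair_prob_Om: "pair_prob_space u Om"
proof -
  interpret Om: prob_space Om by (rule prob_space_Om)
  interpret u: prob_space u by (rule Pol_prob[OF X Y u])
  show ?thesis ..
qed

lemma bfun_Q: "B \<in> sets W \<Longrightarrow> bfun (u >< Om) (\<lambda>z. ind (Q B) (yo z))"
  using bfun_comp[OF bfun_indicator[OF rand_measurable(2)] scale_measurable(1)] by simp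

lemma comp_integral:
  assumes A: "A \<in> sets X" and B: "B \<in> sets W" and f: "bfun Rpos f"
  shows "sform A B f p =
    (LINT z|(u >< Om). ind A (fst (fst z)) * f (tc (fst z) * \<sigma> (yo z)) *
       ind (Q B) (yo z))"
proof -
  note [measurable] = bfun_measurable[OF f] A B Pol_fst[OF X W p] Pol_snd[OF X W p] Pol_t[OF X W p] scale_measurable
  have km: "(\<lambda>q. ind A (fst q) * f (snd q)) \<in> borel_measurable (X >< Rpos)" by measurable
  have S: "{z\<in>space p. yc z \<in> B} \<in> sets p" by measurable
  let ?S = "{z\<in>space (u >< Om). (yo z) \<in> Q B}"
  have S': "?S \<in> sets (u >< Om)"
    using measurable_sets[OF scale_measurable(1) rand_measurable(2)[OF B]] by (simp add: vimage_def Int_def conj_commute)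
  have "sform A B f p = (LINT z|p. (\<lambda>q. ind A (fst q) * f (snd q)) (fst z, tc z) * ind {z\<in>space p. yc z \<in> B} z)"
    unfolding pform_def by (intro Bochner_Integration.integral_cong) (auto simp: indicator_def)
  also have "\<dots> = (LINT z|(u >< Om). (\<lambda>q. ind A (fst q) * f (snd q)) (fst (fst z), tc (fst z) * \<sigma> (yo z)) *
       ind ?S z)"
  proof (rule integral_eq_of_nn_integral[OF _ _ S S' _ km])
    fix g :: "'x \<times> real \<Rightarrow> ennreal" assume g: "g \<in> borel_measurable (X >< Rpos)"
    have "(\<integral>\<^sup>+z. g (fst z, tc z) * ind {z\<in>space p. yc z \<in> B} z \<partial>p) = (\<integral>\<^sup>+z. g (fst z, tc z) * ind B (yc z) \<partial>p)" (is "?L29 = _")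
      by (intro nn_integral_cong) (auto simp: indicator_def)
    also have "\<dots> = (\<integral>\<^sup>+z. g (fst (fst z), tc (fst z) * \<sigma> (yo z)) *
        ind (Q B) (yo z) \<partial>(u >< Om))"
      using c B g unfolding is_comp_def by blast
    also have "\<dots> = (\<integral>\<^sup>+z. g (fst (fst z), tc (fst z) * \<sigma> (yo z)) * ind ?S z \<partial>(u >< Om))"
      by (intro nn_integral_cong) (auto simp: indicator_def)
    finally show "?L29 = \<dots>" .
  qed (measurable, use scale_measurable in measurable)
  also have "\<dots> = (LINT z|(u >< Om). ind A (fst (fst z)) * f (tc (fst z) * \<sigma> (yo z)) *
       ind (Q B) (yo z))"
    by (intro Bochner_Integration.integral_cong) (auto simp: indicator_def)
  finally show ?thesis .
qed

text \<open>When the test function is a product of \<open>g t\<close> and \<open>k s\<close>, the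
  randomness can be integrated out first, and what remains is a \<open>pform\<close> of
  \<open>u\<close>.\<close>

lemma cdens_integral2:
  assumes A: "A \<in> sets X" and B: "B \<in> sets W" and g: "bfun Rpos g" and k: "bfun Rpos k"
  shows "(LINT z|(u >< Om). ind A (fst (fst z)) * (g (tc (fst z)) * k (\<sigma> (yo z))) *
       ind (Q B) (yo z)) = pform (ind A) (cdens \<sigma> (Q B) k) g u"
    and "integrable (u >< Om) (\<lambda>z. ind A (fst (fst z)) * (g (tc (fst z)) * k (\<sigma> (yo z))) *
       ind (Q B) (yo z))"
proof -
  interpret uO: pair_prob_space u Om by (rule pair_prob_Om)
  have b: "bfun (u >< Om) (\<lambda>z. ind A (fst (fst z)) * (g (tc (fst z)) * k (\<sigma> (yo z))) *
       ind (Q B) (yo z))"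
    by (intro bfun_mult bfun_Q B bfun_comp[OF g scale_measurable(3)] bfun_comp[OF k scale_measurable(4)]
        bfun_comp[OF bfun_indicator[OF A] scale_measurable(5)])
  show i: "integrable (u >< Om) (\<lambda>z. ind A (fst (fst z)) * (g (tc (fst z)) * k (\<sigma> (yo z))) *
       ind (Q B) (yo z))"
    by (intro bfun_integrable b) unfold_locales
  have "(LINT z|(u >< Om). ind A (fst (fst z)) * (g (tc (fst z)) * k (\<sigma> (yo z))) *
       ind (Q B) (yo z)) =
    (LINT z|u. (LINT \<omega>|Om. ind A (fst z) * (g (tc z) * k (\<sigma> (yc z, \<omega>))) *
       ind (Q B) (yc z, \<omega>)))" (is "?L30 = _")
    using uO.integral_fst'[OF i] by simp
  also have "\<dots> = (LINT z|u. (LINT \<omega>|Om. (ind A (fst z) * g (tc z)) * (k (\<sigma> (yc z, \<omega>)) *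
       ind (Q B) (yc z, \<omega>))))"
    by (simp only: mult.assoc)
  also have "\<dots> = pform (ind A) (cdens \<sigma> (Q B) k) g u"
    unfolding pform_def cdens_def by (simp add: mult_ac)
  finally show "?L30 = pform (ind A) (cdens \<sigma> (Q B) k) g u" .
qed

lemma comp_bfun:
  assumes A: "A \<in> sets X" and B: "B \<in> sets W" and f: "bfun Rpos f"
  shows "bfun (u >< Om) (\<lambda>z. ind A (fst (fst z)) * f (tc (fst z) * \<sigma> (yo z)) *
       ind (Q B) (yo z))"
  by (intro bfun_mult bfun_Q B bfun_comp[OF f scale_measurable(2)]
      bfun_comp[OF bfun_indicator[OF A] scale_measurable(5)])

text \<open>If \<open>t = 1\<close> on \<open>u\<close>, the test function sees only the derivative
  of \<open>v\<close>, so the variables separate exactly. \<open>\<alpha>\<close> is the density in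
  \<open>y\<close> of the part of \<open>u\<close> over \<open>A\<close>.\<close>

lemma comp_left:
  assumes A: "A \<in> sets X" and B: "B \<in> sets W" and f: "bfun Rpos f" and t1: "AE z in u. tc z = 1"
    and \<alpha>: "bfun Y \<alpha>" "\<And>h. bfun Y h \<Longrightarrow> pform (ind A) h (\<lambda>_. 1) u = (LINT y|Y. \<alpha> y * h y)"
  shows "sform A B f p = pform \<alpha> (ind B) f v"
proof -
  interpret uO: pair_prob_space u Om by (rule pair_prob_Om)
  interpret Om: prob_space Om by (rule prob_space_Om)
  note [measurable] = bfun_measurable[OF f] A B scale_measurable bfun_measurable[OF bfun_Q[OF B]]
    Pol_fst[OF X Y u] Pol_snd[OF X Y u] Pol_t[OF X Y u]
  have "AE z in distr (u >< Om) u fst. tc z = 1"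
    unfolding prob_space.distr_pair_fst[OF prob_space_Om] by (rule t1)
  then have AE: "AE z in u >< Om. tc (fst z) = 1" by (rule AE_distrD[OF measurable_fst])
  have "sform A B f p =
    (LINT z|(u >< Om). ind A (fst (fst z)) * f (tc (fst z) * \<sigma> (yo z)) *
       ind (Q B) (yo z))" by (rule comp_integral[OF A B f])
  also have "\<dots> = (LINT z|(u >< Om). ind A (fst (fst z)) * (1 * f (\<sigma> (yo z))) *
       ind (Q B) (yo z))"
  proof (rule integral_cong_AE)
    show "AE z in u >< Om. ind A (fst (fst z)) * f (tc (fst z) * \<sigma> (yo z)) *
        ind (Q B) (yo z) =
      ind A (fst (fst z)) * (1 * f (\<sigma> (yo z))) * ind (Q B) (yo z)"
      using AE by eventually_elim simp
  qed (rule bfun_measurable[OF comp_bfun[OF A B f]],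
      rule borel_measurable_integrable[OF cdens_integral2(2)[OF A B bfun_const[of Rpos 1] f]])
  also have "\<dots> = pform (ind A) (cdens \<sigma> (Q B) f) (\<lambda>_. 1) u"
    using cdens_integral2(1)[OF A B bfun_const[of Rpos 1] f] by simp
  also have "\<dots> = (LINT y|Y. \<alpha> y * cdens \<sigma> (Q B) f y)"
  proof -
    obtain M where "\<And>t. 0 < t \<Longrightarrow> \<bar>f t\<bar> \<le> M" using bfunD[OF f] by auto
    from cdens_bound(1)[OF f this B] show ?thesis by (rule \<alpha>(2))
  qed
  also have "\<dots> = pform \<alpha> (ind B) f v" by (rule cdens_integral[OF \<alpha>(1) f B])
  finally show ?thesis .
qed

text \<open>The mirror image of \<open>comp_left\<close>. Here \<open>t = 1\<close> on
  \<open>v\<close> has to be transferred to the randomization, and the conditional probability of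
  \<open>B\<close> has to be identified with \<open>\<beta>\<close> almost everywhere.\<close>

lemma comp_right:
  assumes A: "A \<in> sets X" and B: "B \<in> sets W" and f: "bfun Rpos f" and t1: "AE z in v. tc z = 1"
    and \<beta>: "bfun Y \<beta>" "\<And>h. bfun Y h \<Longrightarrow> pform h (ind B) (\<lambda>_. 1) v = (LINT y|Y. h y * \<beta> y)"
  shows "sform A B f p = pform (ind A) \<beta> f u"
proof -
  interpret Y: prob_space Y by (rule Y)
  interpret uO: pair_prob_space u Om by (rule pair_prob_Om)
  interpret Om: prob_space Om by (rule prob_space_Om)
  interpret YO: pair_prob_space Y Om ..
  note [measurable] = bfun_measurable[OF f] A B scale_measurable bfun_measurable[OF bfun_Q[OF B]]
    Pol_fst[OF X Y u] Pol_snd[OF X Y u] Pol_t[OF X Y u] bfun_measurable[OF \<beta>(1)] Pol_fst[OF Y W v] Pol_snd[OF Y W v] Pol_t[OF Y W v]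
  \<comment> \<open>The integrand is the indicator of \<open>t \<noteq> 1\<close>;
    \<open>is_rand\<close> carries its zero integral from \<open>v\<close> to the
    randomization.\<close>
  have AE1: "AE z in Y >< Om. z \<in> Q B \<longrightarrow> \<sigma> z = 1"
  proof -
    have rB: "\<And>h. h\<in>borel_measurable (Y >< Rpos) \<Longrightarrow>
        (\<integral>\<^sup>+z. h (fst z, tc z) * ind B (yc z) \<partial>v) =
        (\<integral>\<^sup>+z. h (fst z, \<sigma> z) * ind (Q B) z \<partial>(Y >< Om))"
      using r B unfolding is_rand_def by blast
    have hm: "(\<lambda>q. if snd q = 1 then 0 else 1 :: ennreal) \<in> borel_measurable (Y >< Rpos)" by measurable
    have "(\<integral>\<^sup>+z. (if \<sigma> z = 1 then 0 else 1) * ind (Q B) z \<partial>(Y >< Om)) =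
        (\<integral>\<^sup>+z. (if tc z = 1 then 0 else 1) * ind B (yc z) \<partial>v)"
      using rB[OF hm] by simp
    also have "\<dots> = (\<integral>\<^sup>+z. 0 \<partial>v)" by (intro nn_integral_cong_AE) (use t1 in eventually_elim, simp)
    also have "\<dots> = 0" by simp
    finally have "AE z in Y >< Om. (if \<sigma> z = 1 then 0 else 1) * ind (Q B) z = (0::ennreal)"
      by (subst (asm) nn_integral_0_iff_AE) auto
    then show ?thesis by eventually_elim (auto split: if_splits)
  qed
  \<comment> \<open>The second coordinate of \<open>u\<close> does not charge null sets of
    \<open>Y\<close>, so the almost sure statement passes from \<open>Y\<close> to
    \<open>u\<close>.\<close>
  have AE2: "AE z in u >< Om. (yo z) \<in> Q B \<longrightarrow> \<sigma> (yo z) = 1"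
  proof -
    have "AE y in Y. AE \<omega> in Om. (y, \<omega>) \<in> Q B \<longrightarrow> \<sigma> (y, \<omega>) = 1" using YO.AE_pair[OF AE1] .
    then have "AE z in u. AE \<omega> in Om. (yc z, \<omega>) \<in> Q B \<longrightarrow> \<sigma> (yc z, \<omega>) = 1"
      by (rule Pol_AE2[OF X Y u])
    then have "AE z in u. AE \<omega> in Om. (fst (snd (fst (z, \<omega>))), snd (z, \<omega>)) \<in> Q B \<longrightarrow> \<sigma> (fst (snd (fst (z, \<omega>))), snd (z, \<omega>)) = 1"
      by simp
    moreover have "{z \<in> space (u >< Om). (yo z) \<in> Q B \<longrightarrow> \<sigma> (yo z) = 1} \<in> sets (u >< Om)"
    proof -
      have "{z \<in> space (Y >< Om). z \<in> Q B \<longrightarrow> \<sigma> z = 1} \<in> sets (Y >< Om)" by measurable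
      from measurable_sets[OF scale_measurable(1) this] show ?thesis
        by (rule back_subst[of "\<lambda>S. S \<in> _"]) (auto simp: space_pair_measure Pol_space[OF X Y u])
    qed
    ultimately show ?thesis by (intro uO.AE_pair_measure) auto
  qed
  have "sform A B f p =
    (LINT z|(u >< Om). ind A (fst (fst z)) * f (tc (fst z) * \<sigma> (yo z)) *
       ind (Q B) (yo z))" by (rule comp_integral[OF A B f])
  also have "\<dots> = (LINT z|(u >< Om). ind A (fst (fst z)) * (f (tc (fst z)) * 1) *
       ind (Q B) (yo z))"
  proof (rule integral_cong_AE)
    show "AE z in u >< Om. ind A (fst (fst z)) * f (tc (fst z) * \<sigma> (yo z)) *
        ind (Q B) (yo z) =
      ind A (fst (fst z)) * (f (tc (fst z)) * 1) * ind (Q B) (yo z)"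
      using AE2 by eventually_elim (auto simp: indicator_def)
  qed (rule bfun_measurable[OF comp_bfun[OF A B f]],
      rule borel_measurable_integrable[OF cdens_integral2(2)[OF A B f bfun_const[of Rpos 1]]])
  also have "\<dots> = pform (ind A) (cdens \<sigma> (Q B) (\<lambda>_. 1)) f u"
    using cdens_integral2(1)[OF A B f bfun_const[of Rpos 1]] by simp
  also have "\<dots> = pform (ind A) \<beta> f u"
  proof -
    have cb: "bfun Y (cdens \<sigma> (Q B) (\<lambda>_. 1))" by (rule cdens_bound(1)[OF bfun_const _ B, of 1 1]) simp
    note [measurable] = bfun_measurable[OF cb]
    \<comment> \<open>Both functions represent the same functional, so their difference is
      orthogonal to itself.\<close>
    let ?d = "\<lambda>y. cdens \<sigma> (Q B) (\<lambda>_. 1) y - \<beta> y"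
    have d: "bfun Y ?d" by (rule bfun_diff[OF cb \<beta>(1)])
    have i: "integrable Y (\<lambda>y. ?d y * g y)" if "bfun Y g" for g
      by (intro bfun_integrable bfun_mult d that) unfold_locales
    have "(LINT y|Y. ?d y * ?d y) = (LINT y|Y. ?d y * cdens \<sigma> (Q B) (\<lambda>_. 1) y) - (LINT y|Y. ?d y * \<beta> y)"
      by (subst Bochner_Integration.integral_diff[symmetric]) (use i[OF cb] i[OF \<beta>(1)] in \<open>auto simp: right_diff_distrib\<close>)
    also have "\<dots> = 0" using cdens_integral[OF d bfun_const[of _ 1] B] \<beta>(2)[OF d] by simp
    finally have "AE y in Y. ?d y * ?d y = 0"
      using i[OF d] by (subst (asm) integral_nonneg_eq_0_iff_AE) auto
    then have "AE y in Y. cdens \<sigma> (Q B) (\<lambda>_. 1) y = \<beta> y" by eventually_elim simp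
    from Pol_AE2[OF X Y u this] have AE3: "AE z in u. ind A (fst z) * cdens \<sigma> (Q B) (\<lambda>_. 1) (yc z) * f (tc z) =
        ind A (fst z) * \<beta> (yc z) * f (tc z)"
      by eventually_elim simp
    show ?thesis
      unfolding pform_def
      by (rule integral_cong_AE[OF borel_measurable_integrable[OF Pol_lfun_integrable[OF X Y u bfun_indicator[OF A] cb bfun_lfun[OF f]]]
            borel_measurable_integrable[OF Pol_lfun_integrable[OF X Y u bfun_indicator[OF A] \<beta>(1) bfun_lfun[OF f]]] AE3])
  qed
  finally show ?thesis .
qed

text \<open>The error has two sources: the mass of \<open>u\<close> outside the cutoff, at most
  \<open>M\<close> times the missing mass of \<open>1 + t\<close>, and the uniform error
  \<open>e\<close> of separating the variables. In the approximating sum the two factors meet only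
  through a \<open>pform\<close> of \<open>u\<close> with a function \<open>cdens\<close> of the
  randomization.\<close>

lemma comp_approx:
  assumes A: "A \<in> sets X" and B: "B \<in> sets W" and f: "ccont f" "\<And>t. 0 < t \<Longrightarrow> \<bar>f t\<bar> \<le> M"
    and I: "finite I" and \<tau>: "\<And>i. ccont (\<tau> i)" and ci: "\<And>i. 0 < c i"
    and e: "\<And>t s. 0 < t \<Longrightarrow> 0 < s \<Longrightarrow> \<bar>f (t * s) * cutoff n t - (\<Sum>i\<in>I. \<tau> i t * f (c i * s))\<bar> \<le> e"
  shows "\<bar>sform A B f p -
      (\<Sum>i\<in>I. pform (ind A) (cdens \<sigma> (Q B) (\<lambda>s. f (c i * s))) (\<tau> i) u)\<bar>
    \<le> M * (2 - pform (\<lambda>_. 1) (\<lambda>_. 1) (\<lambda>t. (1 + t) * cutoff n t) u) + e"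
proof -
  interpret uO: pair_prob_space u Om by (rule pair_prob_Om)
  interpret u: prob_space u by (rule Pol_prob[OF X Y u])
  interpret Om: prob_space Om by (rule prob_space_Om)
  have M: "0 \<le> M" using f(2)[of 1] by simp
  note fb = bounded_continuous_bfun[OF ccont_bounded_continuous[OF f(1)]]
  note \<tau>b = bounded_continuous_bfun[OF ccont_bounded_continuous[OF \<tau>]]
  have fm [measurable]: "f \<in> borel_measurable Rpos" using fb by (rule bfun_measurable)
  have fcb: "bfun Rpos (\<lambda>s. f (c i * s))" for i
  proof (rule bfun_comp[OF fb])
    show "(\<lambda>s. c i * s) \<in> measurable Rpos Rpos" unfolding measurable_Rpos_iff using ci[of i] by auto
  qed
  define G where "G z = ind A (fst (fst z)) * f (tc (fst z) * \<sigma> (yo z)) *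
       ind (Q B) (yo z)" for z :: "('x \<times> 'y \<times> real) \<times> real \<times> real"
  define Gi where "Gi i z = ind A (fst (fst z)) * (\<tau> i (tc (fst z)) * f (c i * \<sigma> (yo z))) *
       ind (Q B) (yo z)" for i and z :: "('x \<times> 'y \<times> real) \<times> real \<times> real"
  have Gint: "integrable (u >< Om) G"
    unfolding G_def[abs_def]
    by (intro bfun_integrable bfun_mult bfun_Q B bfun_comp[OF fb scale_measurable(2)]
        bfun_comp[OF bfun_indicator[OF A] scale_measurable(5)]) unfold_locales
  have Gi: "(LINT z|(u >< Om). Gi i z) = pform (ind A) (cdens \<sigma> (Q B) (\<lambda>s. f (c i * s))) (\<tau> i) u"
    and Giint: "integrable (u >< Om) (Gi i)" for i
    using cdens_integral2[OF A B \<tau>b[of i] fcb[of i]] unfolding Gi_def[abs_def] by auto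
  \<comment> \<open>A pointwise majorant of the error that depends on the \<open>u\<close>
    coordinate only; its integral is the asserted bound.\<close>
  define R where "R z = M * (1 * 1 * ((1 + tc z) - (1 + tc z) * cutoff n (tc z))) + e" for z :: "'x \<times> 'y \<times> real"
  have cl: "lfun (\<lambda>t. (1 + t) * cutoff n t)" by (intro lcont_lfun ccont_lcont ccont_mult cutoff_ccont continuous_intros)
  have int1: "integrable u (\<lambda>z. 1 * 1 * (1 + tc z))" "integrable u (\<lambda>z. 1 * 1 * ((1 + tc z) * cutoff n (tc z)))"
    by (intro Pol_lfun_integrable[OF X Y u, of "\<lambda>_. 1" "\<lambda>_. 1"] bfun_const lfun_one_plus[OF X Y] cl)+
  have Rint: "integrable u R"
    unfolding R_def[abs_def] using int1 by (intro Bochner_Integration.integrable_add integrable_mult_right) (auto simp: right_diff_distrib)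
  have Rval: "(LINT z|u. R z) = M * (2 - pform (\<lambda>_. 1) (\<lambda>_. 1) (\<lambda>t. (1 + t) * cutoff n t) u) + e"
  proof -
    have "(LINT z|u. R z) = M * ((LINT z|u. 1 * 1 * (1 + tc z)) - (LINT z|u. 1 * 1 * ((1 + tc z) * cutoff n (tc z)))) + e"
      unfolding R_def using int1 by (simp add: uO.M1.prob_space)
    then show ?thesis using pform_one_plus[OF X Y u] unfolding pform_def by simp
  qed
  have Rint': "integrable (u >< Om) (\<lambda>z. R (fst z))"
  proof -
    have "integrable (distr (u >< Om) u fst) R" unfolding prob_space.distr_pair_fst[OF prob_space_Om] by (rule Rint)
    then show ?thesis by (rule integrable_distr[OF measurable_fst])
  qed
  have "(LINT z|(u >< Om). R (fst z)) = (LINT z|distr (u >< Om) u fst. R z)"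
    using Rint by (intro integral_distr[symmetric] measurable_fst) (rule borel_measurable_integrable)
  then have RvalO: "(LINT z|(u >< Om). R (fst z)) = M * (2 - pform (\<lambda>_. 1) (\<lambda>_. 1) (\<lambda>t. (1 + t) * cutoff n t) u) + e"
    unfolding prob_space.distr_pair_fst[OF prob_space_Om] Rval .
  have "sform A B f p - (\<Sum>i\<in>I. pform (ind A) (cdens \<sigma> (Q B) (\<lambda>s. f (c i * s))) (\<tau> i) u)
      = (LINT z|(u >< Om). G z) - (\<Sum>i\<in>I. (LINT z|(u >< Om). Gi i z))" (is "?L31 = _")
    unfolding Gi comp_integral[OF A B fb] G_def by simp
  also have "\<dots> = (LINT z|(u >< Om). G z - (\<Sum>i\<in>I. Gi i z))"
    using Gint Giint by (subst Bochner_Integration.integral_diff) auto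
  finally have eq: "?L31 = (LINT z|(u >< Om). G z - (\<Sum>i\<in>I. Gi i z))" .
  have "\<bar>LINT z|(u >< Om). G z - (\<Sum>i\<in>I. Gi i z)\<bar> \<le> (LINT z|(u >< Om). \<bar>G z - (\<Sum>i\<in>I. Gi i z)\<bar>)"
    by (rule integral_abs_bound)
  also have "\<dots> \<le> (LINT z|(u >< Om). R (fst z))"
  proof (rule integral_mono)
    show "integrable (u >< Om) (\<lambda>z. \<bar>G z - (\<Sum>i\<in>I. Gi i z)\<bar>)"
      using Gint Giint by (intro integrable_abs Bochner_Integration.integrable_diff Bochner_Integration.integrable_sum)
    fix z assume z: "z \<in> space (u >< Om)"
    define t where "t = tc (fst z)"
    define s where "s = \<sigma> (yo z)"
    have t: "0 < t" using z by (auto simp: space_pair_measure Pol_space[OF X Y u] t_def)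
    have s: "0 < s" unfolding s_def using z by (intro rand_pos) (auto simp: space_pair_measure Pol_space[OF X Y u])
    have "G z - (\<Sum>i\<in>I. Gi i z) = ind A (fst (fst z)) * ind (Q B) (yo z) * (f (t * s) - (\<Sum>i\<in>I. \<tau> i t * f (c i * s)))"
      unfolding G_def Gi_def t_def s_def by (simp add: sum_distrib_left sum_distrib_right right_diff_distrib mult_ac)
    then have "\<bar>G z - (\<Sum>i\<in>I. Gi i z)\<bar> \<le> \<bar>f (t * s) - (\<Sum>i\<in>I. \<tau> i t * f (c i * s))\<bar>" (is "?L32 \<le> _")
      by (auto simp: indicator_def)
    also have "\<dots> \<le> \<bar>f (t * s) - f (t * s) * cutoff n t\<bar> + \<bar>f (t * s) * cutoff n t - (\<Sum>i\<in>I. \<tau> i t * f (c i * s))\<bar>"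
      by linarith
    also have "\<bar>f (t * s) - f (t * s) * cutoff n t\<bar> \<le> M * (1 * 1 * ((1 + t) - (1 + t) * cutoff n t))"
    proof -
      have "\<bar>f (t * s) - f (t * s) * cutoff n t\<bar> = \<bar>f (t * s)\<bar> * (1 - cutoff n t)"
      proof -
        have "f (t * s) - f (t * s) * cutoff n t = f (t * s) * (1 - cutoff n t)" by (simp add: right_diff_distrib)
        then show ?thesis using cutoff_bounds(2)[of n t] by (simp add: abs_mult)
      qed
      also have "\<dots> \<le> M * (1 - cutoff n t)"
        using cutoff_bounds[of n t] f(2)[of "t * s"] t s by (intro mult_right_mono) auto
      \<comment> \<open>The factor \<open>1 + t \<ge> 1\<close> is inserted to match the quantity
        whose integral is known.\<close>
      also have "\<dots> \<le> M * ((1 + t) * (1 - cutoff n t))"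
        using cutoff_bounds[of n t] t M mult_right_mono[of 1 "1 + t" "1 - cutoff n t"] by (intro mult_left_mono) auto
      finally show ?thesis by (simp add: right_diff_distrib)
    qed
    also have "\<bar>f (t * s) * cutoff n t - (\<Sum>i\<in>I. \<tau> i t * f (c i * s))\<bar> \<le> e" by (rule e[OF t s])
    finally show "?L32 \<le> R (fst z)" unfolding R_def t_def by simp
  qed (rule Rint')
  finally show ?thesis unfolding eq RvalO .
qed

end

end

section \<open>Separation of variables in \<open>f (t * s)\<close>\<close>

lemma ccontD:
  assumes "ccont f"
  shows "\<exists>M l u. 0 \<le> M \<and> (\<forall>t>0. \<bar>f t\<bar> \<le> M) \<and> 0 < l \<and> l < u \<and>
    (\<forall>t>0. t \<notin> {l..u} \<longrightarrow> f t = 0) \<and> continuous_on {0<..} f"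
  by (rule ccontE[OF assms]) blast

text \<open>In the coordinate \<open>ln t\<close> the function has compact support, so it is
  uniformly continuous for the multiplicative structure.\<close>

lemma ccont_log_uniform:
  assumes f: "ccont f" and e: "e > 0"
  shows "\<exists>d>0. \<forall>x>0. \<forall>y>0. \<bar>ln x - ln y\<bar> < d \<longrightarrow> \<bar>f x - f y\<bar> < e"
proof -
  obtain M l u where l: "0 < l" "l < u" and z: "\<And>t. 0 < t \<Longrightarrow> t \<notin> {l..u} \<Longrightarrow> f t = 0" and c: "continuous_on {0<..} f"
    using ccontD[OF f] by blast
  \<comment> \<open>The margin of one unit, together with \<open>\<bar>ln x - ln y\<bar> < 1\<close>
    below, ensures that if one point leaves \<open>?I\<close> then both lie outside the
    support.\<close>
  let ?I = "{ln l - 1..ln u + 1}"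
  have "continuous_on ?I (\<lambda>x. f (exp x))"
    by (rule continuous_on_compose2[OF c]) (auto intro!: continuous_intros)
  then have "uniformly_continuous_on ?I (\<lambda>x. f (exp x))" by (rule compact_uniformly_continuous) auto
  then obtain d where d: "d > 0" "\<And>x y. x \<in> ?I \<Longrightarrow> y \<in> ?I \<Longrightarrow> dist y x < d \<Longrightarrow> dist (f (exp y)) (f (exp x)) < e"
    unfolding uniformly_continuous_on_def using e by metis
  have "\<bar>f x - f y\<bar> < e" if xy: "0 < x" "0 < y" "\<bar>ln x - ln y\<bar> < min d 1" for x y
  proof (cases "ln x \<in> ?I \<and> ln y \<in> ?I")
    case True
    then show ?thesis using d(2)[of "ln y" "ln x"] xy by (auto simp: dist_real_def)
  next
    case False
    then have out: "ln x \<notin> {ln l..ln u}" "ln y \<notin> {ln l..ln u}" using xy by auto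
    have "t \<notin> {l..u}" if "0 < t" "ln t \<notin> {ln l..ln u}" for t using that l by auto
    then have "f x = 0" "f y = 0" using z out xy by auto
    then show ?thesis using e by simp
  qed
  then show ?thesis using d(1) by (intro exI[of _ "min d 1"]) auto
qed

text \<open>Only the hats at the integer part of \<open>x\<close> and at its successor can be
  nonzero at \<open>x\<close>, and these two add up to 1; the range up to \<open>N + 1\<close>
  contains both.\<close>

lemma hat_sum:
  fixes x :: real and N :: int
  assumes "\<bar>x\<bar> \<le> of_int N"
  shows "(\<Sum>i\<in>{- N - 1..N + 1}. max 0 (1 - \<bar>x - of_int i\<bar>)) = 1"
proof -
  have "(\<Sum>i\<in>{- N - 1..N + 1}. max 0 (1 - \<bar>x - of_int i\<bar>)) = (\<Sum>i\<in>{\<lfloor>x\<rfloor>, \<lfloor>x\<rfloor> + 1}. max 0 (1 - \<bar>x - of_int i\<bar>))"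
  proof (rule sum.mono_neutral_right)
    have "- N - 1 \<le> \<lfloor>x\<rfloor>" "\<lfloor>x\<rfloor> \<le> N" using assms by linarith+
    then show "{\<lfloor>x\<rfloor>, \<lfloor>x\<rfloor> + 1} \<subseteq> {- N - 1..N + 1}" by simp
    show "\<forall>i\<in>{- N - 1..N + 1} - {\<lfloor>x\<rfloor>, \<lfloor>x\<rfloor> + 1}. max 0 (1 - \<bar>x - of_int i\<bar>) = 0"
    proof
      fix i assume "i \<in> {- N - 1..N + 1} - {\<lfloor>x\<rfloor>, \<lfloor>x\<rfloor> + 1}"
      then have "i < \<lfloor>x\<rfloor> \<or> i > \<lfloor>x\<rfloor> + 1" by auto
      then have "1 \<le> \<bar>x - of_int i\<bar>" by linarith
      then show "max 0 (1 - \<bar>x - of_int i\<bar>) = 0" by simp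
    qed
  qed simp
  also have "\<dots> = 1"
  proof -
    have "max 0 (1 - \<bar>x - of_int \<lfloor>x\<rfloor>\<bar>) = 1 - (x - of_int \<lfloor>x\<rfloor>)" by linarith
    moreover have "max 0 (1 - \<bar>x - of_int (\<lfloor>x\<rfloor> + 1)\<bar>) = x - of_int \<lfloor>x\<rfloor>" by (simp add: abs_if max_def)
    moreover have "(\<Sum>i\<in>{\<lfloor>x\<rfloor>, \<lfloor>x\<rfloor> + 1}. max 0 (1 - \<bar>x - of_int i\<bar>)) =
        max 0 (1 - \<bar>x - of_int \<lfloor>x\<rfloor>\<bar>) + max 0 (1 - \<bar>x - of_int (\<lfloor>x\<rfloor> + 1)\<bar>)"
      by (subst sum.insert) auto
    ultimately show ?thesis by linarith
  qed
  finally show ?thesis .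
qed

text \<open>A continuous partition of unity in \<open>ln t\<close> separates the variables of \<open>f (t * s)\<close> up to a
  uniform error.\<close>

lemma scaling_approx:
  assumes f: "ccont f" and e: "e > 0"
  shows "\<exists>(I :: int set) \<tau> c. finite I \<and> (\<forall>i. ccont (\<tau> i)) \<and> (\<forall>i. 0 < c i) \<and>
    (\<forall>t>0. \<forall>s>0. \<bar>f (t * s) * cutoff n t - (\<Sum>i\<in>I. \<tau> i t * f (c i * s))\<bar> \<le> e)"
proof -
  obtain d where d: "d > 0" "\<And>x y. 0 < x \<Longrightarrow> 0 < y \<Longrightarrow> \<bar>ln x - ln y\<bar> < d \<Longrightarrow> \<bar>f x - f y\<bar> < e"
    using ccont_log_uniform[OF f e] by metis
  obtain M l u where l: "0 < l" "l < u" and z: "\<And>t. 0 < t \<Longrightarrow> t \<notin> {l..u} \<Longrightarrow> cutoff n t = 0"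
    using ccontD[OF cutoff_ccont[of n]] by blast
  \<comment> \<open>Enough nodes, spaced by \<open>d\<close> in \<open>ln t\<close>, to cover the
    support of the cutoff.\<close>
  define N where "N = \<lceil>(\<bar>ln l\<bar> + \<bar>ln u\<bar>) / d\<rceil>"
  define I where "I = {- N - 1..N + 1}"
  define hat where "hat i t = max 0 (1 - \<bar>ln t / d - of_int i\<bar>)" for i :: int and t
  define \<tau> where "\<tau> i t = cutoff n t * hat i t" for i t
  \<comment> \<open>The node with index \<open>i\<close>; the hat centred there is nonzero only
    where \<open>ln t\<close> is within \<open>d\<close> of \<open>ln (c i)\<close>, so that
    \<open>f (t * s)\<close> and \<open>f (c i * s)\<close> are close for every
    \<open>s\<close>.\<close>
  define c where "c i = exp (d * of_int i)" for i :: int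
  have hatc: "continuous_on {0<..} (hat i)" for i unfolding hat_def using d(1) by (intro continuous_intros) auto
  have \<tau>: "ccont (\<tau> i)" for i
    unfolding \<tau>_def[abs_def] by (intro ccont_mult(1) cutoff_ccont hatc)
  have "\<bar>f (t * s) * cutoff n t - (\<Sum>i\<in>I. \<tau> i t * f (c i * s))\<bar> \<le> e" if t: "0 < t" and s: "0 < s" for t s
  proof (cases "t \<in> {l..u}")
    case False
    then show ?thesis using z[OF t] e by (simp add: \<tau>_def)
  next
    case True
    have "ln l \<le> ln t" "ln t \<le> ln u" using True l by auto
    then have "\<bar>ln t\<bar> \<le> \<bar>ln l\<bar> + \<bar>ln u\<bar>" by linarith
    then have "\<bar>ln t / d\<bar> \<le> (\<bar>ln l\<bar> + \<bar>ln u\<bar>) / d" using d(1) by (simp add: divide_right_mono)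
    also have "\<dots> \<le> of_int N" unfolding N_def by (rule le_of_int_ceiling)
    finally have sum1: "(\<Sum>i\<in>I. hat i t) = 1" unfolding I_def hat_def by (rule hat_sum)
    have h0: "0 \<le> hat i t" for i by (simp add: hat_def)
    have "f (t * s) * cutoff n t - (\<Sum>i\<in>I. \<tau> i t * f (c i * s)) = f (t * s) * cutoff n t * (\<Sum>i\<in>I. hat i t) - (\<Sum>i\<in>I. \<tau> i t * f (c i * s))"
      by (simp add: sum1)
    also have "\<dots> = (\<Sum>i\<in>I. cutoff n t * (hat i t * (f (t * s) - f (c i * s))))"
      unfolding \<tau>_def by (simp add: sum_distrib_left sum_subtractf[symmetric] algebra_simps)
    finally have "\<bar>f (t * s) * cutoff n t - (\<Sum>i\<in>I. \<tau> i t * f (c i * s))\<bar> = \<bar>\<Sum>i\<in>I. cutoff n t * (hat i t * (f (t * s) - f (c i * s)))\<bar>"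
      by simp
    also have "\<dots> \<le> (\<Sum>i\<in>I. \<bar>cutoff n t * (hat i t * (f (t * s) - f (c i * s)))\<bar>)" by (rule sum_abs)
    also have "\<dots> \<le> (\<Sum>i\<in>I. hat i t * e)"
    proof (rule sum_mono)
      fix i
      have "hat i t * \<bar>f (t * s) - f (c i * s)\<bar> \<le> hat i t * e"
      proof (cases "hat i t = 0")
        case False
        then have "\<bar>ln t / d - of_int i\<bar> < 1" by (auto simp: hat_def max_def split: if_splits)
        then have "\<bar>ln t / d - of_int i\<bar> * d < d" using d(1) by simp
        moreover have "\<bar>ln t / d - of_int i\<bar> * d = \<bar>(ln t / d - of_int i) * d\<bar>" using d(1) by (simp add: abs_mult)
        moreover have "(ln t / d - of_int i) * d = ln (t * s) - ln (c i * s)"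
        proof -
          have "(ln t / d - of_int i) * d = ln t - of_int i * d" using d(1) by (simp add: field_simps)
          then show ?thesis using t s by (simp add: c_def ln_mult mult.commute)
        qed
        ultimately have "\<bar>f (t * s) - f (c i * s)\<bar> < e" using t s by (intro d(2)) (auto simp: c_def)
        then show ?thesis using h0 by (intro mult_left_mono) auto
      qed simp
      moreover have "\<bar>cutoff n t * (hat i t * (f (t * s) - f (c i * s)))\<bar> \<le> 1 * (hat i t * \<bar>f (t * s) - f (c i * s)\<bar>)"
        unfolding abs_mult using cutoff_bounds[of n t] h0[of i] by (intro mult_mono) auto
      ultimately show "\<bar>cutoff n t * (hat i t * (f (t * s) - f (c i * s)))\<bar> \<le> hat i t * e" by simp
    qed
    also have "\<dots> = e" using sum1 by (simp add: sum_distrib_right[symmetric])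
    finally show ?thesis .
  qed
  then show ?thesis using \<tau> by (intro exI[of _ I] exI[of _ \<tau>] exI[of _ c]) (auto simp: I_def c_def)
qed

text \<open>\<open>c\<close> may change sign, but \<open>c z + C * tc z\<close> lies between 0 and
  \<open>2 * C * tc z\<close>. Since \<open>t * u\<close> projects to \<open>Y\<close>, the image of
  this weight on \<open>Y\<close> has a density \<open>D\<close> between 0 and \<open>2 * C\<close>
  almost everywhere; subtracting \<open>C\<close> gives \<open>\<alpha>\<close>.\<close>

lemma cond_density:
  assumes X: "prob_space X" and Y: "prob_space Y" and u: "u \<in> Pol X Y"
    and c: "c \<in> borel_measurable u" and le: "\<And>z. z \<in> space u \<Longrightarrow> \<bar>c z\<bar> \<le> C * tc z"
  shows "\<exists>\<alpha>. bfun Y \<alpha> \<and> (\<forall>y. \<bar>\<alpha> y\<bar> \<le> C) \<and> (\<forall>h. bfun Y h \<longrightarrow> (LINT z|u. c z * h (yc z)) = (LINT y|Y. \<alpha> y * h y))"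
proof -
  interpret Y: prob_space Y by fact
  interpret u: prob_space u by (rule Pol_prob[OF X Y u])
  note [measurable] = c Pol_snd[OF X Y u] Pol_t[OF X Y u]
  obtain z0 where "z0 \<in> space u" using u.not_empty by blast
  then have "0 \<le> C * tc z0" "0 < tc z0" using le[of z0] by (auto simp: Pol_space[OF X Y u])
  then have C: "0 \<le> C" by (simp add: zero_le_mult_iff)
  have ti: "integrable u (\<lambda>z. tc z * h (yc z))" "(LINT z|u. tc z * h (yc z)) = (LINT y|Y. h y)"
    if h: "bfun Y h" for h
  proof -
    have "lfun (\<lambda>t. t)" unfolding lfun_def by (auto intro!: exI[of _ 1])
    from Pol_lfun_integrable[OF X Y u bfun_const[of X 1] h this]
    show "integrable u (\<lambda>z. tc z * h (yc z))" by (simp add: mult_ac)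
    note [measurable] = bfun_measurable[OF h]
    have "(LINT y|Y. h y) = (LINT y|distr (tmul u) Y (\<lambda>z. yc z). h y)" by (simp add: Pol_distr2[OF X Y u])
    also have "\<dots> = (LINT z|tmul u. h (yc z))"
      by (rule integral_distr) (simp_all add: Pol_tmul[OF X Y u])
    also have "\<dots> = (LINT z|u. tc z *\<^sub>R h (yc z))"
      unfolding Pol_tmul[OF X Y u] by (rule integral_density) (auto simp: Pol_space[OF X Y u])
    finally show "(LINT z|u. tc z * h (yc z)) = (LINT y|Y. h y)" by simp
  qed
  define d where "d z = c z + C * tc z" for z
  have dm [measurable]: "d \<in> borel_measurable u" unfolding d_def[abs_def] by measurable
  have d: "0 \<le> d z" "d z \<le> 2 * C * tc z" if "z \<in> space u" for z using le[OF that] by (auto simp: d_def)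
  have di: "integrable u d"
    by (rule Bochner_Integration.integrable_bound[of _ "\<lambda>z. 2 * C * tc z"])
      (use ti(1)[OF bfun_const[of Y 1]] d in \<open>auto intro!: AE_I2 intro: order_trans[OF _ abs_ge_self]\<close>)
  define N where "N = distr (density u (\<lambda>z. ennreal (d z))) Y (\<lambda>z. yc z)"
  have e: "emeasure N A = ennreal (LINT z|u. d z * ind A (yc z))" if A [measurable]: "A \<in> sets Y" for A
  proof -
    have "emeasure N A = (\<integral>\<^sup>+z. ennreal (d z * ind A (yc z)) \<partial>u)"
      unfolding N_def by (subst emeasure_distr) (auto simp: emeasure_density indicator_def intro!: nn_integral_cong)
    also have "\<dots> = ennreal (LINT z|u. d z * ind A (yc z))"
    proof (rule nn_integral_eq_integral)
      show "integrable u (\<lambda>z. d z * ind A (yc z))"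
        by (rule Bochner_Integration.integrable_bound[OF di]) (auto simp: indicator_def)
    qed (use d in auto)
    finally show ?thesis .
  qed
  interpret N: finite_measure N by (rule finite_measureI) (use e[OF sets.top] in \<open>simp add: N_def\<close>)
  have "absolutely_continuous Y N"
    unfolding absolutely_continuous_def
  proof
    fix A assume A: "A \<in> null_sets Y"
    have "AE z in u. d z * ind A (yc z) = 0"
      using Pol_AE2[OF X Y u AE_not_in[OF A]] by eventually_elim simp
    then have "emeasure N A = 0" using e[of A] A integral_cong_AE[of "\<lambda>z. d z * ind A (yc z)" u "\<lambda>_. 0"] by auto
    then show "A \<in> null_sets N" using A by (intro null_setsI) (auto simp: N_def)
  qed
  then obtain D where D [measurable]: "D \<in> borel_measurable Y" "AE y in Y. RN_deriv Y N y = ennreal (D y)" and D0: "\<And>y. 0 \<le> D y"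
    using Y.real_RN_deriv[OF N.finite_measure_axioms] by (metis N_def sets_distr)
  have N: "N = density Y (\<lambda>y. ennreal (D y))"
    using Y.density_RN_deriv[OF \<open>absolutely_continuous Y N\<close>] density_cong[OF _ _ D(2)] by (simp add: N_def)
  have Di: "integrable Y D"
  proof (rule integrableI_bounded)
    have "(\<integral>\<^sup>+y. ennreal (norm (D y)) \<partial>Y) = emeasure N (space Y)"
      unfolding N using D0 by (subst emeasure_density) (auto intro!: nn_integral_cong)
    then show "(\<integral>\<^sup>+y. ennreal (norm (D y)) \<partial>Y) < \<infinity>" by (metis N.emeasure_finite infinity_ennreal_def top.not_eq_extremum)
  qed (rule D(1))
  \<comment> \<open>Tested on sets \<open>A\<close>: the mass of \<open>d\<close> over
    \<open>A\<close> is at most \<open>2 * C\<close> times the mass of \<open>t\<close> there, which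
    is the measure of \<open>A\<close> in \<open>Y\<close>.\<close>
  have "AE y in Y. 0 \<le> 2 * C - D y"
  proof (rule Y.density_nonneg)
    fix A assume A [measurable]: "A \<in> sets Y"
    have "ennreal (LINT y|Y. D y * ind A y) = ennreal (LINT z|u. d z * ind A (yc z))"
      unfolding e[OF A, symmetric] unfolding N
      using D0 integrable_mult_indicator[OF A Di]
      by (subst nn_integral_eq_integral[symmetric]) (auto simp: emeasure_density ennreal_mult' ennreal_indicator mult.commute)
    moreover have "0 \<le> (LINT y|Y. D y * ind A y)" "0 \<le> (LINT z|u. d z * ind A (yc z))"
      using D0 d by (auto intro!: Bochner_Integration.integral_nonneg_AE AE_I2)
    ultimately have "(LINT y|Y. D y * ind A y) = (LINT z|u. d z * ind A (yc z))" (is "?L33 = _") by simp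
    also have "\<dots> \<le> (LINT z|u. 2 * C * (tc z * ind A (yc z)))"
    proof (rule integral_mono_AE)
      show "integrable u (\<lambda>z. d z * ind A (yc z))"
        by (rule Bochner_Integration.integrable_bound[OF di]) (auto simp: indicator_def)
    qed (use ti(1)[OF bfun_indicator[OF A]] d in \<open>auto simp: indicator_def\<close>)
    also have "\<dots> = 2 * C * (LINT y|Y. ind A y)" using ti(2)[OF bfun_indicator[OF A]] by simp
    finally have "?L33 \<le> 2 * C * (LINT y|Y. ind A y)" .
    moreover have "set_lebesgue_integral Y A (\<lambda>y. 2 * C - D y) = (LINT y|Y. 2 * C * ind A y - D y * ind A y)"
      unfolding set_lebesgue_integral_def by (intro Bochner_Integration.integral_cong) (auto simp: indicator_def)
    moreover have "integrable Y (\<lambda>y. D y * ind A y)" "integrable Y (\<lambda>y. 2 * C * ind A y)"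
      using integrable_mult_indicator[OF A Di] bfun_integrable[OF Y.finite_measure_axioms bfun_indicator[OF A]]
      by (simp_all add: mult.commute)
    ultimately show "0 \<le> set_lebesgue_integral Y A (\<lambda>y. 2 * C - D y)" by simp
  qed (use Di in simp)
  then have GD: "AE y in Y. min (D y) (2 * C) = D y" by eventually_elim simp
  show ?thesis
  \<comment> \<open>Truncation at \<open>2 * C\<close> makes the bound hold at every point instead
    of almost every one.\<close>
  proof (intro exI[of _ "\<lambda>y. min (D y) (2 * C) - C"] conjI allI impI)
    have Gb: "bfun Y (\<lambda>y. min (D y) (2 * C))" by (rule bfunI[of _ _ "2 * C"]) (use D0 C in auto)
    show "bfun Y (\<lambda>y. min (D y) (2 * C) - C)" by (rule bfun_diff[OF Gb bfun_const])
    show "\<bar>min (D y) (2 * C) - C\<bar> \<le> C" for y using D0[of y] C by linarith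
    fix h assume h: "bfun Y h"
    note [measurable] = bfun_measurable[OF h]
    obtain K where K: "0 \<le> K" "\<And>y. y \<in> space Y \<Longrightarrow> \<bar>h y\<bar> \<le> K" using bfunD[OF h] by blast
    have dh: "integrable u (\<lambda>z. d z * h (yc z))"
      by (rule Bochner_Integration.integrable_bound[of _ "\<lambda>z. K * d z"])
        (use di K d measurable_space[OF Pol_snd[OF X Y u]] in \<open>auto simp: abs_mult mult.commute[of K] intro!: mult_left_mono\<close>)
    have "(LINT z|u. d z *\<^sub>R h (yc z)) = (LINT z|density u (\<lambda>z. ennreal (d z)). h (yc z))"
      by (rule integral_density[symmetric]) (auto simp: d)
    also have "\<dots> = (LINT y|N. h y)" unfolding N_def by (rule integral_distr[symmetric]) auto
    also have "\<dots> = (LINT y|Y. D y *\<^sub>R h y)" unfolding N by (rule integral_density) (auto simp: D0)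
    also have "\<dots> = (LINT y|Y. min (D y) (2 * C) * h y)"
      by (rule integral_cong_AE) (use GD in \<open>auto elim: eventually_mono\<close>)
    finally have "(LINT z|u. d z * h (yc z)) = (LINT y|Y. min (D y) (2 * C) * h y)" by simp
    moreover have "(LINT z|u. c z * h (yc z)) = (LINT z|u. d z * h (yc z) - C * (tc z * h (yc z)))"
      by (simp add: d_def algebra_simps)
    ultimately show "(LINT z|u. c z * h (yc z)) = (LINT y|Y. (min (D y) (2 * C) - C) * h y)"
      using dh ti[OF h] bfun_integrable[OF Y.finite_measure_axioms h] bfun_integrable[OF Y.finite_measure_axioms bfun_mult[OF Gb h]]
      by (simp add: left_diff_distrib)
  qed
qed

section \<open>Separate continuity of the composition\<close>

lemma ccont_scale:
  assumes "ccont f" "0 < c" shows "ccont (\<lambda>s. f (c * s))"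
proof -
  obtain M l u where l: "0 < l" "l < u" and z: "\<And>t. 0 < t \<Longrightarrow> t \<notin> {l..u} \<Longrightarrow> f t = 0" and fc: "continuous_on {0<..} f"
    using ccontD[OF assms(1)] by blast
  have "continuous_on {0<..} (\<lambda>s. f (c * s))"
    by (rule continuous_on_compose2[OF fc]) (use assms(2) in \<open>auto intro!: continuous_intros\<close>)
  moreover have "f (c * t) = 0" if "0 < t" "t \<notin> {l / c..u / c}" for t
    using that assms(2) by (intro z) (auto simp: field_simps)
  moreover have "0 < l / c" "l / c < u / c" using l assms(2) by (auto simp: divide_strict_right_mono)
  ultimately show ?thesis unfolding ccont_def by blast
qed

lemma pform_continuous:
  assumes X: "prob_space X" and Y: "prob_space Y" and "bfun X a" "bfun Y b" "lcont f"
    and F: "continuous_map S (pol_topology X Y) F" and s: "s \<in> topspace S"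
  shows "((\<lambda>s. pform a b f (F s)) \<longlongrightarrow> pform a b f (F s)) (atin S s)"
  using F s limitin_pol_tendsto[OF X Y _ assms(3-5)] unfolding continuous_map_atin by blast

text \<open>The randomization is chosen for \<open>v\<close> before \<open>u\<close>, which is what
  continuity in \<open>u\<close> relies on.\<close>

definition comp_op ::
    "'x measure \<Rightarrow> 'y measure \<Rightarrow> 'w measure \<Rightarrow>
     (('x \<times> 'y \<times> real) measure \<Rightarrow> ('y \<times> 'w \<times> real) measure \<Rightarrow> ('x \<times> 'w \<times> real) measure) \<Rightarrow> bool" where
  "comp_op X Y W F \<longleftrightarrow> (\<forall>v\<in>Pol Y W. \<exists>\<sigma> Q. is_rand Y W v \<sigma> Q \<and>
     (\<forall>u\<in>Pol X Y. F u v \<in> Pol X W \<and> is_comp X W u \<sigma> Q (F u v)))"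

lemma comp_op_exists:
  assumes "prob_space X" "prob_space Y" "lebesgue_prob_space W"
  shows "\<exists>F. comp_op X Y W F"
proof -
  have "\<forall>v. \<exists>q. v \<in> Pol Y W \<longrightarrow> is_rand Y W v (fst q) (snd q) \<and>
      (\<forall>u\<in>Pol X Y. \<exists>p\<in>Pol X W. is_comp X W u (fst q) (snd q) p)"
    using comp_exists[OF assms] by (metis fst_conv snd_conv)
  then obtain q where q: "\<And>v. v \<in> Pol Y W \<Longrightarrow> is_rand Y W v (fst (q v)) (snd (q v)) \<and>
      (\<forall>u\<in>Pol X Y. \<exists>p\<in>Pol X W. is_comp X W u (fst (q v)) (snd (q v)) p)" by metis
  define F where "F u v = (SOME p. p \<in> Pol X W \<and> is_comp X W u (fst (q v)) (snd (q v)) p)" for u v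
  have "F u v \<in> Pol X W \<and> is_comp X W u (fst (q v)) (snd (q v)) (F u v)" if "v \<in> Pol Y W" "u \<in> Pol X Y" for u v
    unfolding F_def by (rule someI_ex) (use q that in blast)
  then have "comp_op X Y W F" unfolding comp_op_def using q by blast
  then show ?thesis by blast
qed

context
  fixes X :: "'x measure" and Y :: "'y measure" and W :: "'w measure" and F
  assumes X: "prob_space X" and Y: "prob_space Y" and W: "prob_space W" and F: "comp_op X Y W F"
begin

lemma comp_op_Pol: "u \<in> Pol X Y \<Longrightarrow> v \<in> Pol Y W \<Longrightarrow> F u v \<in> Pol X W"
  using F unfolding comp_op_def by blast

text \<open>With \<open>v\<close> fixed the functions \<open>cdens\<close> do not change, so the
  approximating sum is continuous in \<open>u\<close>. The cutoff error stays small near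
  \<open>u0\<close> because \<open>R n u\<close> is itself continuous in \<open>u\<close>.\<close>

lemma comp_op_continuous1:
  assumes v: "v \<in> Pol Y W"
  shows "continuous_map (pol_topology X Y) (pol_topology X W) (\<lambda>u. F u v)"
proof (rule continuous_map_polI[OF X W])
  obtain \<sigma> Q where r: "is_rand Y W v \<sigma> Q" and c: "\<And>u. u \<in> Pol X Y \<Longrightarrow> is_comp X W u \<sigma> Q (F u v)"
    using F v unfolding comp_op_def by blast
  fix u0 assume "u0 \<in> topspace (pol_topology X Y)"
  then have u0: "u0 \<in> Pol X Y" by (simp add: topspace_pol_topology[OF X Y])
  show "F u0 v \<in> Pol X W" by (rule comp_op_Pol[OF u0 v])
  fix A B f assume A: "A \<in> sets X" and B: "B \<in> sets W" and f: "ccont f"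
  obtain M where M: "0 \<le> M" "\<And>t. 0 < t \<Longrightarrow> \<bar>f t\<bar> \<le> M" using ccontD[OF f] by blast
  let ?T = "atin (pol_topology X Y) u0"
  have id: "continuous_map (pol_topology X Y) (pol_topology X Y) (\<lambda>u. u)" by simp
  have u0': "u0 \<in> topspace (pol_topology X Y)" using u0 by (simp add: topspace_pol_topology[OF X Y])
  note lim = pform_continuous[OF X Y _ _ _ id u0']
  have ev: "\<forall>\<^sub>F u in ?T. u \<in> Pol X Y"
    unfolding eventually_atin using topspace_pol_topology[OF X Y] by (metis DiffD1 openin_topspace u0)
  show "((\<lambda>u. sform A B f (F u v)) \<longlongrightarrow> sform A B f (F u0 v)) ?T"
  proof (rule tendsto_approx)
    fix e :: real assume e: "e > 0"
    define R where "R n u = pform (\<lambda>_. 1) (\<lambda>_. 1) (\<lambda>t. (1 + t) * cutoff n t) u" for n and u :: "('x \<times> 'y \<times> real) measure"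
    \<comment> \<open>The cutoff error \<open>M * d\<close> and the separation error take half of
      \<open>e\<close> each.\<close>
    define d where "d = e / (2 * (M + 1))"
    have d: "d > 0" "M * d \<le> e / 2" using e M(1) by (auto simp: d_def field_simps)
    have "\<forall>\<^sub>F n in sequentially. \<bar>R n u0 - 2\<bar> < d"
      using tendstoD[OF cutoff_tight[OF X Y u0] d(1)] by (simp add: R_def dist_real_def)
    then obtain n where n: "\<bar>R n u0 - 2\<bar> < d" by (auto simp: eventually_sequentially)
    have "((\<lambda>u. R n u) \<longlongrightarrow> R n u0) ?T"
      unfolding R_def by (intro lim bfun_const ccont_lcont ccont_mult cutoff_ccont continuous_intros)
    then have evR: "\<forall>\<^sub>F u in ?T. 2 - d < R n u"
      using order_tendstoD(1)[of "\<lambda>u. R n u" "R n u0" ?T "2 - d"] n by auto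
    have "0 < e / 2" using e by simp
    from scaling_approx[OF f this, of n] obtain I :: "int set" and \<tau> c' where "finite I \<and> (\<forall>i. ccont (\<tau> i)) \<and> (\<forall>i. 0 < c' i) \<and>
        (\<forall>t>0. \<forall>s>0. \<bar>f (t * s) * cutoff n t - (\<Sum>i\<in>I. \<tau> i t * f (c' i * s))\<bar> \<le> e / 2)"
      by (elim exE)
    then have I: "finite I" and \<tau>: "\<And>i. ccont (\<tau> i)" and c': "\<And>i. 0 < c' i"
      and e': "\<And>t s. 0 < t \<Longrightarrow> 0 < s \<Longrightarrow> \<bar>f (t * s) * cutoff n t - (\<Sum>i\<in>I. \<tau> i t * f (c' i * s))\<bar> \<le> e / 2"
      by auto
    define g where "g u = (\<Sum>i\<in>I. pform (ind A) (cdens \<sigma> (Q B) (\<lambda>s. f (c' i * s))) (\<tau> i) u)" for u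
    have err: "\<bar>sform A B f (F u v) - g u\<bar> \<le> e" if u: "u \<in> Pol X Y" "2 - d < R n u" for u
    proof -
      have "\<bar>sform A B f (F u v) - g u\<bar> \<le> M * (2 - R n u) + e / 2"
        unfolding g_def R_def
        by (rule comp_approx[OF X Y W v r u(1) comp_op_Pol[OF u(1) v] c[OF u(1)] A B f M(2) I \<tau> c' e'])
      also have "M * (2 - R n u) \<le> M * d" using u M by (intro mult_left_mono) auto
      finally show ?thesis using d by linarith
    qed
    have fb: "bfun Rpos (\<lambda>s. f (c' i * s))" for i
      by (intro bounded_continuous_bfun ccont_bounded_continuous ccont_scale f c')
    have cb: "bfun Y (cdens \<sigma> (Q B) (\<lambda>s. f (c' i * s)))" for i
      by (rule cdens_bound(1)[OF X Y W v r fb _ B, of _ M]) (use M c' in auto)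
    have "((\<lambda>u. g u) \<longlongrightarrow> g u0) ?T"
      unfolding g_def by (intro tendsto_sum lim bfun_indicator A cb ccont_lcont \<tau>)
    moreover have "\<forall>\<^sub>F u in ?T. \<bar>sform A B f (F u v) - g u\<bar> \<le> e"
      using ev evR by eventually_elim (rule err)
    moreover have "\<bar>sform A B f (F u0 v) - g u0\<bar> \<le> e"
      by (rule err[OF u0]) (use n in auto)
    ultimately show "\<exists>g L. (g \<longlongrightarrow> L) ?T \<and>
      (\<forall>\<^sub>F j in ?T. \<bar>sform A B f (F j v) - g j\<bar> \<le> e) \<and>
      \<bar>sform A B f (F u0 v) - L\<bar> \<le> e" by blast
  qed
qed

text \<open>The randomization varies with \<open>v\<close> in an uncontrolled way, so
  \<open>cdens\<close> offers no continuity. The same sum is rewritten with densities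
  \<open>\<alpha> i\<close> that come from \<open>u\<close> and do not involve
  \<open>v\<close>.\<close>

lemma comp_op_continuous2:
  assumes u: "u \<in> Pol X Y"
  shows "continuous_map (pol_topology Y W) (pol_topology X W) (\<lambda>v. F u v)"
proof (rule continuous_map_polI[OF X W])
  interpret u: prob_space u by (rule Pol_prob[OF X Y u])
  fix v0 assume v0': "v0 \<in> topspace (pol_topology Y W)"
  then have v0: "v0 \<in> Pol Y W" by (simp add: topspace_pol_topology[OF Y W])
  show "F u v0 \<in> Pol X W" by (rule comp_op_Pol[OF u v0])
  fix A B f assume A: "A \<in> sets X" and B: "B \<in> sets W" and f: "ccont f"
  obtain M where M: "0 \<le> M" "\<And>t. 0 < t \<Longrightarrow> \<bar>f t\<bar> \<le> M" using ccontD[OF f] by blast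
  let ?T = "atin (pol_topology Y W) v0"
  have id: "continuous_map (pol_topology Y W) (pol_topology Y W) (\<lambda>u. u)" by simp
  note lim = pform_continuous[OF Y W _ _ _ id v0']
  have ev: "\<forall>\<^sub>F u in ?T. u \<in> Pol Y W"
    unfolding eventually_atin using topspace_pol_topology[OF Y W] by (metis DiffD1 openin_topspace v0)
  show "((\<lambda>v. sform A B f (F u v)) \<longlongrightarrow> sform A B f (F u v0)) ?T"
  proof (rule tendsto_approx)
    fix e :: real assume e: "e > 0"
    define R where "R n = pform (\<lambda>_. 1) (\<lambda>_. 1) (\<lambda>t. (1 + t) * cutoff n t) u" for n
    define d where "d = e / (2 * (M + 1))"
    have d: "d > 0" "M * d \<le> e / 2" using e M(1) by (auto simp: d_def field_simps)
    have "\<forall>\<^sub>F n in sequentially. \<bar>R n - 2\<bar> < d"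
      using tendstoD[OF cutoff_tight[OF X Y u] d(1)] by (simp add: R_def dist_real_def)
    then obtain n where n: "\<bar>R n - 2\<bar> < d" by (auto simp: eventually_sequentially)
    have "0 < e / 2" using e by simp
    from scaling_approx[OF f this, of n] obtain I :: "int set" and \<tau> c' where "finite I \<and> (\<forall>i. ccont (\<tau> i)) \<and> (\<forall>i. 0 < c' i) \<and>
        (\<forall>t>0. \<forall>s>0. \<bar>f (t * s) * cutoff n t - (\<Sum>i\<in>I. \<tau> i t * f (c' i * s))\<bar> \<le> e / 2)"
      by (elim exE)
    then have I: "finite I" and \<tau>: "\<And>i. ccont (\<tau> i)" and c': "\<And>i. 0 < c' i"
      and e': "\<And>t s. 0 < t \<Longrightarrow> 0 < s \<Longrightarrow> \<bar>f (t * s) * cutoff n t - (\<Sum>i\<in>I. \<tau> i t * f (c' i * s))\<bar> \<le> e / 2"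
      by auto
    \<comment> \<open>The support of \<open>\<tau> i\<close> is away from 0, hence
      \<open>\<tau> i t\<close> is at most a multiple of \<open>t\<close> and
      \<open>cond_density\<close> applies.\<close>
    have "\<exists>\<alpha>. bfun Y \<alpha> \<and> (\<forall>h. bfun Y h \<longrightarrow> pform (ind A) h (\<tau> i) u = (LINT y|Y. \<alpha> y * h y))" for i
    proof -
      obtain K l l' where K: "0 \<le> K" "\<And>t. 0 < t \<Longrightarrow> \<bar>\<tau> i t\<bar> \<le> K" and l: "0 < l"
        and z: "\<And>t. 0 < t \<Longrightarrow> t \<notin> {l..l'} \<Longrightarrow> \<tau> i t = 0" using ccontD[OF \<tau>[of i]] by blast
      note [measurable] = A Pol_fst[OF X Y u] Pol_t[OF X Y u] bfun_measurable[OF bounded_continuous_bfun[OF ccont_bounded_continuous[OF \<tau>[of i]]]]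
      have le: "\<bar>ind A (fst z) * \<tau> i (tc z)\<bar> \<le> (K / l) * tc z" if zu: "z \<in> space u" for z
      proof -
        have t: "0 < tc z" using zu by (auto simp: Pol_space[OF X Y u])
        have "\<bar>\<tau> i (tc z)\<bar> \<le> (K / l) * tc z"
        proof (cases "tc z \<in> {l..l'}")
          case True
          then have "K * l \<le> K * tc z" using K by (intro mult_left_mono) auto
          then have "K \<le> (K / l) * tc z" using l by (simp add: field_simps)
          then show ?thesis using K(2)[OF t] by linarith
        next
          case False
          then show ?thesis using z[OF t False] K l t by simp
        qed
        moreover have "0 \<le> (K / l) * tc z" using K l t by simp
        ultimately show ?thesis by (auto simp: indicator_def)
      qed
      have m: "(\<lambda>z. ind A (fst z) * \<tau> i (tc z)) \<in> borel_measurable u" by measurable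
      obtain \<alpha> where \<alpha>: "bfun Y \<alpha>" "\<And>h. bfun Y h \<Longrightarrow> (LINT z|u. (ind A (fst z) * \<tau> i (tc z)) * h (yc z)) = (LINT y|Y. \<alpha> y * h y)"
        using cond_density[OF X Y u m le] by blast
      have "pform (ind A) h (\<tau> i) u = (LINT z|u. (ind A (fst z) * \<tau> i (tc z)) * h (yc z))" for h
        unfolding pform_def by (simp add: mult_ac)
      then show ?thesis using \<alpha> by metis
    qed
    then obtain \<alpha> where \<alpha>: "\<And>i. bfun Y (\<alpha> i)" "\<And>i h. bfun Y h \<Longrightarrow> pform (ind A) h (\<tau> i) u = (LINT y|Y. \<alpha> i y * h y)"
      by metis
    define g where "g v = (\<Sum>i\<in>I. pform (\<alpha> i) (ind B) (\<lambda>s. f (c' i * s)) v)" for v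
    have fb: "bfun Rpos (\<lambda>s. f (c' i * s))" for i
      by (intro bounded_continuous_bfun ccont_bounded_continuous ccont_scale f c')
    have err: "\<bar>sform A B f (F u v) - g v\<bar> \<le> e" if v: "v \<in> Pol Y W" for v
    proof -
      obtain \<sigma> Q where r: "is_rand Y W v \<sigma> Q" and c: "is_comp X W u \<sigma> Q (F u v)"
        using F v u unfolding comp_op_def by blast
      have cb: "bfun Y (cdens \<sigma> (Q B) (\<lambda>s. f (c' i * s)))" for i
        by (rule cdens_bound(1)[OF X Y W v r fb _ B, of _ M]) (use M c' in auto)
      \<comment> \<open>Each term is the integral over \<open>Y\<close> of the product of
        \<open>\<alpha> i\<close> and \<open>cdens\<close>, which can be read as a value for
        \<open>u\<close> or as a value for \<open>v\<close>.\<close>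
      have "g v = (\<Sum>i\<in>I. pform (ind A) (cdens \<sigma> (Q B) (\<lambda>s. f (c' i * s))) (\<tau> i) u)"
        unfolding g_def by (intro sum.cong refl) (simp add: \<alpha>(2)[OF cb] cdens_integral[OF X Y W v r \<alpha>(1) fb B])
      then have "\<bar>sform A B f (F u v) - g v\<bar> \<le> M * (2 - R n) + e / 2"
        using comp_approx[OF X Y W v r u comp_op_Pol[OF u v] c A B f M(2) I \<tau> c' e'] by (simp add: R_def)
      also have "M * (2 - R n) \<le> M * d" using n M by (intro mult_left_mono) auto
      finally show ?thesis using d by linarith
    qed
    have "((\<lambda>v. g v) \<longlongrightarrow> g v0) ?T"
      unfolding g_def by (intro tendsto_sum lim bfun_indicator B \<alpha>(1) ccont_lcont ccont_scale f c')
    moreover have "\<forall>\<^sub>F v in ?T. \<bar>sform A B f (F u v) - g v\<bar> \<le> e"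
      using ev by eventually_elim (rule err)
    moreover have "\<bar>sform A B f (F u v0) - g v0\<bar> \<le> e" by (rule err[OF v0])
    ultimately show "\<exists>g L. (g \<longlongrightarrow> L) ?T \<and>
      (\<forall>\<^sub>F j in ?T. \<bar>sform A B f (F u j) - g j\<bar> \<le> e) \<and>
      \<bar>sform A B f (F u v0) - L\<bar> \<le> e" by blast
  qed
qed

lemma comp_op_is_pol_product: "is_pol_product X Y W F"
  unfolding is_pol_product_def
proof (intro conjI allI impI ballI)
  fix u v s s' assume u: "given_by X Y u s" and v: "given_by Y W v s'"
  then have uP: "u \<in> Pol X Y" and vP: "v \<in> Pol Y W" by (auto simp: given_by_def)
  show "F u v \<in> Pol X W" by (rule comp_op_Pol[OF uP vP])
  obtain \<sigma> Q where r: "is_rand Y W v \<sigma> Q" and c: "is_comp X W u \<sigma> Q (F u v)"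
    using F vP uP unfolding comp_op_def by blast
  fix A B C assume "A \<in> sets X" "B \<in> sets W" "C \<in> sets Rpos"
  then show "emeasure (F u v) (A \<times> B \<times> C) =
             (\<integral>\<^sup>+z\<in>A \<times> B. (case z of (x, w) \<Rightarrow>
                \<integral>\<^sup>+y. emeasure (mult_conv (s x y) (s' y w)) C \<partial>Y) \<partial>(X >< W))"
    by (rule comp_continuous[OF X Y W u v r c comp_op_Pol[OF uP vP]])
qed (rule comp_op_continuous1 comp_op_continuous2, assumption)+

end

text \<open>The difference of a test value along \<open>F\<close> and \<open>G\<close> is a
  continuous real function; the set where it is nonzero is open and, if nonempty, would contain a
  continuous polymorphism.\<close>

lemma pform_dense_eq:
  assumes X: "prob_space X" and Y: "prob_space Y" and W: "prob_space W"
    and F: "continuous_map (pol_topology X Y) (pol_topology W V) F"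
    and G: "continuous_map (pol_topology X Y) (pol_topology W V) G"
    and V: "prob_space V" and eq: "\<And>u s. given_by X Y u s \<Longrightarrow> F u = G u" and u: "u \<in> Pol X Y"
  shows "F u = G u"
proof (rule Pol_eqI[OF W V])
  have u': "u \<in> topspace (pol_topology X Y)" using u by (simp add: topspace_pol_topology[OF X Y])
  show "F u \<in> Pol W V" "G u \<in> Pol W V"
    using F G u' topspace_pol_topology[OF W V] by (auto simp: continuous_map_def)
  fix A B f assume A: "A \<in> sets W" and B: "B \<in> sets V" and f: "ccont f"
  define D where "D u = sform A B f (F u) - sform A B f (G u)" for u
  have "continuous_map (pol_topology X Y) euclideanreal D"
    unfolding continuous_map_atin limitin_canonical_iff D_def
    by (intro ballI tendsto_diff pform_continuous[OF W V] bfun_indicator A B ccont_lcont f F G)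
  then have "openin (pol_topology X Y) {u \<in> topspace (pol_topology X Y). D u \<in> - {0}}"
    by (rule openin_continuous_map_preimage) auto
  then have op: "openin (pol_topology X Y) {u \<in> topspace (pol_topology X Y). D u \<noteq> 0}" by simp
  show "sform A B f (F u) = sform A B f (G u)"
  proof (rule ccontr)
    assume "sform A B f (F u) \<noteq> sform A B f (G u)"
    then have "u \<in> {u \<in> topspace (pol_topology X Y). D u \<noteq> 0}" using u' by (simp add: D_def)
    from continuous_dense[OF X Y op this] obtain v s where "D v \<noteq> 0" "given_by X Y v s" by auto
    then show False using eq by (simp add: D_def)
  qed
qed

text \<open>Two density passes: in \<open>u\<close> with \<open>v\<close> continuous, and then in
  \<open>v\<close>.\<close>

lemma is_pol_product_unique:
  assumes X: "prob_space X" and Y: "prob_space Y" and W: "prob_space W"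
    and F: "is_pol_product X Y W F" and G: "is_pol_product X Y W G"
    and u: "u \<in> Pol X Y" and v: "v \<in> Pol Y W"
  shows "F u v = G u v"
proof -
  have cont: "F u v = G u v" if u: "given_by X Y u s" and v: "given_by Y W v s'" for u v s s'
  proof -
    have FP: "F u v \<in> Pol X W" and GP: "G u v \<in> Pol X W"
      using F G u v unfolding is_pol_product_def by blast+
    interpret p: prob_space "F u v" by (rule Pol_prob[OF X W FP])
    show ?thesis
    proof (rule finite_measure_triple_eqI[OF _ Pol_sets[OF X W FP] Pol_sets[OF X W GP]])
      show "finite_measure (F u v)" by unfold_locales
      fix A B C assume "A \<in> sets X" "B \<in> sets W" "C \<in> sets Rpos"
      then show "emeasure (F u v) (A \<times> B \<times> C) = emeasure (G u v) (A \<times> B \<times> C)"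
        using F G u v unfolding is_pol_product_def by simp
    qed
  qed
  have 1: "F u v = G u v" if u: "u \<in> Pol X Y" and v: "given_by Y W v s'" for u v s'
  proof (rule pform_dense_eq[OF X Y X _ _ W _ u, of "\<lambda>u. F u v" "\<lambda>u. G u v"])
    have vP: "v \<in> Pol Y W" using v by (simp add: given_by_def)
    show "continuous_map (pol_topology X Y) (pol_topology X W) (\<lambda>u. F u v)" "continuous_map (pol_topology X Y) (pol_topology X W) (\<lambda>u. G u v)"
      using F G vP unfolding is_pol_product_def by blast+
  qed (rule cont[OF _ v])
  show ?thesis
  proof (rule pform_dense_eq[OF Y W X _ _ W _ v, of "F u" "G u"])
    show "continuous_map (pol_topology Y W) (pol_topology X W) (F u)" "continuous_map (pol_topology Y W) (pol_topology X W) (G u)"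
      using F G u unfolding is_pol_product_def by blast+
  qed (rule 1[OF u])
qed

text \<open>Existence makes the chosen operation a product in the required sense; uniqueness then
  equips it with the randomizations of the operation that was constructed.\<close>

lemma pol_prod_comp_op:
  assumes X: "prob_space X" and Y: "prob_space Y" and W: "lebesgue_prob_space W"
  shows "comp_op X Y W (pol_prod X Y W)" "is_pol_product X Y W (pol_prod X Y W)"
proof -
  have W': "prob_space W" using W by (simp add: lebesgue_prob_space_def)
  obtain F where F: "comp_op X Y W F" using comp_op_exists[OF assms] by blast
  have pF: "is_pol_product X Y W F" by (rule comp_op_is_pol_product[OF X Y W' F])
  then show pp: "is_pol_product X Y W (pol_prod X Y W)"
    unfolding pol_prod_def by (rule someI[of "is_pol_product X Y W" F])
  have "pol_prod X Y W u v = F u v" if "u \<in> Pol X Y" "v \<in> Pol Y W" for u v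
    by (rule is_pol_product_unique[OF X Y W' pp pF that])
  then show "comp_op X Y W (pol_prod X Y W)" using F unfolding comp_op_def by simp
qed

section \<open>Conditional expectations and the polymorphisms \<open>\<mm>\<^sub>\<alpha>\<close>\<close>

lemma Pol_int1:
  assumes X: "prob_space X" and Y: "prob_space Y" and p: "p \<in> Pol X Y" and a: "(a :: _ \<Rightarrow> real) \<in> borel_measurable X"
  shows "(LINT z|p. a (fst z)) = (LINT x|X. a x)" "integrable X a \<Longrightarrow> integrable p (\<lambda>z. a (fst z))"
proof -
  show "(LINT z|p. a (fst z)) = (LINT x|X. a x)"
    using integral_distr[OF Pol_fst[OF X Y p] a] by (simp add: Pol_distr1[OF X Y p])
  assume "integrable X a"
  then have "integrable (distr p X fst) a" by (simp add: Pol_distr1[OF X Y p])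
  then show "integrable p (\<lambda>z. a (fst z))" by (rule integrable_distr[OF Pol_fst[OF X Y p]])
qed

lemma Pol_int2:
  assumes X: "prob_space X" and Y: "prob_space Y" and p: "p \<in> Pol X Y" and b: "(b :: _ \<Rightarrow> real) \<in> borel_measurable Y"
  shows "(LINT z|p. tc z * b (yc z)) = (LINT y|Y. b y)"
    "integrable Y b \<Longrightarrow> integrable p (\<lambda>z. tc z * b (yc z))"
proof -
  note [measurable] = b Pol_snd[OF X Y p] Pol_t[OF X Y p]
  have m: "(\<lambda>z. yc z) \<in> measurable (tmul p) Y" by (simp add: Pol_tmul[OF X Y p])
  have "(LINT y|Y. b y) = (LINT y|distr (tmul p) Y (\<lambda>z. yc z). b y)" by (simp add: Pol_distr2[OF X Y p])
  also have "\<dots> = (LINT z|tmul p. b (yc z))" by (rule integral_distr[OF m b])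
  also have "\<dots> = (LINT z|p. tc z *\<^sub>R b (yc z))"
    unfolding Pol_tmul[OF X Y p] by (rule integral_density) (auto simp: Pol_space[OF X Y p])
  finally show "(LINT z|p. tc z * b (yc z)) = (LINT y|Y. b y)" by simp
  assume "integrable Y b"
  then have "integrable (distr (tmul p) Y (\<lambda>z. yc z)) b" by (simp add: Pol_distr2[OF X Y p])
  then have "integrable (tmul p) (\<lambda>z. b (yc z))" by (rule integrable_distr[OF m])
  then have "integrable p (\<lambda>z. tc z *\<^sub>R b (yc z))"
    unfolding Pol_tmul[OF X Y p] by (subst (asm) integrable_density) (auto simp: Pol_space[OF X Y p])
  then show "integrable p (\<lambda>z. tc z * b (yc z))" by simp
qed

text \<open>Boundedness and support away from 0 give the two estimates; each of them lets an error
  be measured in one of the two marginals.\<close>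

lemma ccont_le_linear:
  assumes "ccont f" shows "\<exists>C\<ge>0. \<forall>t>0. \<bar>f t\<bar> \<le> C \<and> \<bar>f t\<bar> \<le> C * t"
proof -
  obtain M l u where M: "0 \<le> M" "\<And>t. 0 < t \<Longrightarrow> \<bar>f t\<bar> \<le> M" and l: "0 < l"
    and z: "\<And>t. 0 < t \<Longrightarrow> t \<notin> {l..u} \<Longrightarrow> f t = 0" using ccontD[OF assms] by blast
  have "\<bar>f t\<bar> \<le> (M / l) * t" if t: "0 < t" for t
  proof (cases "t \<in> {l..u}")
    case True
    then have "M * l \<le> M * t" using M by (intro mult_left_mono) auto
    then have "M \<le> (M / l) * t" using l by (simp add: field_simps)
    then show ?thesis using M(2)[OF t] by linarith
  next
    case False
    then show ?thesis using z[OF t False] M l t by simp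
  qed
  moreover have "(M / l) * t \<le> max M (M / l) * t" if "0 < t" for t using that by (intro mult_right_mono) auto
  ultimately show ?thesis using M by (intro exI[of _ "max M (M / l)"]) (force simp: le_max_iff_disj)
qed

text \<open>A function \<open>e\<close> is the conditional expectation, bounded by 1, of the indicator of \<open>A\<close> with respect
  to \<open>\<pi>\<close>.\<close>

definition is_cexp :: "'z measure \<Rightarrow> 'w measure \<Rightarrow> ('z \<Rightarrow> 'w) \<Rightarrow> 'z set \<Rightarrow> ('z \<Rightarrow> real) \<Rightarrow> bool" where
  "is_cexp Z Q \<pi> A e \<longleftrightarrow> (\<exists>\<alpha>. bfun Q \<alpha> \<and> (\<forall>y. \<bar>\<alpha> y\<bar> \<le> 1) \<and> e = (\<lambda>z. \<alpha> (\<pi> z)) \<and>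
     (\<forall>h. bfun Q h \<longrightarrow> (LINT z|Z. ind A z * h (\<pi> z)) = (LINT y|Q. \<alpha> y * h y)))"

context
  fixes Z :: "'z measure" and Q :: "'w measure" and \<pi>
  assumes Z: "lebesgue_prob_space Z" and Q: "lebesgue_prob_space Q" and \<pi>: "\<pi> \<in> measurable Z Q" and d\<pi>: "distr Z Q \<pi> = Q"
begin

lemma Z_prob: "prob_space Z" and Q_prob: "prob_space Q"
  using Z Q by (auto simp: lebesgue_prob_space_def)

lemma one_Rpos [measurable]: "(\<lambda>_. 1 :: real) \<in> measurable M Rpos"
  by (simp add: measurable_Rpos_iff)

lemma l_pol_nn: "h \<in> borel_measurable (triple Z Q) \<Longrightarrow> (\<integral>\<^sup>+z. h z \<partial>l_pol Z Q \<pi>) = (\<integral>\<^sup>+z. h (z, \<pi> z, 1) \<partial>Z)"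
  unfolding l_pol_def using \<pi> by (subst nn_integral_distr) auto

lemma l_star_nn: "h \<in> borel_measurable (triple Q Z) \<Longrightarrow> (\<integral>\<^sup>+z. h z \<partial>l_star Z Q \<pi>) = (\<integral>\<^sup>+z. h (\<pi> z, z, 1) \<partial>Z)"
  unfolding l_star_def using \<pi> by (subst nn_integral_distr) auto

lemma l_pol_Pol: "l_pol Z Q \<pi> \<in> Pol Z Q"
proof (rule PolI)
  show "sets (l_pol Z Q \<pi>) = sets (triple Z Q)" by (simp add: l_pol_def)
  show "(\<integral>\<^sup>+z. ind A (fst z) \<partial>l_pol Z Q \<pi>) = emeasure Z A" if "A \<in> sets Z" for A
    using that by (subst l_pol_nn) auto
  show "(\<integral>\<^sup>+z. ennreal (tc z) * ind B (yc z) \<partial>l_pol Z Q \<pi>) = emeasure Q B" if B: "B \<in> sets Q" for B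
  proof -
    have "(\<integral>\<^sup>+z. ennreal (tc z) * ind B (yc z) \<partial>l_pol Z Q \<pi>) = (\<integral>\<^sup>+z. ind B (\<pi> z) \<partial>Z)"
      using B by (subst l_pol_nn) auto
    also have "\<dots> = (\<integral>\<^sup>+y. ind B y \<partial>distr Z Q \<pi>)" using B \<pi> by (intro nn_integral_distr[symmetric]) auto
    finally show ?thesis using B by (simp add: d\<pi>)
  qed
qed

lemma l_star_Pol: "l_star Z Q \<pi> \<in> Pol Q Z"
proof (rule PolI)
  show "sets (l_star Z Q \<pi>) = sets (triple Q Z)" by (simp add: l_star_def)
  show "(\<integral>\<^sup>+z. ennreal (tc z) * ind A (yc z) \<partial>l_star Z Q \<pi>) = emeasure Z A" if "A \<in> sets Z" for A
    using that by (subst l_star_nn) auto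
  show "(\<integral>\<^sup>+z. ind B (fst z) \<partial>l_star Z Q \<pi>) = emeasure Q B" if B: "B \<in> sets Q" for B
  proof -
    have "(\<integral>\<^sup>+z. ind B (fst z) \<partial>l_star Z Q \<pi>) = (\<integral>\<^sup>+z. ind B (\<pi> z) \<partial>Z)"
      using B by (subst l_star_nn) auto
    also have "\<dots> = (\<integral>\<^sup>+y. ind B y \<partial>distr Z Q \<pi>)" using B \<pi> by (intro nn_integral_distr[symmetric]) auto
    finally show ?thesis using B by (simp add: d\<pi>)
  qed
qed

lemma l_pol_pform:
  assumes "a \<in> borel_measurable Z" "h \<in> borel_measurable Q" "f \<in> borel_measurable Rpos"
  shows "pform a h f (l_pol Z Q \<pi>) = (LINT z|Z. a z * h (\<pi> z) * f 1)"
  unfolding pform_def l_pol_def using assms \<pi> by (subst integral_distr) auto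

lemma l_star_pform:
  assumes "a \<in> borel_measurable Z" "h \<in> borel_measurable Q" "f \<in> borel_measurable Rpos"
  shows "pform h a f (l_star Z Q \<pi>) = (LINT z|Z. h (\<pi> z) * a z * f 1)"
  unfolding pform_def l_star_def using assms \<pi> by (subst integral_distr) auto

lemma l_pol_AE: "AE z in l_pol Z Q \<pi>. tc z = 1"
  unfolding l_pol_def using \<pi> by (subst AE_distr_iff) (auto intro: measurable_RposD)

lemma cexp_exists:
  assumes A: "A \<in> sets Z" shows "\<exists>e. is_cexp Z Q \<pi> A e"
proof -
  let ?l = "l_pol Z Q \<pi>"
  note [measurable] = A \<pi> Pol_fst[OF Z_prob Q_prob l_pol_Pol] Pol_t[OF Z_prob Q_prob l_pol_Pol]
  \<comment> \<open>On \<open>l_pol\<close> the derivative is 1, so the factor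
    \<open>min 1 (tc z)\<close> changes no integral; it supplies the pointwise bound by
    \<open>t\<close> that \<open>cond_density\<close> asks for.\<close>
  have m: "(\<lambda>z. ind A (fst z) * min 1 (tc z)) \<in> borel_measurable ?l" by measurable
  have le: "\<bar>ind A (fst z) * min 1 (tc z)\<bar> \<le> 1 * tc z" if "z \<in> space ?l" for z
    using that by (auto simp: Pol_space[OF Z_prob Q_prob l_pol_Pol] indicator_def)
  obtain \<alpha> where \<alpha>: "bfun Q \<alpha>" "\<And>y. \<bar>\<alpha> y\<bar> \<le> 1"
    "\<And>h. bfun Q h \<Longrightarrow> (LINT z|?l. ind A (fst z) * min 1 (tc z) * h (yc z)) = (LINT y|Q. \<alpha> y * h y)"
    using cond_density[OF Z_prob Q_prob l_pol_Pol m le] by blast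
  have "(LINT z|Z. ind A z * h (\<pi> z)) = (LINT y|Q. \<alpha> y * h y)" if h: "bfun Q h" for h
  proof -
    note [measurable] = bfun_measurable[OF h]
    have "(LINT z|?l. ind A (fst z) * min 1 (tc z) * h (yc z)) = (LINT z|Z. ind A z * h (\<pi> z))"
      unfolding l_pol_def by (subst integral_distr) auto
    then show ?thesis using \<alpha>(3)[OF h] by simp
  qed
  then show ?thesis unfolding is_cexp_def using \<alpha>(1,2) by blast
qed

lemma cexp_bfun:
  assumes "is_cexp Z Q \<pi> A e" shows "bfun Z e" "\<And>z. \<bar>e z\<bar> \<le> 1"
  using assms \<pi> unfolding is_cexp_def by (auto intro: bfun_comp)

lemma integral_pi: "bfun Q h \<Longrightarrow> (LINT z|Z. h (\<pi> z)) = (LINT y|Q. h y)"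
  using integral_distr[OF \<pi>, of h] by (simp add: d\<pi> bfun_measurable)

text \<open>Self-adjointness: both sides are the integral over \<open>Q\<close> of the product of
  the two conditional expectations.\<close>

lemma cexp_sym:
  assumes A: "is_cexp Z Q \<pi> A e" and B: "is_cexp Z Q \<pi> B e'"
  shows "(LINT z|Z. e z * ind B z) = (LINT z|Z. ind A z * e' z)"
proof -
  obtain \<alpha> where \<alpha>: "bfun Q \<alpha>" "e = (\<lambda>z. \<alpha> (\<pi> z))" "\<And>h. bfun Q h \<Longrightarrow> (LINT z|Z. ind A z * h (\<pi> z)) = (LINT y|Q. \<alpha> y * h y)"
    using A unfolding is_cexp_def by blast
  obtain \<beta> where \<beta>: "bfun Q \<beta>" "e' = (\<lambda>z. \<beta> (\<pi> z))" "\<And>h. bfun Q h \<Longrightarrow> (LINT z|Z. ind B z * h (\<pi> z)) = (LINT y|Q. \<beta> y * h y)"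
    using B unfolding is_cexp_def by blast
  show ?thesis using \<alpha>(3)[OF \<beta>(1)] \<beta>(3)[OF \<alpha>(1)] by (simp add: \<alpha>(2) \<beta>(2) mult.commute)
qed

lemma m_pol_Pol: "m_pol Z Q \<pi> \<in> Pol Z Z"
  unfolding m_pol_def by (rule comp_op_Pol[OF Z_prob Q_prob Z_prob pol_prod_comp_op(1)[OF Z_prob Q_prob Z] l_pol_Pol l_star_Pol])

text \<open>Both factors of \<open>m_pol\<close> have derivative 1, so \<open>f\<close> contributes
  only \<open>f 1\<close>, and \<open>comp_left\<close> leaves the conditional expectation of
  \<open>ind A\<close>.\<close>

lemma m_pol_pform:
  assumes A: "A \<in> sets Z" and B: "B \<in> sets Z" and f: "bfun Rpos f" and e: "is_cexp Z Q \<pi> A e"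
  shows "sform A B f (m_pol Z Q \<pi>) = f 1 * (LINT z|Z. e z * ind B z)"
proof -
  obtain \<alpha> where \<alpha>: "bfun Q \<alpha>" "e = (\<lambda>z. \<alpha> (\<pi> z))" "\<And>h. bfun Q h \<Longrightarrow> (LINT z|Z. ind A z * h (\<pi> z)) = (LINT y|Q. \<alpha> y * h y)"
    using e unfolding is_cexp_def by blast
  obtain \<sigma> S where r: "is_rand Q Z (l_star Z Q \<pi>) \<sigma> S" and c: "is_comp Z Z (l_pol Z Q \<pi>) \<sigma> S (m_pol Z Q \<pi>)"
    using pol_prod_comp_op(1)[OF Z_prob Q_prob Z] l_pol_Pol l_star_Pol unfolding comp_op_def m_pol_def by blast
  have "sform A B f (m_pol Z Q \<pi>) = pform \<alpha> (ind B) f (l_star Z Q \<pi>)"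
  proof (rule comp_left[OF Z_prob Q_prob Z_prob l_star_Pol r l_pol_Pol m_pol_Pol c A B f l_pol_AE \<alpha>(1)])
    show "pform (ind A) h (\<lambda>_. 1) (l_pol Z Q \<pi>) = (LINT y|Q. \<alpha> y * h y)" if "bfun Q h" for h
      using that A \<alpha>(3)[OF that] by (subst l_pol_pform) (auto intro: bfun_measurable)
  qed
  also have "\<dots> = (LINT z|Z. \<alpha> (\<pi> z) * ind B z * f 1)"
    by (rule l_star_pform) (use B \<alpha>(1) f in \<open>auto intro: bfun_measurable\<close>)
  finally show ?thesis by (simp add: \<alpha>(2) mult.commute)
qed

text \<open>The test function vanishes exactly at \<open>t = 1\<close>, and its integral is a
  multiple of its value there.\<close>

lemma m_pol_AE: "AE z in m_pol Z Q \<pi>. tc z = 1"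
proof -
  let ?m = "m_pol Z Q \<pi>" and ?f = "\<lambda>t::real. min 1 \<bar>t - 1\<bar>"
  have f: "bfun Rpos ?f" by (rule bfunI[of _ _ 1]) auto
  obtain e where e: "is_cexp Z Q \<pi> (space Z) e" using cexp_exists[OF sets.top] by blast
  have "sform (space Z) (space Z) ?f ?m = 0"
    using m_pol_pform[OF sets.top sets.top f e] by simp
  moreover have "integrable ?m (\<lambda>z. ind (space Z) (fst z) * ind (space Z) (yc z) * ?f (tc z))"
    by (intro Pol_lfun_integrable[OF Z_prob Z_prob m_pol_Pol] bfun_indicator sets.top bfun_lfun[OF f])
  ultimately have "AE z in ?m. ind (space Z) (fst z) * ind (space Z) (yc z) * ?f (tc z) = 0"
    unfolding pform_def by (subst (asm) integral_nonneg_eq_0_iff_AE) auto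
  then show ?thesis using AE_space
    by eventually_elim (auto simp: Pol_space[OF Z_prob Z_prob m_pol_Pol] min_def split: if_splits)
qed

text \<open>\<open>comp_left\<close> with density \<open>e\<close>; the formula for
  \<open>m_pol\<close> on indicators extends to bounded functions by \<open>blin_eq\<close>.\<close>

lemma m_pol_left:
  assumes r: "r \<in> Pol Z Z" and A: "A \<in> sets Z" and B: "B \<in> sets Z" and f: "bfun Rpos f" and e: "is_cexp Z Q \<pi> A e"
  shows "sform A B f (pol_prod Z Z Z (m_pol Z Q \<pi>) r) = pform e (ind B) f r"
proof -
  let ?m = "m_pol Z Q \<pi>"
  interpret Z: prob_space Z by (rule Z_prob)
  note co = pol_prod_comp_op(1)[OF Z_prob Z_prob Z]
  obtain \<sigma> S where rr: "is_rand Z Z r \<sigma> S" and c: "is_comp Z Z ?m \<sigma> S (pol_prod Z Z Z ?m r)"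
    using co m_pol_Pol r unfolding comp_op_def by blast
  show ?thesis
  proof (rule comp_left[OF Z_prob Z_prob Z_prob r rr m_pol_Pol comp_op_Pol[OF Z_prob Z_prob Z_prob co m_pol_Pol r] c A B f m_pol_AE cexp_bfun(1)[OF e]])
    fix h assume h: "bfun Z h"
    show "pform (ind A) h (\<lambda>_. 1) ?m = (LINT y|Z. e y * h y)"
    proof (rule blin_eq[OF blin_pform2[OF Z_prob Z_prob m_pol_Pol bfun_indicator[OF A], of 1 "\<lambda>_. 1" 1] blin_integral[OF Z.finite_measure_axioms cexp_bfun(1)[OF e], of 1] h])
      show "sform A B (\<lambda>_. 1) ?m = (LINT y|Z. e y * ind B y)" if "B \<in> sets Z" for B
        using m_pol_pform[OF A that bfun_const e, of 1] by simp
      show "lfun (\<lambda>_. 1)" by (rule bfun_lfun[OF bfun_const])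
    qed (use cexp_bfun(2)[OF e] in \<open>auto simp: indicator_def\<close>)
  qed
qed

text \<open>\<open>m_pol_pform\<close> puts the conditional expectation on the first set;
  self-adjointness moves it to \<open>B\<close>, as \<open>comp_right\<close> requires.\<close>

lemma m_pol_right:
  assumes r: "r \<in> Pol Z Z" and A: "A \<in> sets Z" and B: "B \<in> sets Z" and f: "bfun Rpos f" and e: "is_cexp Z Q \<pi> B e"
  shows "sform A B f (pol_prod Z Z Z r (m_pol Z Q \<pi>)) = pform (ind A) e f r"
proof -
  let ?m = "m_pol Z Q \<pi>"
  interpret Z: prob_space Z by (rule Z_prob)
  note co = pol_prod_comp_op(1)[OF Z_prob Z_prob Z]
  obtain \<sigma> S where rr: "is_rand Z Z ?m \<sigma> S" and c: "is_comp Z Z r \<sigma> S (pol_prod Z Z Z r ?m)"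
    using co m_pol_Pol r unfolding comp_op_def by blast
  show ?thesis
  proof (rule comp_right[OF Z_prob Z_prob Z_prob m_pol_Pol rr r comp_op_Pol[OF Z_prob Z_prob Z_prob co r m_pol_Pol] c A B f m_pol_AE cexp_bfun(1)[OF e]])
    fix h assume h: "bfun Z h"
    have "pform h (ind B) (\<lambda>_. 1) ?m = (LINT y|Z. e y * h y)"
    proof (rule blin_eq[OF blin_pform1[OF Z_prob Z_prob m_pol_Pol bfun_indicator[OF B], of 1 "\<lambda>_. 1" 1] blin_integral[OF Z.finite_measure_axioms cexp_bfun(1)[OF e], of 1] h])
      show "sform A B (\<lambda>_. 1) ?m = (LINT y|Z. e y * ind A y)" if A: "A \<in> sets Z" for A
      proof -
        obtain e' where e': "is_cexp Z Q \<pi> A e'" using cexp_exists[OF A] by blast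
        have "sform A B (\<lambda>_. 1) ?m = (LINT z|Z. e' z * ind B z)"
          using m_pol_pform[OF A B bfun_const e', of 1] by simp
        then show ?thesis using cexp_sym[OF e' e] by (simp add: mult.commute)
      qed
      show "lfun (\<lambda>_. 1)" by (rule bfun_lfun[OF bfun_const])
    qed (use cexp_bfun(2)[OF e] in \<open>auto simp: indicator_def\<close>)
    then show "pform h (ind B) (\<lambda>_. 1) ?m = (LINT y|Z. h y * e y)" by (simp add: mult.commute)
  qed
qed

lemma m_pol_both:
  assumes r: "r \<in> Pol Z Z" and A: "A \<in> sets Z" and B: "B \<in> sets Z" and f: "bfun Rpos f"
    and e: "is_cexp Z Q \<pi> A e" and e': "is_cexp Z Q \<pi> B e'"
  shows "sform A B f (pol_prod Z Z Z (pol_prod Z Z Z (m_pol Z Q \<pi>) r) (m_pol Z Q \<pi>)) = pform e e' f r"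
proof -
  let ?m = "m_pol Z Q \<pi>"
  let ?n = "pol_prod Z Z Z ?m r"
  have n: "?n \<in> Pol Z Z"
    by (rule comp_op_Pol[OF Z_prob Z_prob Z_prob pol_prod_comp_op(1)[OF Z_prob Z_prob Z] m_pol_Pol r])
  obtain C where C: "\<And>t. 0 < t \<Longrightarrow> \<bar>f t\<bar> \<le> C * (1 + t)" using bfun_lfun[OF f] by (auto simp: lfun_def)
  have "sform A B f (pol_prod Z Z Z ?n ?m) = pform (ind A) e' f ?n"
    by (rule m_pol_right[OF n A B f e'])
  also have "\<dots> = pform e e' f r"
    by (rule blin_eq[OF blin_pform2[OF Z_prob Z_prob n bfun_indicator[OF A], of 1 f C]
          blin_pform2[OF Z_prob Z_prob r cexp_bfun(1)[OF e], of 1 f C] cexp_bfun(1)[OF e']])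
      (use C bfun_lfun[OF f] cexp_bfun(2)[OF e] m_pol_left[OF r A _ f e] in \<open>auto simp: indicator_def\<close>)
  finally show ?thesis .
qed

end

text \<open>The two errors are absorbed by different marginals:
  \<open>\<bar>f t\<bar> \<le> C\<close> for the first coordinate, whose law is \<open>Z\<close>,
  and \<open>\<bar>f t\<bar> \<le> C * t\<close> for the second, whose law is \<open>Z\<close> after
  weighting by \<open>t\<close>.\<close>

lemma pform_L1_tendsto:
  assumes Z: "prob_space Z" and r: "r \<in> Pol Z Z" and f: "ccont f"
    and e: "\<And>k. bfun Z (e k)" "\<And>k z. \<bar>e k z\<bar> \<le> 1" and e': "\<And>k. bfun Z (e' k)" "\<And>k z. \<bar>e' k z\<bar> \<le> 1"
    and a: "bfun Z a" "\<And>z. \<bar>a z\<bar> \<le> 1" and b: "bfun Z b" "\<And>z. \<bar>b z\<bar> \<le> 1"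
    and lim: "(\<lambda>k. LINT z|Z. \<bar>e k z - a z\<bar>) \<longlonglongrightarrow> 0" "(\<lambda>k. LINT z|Z. \<bar>e' k z - b z\<bar>) \<longlonglongrightarrow> 0"
  shows "(\<lambda>k. pform (e k) (e' k) f r) \<longlonglongrightarrow> pform a b f r"
proof -
  interpret Z: prob_space Z by fact
  obtain C where C: "0 \<le> C" "\<And>t. 0 < t \<Longrightarrow> \<bar>f t\<bar> \<le> C" "\<And>t. 0 < t \<Longrightarrow> \<bar>f t\<bar> \<le> C * t"
    using ccont_le_linear[OF f] by blast
  note lf = lcont_lfun[OF ccont_lcont[OF f]]
  have d1: "bfun Z (\<lambda>z. \<bar>e k z - a z\<bar>)" and d2: "bfun Z (\<lambda>z. \<bar>e' k z - b z\<bar>)" for k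
    using bfun_diff[OF e(1)[of k] a(1)] bfun_diff[OF e'(1)[of k] b(1)] unfolding bfun_def by auto
  have bound: "\<bar>pform (e k) (e' k) f r - pform a b f r\<bar> \<le> C * (LINT z|Z. \<bar>e k z - a z\<bar>) + C * (LINT z|Z. \<bar>e' k z - b z\<bar>)" for k
  proof -
    let ?x = "\<lambda>z. fst z" and ?y = "\<lambda>z. yc z" and ?t = "\<lambda>z. tc z"
    have i1: "integrable r (\<lambda>z. e k (?x z) * e' k (?y z) * f (?t z))" "integrable r (\<lambda>z. a (?x z) * b (?y z) * f (?t z))"
      by (intro Pol_lfun_integrable[OF Z Z r] e e' a b lf)+
    have i2: "integrable r (\<lambda>z. \<bar>e k (?x z) - a (?x z)\<bar>)" "integrable r (\<lambda>z. ?t z * \<bar>e' k (?y z) - b (?y z)\<bar>)"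
      using Pol_int1(2)[OF Z Z r bfun_measurable[OF d1[of k]] bfun_integrable[OF Z.finite_measure_axioms d1[of k]]]
        Pol_int2(2)[OF Z Z r bfun_measurable[OF d2[of k]] bfun_integrable[OF Z.finite_measure_axioms d2[of k]]] by auto
    have "\<bar>pform (e k) (e' k) f r - pform a b f r\<bar> = \<bar>LINT z|r. e k (?x z) * e' k (?y z) * f (?t z) - a (?x z) * b (?y z) * f (?t z)\<bar>"
      unfolding pform_def using i1 by simp
    also have "\<dots> \<le> (LINT z|r. \<bar>e k (?x z) * e' k (?y z) * f (?t z) - a (?x z) * b (?y z) * f (?t z)\<bar>)"
      by (rule integral_abs_bound)
    also have "\<dots> \<le> (LINT z|r. C * \<bar>e k (?x z) - a (?x z)\<bar> + C * (?t z * \<bar>e' k (?y z) - b (?y z)\<bar>))"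
    proof (rule integral_mono)
      fix z assume z: "z \<in> space r"
      have t: "0 < ?t z" using z by (auto simp: Pol_space[OF Z Z r])
      have "e k (?x z) * e' k (?y z) * f (?t z) - a (?x z) * b (?y z) * f (?t z) =
          (e k (?x z) - a (?x z)) * (e' k (?y z) * f (?t z)) + (e' k (?y z) - b (?y z)) * (a (?x z) * f (?t z))"
        by (simp add: algebra_simps)
      also have "\<bar>\<dots>\<bar> \<le> \<bar>e k (?x z) - a (?x z)\<bar> * (\<bar>e' k (?y z)\<bar> * \<bar>f (?t z)\<bar>) + \<bar>e' k (?y z) - b (?y z)\<bar> * (\<bar>a (?x z)\<bar> * \<bar>f (?t z)\<bar>)"
        by (rule order_trans[OF abs_triangle_ineq]) (simp add: abs_mult)
      also have "\<dots> \<le> \<bar>e k (?x z) - a (?x z)\<bar> * (1 * C) + \<bar>e' k (?y z) - b (?y z)\<bar> * (1 * (C * ?t z))"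
        by (intro add_mono mult_mono e'(2) a(2) C t order_refl) auto
      finally show "\<bar>e k (?x z) * e' k (?y z) * f (?t z) - a (?x z) * b (?y z) * f (?t z)\<bar>
          \<le> C * \<bar>e k (?x z) - a (?x z)\<bar> + C * (?t z * \<bar>e' k (?y z) - b (?y z)\<bar>)" by (simp add: mult_ac)
    qed (use i1 i2 in auto)
    also have "\<dots> = C * (LINT z|r. \<bar>e k (?x z) - a (?x z)\<bar>) + C * (LINT z|r. ?t z * \<bar>e' k (?y z) - b (?y z)\<bar>)"
      using i2 by simp
    also have "\<dots> = C * (LINT z|Z. \<bar>e k z - a z\<bar>) + C * (LINT z|Z. \<bar>e' k z - b z\<bar>)"
      using Pol_int1(1)[OF Z Z r bfun_measurable[OF d1[of k]]] Pol_int2(1)[OF Z Z r bfun_measurable[OF d2[of k]]] by simp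
    finally show ?thesis .
  qed
  have "(\<lambda>k. C * (LINT z|Z. \<bar>e k z - a z\<bar>) + C * (LINT z|Z. \<bar>e' k z - b z\<bar>)) \<longlonglongrightarrow> C * 0 + C * 0"
    by (intro tendsto_intros lim)
  then have "(\<lambda>k. C * (LINT z|Z. \<bar>e k z - a z\<bar>) + C * (LINT z|Z. \<bar>e' k z - b z\<bar>)) \<longlonglongrightarrow> 0" by simp
  then have "(\<lambda>k. pform (e k) (e' k) f r - pform a b f r) \<longlonglongrightarrow> 0"
    by (rule Lim_null_comparison[rotated]) (use bound in \<open>auto intro!: always_eventually\<close>)
  then show ?thesis by (rule LIM_zero_cancel)
qed

section \<open>Nonsingular transformations as polymorphisms\<close>

context
  fixes Z :: "'z measure" and q :: "'z \<Rightarrow> 'z"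
  assumes Z: "prob_space Z" and q: "nonsingular Z q"
begin

abbreviation (input) "qi \<equiv> the_inv_into (space Z) q"

lemma ns_measurable: "q \<in> measurable Z Z" "qi \<in> measurable Z Z"
  using q by (auto simp: nonsingular_def)

lemma ns_inv: "z \<in> space Z \<Longrightarrow> q (qi z) = z" "z \<in> space Z \<Longrightarrow> qi (q z) = z"
  using q unfolding nonsingular_def bij_betw_def by (auto intro: f_the_inv_into_f the_inv_into_f_f)

lemma ns_AE:
  assumes "AE z in Z. P z" shows "AE z in Z. P (q z)"
proof -
  obtain N where N: "{x \<in> space Z. \<not> P x} \<subseteq> N" "emeasure Z N = 0" "N \<in> sets Z" using assms by (rule AE_E)
  then have "q -` N \<inter> space Z \<in> null_sets Z" using q unfolding nonsingular_def by blast
  from AE_not_in[OF this] AE_space show ?thesis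
    by eventually_elim (use N(1) measurable_space[OF ns_measurable(1)] in auto)
qed

text \<open>That images of null sets are null gives absolute continuity; that preimages of null sets
  are null gives positivity of the derivative almost everywhere. Hence the default 1 in
  \<open>rn_der\<close> affects a null set only.\<close>

lemma ns_rn_density:
  shows "rn_der Z q \<in> borel_measurable Z" "\<And>z. 0 < rn_der Z q z"
    "density Z (\<lambda>z. ennreal (rn_der Z q z)) = distr Z Z qi"
proof -
  interpret Z: prob_space Z by fact
  let ?D = "distr Z Z qi"
  interpret D: prob_space ?D by (rule Z.prob_space_distr[OF ns_measurable(2)])
  show m: "rn_der Z q \<in> borel_measurable Z" unfolding rn_der_def[abs_def] Let_def by measurable
  show "0 < rn_der Z q z" for z by (simp add: rn_der_def Let_def)
  have ac: "absolutely_continuous Z ?D"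
    unfolding absolutely_continuous_def
  proof
    fix N assume N: "N \<in> null_sets Z"
    then have Ns: "N \<in> sets Z" "N \<subseteq> space Z" using sets.sets_into_space by auto
    have "qi -` N \<inter> space Z = q ` N"
    proof
      show "qi -` N \<inter> space Z \<subseteq> q ` N" using ns_inv(1) by (metis IntD1 IntD2 image_eqI subsetI vimageD)
      show "q ` N \<subseteq> qi -` N \<inter> space Z" using ns_inv(2) Ns measurable_space[OF ns_measurable(1)] by auto
    qed
    moreover have "q ` N \<in> null_sets Z" using q N unfolding nonsingular_def by blast
    ultimately show "N \<in> null_sets ?D" using Ns ns_measurable(2) by (subst null_sets_distr_iff) auto
  qed
  have dens: "density Z (RN_deriv Z ?D) = ?D" by (rule Z.density_RN_deriv[OF ac]) simp
  have fin: "AE z in Z. RN_deriv Z ?D z \<noteq> \<infinity>"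
    by (rule Z.RN_deriv_finite[OF _ ac]) (auto intro: D.sigma_finite_measure_axioms)
  \<comment> \<open>The image measure gives no mass to the zero set of its density; pulling back
    along \<open>q\<close> shows that this set is null for \<open>Z\<close>.\<close>
  define S where "S = {z\<in>space Z. RN_deriv Z ?D z = 0}"
  have S [measurable]: "S \<in> sets Z" unfolding S_def by measurable
  have "emeasure ?D S = (\<integral>\<^sup>+z. RN_deriv Z ?D z * ind S z \<partial>Z)"
    by (subst dens[symmetric]) (simp add: emeasure_density)
  also have "\<dots> = (\<integral>\<^sup>+z. 0 \<partial>Z)" by (intro nn_integral_cong) (auto simp: S_def indicator_def)
  finally have "S \<in> null_sets ?D" using S by (intro null_setsI) auto
  then have "qi -` S \<inter> space Z \<in> null_sets Z" using ns_measurable(2) by (subst (asm) null_sets_distr_iff) auto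
  from ns_AE[OF AE_not_in[OF this]] have "AE z in Z. z \<notin> S"
    using AE_space by eventually_elim (use ns_inv measurable_space[OF ns_measurable(1)] in auto)
  then have "AE z in Z. ennreal (rn_der Z q z) = RN_deriv Z ?D z"
    using fin AE_space
  proof eventually_elim
    case (elim z)
    then have "0 < enn2real (RN_deriv Z ?D z)" "ennreal (enn2real (RN_deriv Z ?D z)) = RN_deriv Z ?D z"
      by (auto simp: S_def enn2real_positive_iff less_top zero_less_iff_neq_zero)
    then show ?case by (simp add: rn_der_def)
  qed
  then have "density Z (\<lambda>z. ennreal (rn_der Z q z)) = density Z (RN_deriv Z ?D)"
    by (intro density_cong) (use m in auto)
  then show "density Z (\<lambda>z. ennreal (rn_der Z q z)) = ?D" by (simp add: dens)
qed

lemma ns_change_of_variables: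
  assumes h: "h \<in> borel_measurable Z"
  shows "(\<integral>\<^sup>+z. ennreal (rn_der Z q z) * h (q z) \<partial>Z) = (\<integral>\<^sup>+z. h z \<partial>Z)"
proof -
  note m = ns_rn_density(1) ns_measurable
  have "(\<integral>\<^sup>+z. ennreal (rn_der Z q z) * h (q z) \<partial>Z) = (\<integral>\<^sup>+z. h (q z) \<partial>density Z (\<lambda>z. ennreal (rn_der Z q z)))"
    using m measurable_compose[OF m(2) h] by (intro nn_integral_density[symmetric]) auto
  also have "\<dots> = (\<integral>\<^sup>+z. h (q (qi z)) \<partial>Z)"
    unfolding ns_rn_density(3) using m measurable_compose[OF m(2) h] by (intro nn_integral_distr) auto
  also have "\<dots> = (\<integral>\<^sup>+z. h z \<partial>Z)" by (intro nn_integral_cong) (simp add: ns_inv)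
  finally show ?thesis .
qed

text \<open>Change of variables characterizes the derivative; the measure preserving case and the
  chain rule are obtained by checking it.\<close>

lemma ns_rn_unique:
  assumes g: "g \<in> borel_measurable Z" "\<And>z. z \<in> space Z \<Longrightarrow> 0 \<le> g z"
    and eq: "\<And>h. h \<in> borel_measurable Z \<Longrightarrow> (\<integral>\<^sup>+z. ennreal (g z) * h (q z) \<partial>Z) = (\<integral>\<^sup>+z. h z \<partial>Z)"
  shows "AE z in Z. rn_der Z q z = g z"
proof -
  interpret Z: prob_space Z by fact
  note [measurable] = ns_measurable ns_rn_density(1) g(1)
  have "AE z in Z. ennreal (rn_der Z q z) = ennreal (g z)"
  proof (rule AE_eq_of_nn_integral)
    fix A assume A [measurable]: "A \<in> sets Z"
    have qA: "(\<lambda>z. ind A (qi z) :: ennreal) \<in> borel_measurable Z" by measurable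
    \<comment> \<open>Writing \<open>z\<close> as \<open>qi (q z)\<close> turns the indicator into a
      function of \<open>q z\<close>, the form required by the change of variables.\<close>
    have *: "(\<integral>\<^sup>+z. k z * ind A z \<partial>Z) = (\<integral>\<^sup>+z. k z * ind A (qi (q z)) \<partial>Z)" for k :: "'z \<Rightarrow> ennreal"
      by (intro nn_integral_cong) (simp add: ns_inv)
    show "(\<integral>\<^sup>+z\<in>A. ennreal (rn_der Z q z) \<partial>Z) = (\<integral>\<^sup>+z\<in>A. ennreal (g z) \<partial>Z)"
      unfolding * ns_change_of_variables[OF qA] eq[OF qA] by simp
  qed (auto intro: Z.sigma_finite_measure_axioms)
  then show ?thesis
    using AE_space by eventually_elim (use ns_rn_density(2) g(2) in \<open>auto simp: less_imp_le\<close>)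
qed

lemma ns_preserving:
  assumes "distr Z Z q = Z" shows "AE z in Z. rn_der Z q z = 1"
proof (rule ns_rn_unique)
  show "(\<integral>\<^sup>+z. ennreal 1 * h (q z) \<partial>Z) = (\<integral>\<^sup>+z. h z \<partial>Z)" if "h \<in> borel_measurable Z" for h
    using nn_integral_distr[OF ns_measurable(1), of h] that assms by simp
qed auto

lemma pol_of_measurable: "(\<lambda>z. (z, q z, rn_der Z q z)) \<in> measurable Z (triple Z Z)"
proof -
  have "rn_der Z q \<in> measurable Z Rpos" using ns_rn_density by (simp add: measurable_Rpos_iff)
  then show ?thesis using ns_measurable by measurable
qed

lemma pol_of_Pol: "pol_of Z q \<in> Pol Z Z"
proof (rule PolI)
  show "sets (pol_of Z q) = sets (triple Z Z)" by (simp add: pol_of_def)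
  show "(\<integral>\<^sup>+z. ind A (fst z) \<partial>pol_of Z q) = emeasure Z A" if "A \<in> sets Z" for A
    unfolding pol_of_def using that by (subst nn_integral_distr[OF pol_of_measurable]) auto
  show "(\<integral>\<^sup>+z. ennreal (tc z) * ind A (yc z) \<partial>pol_of Z q) = emeasure Z A" if "A \<in> sets Z" for A
    unfolding pol_of_def using that ns_change_of_variables[of "ind A"] by (subst nn_integral_distr[OF pol_of_measurable]) auto
qed

lemma pform_pol_of:
  assumes "a \<in> borel_measurable Z" "b \<in> borel_measurable Z" "f \<in> borel_measurable Rpos"
  shows "pform a b f (pol_of Z q) = (LINT z|Z. a z * b (q z) * f (rn_der Z q z))"
  unfolding pform_def pol_of_def using assms by (subst integral_distr[OF pol_of_measurable]) auto

lemma ns_integral: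
  assumes h: "(h :: _ \<Rightarrow> 'b :: {banach, second_countable_topology}) \<in> borel_measurable Z"
  shows "(LINT z|Z. rn_der Z q z *\<^sub>R h (q z)) = (LINT z|Z. h z)"
    "integrable Z h \<Longrightarrow> integrable Z (\<lambda>z. rn_der Z q z *\<^sub>R h (q z))"
proof -
  have m: "q \<in> measurable (density Z (\<lambda>z. ennreal (rn_der Z q z))) Z" using ns_measurable by simp
  have d: "distr (density Z (\<lambda>z. ennreal (rn_der Z q z))) Z q = Z"
  proof -
    have "distr (density Z (\<lambda>z. ennreal (rn_der Z q z))) Z q = distr Z Z (q \<circ> qi)"
      unfolding ns_rn_density(3) by (rule distr_distr[OF ns_measurable])
    also have "\<dots> = distr Z Z (\<lambda>z. z)" by (rule distr_cong) (auto simp: ns_inv)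
    finally show ?thesis by simp
  qed
  have "(LINT z|Z. h z) = (LINT z|density Z (\<lambda>z. ennreal (rn_der Z q z)). h (q z))"
    using integral_distr[OF m h] by (simp add: d)
  also have "\<dots> = (LINT z|Z. rn_der Z q z *\<^sub>R h (q z))"
    using ns_rn_density measurable_compose[OF ns_measurable(1) h] by (intro integral_density) (auto simp: less_imp_le)
  finally show "(LINT z|Z. rn_der Z q z *\<^sub>R h (q z)) = (LINT z|Z. h z)" by simp
  assume "integrable Z h"
  then have "integrable (density Z (\<lambda>z. ennreal (rn_der Z q z))) (\<lambda>z. h (q z))"
    using integrable_distr[OF m, of h] by (simp add: d)
  then show "integrable Z (\<lambda>z. rn_der Z q z *\<^sub>R h (q z))"
    using ns_rn_density measurable_compose[OF ns_measurable(1) h] by (subst (asm) integrable_density) (auto simp: less_imp_le)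
qed

end

lemma ns_rn_chain:
  assumes Z: "prob_space Z" and q: "nonsingular Z q" and q': "nonsingular Z q'" and p: "nonsingular Z p"
    and pq: "AE z in Z. p z = q' (q z)"
  shows "AE z in Z. rn_der Z p z = rn_der Z q' (q z) * rn_der Z q z"
proof (rule ns_rn_unique[OF Z p])
  note m = ns_measurable[OF Z q] ns_measurable[OF Z q'] ns_rn_density[OF Z q] ns_rn_density[OF Z q']
  note [measurable] = m(1,3,5,8)
  show "(\<lambda>z. rn_der Z q' (q z) * rn_der Z q z) \<in> borel_measurable Z" by measurable
  show "0 \<le> rn_der Z q' (q z) * rn_der Z q z" for z using m(6,9) by (simp add: less_imp_le)
  fix h :: "'a \<Rightarrow> ennreal" assume [measurable]: "h \<in> borel_measurable Z"
  have "(\<integral>\<^sup>+z. ennreal (rn_der Z q' (q z) * rn_der Z q z) * h (p z) \<partial>Z) =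
      (\<integral>\<^sup>+z. ennreal (rn_der Z q z) * (ennreal (rn_der Z q' (q z)) * h (q' (q z))) \<partial>Z)" (is "?L34 = _")
    by (intro nn_integral_cong_AE) (use pq in eventually_elim, simp add: ennreal_mult less_imp_le m mult_ac)
  also have "\<dots> = (\<integral>\<^sup>+z. ennreal (rn_der Z q' z) * h (q' z) \<partial>Z)"
    by (rule ns_change_of_variables[OF Z q]) measurable
  also have "\<dots> = (\<integral>\<^sup>+z. h z \<partial>Z)" by (rule ns_change_of_variables[OF Z q']) measurable
  finally show "?L34 = (\<integral>\<^sup>+z. h z \<partial>Z)" .
qed

section \<open>The Hilbert space and its unitary representation\<close>

text \<open>Regularity of the image measure on the line: a Borel set is squeezed between a compact
  set and an open set of nearly the same measure, and a finite union of basis sets fits in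
  between.\<close>

lemma lebesgue_dense_sets:
  assumes W: "lebesgue_prob_space (W :: 'w measure)"
  shows "\<exists>C :: nat \<Rightarrow> 'w set. (\<forall>n. C n \<in> sets W) \<and>
    (\<forall>A\<in>sets W. \<forall>e>0. \<exists>n. measure W ((A - C n) \<union> (C n - A)) < e)"
proof -
  interpret W: prob_space W using W by (simp add: lebesgue_prob_space_def)
  obtain \<phi> :: "'w \<Rightarrow> real" and \<psi> where \<phi>: "\<phi> \<in> borel_measurable W"
    and \<psi>: "\<psi> \<in> measurable (completion (distr W borel \<phi>)) W"
    and AE: "AE w in W. \<psi> (\<phi> w) = w"
    using lebesgue_borel_model[OF W] by blast
  let ?N = "distr W borel \<phi>"
  interpret N: prob_space ?N by (rule W.prob_space_distr[OF \<phi>])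
  obtain B :: "real set set" where B: "countable B" "topological_basis B" using ex_countable_basis by blast
  define \<G> where "\<G> = (\<lambda>F. \<Union>F) ` {F. finite F \<and> F \<subseteq> B}"
  have cG: "countable \<G>" unfolding \<G>_def by (intro countable_image countable_Collect_finite_subset B)
  have "{} \<in> \<G>" unfolding \<G>_def by (intro image_eqI[of _ _ "{}"]) auto
  then have nG: "\<G> \<noteq> {}" by blast
  have oG: "open G" if "G \<in> \<G>" for G
    using that topological_basis_open[OF B(2)] unfolding \<G>_def by auto
  define C where "C n = \<phi> -` (from_nat_into \<G> n) \<inter> space W" for n
  have C: "C n \<in> sets W" for n
    unfolding C_def by (rule measurable_sets[OF \<phi> borel_open[OF oG[OF from_nat_into[OF nG]]]])
  have "\<exists>n. measure W ((A - C n) \<union> (C n - A)) < e" if A: "A \<in> sets W" and e: "e > 0" for A e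
  proof -
    obtain A' where A': "A' \<in> sets borel" "AE w in W. w \<in> A \<longleftrightarrow> \<phi> w \<in> A'"
      by (rule borel_model_sets[OF \<phi> \<psi> AE A]) blast
    have fin: "emeasure ?N (space ?N) \<noteq> \<infinity>" using N.emeasure_finite by simp
    have sN: "sets ?N = sets borel" by simp
    \<comment> \<open>If no compact set came within \<open>e / 2\<close>, inner regularity would
      bound the measure of \<open>A'\<close> by itself minus \<open>e / 2\<close>.\<close>
    have "\<exists>K. K \<subseteq> A' \<and> compact K \<and> emeasure ?N A' < emeasure ?N K + ennreal (e / 2)"
    proof (rule ccontr)
      assume no: "\<not> ?thesis"
      have "emeasure ?N A' = (SUP K\<in>{K. K \<subseteq> A' \<and> compact K}. emeasure ?N K)"
        by (rule inner_regular[OF sN fin A'(1)])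
      also have "\<dots> \<le> emeasure ?N A' - ennreal (e / 2)"
      proof (rule SUP_least)
        fix K assume "K \<in> {K. K \<subseteq> A' \<and> compact K}"
        then have "emeasure ?N K + ennreal (e / 2) \<le> emeasure ?N A'" using no by (auto simp: not_less)
        then show "emeasure ?N K \<le> emeasure ?N A' - ennreal (e / 2)"
          by (simp add: ennreal_le_minus_iff)
      qed
      finally have le: "emeasure ?N A' \<le> emeasure ?N A' - ennreal (e / 2)" .
      have "emeasure ?N {} + ennreal (e / 2) \<le> emeasure ?N A'" using no by (auto simp: not_less)
      then have "e / 2 \<le> measure ?N A'" using e by (simp add: N.emeasure_eq_measure)
      then have "measure ?N A' \<le> measure ?N A' - e / 2"
        using le e by (simp add: N.emeasure_eq_measure ennreal_minus)
      then show False using e by simp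
    qed
    then obtain K where K: "K \<subseteq> A'" "compact K" "emeasure ?N A' < emeasure ?N K + ennreal (e / 2)" by blast
    have "\<exists>U. A' \<subseteq> U \<and> open U \<and> emeasure ?N U < emeasure ?N A' + ennreal (e / 2)"
    proof -
      have "(INF U\<in>{U. A' \<subseteq> U \<and> open U}. emeasure ?N U) < emeasure ?N A' + ennreal (e / 2)"
        unfolding outer_regular[OF sN fin A'(1), symmetric] using e by (simp add: N.emeasure_eq_measure ennreal_plus[symmetric] ennreal_less_iff del: ennreal_plus)
      then show ?thesis by (auto simp: INF_less_iff)
    qed
    then obtain U where U: "A' \<subseteq> U" "open U" "emeasure ?N U < emeasure ?N A' + ennreal (e / 2)" by blast
    have "\<forall>x\<in>K. \<exists>b\<in>B. x \<in> b \<and> b \<subseteq> U" using topological_basisE[OF B(2) U(2)] K U by (metis subsetD)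
    then obtain b where b: "\<And>x. x \<in> K \<Longrightarrow> b x \<in> B" "\<And>x. x \<in> K \<Longrightarrow> x \<in> b x" "\<And>x. x \<in> K \<Longrightarrow> b x \<subseteq> U" by metis
    obtain D where D: "D \<subseteq> K" "finite D" "K \<subseteq> (\<Union>c\<in>D. b c)"
      by (rule compactE_image[OF K(2), of K b]) (use b topological_basis_open[OF B(2)] in auto)
    define G where "G = \<Union>(b ` D)"
    have "G \<in> \<G>" unfolding \<G>_def G_def by (rule image_eqI[OF refl]) (use D b in auto)
    then obtain n where n: "from_nat_into \<G> n = G" using cG by (metis from_nat_into_to_nat_on)
    have KG: "K \<subseteq> G" using D(3) by (simp add: G_def)
    have GU: "G \<subseteq> U" unfolding G_def using D(1) b(3) by blast
    have Km: "K \<in> sets borel" using K(2) by (simp add: borel_compact)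
    have "measure W ((A - C n) \<union> (C n - A)) \<le> measure W (\<phi> -` (U - K) \<inter> space W)"
    proof (rule W.finite_measure_mono_AE)
      show "AE x in W. x \<in> (A - C n) \<union> (C n - A) \<longrightarrow> x \<in> \<phi> -` (U - K) \<inter> space W"
        using A'(2) AE_space by eventually_elim (use KG GU K U in \<open>auto simp: C_def n\<close>)
      show "\<phi> -` (U - K) \<inter> space W \<in> sets W" by (rule measurable_sets[OF \<phi>]) (use U Km in auto)
    qed
    also have "\<dots> = measure ?N (U - K)" using U Km by (subst measure_distr[OF \<phi>]) auto
    also have "\<dots> = measure ?N U - measure ?N K" using U Km K by (intro N.finite_measure_Diff) auto
    also have "\<dots> < e"
    proof -
      have "measure ?N A' < measure ?N K + e / 2" "measure ?N U < measure ?N A' + e / 2"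
        using K(3) U(3) e by (simp_all add: N.emeasure_eq_measure ennreal_plus[symmetric] ennreal_less_iff del: ennreal_plus)
      then show ?thesis by linarith
    qed
    finally show ?thesis by blast
  qed
  then show ?thesis using C by blast
qed

text \<open>Norm and inner product act on functions rather than on classes; passing to classes is
  left to the models of the Hilbert space.\<close>

definition nrm :: "'z measure \<Rightarrow> ('z \<Rightarrow> complex) \<Rightarrow> real" where
  "nrm Z f = sqrt (LINT z|Z. (cmod (f z))\<^sup>2)"

abbreviation "dst Z f g \<equiv> nrm Z (\<lambda>z. f z - g z)"

definition ip :: "'z measure \<Rightarrow> ('z \<Rightarrow> complex) \<Rightarrow> ('z \<Rightarrow> complex) \<Rightarrow> complex" where
  "ip Z f g = (LINT z|Z. f z * cnj (g z))"

section \<open>Square-integrable functions: inequalities, completeness, a countable dense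
  family\<close>

lemma L2_measurable [measurable_dest]: "f \<in> L2_fun Z \<Longrightarrow> f \<in> borel_measurable Z"
  by (simp add: L2_fun_def)

lemma L2_integrable: "f \<in> L2_fun Z \<Longrightarrow> integrable Z (\<lambda>z. (cmod (f z))\<^sup>2)"
  by (simp add: L2_fun_def)

lemma L2_bound:
  assumes "f \<in> L2_fun Z" "g \<in> borel_measurable Z" "AE z in Z. cmod (g z) \<le> c * cmod (f z)"
  shows "g \<in> L2_fun Z"
proof -
  have "integrable Z (\<lambda>z. (cmod (g z))\<^sup>2)"
  proof (rule Bochner_Integration.integrable_bound)
    show "integrable Z (\<lambda>z. c\<^sup>2 * (cmod (f z))\<^sup>2)" using L2_integrable[OF assms(1)] by simp
    show "AE z in Z. norm ((cmod (g z))\<^sup>2) \<le> norm (c\<^sup>2 * (cmod (f z))\<^sup>2)"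
      using assms(3) by eventually_elim (auto simp: power_mult_distrib[symmetric] intro: power_mono)
  qed (use assms in measurable)
  then show ?thesis using assms by (simp add: L2_fun_def)
qed

lemma L2_add:
  assumes "f \<in> L2_fun Z" "g \<in> L2_fun Z" shows "(\<lambda>z. f z + g z) \<in> L2_fun Z"
proof -
  have "integrable Z (\<lambda>z. (cmod (f z + g z))\<^sup>2)"
  proof (rule Bochner_Integration.integrable_bound)
    show "integrable Z (\<lambda>z. 2 * (cmod (f z))\<^sup>2 + 2 * (cmod (g z))\<^sup>2)" using L2_integrable[OF assms(1)] L2_integrable[OF assms(2)] by simp
    show "AE z in Z. norm ((cmod (f z + g z))\<^sup>2) \<le> norm (2 * (cmod (f z))\<^sup>2 + 2 * (cmod (g z))\<^sup>2)"
    proof (rule AE_I2)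
      fix z
      have "(cmod (f z + g z))\<^sup>2 \<le> (cmod (f z) + cmod (g z))\<^sup>2" by (intro power_mono norm_triangle_ineq) simp
      also have "\<dots> \<le> 2 * (cmod (f z))\<^sup>2 + 2 * (cmod (g z))\<^sup>2"
        using sum_squares_bound[of "cmod (f z)" "cmod (g z)"] by (simp add: power2_sum)
      finally show "norm ((cmod (f z + g z))\<^sup>2) \<le> norm (2 * (cmod (f z))\<^sup>2 + 2 * (cmod (g z))\<^sup>2)" by simp
    qed
  qed (use assms in measurable)
  then show ?thesis using L2_measurable[OF assms(1)] L2_measurable[OF assms(2)] by (simp add: L2_fun_def)
qed

lemma L2_scale: "f \<in> L2_fun Z \<Longrightarrow> (\<lambda>z. c * f z) \<in> L2_fun Z"
  by (rule L2_bound[of f _ _ "cmod c"]) (auto simp: norm_mult L2_measurable)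

lemma L2_diff: "f \<in> L2_fun Z \<Longrightarrow> g \<in> L2_fun Z \<Longrightarrow> (\<lambda>z. f z - g z) \<in> L2_fun Z"
  using L2_add[OF _ L2_scale[of g Z "-1"], of f] by simp

lemma L2_zero: "(\<lambda>_. 0) \<in> L2_fun Z"
  by (simp add: L2_fun_def)

lemma L2_of_bfun:
  assumes "prob_space Z" "bfun Z f" shows "(\<lambda>z. complex_of_real (f z)) \<in> L2_fun Z"
proof -
  interpret prob_space Z by fact
  have "integrable Z (\<lambda>z. f z * f z)" using assms(2) by (intro bfun_integrable bfun_mult) unfold_locales
  then show ?thesis using bfun_measurable[OF assms(2)] by (simp add: L2_fun_def power2_eq_square)
qed

lemma borel_measurable_cnj: "f \<in> borel_measurable M \<Longrightarrow> (\<lambda>x. cnj (f x)) \<in> borel_measurable M"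
  by (rule measurable_compose[OF _ borel_measurable_continuous_onI[OF continuous_on_cnj[OF continuous_on_id]], unfolded o_def])

lemma ip_integrable:
  assumes "f \<in> L2_fun Z" "g \<in> L2_fun Z"
  shows "integrable Z (\<lambda>z. f z * cnj (g z))" "integrable Z (\<lambda>z. cmod (f z) * cmod (g z))"
proof -
  have i: "integrable Z (\<lambda>z. (cmod (f z))\<^sup>2 + (cmod (g z))\<^sup>2)" using L2_integrable[OF assms(1)] L2_integrable[OF assms(2)] by simp
  have le: "cmod (f z) * cmod (g z) \<le> (cmod (f z))\<^sup>2 + (cmod (g z))\<^sup>2" for z
  proof -
    have "0 \<le> cmod (f z) * cmod (g z)" by simp
    then show ?thesis using sum_squares_bound[of "cmod (f z)" "cmod (g z)"] by linarith
  qed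
  show "integrable Z (\<lambda>z. f z * cnj (g z))"
    by (rule Bochner_Integration.integrable_bound[OF i]) (use assms le in \<open>auto simp: norm_mult L2_measurable intro!: borel_measurable_times borel_measurable_cnj\<close>)
  show "integrable Z (\<lambda>z. cmod (f z) * cmod (g z))"
    by (rule Bochner_Integration.integrable_bound[OF i]) (use assms le in \<open>auto simp: L2_measurable\<close>)
qed

lemma nrm_nonneg: "0 \<le> nrm Z f"
  by (simp add: nrm_def)

lemma nrm_sq: "(nrm Z f)\<^sup>2 = (LINT z|Z. (cmod (f z))\<^sup>2)"
  by (simp add: nrm_def)

lemma ip_self: "ip Z f f = complex_of_real ((nrm Z f)\<^sup>2)"
proof -
  have "ip Z f f = (LINT z|Z. complex_of_real ((cmod (f z))\<^sup>2))"
    unfolding ip_def by (simp only: complex_norm_square)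
  then show ?thesis unfolding nrm_sq by (simp only: integral_complex_of_real)
qed

lemma nrm_eq_0: "f \<in> L2_fun Z \<Longrightarrow> nrm Z f = 0 \<longleftrightarrow> (AE z in Z. f z = 0)"
  using integral_nonneg_eq_0_iff_AE[OF L2_integrable, of f Z] by (simp add: nrm_def)

lemma L2_Cauchy_Schwarz:
  assumes "f \<in> L2_fun Z" "g \<in> L2_fun Z"
  shows "(LINT z|Z. cmod (f z) * cmod (g z)) \<le> nrm Z f * nrm Z g" "cmod (ip Z f g) \<le> nrm Z f * nrm Z g"
proof -
  define a b c where "a = (nrm Z f)\<^sup>2" and "b = (nrm Z g)\<^sup>2" and "c = (LINT z|Z. cmod (f z) * cmod (g z))"
  note i = L2_integrable[OF assms(1)] L2_integrable[OF assms(2)] ip_integrable(2)[OF assms]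
  have c0: "0 \<le> c" unfolding c_def by simp
  have q: "0 \<le> t\<^sup>2 * a - 2 * t * c + b" for t
  proof -
    have "0 \<le> (LINT z|Z. (t * cmod (f z) - cmod (g z))\<^sup>2)" by simp
    also have "\<dots> = (LINT z|Z. t\<^sup>2 * (cmod (f z))\<^sup>2 - 2 * t * (cmod (f z) * cmod (g z)) + (cmod (g z))\<^sup>2)"
      by (intro Bochner_Integration.integral_cong refl) (simp add: power2_diff power_mult_distrib algebra_simps)
    also have "\<dots> = t\<^sup>2 * a - 2 * t * c + b" using i by (simp add: a_def b_def c_def nrm_sq)
    finally show ?thesis .
  qed
  have "c\<^sup>2 \<le> a * b"
  proof (cases "a = 0")
    case True
    have "c = 0"
    proof (rule ccontr)
      assume "c \<noteq> 0"
      then have "0 < c" using c0 by simp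
      \<comment> \<open>With \<open>a = 0\<close> the quadratic is linear in \<open>t\<close>, and
        at this \<open>t\<close> its value is \<open>- 1\<close>.\<close>
      then show False using q[of "(b + 1) / (2 * c)"] True by (simp add: field_simps)
    qed
    then show ?thesis using True by simp
  next
    case False
    then have "0 < a" by (simp add: a_def)
    then show ?thesis using q[of "c / a"] by (simp add: field_simps power2_eq_square)
  qed
  also have "a * b = (nrm Z f * nrm Z g)\<^sup>2" by (simp add: a_def b_def power_mult_distrib)
  finally show 1: "(LINT z|Z. cmod (f z) * cmod (g z)) \<le> nrm Z f * nrm Z g"
    unfolding c_def by (rule power2_le_imp_le) (simp add: nrm_nonneg)
  have "cmod (ip Z f g) \<le> (LINT z|Z. cmod (f z * cnj (g z)))" unfolding ip_def by (rule integral_norm_bound)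
  then show "cmod (ip Z f g) \<le> nrm Z f * nrm Z g" using 1 by (simp add: norm_mult)
qed

lemma ip_add: "f \<in> L2_fun Z \<Longrightarrow> g \<in> L2_fun Z \<Longrightarrow> h \<in> L2_fun Z \<Longrightarrow> ip Z (\<lambda>z. f z + g z) h = ip Z f h + ip Z g h"
  unfolding ip_def by (simp add: distrib_right ip_integrable)

lemma ip_scale: "ip Z (\<lambda>z. c * f z) h = c * ip Z f h"
  unfolding ip_def by (simp add: mult.assoc)

lemma ip_cnj: "ip Z g f = cnj (ip Z f g)"
  unfolding ip_def by (simp add: Bochner_Integration.integral_cnj[symmetric] mult.commute)

lemma ip_diff: "f \<in> L2_fun Z \<Longrightarrow> g \<in> L2_fun Z \<Longrightarrow> h \<in> L2_fun Z \<Longrightarrow> ip Z (\<lambda>z. f z - g z) h = ip Z f h - ip Z g h"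
  unfolding ip_def by (simp add: left_diff_distrib ip_integrable)

lemma ip_diff2: "f \<in> L2_fun Z \<Longrightarrow> g \<in> L2_fun Z \<Longrightarrow> h \<in> L2_fun Z \<Longrightarrow> ip Z h (\<lambda>z. f z - g z) = ip Z h f - ip Z h g"
  unfolding ip_def by (simp add: right_diff_distrib ip_integrable)

lemma ip_add2: "f \<in> L2_fun Z \<Longrightarrow> g \<in> L2_fun Z \<Longrightarrow> h \<in> L2_fun Z \<Longrightarrow> ip Z h (\<lambda>z. f z + g z) = ip Z h f + ip Z h g"
  unfolding ip_def by (simp add: distrib_left ip_integrable)

lemma ip_cong:
  assumes "f \<in> L2_fun Z" "g \<in> L2_fun Z" "f' \<in> L2_fun Z" "g' \<in> L2_fun Z" "AE z in Z. f z = f' z" "AE z in Z. g z = g' z"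
  shows "ip Z f g = ip Z f' g'"
  unfolding ip_def
proof (rule integral_cong_AE)
  show "AE z in Z. f z * cnj (g z) = f' z * cnj (g' z)" using assms(5,6) by eventually_elim simp
qed (use ip_integrable[OF assms(1,2)] ip_integrable[OF assms(3,4)] in \<open>auto intro: borel_measurable_integrable\<close>)

lemma nrm_triangle:
  assumes f: "f \<in> L2_fun Z" and g: "g \<in> L2_fun Z" shows "nrm Z (\<lambda>z. f z + g z) \<le> nrm Z f + nrm Z g"
proof (rule power2_le_imp_le)
  have s: "(\<lambda>z. f z + g z) \<in> L2_fun Z" by (rule L2_add[OF f g])
  have "(nrm Z (\<lambda>z. f z + g z))\<^sup>2 = Re (ip Z (\<lambda>z. f z + g z) (\<lambda>z. f z + g z))" (is "?L35 = _") by (simp add: ip_self)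
  also have "\<dots> = Re (ip Z f f + ip Z f g + ip Z g f + ip Z g g)"
    by (simp add: ip_add ip_add2 f g s)
  also have "\<dots> \<le> (nrm Z f)\<^sup>2 + 2 * (nrm Z f * nrm Z g) + (nrm Z g)\<^sup>2"
    using L2_Cauchy_Schwarz(2)[OF f g] complex_Re_le_cmod[of "ip Z f g"]
    by (simp add: ip_self ip_cnj[of Z g f] del: of_real_power)
  finally show "?L35 \<le> (nrm Z f + nrm Z g)\<^sup>2" by (simp add: power2_sum)
qed (simp add: nrm_nonneg)

lemma nrm_diff_triangle:
  assumes "f \<in> L2_fun Z" "g \<in> L2_fun Z" "h \<in> L2_fun Z"
  shows "dst Z f h \<le> dst Z f g + dst Z g h"
  using nrm_triangle[OF L2_diff[OF assms(1,2)] L2_diff[OF assms(2,3)]] by simp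

lemma nrm_commute: "dst Z f g = dst Z g f"
  by (simp add: nrm_def norm_minus_commute)

lemma nrm_scale: "nrm Z (\<lambda>z. c * f z) = cmod c * nrm Z f"
  by (simp add: nrm_def norm_mult power_mult_distrib real_sqrt_mult)

lemma L1_le_nrm:
  assumes Z: "prob_space Z" and f: "f \<in> L2_fun Z"
  shows "(LINT z|Z. cmod (f z)) \<le> nrm Z f" "integrable Z (\<lambda>z. cmod (f z))"
proof -
  interpret prob_space Z by fact
  have 1: "(\<lambda>_. 1) \<in> L2_fun Z" using L2_of_bfun[OF Z bfun_const[of Z 1]] by simp
  have "nrm Z (\<lambda>_. 1) = 1" by (simp add: nrm_def prob_space)
  then show "(LINT z|Z. cmod (f z)) \<le> nrm Z f" using L2_Cauchy_Schwarz(1)[OF f 1] by simp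
  show "integrable Z (\<lambda>z. cmod (f z))" using ip_integrable(2)[OF f 1] by simp
qed

lemma L2_nn: "f \<in> L2_fun Z \<Longrightarrow> (\<integral>\<^sup>+z. ennreal ((cmod (f z))\<^sup>2) \<partial>Z) = ennreal ((nrm Z f)\<^sup>2)"
  unfolding nrm_sq by (intro nn_integral_eq_integral L2_integrable) auto

text \<open>The Riesz-Fischer argument: a subsequence with geometrically small increments converges
  almost everywhere, and Fatou's lemma gives the norm estimate for the whole sequence.\<close>

lemma L2_complete:
  assumes Z: "prob_space Z" and f: "\<And>n. f n \<in> L2_fun Z"
    and C: "\<And>e. e > 0 \<Longrightarrow> \<exists>N. \<forall>n\<ge>N. \<forall>m\<ge>N. dst Z (f n) (f m) < e"
  shows "\<exists>g\<in>L2_fun Z. (\<lambda>n. dst Z (f n) g) \<longlonglongrightarrow> 0"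
proof -
  interpret prob_space Z by fact
  have "\<exists>N. \<forall>n\<ge>N. \<forall>m\<ge>N. dst Z (f n) (f m) < (1 / 2) ^ k" for k by (rule C) simp
  then obtain N where N: "\<And>k n m. n \<ge> N k \<Longrightarrow> m \<ge> N k \<Longrightarrow> dst Z (f n) (f m) < (1 / 2) ^ k" by metis
  \<comment> \<open>An index beyond all of \<open>N i\<close> with \<open>i \<le> k\<close> at once,
    so that \<open>r j\<close> is admissible for every accuracy \<open>k \<le> j\<close>.\<close>
  define r where "r k = (\<Sum>i\<le>k. N i) + k" for k
  have rN: "N k \<le> r j" if "k \<le> j" for k j
  proof -
    have "N k \<le> (\<Sum>i\<le>j. N i)" using that by (intro member_le_sum) auto
    then show ?thesis by (simp add: r_def)
  qed
  define g where "g k = f (r k)" for k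
  have g: "g k \<in> L2_fun Z" for k by (simp add: g_def f)
  have gm [measurable]: "g k \<in> borel_measurable Z" for k using g by (rule L2_measurable)
  have gd: "dst Z (g (Suc k)) (g k) < (1 / 2) ^ k" for k
    unfolding g_def by (intro N rN) auto
  have "(\<integral>\<^sup>+z. (\<Sum>k. ennreal (cmod (g (Suc k) z - g k z))) \<partial>Z) = (\<Sum>k. (\<integral>\<^sup>+z. ennreal (cmod (g (Suc k) z - g k z)) \<partial>Z))"
    by (rule nn_integral_suminf) measurable
  also have "\<dots> \<le> (\<Sum>k. ennreal ((1 / 2) ^ k))"
  proof (intro suminf_le summableI)
    fix k
    have d: "(\<lambda>z. g (Suc k) z - g k z) \<in> L2_fun Z" by (intro L2_diff g)
    have "(\<integral>\<^sup>+z. ennreal (cmod (g (Suc k) z - g k z)) \<partial>Z) = ennreal (LINT z|Z. cmod (g (Suc k) z - g k z))" (is "?L36 = _")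
      by (rule nn_integral_eq_integral) (use L1_le_nrm[OF Z d] in auto)
    also have "\<dots> \<le> ennreal ((1 / 2) ^ k)" using L1_le_nrm(1)[OF Z d] gd[of k] by (intro ennreal_leI) linarith
    finally show "?L36 \<le> ennreal ((1 / 2) ^ k)" .
  qed
  also have "\<dots> < \<infinity>"
    by (subst suminf_ennreal_eq[of _ 2]) (use power_half_series in \<open>auto intro: geometric_sums[of "1/2 :: real", simplified]\<close>)
  finally have "AE z in Z. (\<Sum>k. ennreal (cmod (g (Suc k) z - g k z))) \<noteq> \<infinity>"
    by (intro nn_integral_PInf_AE) auto
  then have conv: "AE z in Z. convergent (\<lambda>k. g k z)"
  proof eventually_elim
    case (elim z)
    then have "summable (\<lambda>k. cmod (g (Suc k) z - g k z))"
      by (intro summable_suminf_not_top) auto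
    then have "summable (\<lambda>k. g (Suc k) z - g k z)" by (rule summable_norm_cancel)
    then have "(\<lambda>n. (\<Sum>k<n. g (Suc k) z - g k z)) \<longlonglongrightarrow> (\<Sum>k. g (Suc k) z - g k z)" by (rule summable_LIMSEQ)
    then have "(\<lambda>n. g n z - g 0 z) \<longlonglongrightarrow> (\<Sum>k. g (Suc k) z - g k z)" by (simp add: sum_lessThan_telescope[of "\<lambda>k. g k z"])
    then have "(\<lambda>n. g n z - g 0 z + g 0 z) \<longlonglongrightarrow> (\<Sum>k. g (Suc k) z - g k z) + g 0 z" by (rule tendsto_add) simp
    then show ?case by (auto simp: convergent_def)
  qed
  define h where "h z = lim (\<lambda>k. g k z)" for z
  have hm [measurable]: "h \<in> borel_measurable Z" unfolding h_def by (rule borel_measurable_lim_metric) measurable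
  have hl: "AE z in Z. (\<lambda>k. g k z) \<longlonglongrightarrow> h z"
    using conv by eventually_elim (simp add: h_def convergent_LIMSEQ_iff)
  have bound: "(\<integral>\<^sup>+z. ennreal ((cmod (f n z - h z))\<^sup>2) \<partial>Z) \<le> ennreal (((1 / 2) ^ j)\<^sup>2)" if n: "n \<ge> N j" for n j
  proof -
    have fm [measurable]: "f n \<in> borel_measurable Z" using f by (rule L2_measurable)
    have "(\<integral>\<^sup>+z. ennreal ((cmod (f n z - h z))\<^sup>2) \<partial>Z) = (\<integral>\<^sup>+z. liminf (\<lambda>k. ennreal ((cmod (f n z - g k z))\<^sup>2)) \<partial>Z)"
    proof (intro nn_integral_cong_AE)
      show "AE z in Z. ennreal ((cmod (f n z - h z))\<^sup>2) = liminf (\<lambda>k. ennreal ((cmod (f n z - g k z))\<^sup>2))"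
        using hl
      proof eventually_elim
        case (elim z)
        have "(\<lambda>k. ennreal ((cmod (f n z - g k z))\<^sup>2)) \<longlonglongrightarrow> ennreal ((cmod (f n z - h z))\<^sup>2)"
          by (intro tendsto_intros elim)
        then show ?case by (rule lim_imp_Liminf[OF sequentially_bot, symmetric])
      qed
    qed
    also have "\<dots> \<le> liminf (\<lambda>k. \<integral>\<^sup>+z. ennreal ((cmod (f n z - g k z))\<^sup>2) \<partial>Z)"
      by (rule nn_integral_liminf) measurable
    also have "\<dots> \<le> ennreal (((1 / 2) ^ j)\<^sup>2)"
    proof (rule Liminf_le)
      have "(\<integral>\<^sup>+z. ennreal ((cmod (f n z - g k z))\<^sup>2) \<partial>Z) \<le> ennreal (((1 / 2) ^ j)\<^sup>2)" if k: "k \<ge> j" for k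
      proof -
        have "dst Z (f n) (g k) < (1 / 2) ^ j" unfolding g_def by (intro N n rN k)
        then show ?thesis using L2_nn[OF L2_diff[OF f g]] nrm_nonneg by (auto intro!: ennreal_leI power_mono simp: less_imp_le)
      qed
      then show "\<forall>\<^sub>F k in sequentially. (\<integral>\<^sup>+z. ennreal ((cmod (f n z - g k z))\<^sup>2) \<partial>Z) \<le> ennreal (((1 / 2) ^ j)\<^sup>2)"
        unfolding eventually_sequentially by blast
    qed simp
    finally show ?thesis .
  qed
  have dL2: "(\<lambda>z. f n z - h z) \<in> L2_fun Z" if "n \<ge> N 0" for n
  proof -
    have [measurable]: "f n \<in> borel_measurable Z" using f by (rule L2_measurable)
    have "integrable Z (\<lambda>z. (cmod (f n z - h z))\<^sup>2)"
    proof (rule integrableI_bounded)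
      show "(\<integral>\<^sup>+z. ennreal (norm ((cmod (f n z - h z))\<^sup>2)) \<partial>Z) < \<infinity>"
        using le_less_trans[OF bound[OF that] ennreal_less_top] by simp
    qed measurable
    then show ?thesis by (simp add: L2_fun_def)
  qed
  have hL2: "h \<in> L2_fun Z" using L2_diff[OF f[of "N 0"] dL2[of "N 0"]] by simp
  have "(\<lambda>n. dst Z (f n) h) \<longlonglongrightarrow> 0"
  proof (rule LIMSEQ_I)
    fix e :: real assume e: "e > 0"
    obtain j where j: "(1 / 2 :: real) ^ j < e" using real_arch_pow_inv[OF e, of "1/2"] by auto
    have "dst Z (f n) h < e" if n: "n \<ge> N j" for n
    proof -
      have "ennreal ((dst Z (f n) h)\<^sup>2) \<le> ennreal (((1 / 2) ^ j)\<^sup>2)"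
        using bound[OF n] L2_nn[OF L2_diff[OF f hL2]] by simp
      then have "(dst Z (f n) h)\<^sup>2 \<le> ((1 / 2) ^ j)\<^sup>2" by (subst (asm) ennreal_le_iff) auto
      then have "dst Z (f n) h \<le> (1 / 2) ^ j" by (rule power2_le_imp_le) simp
      then show ?thesis using j by simp
    qed
    then show "\<exists>no. \<forall>n\<ge>no. norm (dst Z (f n) h - 0) < e"
      by (intro exI[of _ "N j"]) (simp add: abs_of_nonneg[OF nrm_nonneg])
  qed
  then show ?thesis using hL2 by blast
qed

text \<open>Lists of rational coefficients and indices of sets from a sequence; the family is
  countable because the lists are.\<close>

definition simp_fun :: "(nat \<Rightarrow> 'z set) \<Rightarrow> (rat \<times> rat \<times> nat) list \<Rightarrow> 'z \<Rightarrow> complex" where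
  "simp_fun C xs z = (\<Sum>(p, q, n)\<leftarrow>xs. Complex (of_rat p) (of_rat q) * ind (C n) z)"

lemma simp_fun_L2:
  assumes Z: "prob_space Z" and C: "\<And>n. C n \<in> sets Z" shows "simp_fun C xs \<in> L2_fun Z"
proof (induction xs)
  case Nil
  then show ?case using L2_zero by (simp add: simp_fun_def[abs_def])
next
  case (Cons x xs)
  obtain p q n where x: "x = (p, q, n)" by (cases x)
  have "(\<lambda>z. complex_of_real (ind (C n) z)) \<in> L2_fun Z" by (intro L2_of_bfun[OF Z] bfun_indicator C)
  then have "(\<lambda>z. ind (C n) z :: complex) \<in> L2_fun Z"
    by (rule back_subst[of "\<lambda>f. f \<in> L2_fun Z"]) (auto simp: indicator_def)
  from L2_add[OF L2_scale[OF this] Cons] show ?case by (simp add: simp_fun_def[abs_def] x)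
qed

text \<open>The class \<open>V\<close> of approximable functions is closed under sums and limits and
  contains multiples of indicators, hence all simple functions and then all of
  \<open>L2_fun Z\<close>.\<close>

lemma simp_fun_dense:
  assumes Z: "prob_space Z" and C: "\<And>n. C n \<in> sets Z"
    and dense: "\<And>A e. A \<in> sets Z \<Longrightarrow> e > 0 \<Longrightarrow> \<exists>n. measure Z ((A - C n) \<union> (C n - A)) < e"
    and f: "f \<in> L2_fun Z" and e: "e > 0"
  shows "\<exists>xs. dst Z f (simp_fun C xs) < e"
proof -
  interpret prob_space Z by fact
  note sL2 = simp_fun_L2[OF Z C]
  define V where "V = {f \<in> L2_fun Z. \<forall>e>0. \<exists>xs. dst Z f (simp_fun C xs) < e}"
  have indL2: "(\<lambda>z. ind A z :: complex) \<in> L2_fun Z" if "A \<in> sets Z" for A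
    using L2_of_bfun[OF Z bfun_indicator[OF that]] by (rule back_subst[of "\<lambda>f. f \<in> L2_fun Z"]) (auto simp: indicator_def)
  have V_closed: "f \<in> V" if f: "f \<in> L2_fun Z" and ap: "\<And>e. e > 0 \<Longrightarrow> \<exists>g\<in>V. dst Z f g < e" for f
  proof -
    have "\<exists>xs. dst Z f (simp_fun C xs) < e" if e: "e > 0" for e
    proof -
      obtain g where g: "g \<in> V" "dst Z f g < e / 2" using ap[of "e / 2"] e by auto
      then obtain xs where xs: "dst Z g (simp_fun C xs) < e / 2" using e half_gt_zero unfolding V_def by blast
      have "dst Z f (simp_fun C xs) \<le> dst Z f g + dst Z g (simp_fun C xs)"
        using g f sL2 by (intro nrm_diff_triangle) (auto simp: V_def)
      then show ?thesis using g xs by (intro exI[of _ xs]) linarith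
    qed
    then show ?thesis using f by (simp add: V_def)
  qed
  have V_add: "(\<lambda>z. f z + g z) \<in> V" if f: "f \<in> V" and g: "g \<in> V" for f g
  proof -
    have fg: "f \<in> L2_fun Z" "g \<in> L2_fun Z" using f g by (auto simp: V_def)
    have "\<exists>xs. nrm Z (\<lambda>z. f z + g z - simp_fun C xs z) < e" if e: "e > 0" for e
    proof -
      obtain xs where xs: "dst Z f (simp_fun C xs) < e / 2" using f e half_gt_zero unfolding V_def by blast
      obtain ys where ys: "dst Z g (simp_fun C ys) < e / 2" using g e half_gt_zero unfolding V_def by blast
      have "nrm Z (\<lambda>z. f z + g z - simp_fun C (xs @ ys) z) = nrm Z (\<lambda>z. (f z - simp_fun C xs z) + (g z - simp_fun C ys z))"
        by (simp add: simp_fun_def algebra_simps)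
      also have "\<dots> \<le> dst Z f (simp_fun C xs) + dst Z g (simp_fun C ys)"
        by (intro nrm_triangle L2_diff fg sL2)
      finally show ?thesis using xs ys by (intro exI[of _ "xs @ ys"]) linarith
    qed
    then show ?thesis using L2_add[OF fg] by (simp add: V_def)
  qed
  have V_ind: "(\<lambda>z. c * ind A z) \<in> V" if A: "A \<in> sets Z" for A c
  proof -
    have "\<exists>xs. nrm Z (\<lambda>z. c * ind A z - simp_fun C xs z) < e" if e: "e > 0" for e
    proof -
      \<comment> \<open>Half of \<open>e\<close> pays for replacing \<open>A\<close> by
        \<open>C n\<close>, the other half for rounding the coefficient to a rational one.\<close>
      define d where "d = e / 2 / (cmod c + 1)"
      have d: "d > 0" using e by (simp add: d_def add_nonneg_pos)
      obtain n where n: "measure Z ((A - C n) \<union> (C n - A)) < d\<^sup>2" using dense[OF A, of "d\<^sup>2"] d by auto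
      obtain p where p: "Re c < real_of_rat p" "real_of_rat p < Re c + e / 4" using of_rat_dense[of "Re c" "Re c + e / 4"] e by auto
      obtain q where q: "Im c < real_of_rat q" "real_of_rat q < Im c + e / 4" using of_rat_dense[of "Im c" "Im c + e / 4"] e by auto
      define c' where "c' = Complex (of_rat p) (of_rat q)"
      have "cmod (c - c') \<le> \<bar>Re (c - c')\<bar> + \<bar>Im (c - c')\<bar>" by (rule cmod_le)
      then have cc: "cmod (c - c') < e / 2" using p q by (simp add: c'_def)
      have "nrm Z (\<lambda>z. c * ind A z - simp_fun C [(p, q, n)] z) =
          nrm Z (\<lambda>z. c * (ind A z - ind (C n) z) + (c - c') * ind (C n) z)"
        by (simp add: simp_fun_def c'_def algebra_simps)
      also have "\<dots> \<le> nrm Z (\<lambda>z. c * (ind A z - ind (C n) z)) + nrm Z (\<lambda>z. (c - c') * ind (C n) z)"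
        by (intro nrm_triangle L2_scale L2_diff indL2 A C)
      also have "nrm Z (\<lambda>z. c * (ind A z - ind (C n) z)) = cmod c * dst Z (ind A) (ind (C n))" by (rule nrm_scale)
      also have "dst Z (ind A) (ind (C n)) \<le> d"
      proof -
        have "(LINT z|Z. (cmod (ind A z - ind (C n) z))\<^sup>2) = (LINT z|Z. ind ((A - C n) \<union> (C n - A)) z)"
          by (intro Bochner_Integration.integral_cong refl) (auto simp: indicator_def)
        also have "\<dots> = measure Z ((A - C n) \<union> (C n - A))" using A C by simp
        finally have "dst Z (ind A) (ind (C n)) < sqrt (d\<^sup>2)"
          using real_sqrt_less_mono[OF n] unfolding nrm_def by (simp only:)
        then show ?thesis using d by simp
      qed
      also have "nrm Z (\<lambda>z. (c - c') * ind (C n) z) = cmod (c - c') * nrm Z (ind (C n))" by (rule nrm_scale)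
      also have "nrm Z (ind (C n)) \<le> 1"
      proof -
        have "(LINT z|Z. (cmod (ind (C n) z))\<^sup>2) = (LINT z|Z. ind (C n) z)"
          by (intro Bochner_Integration.integral_cong refl) (auto simp: indicator_def)
        also have "\<dots> \<le> 1" using C by simp
        finally show ?thesis unfolding nrm_def by simp
      qed
      also have "cmod c * d + cmod (c - c') * 1 < e"
      proof -
        have "cmod c + 1 \<noteq> 0" using norm_ge_zero[of c] by linarith
        then have "(cmod c + 1) * d = e / 2" unfolding d_def by (metis nonzero_mult_div_cancel_left times_divide_eq_right)
        then have "cmod c * d \<le> e / 2" using d by (simp add: distrib_right)
        then show ?thesis using cc by simp
      qed
      finally show ?thesis by (auto simp: mult_left_mono)
    qed
    then show ?thesis using L2_scale[OF indL2[OF A]] by (simp add: V_def)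
  qed
  have V_simple: "s \<in> V" if s: "simple_function Z s" for s
  proof -
    have fin: "finite (s ` space Z)" using s by (rule simple_functionD)
    have sum: "(\<lambda>z. \<Sum>y\<in>Y. y * ind (s -` {y} \<inter> space Z) z) \<in> V" if "finite Y" for Y
      using that
    proof (induction Y)
      case empty
      then show ?case using V_ind[OF sets.empty_sets, of 0] by simp
    next
      case (insert y Y)
      have "s -` {y} \<inter> space Z \<in> sets Z" using s by (rule simple_functionD)
      from V_add[OF V_ind[OF this, of y] insert.IH] show ?case by (simp only: sum.insert[OF insert.hyps])
    qed
    have sm: "s \<in> borel_measurable Z" using s by (rule borel_measurable_simple_function)
    have eq: "s z = (\<Sum>y\<in>s ` space Z. y * ind (s -` {y} \<inter> space Z) z)" if "z \<in> space Z" for z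
    proof -
      have "(\<Sum>y\<in>s ` space Z. y * ind (s -` {y} \<inter> space Z) z) = (\<Sum>y\<in>s ` space Z. if s z = y then y else 0)"
        using that by (intro sum.cong) (auto simp: indicator_def)
      also have "\<dots> = s z" using that fin by simp
      finally show ?thesis by simp
    qed
    have V_AE: "f \<in> V" if "g \<in> V" "f \<in> borel_measurable Z" "\<And>z. z \<in> space Z \<Longrightarrow> f z = g z" for f g
    proof (rule V_closed)
      have gL: "g \<in> L2_fun Z" using that(1) by (simp add: V_def)
      have "AE z in Z. cmod (f z) \<le> 1 * cmod (g z)" by (rule AE_I2) (simp add: that(3))
      then show "f \<in> L2_fun Z" by (rule L2_bound[OF gL that(2)])
      have "(LINT z|Z. (cmod (f z - g z))\<^sup>2) = (LINT z|Z. 0)"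
        by (intro Bochner_Integration.integral_cong refl) (simp add: that(3))
      then have "dst Z f g = 0" unfolding nrm_def by simp
      then show "\<exists>g\<in>V. dst Z f g < e" if "e > 0" for e using \<open>g \<in> V\<close> that by (intro bexI[of _ g]) simp_all
    qed
    show ?thesis by (rule V_AE[OF sum[OF fin] sm eq])
  qed
  have "f \<in> V"
  proof (rule V_closed[OF f])
    fix e :: real assume e: "e > 0"
    have fm [measurable]: "f \<in> borel_measurable Z" using f by (rule L2_measurable)
    obtain s where s: "\<And>i. simple_function Z (s i)" "\<And>x. x \<in> space Z \<Longrightarrow> (\<lambda>i. s i x) \<longlonglongrightarrow> f x"
      "\<And>i x. x \<in> space Z \<Longrightarrow> dist (s i x) 0 \<le> 2 * dist (f x) 0"
      using borel_measurable_implies_sequence_metric[OF fm, of 0] by metis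
    have sm [measurable]: "s i \<in> borel_measurable Z" for i using s(1) by (rule borel_measurable_simple_function)
    have "(\<lambda>i. LINT z|Z. (cmod (f z - s i z))\<^sup>2) \<longlonglongrightarrow> (LINT z|Z. 0)"
    \<comment> \<open>The simple functions are bounded by twice \<open>f\<close> in modulus, so the
      difference is at most three times \<open>f\<close>; squaring gives 9.\<close>
    proof (rule integral_dominated_convergence[where w = "\<lambda>z. 9 * (cmod (f z))\<^sup>2"])
      show "integrable Z (\<lambda>z. 9 * (cmod (f z))\<^sup>2)" using L2_integrable[OF f] by simp
      show "AE z in Z. (\<lambda>i. (cmod (f z - s i z))\<^sup>2) \<longlonglongrightarrow> 0"
      proof (rule AE_I2)
        fix z assume "z \<in> space Z"
        from tendsto_power[OF tendsto_norm[OF tendsto_diff[OF tendsto_const s(2)[OF this]]], of "f z" 2]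
        show "(\<lambda>i. (cmod (f z - s i z))\<^sup>2) \<longlonglongrightarrow> 0" by simp
      qed
      show "AE z in Z. norm ((cmod (f z - s i z))\<^sup>2) \<le> 9 * (cmod (f z))\<^sup>2" for i
      proof (rule AE_I2)
        fix z assume "z \<in> space Z"
        then have "cmod (f z - s i z) \<le> 3 * cmod (f z)" using s(3)[of z i] norm_triangle_ineq4[of "f z" "s i z"] by simp
        then have "(cmod (f z - s i z))\<^sup>2 \<le> (3 * cmod (f z))\<^sup>2" by (intro power_mono) auto
        then show "norm ((cmod (f z - s i z))\<^sup>2) \<le> 9 * (cmod (f z))\<^sup>2" by (simp add: power_mult_distrib)
      qed
    qed measurable
    then have "\<forall>\<^sub>F i in sequentially. (LINT z|Z. (cmod (f z - s i z))\<^sup>2) < e\<^sup>2"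
      using e by (intro order_tendstoD(2)[where a = "e\<^sup>2"]) auto
    then obtain i where i: "(LINT z|Z. (cmod (f z - s i z))\<^sup>2) < e\<^sup>2" by (auto simp: eventually_sequentially)
    have "dst Z f (s i) < sqrt (e\<^sup>2)" unfolding nrm_def by (rule real_sqrt_less_mono[OF i])
    then show "\<exists>g\<in>V. dst Z f g < e" using V_simple[OF s(1)] e by auto
  qed
  then show ?thesis using e by (simp add: V_def)
qed

text \<open>\<open>J\<close> encodes a function as a vector and \<open>R\<close> picks a
  representative. One development thus serves both the classes in \<open>L2 Z\<close> and the
  sequences over which representations are quantified.\<close>

definition l2_space :: "'z measure \<Rightarrow> (('z \<Rightarrow> complex) \<Rightarrow> 'h) \<Rightarrow> ('h \<Rightarrow> 'z \<Rightarrow> complex) \<Rightarrow> 'h hilbert" where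
  "l2_space Z J R = \<lparr>hcarrier = J ` L2_fun Z, hzero = J (\<lambda>_. 0),
     hplus = (\<lambda>x y. J (\<lambda>z. R x z + R y z)), hscale = (\<lambda>c x. J (\<lambda>z. c * R x z)),
     hinner = (\<lambda>x y. LINT z|Z. R x z * cnj (R y z))\<rparr>"

locale l2_model = prob_space Z for Z :: "'z measure" +
  fixes J :: "('z \<Rightarrow> complex) \<Rightarrow> 'h" and R :: "'h \<Rightarrow> 'z \<Rightarrow> complex"
  assumes R_L2: "f \<in> L2_fun Z \<Longrightarrow> R (J f) \<in> L2_fun Z"
    and R_AE: "f \<in> L2_fun Z \<Longrightarrow> AE z in Z. R (J f) z = f z"
    and J_cong: "f \<in> L2_fun Z \<Longrightarrow> g \<in> L2_fun Z \<Longrightarrow> AE z in Z. f z = g z \<Longrightarrow> J f = J g"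
begin

abbreviation "H \<equiv> l2_space Z J R"

lemma hcarrier_H: "hcarrier H = J ` L2_fun Z" and hzero_H: "hzero H = J (\<lambda>_. 0)"
  by (simp_all add: l2_space_def)

lemma J_eq_iff:
  assumes "f \<in> L2_fun Z" "g \<in> L2_fun Z" shows "J f = J g \<longleftrightarrow> (AE z in Z. f z = g z)"
proof
  assume eq: "J f = J g"
  show "AE z in Z. f z = g z" using R_AE[OF assms(1)] R_AE[OF assms(2)] unfolding eq by eventually_elim simp
qed (rule J_cong[OF assms])

lemma hplus_J:
  assumes f: "f \<in> L2_fun Z" and g: "g \<in> L2_fun Z" shows "hplus H (J f) (J g) = J (\<lambda>z. f z + g z)"
proof -
  have "AE z in Z. R (J f) z + R (J g) z = f z + g z" using R_AE[OF f] R_AE[OF g] by eventually_elim simp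
  then show ?thesis by (simp add: l2_space_def J_eq_iff L2_add R_L2 f g)
qed

lemma hscale_J:
  assumes f: "f \<in> L2_fun Z" shows "hscale H c (J f) = J (\<lambda>z. c * f z)"
proof -
  have "AE z in Z. c * R (J f) z = c * f z" using R_AE[OF f] by eventually_elim simp
  then show ?thesis unfolding l2_space_def hilbert.simps by (subst J_eq_iff[OF L2_scale[OF R_L2[OF f]] L2_scale[OF f]])
qed

lemma hinner_J:
  assumes f: "f \<in> L2_fun Z" and g: "g \<in> L2_fun Z" shows "hinner H (J f) (J g) = ip Z f g"
proof -
  have "hinner H (J f) (J g) = ip Z (R (J f)) (R (J g))" by (simp add: l2_space_def ip_def)
  also have "\<dots> = ip Z f g" by (intro ip_cong R_L2 f g R_AE)
  finally show ?thesis .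
qed

lemma hdiff_J:
  assumes f: "f \<in> L2_fun Z" and g: "g \<in> L2_fun Z" shows "hplus H (J f) (hscale H (- 1) (J g)) = J (\<lambda>z. f z - g z)"
  using hplus_J[OF f L2_scale[OF g, of "- 1"]] by (simp add: hscale_J g)

lemma hdist_J:
  assumes f: "f \<in> L2_fun Z" and g: "g \<in> L2_fun Z" shows "hdist H (J f) (J g) = dst Z f g"
  using f g by (simp add: hdist_def hcarrier_H hdiff_J hinner_J L2_diff ip_self nrm_nonneg del: of_real_power)

lemma metric: "Metric_space (hcarrier H) (hdist H)"
proof
  have nn: "0 \<le> Re (hinner H (J f) (J f))" if "f \<in> L2_fun Z" for f
    using that by (simp add: hinner_J ip_self del: of_real_power)
  show "0 \<le> hdist H x y" for x y
  proof (cases "x \<in> hcarrier H \<and> y \<in> hcarrier H")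
    case True
    then show ?thesis by (auto simp: hcarrier_H hdist_J nrm_nonneg)
  qed (auto simp: hdist_def)
  show "hdist H x y = hdist H y x" for x y
  proof (cases "x \<in> hcarrier H \<and> y \<in> hcarrier H")
    case True
    then show ?thesis by (auto simp: hcarrier_H hdist_J intro: nrm_commute)
  qed (auto simp: hdist_def)
  show "hdist H x y = 0 \<longleftrightarrow> x = y" if "x \<in> hcarrier H" "y \<in> hcarrier H" for x y
    using that by (auto simp: hcarrier_H hdist_J nrm_eq_0 L2_diff J_eq_iff)
  show "hdist H x z \<le> hdist H x y + hdist H y z" if "x \<in> hcarrier H" "y \<in> hcarrier H" "z \<in> hcarrier H" for x y z
    using that by (auto simp: hcarrier_H hdist_J nrm_diff_triangle)
qed

text \<open>Density is expressed by functions alone, without \<open>J\<close> and \<open>R\<close>;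
  this is what carries admissibility from one model to the other.\<close>

lemma closure_iff:
  assumes "S \<subseteq> L2_fun Z"
  shows "htopology H closure_of (J ` S) = hcarrier H \<longleftrightarrow>
    (\<forall>f\<in>L2_fun Z. \<forall>e>0. \<exists>g\<in>S. dst Z f g < e)"
proof -
  interpret M: Metric_space "hcarrier H" "hdist H" by (rule metric)
  have "htopology H closure_of (J ` S) = hcarrier H \<longleftrightarrow>
      (\<forall>x\<in>hcarrier H. \<forall>e>0. \<exists>y\<in>J ` S. y \<in> hcarrier H \<and> hdist H x y < e)"
    unfolding M.metric_closure_of M.in_mball by blast
  also have "\<dots> \<longleftrightarrow> (\<forall>f\<in>L2_fun Z. \<forall>e>0. \<exists>g\<in>S. J g \<in> hcarrier H \<and> hdist H (J f) (J g) < e)"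
    by (simp add: hcarrier_H)
  also have "\<dots> \<longleftrightarrow> (\<forall>f\<in>L2_fun Z. \<forall>e>0. \<exists>g\<in>S. dst Z f g < e)"
  proof -
    have "J g \<in> hcarrier H \<and> hdist H (J f) (J g) < e \<longleftrightarrow> dst Z f g < e"
      if "f \<in> L2_fun Z" "g \<in> S" for f g e
      using hdist_J[OF that(1), of g] that assms by (simp add: hcarrier_H subset_iff)
    then show ?thesis by simp
  qed
  finally show ?thesis .
qed

lemma separable_hilbert:
  assumes "countable D" "D \<subseteq> L2_fun Z" "\<And>f e. f \<in> L2_fun Z \<Longrightarrow> e > 0 \<Longrightarrow> \<exists>g\<in>D. dst Z f g < e"
  shows "separable_hilbert_space H"
proof -
  interpret M: Metric_space "hcarrier H" "hdist H" by (rule metric)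
  have "htopology H closure_of (J ` D) = hcarrier H" using closure_iff[OF assms(2)] assms(3) by blast
  then have sep: "separable_space (htopology H)" unfolding separable_space_def M.topspace_mtopology
    using assms(1,2) by (intro exI[of _ "J ` D"]) (auto simp: hcarrier_H)
  have compl: "M.mcomplete" unfolding M.mcomplete_def
  proof (intro allI impI)
    fix x assume C: "M.MCauchy x"
    then have "range x \<subseteq> hcarrier H" by (simp add: M.MCauchy_def)
    then have "\<forall>n. \<exists>f\<in>L2_fun Z. x n = J f" unfolding hcarrier_H by blast
    then obtain f where f: "\<And>n. f n \<in> L2_fun Z" "\<And>n. x n = J (f n)" by metis
    have "\<exists>g\<in>L2_fun Z. (\<lambda>n. dst Z (f n) g) \<longlonglongrightarrow> 0"
    proof (rule L2_complete[OF prob_space_axioms f(1)])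
      fix e :: real assume "e > 0"
      then show "\<exists>N. \<forall>n\<ge>N. \<forall>m\<ge>N. dst Z (f n) (f m) < e"
        using C unfolding M.MCauchy_def f(2) hdist_J[OF f(1) f(1)] by meson
    qed
    then obtain g where g: "g \<in> L2_fun Z" "(\<lambda>n. dst Z (f n) g) \<longlonglongrightarrow> 0" by blast
    have "limitin M.mtopology x (J g) sequentially"
      unfolding M.limitin_metric
    proof (intro conjI allI impI)
      fix e :: real assume "e > 0"
      with g(2) have "\<forall>\<^sub>F n in sequentially. dst Z (f n) g < e" by (rule order_tendstoD(2))
      then show "\<forall>\<^sub>F n in sequentially. x n \<in> hcarrier H \<and> hdist H (x n) (J g) < e"
        by eventually_elim (auto simp: f hcarrier_H hdist_J g(1))
    qed (use g in \<open>auto simp: hcarrier_H\<close>)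
    then show "\<exists>y. limitin M.mtopology x y sequentially" by blast
  qed
  show ?thesis
    unfolding separable_hilbert_space_def hcarrier_H[unfolded hcarrier_H]
  proof (intro conjI)
    show "M.mcomplete" "separable_space (htopology H)" by (rule compl, rule sep)
    show "\<forall>x\<in>hcarrier H. \<forall>y\<in>hcarrier H. hinner H y x = cnj (hinner H x y)"
      by (auto simp: hcarrier_H hinner_J intro: ip_cnj)
    show "\<forall>x\<in>hcarrier H. hplus H x (hscale H (- 1) x) = hzero H"
      by (auto simp only: hcarrier_H hzero_H hdiff_J) simp
  qed (auto simp: hcarrier_H hzero_H hplus_J hscale_J hinner_J L2_add L2_scale L2_zero L2_diff ip_add ip_scale
        ip_self J_eq_iff nrm_eq_0 algebra_simps simp del: of_real_power)
qed

end

section \<open>The unitary operators, defined on functions\<close>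

definition U_op :: "'z measure \<Rightarrow> real \<Rightarrow> ('z \<Rightarrow> 'z) \<Rightarrow> ('z \<Rightarrow> complex) \<Rightarrow> 'z \<Rightarrow> complex" where
  "U_op Z s q f z = f (q z) * complex_of_real (rn_der Z q z) powr (1 / 2 + \<i> * complex_of_real s)"

lemma cmod_powr_half: "0 < t \<Longrightarrow> (cmod (complex_of_real t powr (1 / 2 + \<i> * complex_of_real s)))\<^sup>2 = t"
  by (simp add: norm_powr_real_powr powr_half_sqrt)

context
  fixes Z :: "'z measure" and q :: "'z \<Rightarrow> 'z" and s :: real
  assumes Z: "prob_space Z" and q: "nonsingular Z q"
begin

lemma U_measurable: "f \<in> borel_measurable Z \<Longrightarrow> U_op Z s q f \<in> borel_measurable Z"
proof -
  assume f: "f \<in> borel_measurable Z"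
  note [measurable] = ns_measurable(1)[OF Z q] ns_rn_density(1)[OF Z q] f
  have "continuous_on {0<..} (\<lambda>t. complex_of_real t powr (1 / 2 + \<i> * complex_of_real s))"
    by (intro continuous_intros) (auto simp: complex_nonpos_Reals_iff)
  then have c: "(\<lambda>t. complex_of_real t powr (1 / 2 + \<i> * complex_of_real s)) \<in> borel_measurable Rpos"
    by (rule borel_measurable_continuous_on_restrict)
  have "rn_der Z q \<in> measurable Z Rpos" using ns_rn_density[OF Z q] by (simp add: measurable_Rpos_iff)
  from measurable_compose[OF this c] show ?thesis unfolding U_op_def[abs_def] by measurable
qed

lemma U_mult_cnj: "U_op Z s q f z * cnj (U_op Z s q g z) = rn_der Z q z *\<^sub>R (f (q z) * cnj (g (q z)))"
proof -
  define w where "w = complex_of_real (rn_der Z q z) powr (1 / 2 + \<i> * complex_of_real s)"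
  have "w * cnj w = complex_of_real ((cmod w)\<^sup>2)" by (rule complex_norm_square[symmetric])
  also have "(cmod w)\<^sup>2 = rn_der Z q z" unfolding w_def by (rule cmod_powr_half[OF ns_rn_density(2)[OF Z q]])
  finally have w: "w * cnj w = complex_of_real (rn_der Z q z)" .
  have "U_op Z s q f z * cnj (U_op Z s q g z) = (w * cnj w) * (f (q z) * cnj (g (q z)))"
    by (simp add: U_op_def w_def mult_ac)
  then show ?thesis unfolding w by (simp add: scaleR_conv_of_real)
qed

lemma U_L2: assumes f: "f \<in> L2_fun Z" shows "U_op Z s q f \<in> L2_fun Z"
proof -
  have [measurable]: "f \<in> borel_measurable Z" using f by (rule L2_measurable)
  have sq: "(cmod (U_op Z s q f z))\<^sup>2 = rn_der Z q z *\<^sub>R (cmod (f (q z)))\<^sup>2" for z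
    by (simp add: U_op_def norm_mult power_mult_distrib cmod_powr_half ns_rn_density(2)[OF Z q])
  have "integrable Z (\<lambda>z. (cmod (U_op Z s q f z))\<^sup>2)" unfolding sq
    by (rule ns_integral(2)[OF Z q]) (use L2_integrable[OF f] in auto)
  then show ?thesis using U_measurable by (simp add: L2_fun_def)
qed

lemma U_ip:
  assumes f: "f \<in> L2_fun Z" and g: "g \<in> L2_fun Z"
  shows "ip Z (U_op Z s q f) (U_op Z s q g) = ip Z f g"
  unfolding ip_def U_mult_cnj
  by (rule ns_integral(1)[OF Z q]) (rule borel_measurable_integrable[OF ip_integrable(1)[OF f g]])

lemma U_cong: "AE z in Z. f z = g z \<Longrightarrow> AE z in Z. U_op Z s q f z = U_op Z s q g z"
  using ns_AE[OF Z q, of "\<lambda>z. f z = g z"] by (simp add: U_op_def eventually_mono)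

lemma U_preserving:
  assumes "distr Z Z q = Z" shows "AE z in Z. U_op Z s q f z = f (q z)"
  using ns_preserving[OF Z q assms] by eventually_elim (simp add: U_op_def)

text \<open>The chain rule for derivatives, together with multiplicativity of complex powers at
  positive reals.\<close>

lemma U_comp:
  assumes q': "nonsingular Z q'" and p: "nonsingular Z p" and pq: "AE z in Z. p z = q' (q z)"
  shows "AE z in Z. U_op Z s p f z = U_op Z s q (U_op Z s q' f) z"
  using ns_rn_chain[OF Z q q' p pq] pq
proof eventually_elim
  case (elim z)
  have "complex_of_real (rn_der Z q' (q z) * rn_der Z q z) powr (1 / 2 + \<i> * complex_of_real s) =
    complex_of_real (rn_der Z q' (q z)) powr (1 / 2 + \<i> * complex_of_real s) *
    complex_of_real (rn_der Z q z) powr (1 / 2 + \<i> * complex_of_real s)"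
    unfolding of_real_mult using ns_rn_density(2)[OF Z q'] ns_rn_density(2)[OF Z q]
    by (intro powr_times_real) (auto simp: less_imp_le)
  then show ?case unfolding U_op_def elim by (simp add: mult_ac)
qed

end

lemma indicator_L2:
  assumes "prob_space Z" "A \<in> sets Z" shows "(\<lambda>z. complex_of_real (ind A z)) \<in> L2_fun Z"
  by (rule L2_of_bfun[OF assms(1) bfun_indicator[OF assms(2)]])

text \<open>By density of \<open>simp_fun\<close>, multiples of indicators together with sums and
  limits reach every square-integrable function.\<close>

lemma L2_induct [consumes 2, case_names indicator add limit]:
  assumes Z: "lebesgue_prob_space Z" and f: "f \<in> L2_fun Z"
    and ind: "\<And>c A. A \<in> sets Z \<Longrightarrow> P (\<lambda>z. c * complex_of_real (ind A z))"
    and add: "\<And>f g. f \<in> L2_fun Z \<Longrightarrow> g \<in> L2_fun Z \<Longrightarrow> P f \<Longrightarrow> P g \<Longrightarrow> P (\<lambda>z. f z + g z)"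
    and lim: "\<And>f. f \<in> L2_fun Z \<Longrightarrow> (\<And>e. e > 0 \<Longrightarrow> \<exists>g\<in>L2_fun Z. P g \<and> dst Z f g < e) \<Longrightarrow> P f"
  shows "P f"
proof -
  have pZ: "prob_space Z" using Z by (simp add: lebesgue_prob_space_def)
  from lebesgue_dense_sets[OF Z]
  obtain C :: "nat \<Rightarrow> _ set" where C0: "(\<forall>n. C n \<in> sets Z) \<and> (\<forall>A\<in>sets Z. \<forall>e>0. \<exists>n. measure Z ((A - C n) \<union> (C n - A)) < e)" ..
  note C = C0[THEN conjunct1, rule_format] C0[THEN conjunct2, rule_format]
  have s: "P (simp_fun C xs)" for xs
  proof (induction xs)
    case Nil
    show ?case using ind[of "{}" 0] by (simp add: simp_fun_def[abs_def])
  next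
    case (Cons x xs)
    obtain p q n where x: "x = (p, q, n)" by (cases x)
    have "simp_fun C (x # xs) = (\<lambda>z. Complex (of_rat p) (of_rat q) * complex_of_real (ind (C n) z) + simp_fun C xs z)"
      by (simp add: simp_fun_def[abs_def] x indicator_def fun_eq_iff)
    then show ?case using add[OF L2_scale[OF indicator_L2[OF pZ C(1)]] simp_fun_L2[OF pZ C(1)] ind[OF C(1)] Cons] by simp
  qed
  show ?thesis
  proof (rule lim[OF f])
    fix e :: real assume "e > 0"
    from simp_fun_dense[OF pZ C f this] obtain xs where "dst Z f (simp_fun C xs) < e" ..
    then show "\<exists>g\<in>L2_fun Z. P g \<and> dst Z f g < e"
      using s simp_fun_L2[OF pZ C(1)] by (intro bexI[of _ "simp_fun C xs"] conjI)
  qed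
qed

lemma U_diff: "U_op Z s q (\<lambda>z. f z - g z) z = U_op Z s q f z - U_op Z s q g z"
  by (simp add: U_op_def left_diff_distrib)

lemma U_nrm: "prob_space Z \<Longrightarrow> nonsingular Z q \<Longrightarrow> f \<in> L2_fun Z \<Longrightarrow> nrm Z (U_op Z s q f) = nrm Z f"
  using U_ip[of Z q f f s] by (simp add: ip_self U_L2 nrm_nonneg del: of_real_power)

text \<open>The modulus is the square root of \<open>t\<close>, which is at most
  \<open>1 + t\<close>. The matrix coefficients on indicators are therefore values of
  \<open>pform\<close> at test functions for which convergence in \<open>Pol\<close> is
  known.\<close>

lemma lcont_powr_half:
  "lcont (\<lambda>t. Re (complex_of_real t powr (1 / 2 + \<i> * complex_of_real s)))" (is "lcont (\<lambda>t. Re (?w t))")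
  "lcont (\<lambda>t. Im (complex_of_real t powr (1 / 2 + \<i> * complex_of_real s)))"
proof -
  have c: "continuous_on {0<..} ?w" by (intro continuous_intros) (auto simp: complex_nonpos_Reals_iff)
  have b: "cmod (?w t) \<le> 1 * (1 + t)" if "t > 0" for t
  proof (rule power2_le_imp_le)
    have "t \<le> (1 + t)\<^sup>2" using that by (simp add: power2_sum)
    then show "(cmod (?w t))\<^sup>2 \<le> (1 * (1 + t))\<^sup>2" using cmod_powr_half[OF that, of s] by simp
  qed (use that in simp)
  show "lcont (\<lambda>t. Re (?w t))" "lcont (\<lambda>t. Im (?w t))"
    unfolding lcont_def using b order_trans[OF abs_Re_le_cmod] order_trans[OF abs_Im_le_cmod]
    by (intro conjI continuous_on_Re continuous_on_Im c exI[of _ 1]; blast)+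
qed

text \<open>Matrix coefficients on indicators converge by the topology of \<open>Pol Z Z\<close>,
  and weak convergence spreads by density; as the operators are isometric, it upgrades to strong
  convergence.\<close>

lemma U_strong_continuous:
  assumes Z: "lebesgue_prob_space Z" and q: "\<forall>\<^sub>F i in F. nonsingular Z (q i)" and q0: "nonsingular Z q0"
    and L: "limitin (pol_topology Z Z) (\<lambda>i. pol_of Z (q i)) (pol_of Z q0) F" and f: "f \<in> L2_fun Z"
  shows "((\<lambda>i. dst Z (U_op Z s (q i) f) (U_op Z s q0 f)) \<longlongrightarrow> 0) F"
proof -
  have pZ: "prob_space Z" using Z by (simp add: lebesgue_prob_space_def)
  interpret prob_space Z by (rule pZ)
  let ?U = "U_op Z s"
  let ?I = "\<lambda>A z. complex_of_real (ind A z)"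
  let ?w = "\<lambda>t. complex_of_real t powr (1 / 2 + \<i> * complex_of_real s)"
  have coeff: "Re (ip Z (?U q (?I A)) (?I B)) = sform B A (\<lambda>t. Re (?w t)) (pol_of Z q)"
    "Im (ip Z (?U q (?I A)) (?I B)) = sform B A (\<lambda>t. Im (?w t)) (pol_of Z q)"
    if A: "A \<in> sets Z" and B: "B \<in> sets Z" and q: "nonsingular Z q" for A B q
  proof -
    have i: "integrable Z (\<lambda>z. ?U q (?I A) z * cnj (?I B z))"
      by (intro ip_integrable U_L2 pZ q indicator_L2 A B)
    have m: "(\<lambda>t. Re (?w t)) \<in> borel_measurable Rpos" "(\<lambda>t. Im (?w t)) \<in> borel_measurable Rpos"
      using lcont_lfun[OF lcont_powr_half(1)] lcont_lfun[OF lcont_powr_half(2)] by (auto simp: lfun_def)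
    show "Re (ip Z (?U q (?I A)) (?I B)) = sform B A (\<lambda>t. Re (?w t)) (pol_of Z q)"
      unfolding ip_def integral_Re[OF i, symmetric] using A B m
      by (subst pform_pol_of[OF pZ q]) (auto intro!: Bochner_Integration.integral_cong simp: U_op_def indicator_def)
    show "Im (ip Z (?U q (?I A)) (?I B)) = sform B A (\<lambda>t. Im (?w t)) (pol_of Z q)"
      unfolding ip_def integral_Im[OF i, symmetric] using A B m
      by (subst pform_pol_of[OF pZ q]) (auto intro!: Bochner_Integration.integral_cong simp: U_op_def indicator_def)
  qed
  have weak: "((\<lambda>i. ip Z (?U (q i) (?I A)) h) \<longlongrightarrow> ip Z (?U q0 (?I A)) h) F" if A: "A \<in> sets Z" and h: "h \<in> L2_fun Z" for A h
    using Z h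
  proof (induction rule: L2_induct)
    case (indicator c B)
    note bb = bfun_indicator[OF indicator] bfun_indicator[OF A]
    have "((\<lambda>i. ip Z (?U (q i) (?I A)) (?I B)) \<longlongrightarrow> ip Z (?U q0 (?I A)) (?I B)) F"
      unfolding tendsto_complex_iff
    proof
      have "\<forall>\<^sub>F i in F. sform B A (\<lambda>t. Re (?w t)) (pol_of Z (q i)) = Re (ip Z (?U (q i) (?I A)) (?I B))"
        using q by eventually_elim (simp only: coeff[OF A indicator])
      with limitin_pol_tendsto[OF pZ pZ L bb lcont_powr_half(1)[of s]]
      show "((\<lambda>i. Re (ip Z (?U (q i) (?I A)) (?I B))) \<longlongrightarrow> Re (ip Z (?U q0 (?I A)) (?I B))) F"
        unfolding coeff(1)[OF A indicator q0, symmetric] by (rule Lim_transform_eventually)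
      have "\<forall>\<^sub>F i in F. sform B A (\<lambda>t. Im (?w t)) (pol_of Z (q i)) = Im (ip Z (?U (q i) (?I A)) (?I B))"
        using q by eventually_elim (simp only: coeff[OF A indicator])
      with limitin_pol_tendsto[OF pZ pZ L bb lcont_powr_half(2)[of s]]
      show "((\<lambda>i. Im (ip Z (?U (q i) (?I A)) (?I B))) \<longlongrightarrow> Im (ip Z (?U q0 (?I A)) (?I B))) F"
        unfolding coeff(2)[OF A indicator q0, symmetric] by (rule Lim_transform_eventually)
    qed
    then have "((\<lambda>i. cnj c * ip Z (?U (q i) (?I A)) (?I B)) \<longlongrightarrow> cnj c * ip Z (?U q0 (?I A)) (?I B)) F"
      by (rule tendsto_mult_left)
    moreover have "ip Z g (\<lambda>z. c * ?I B z) = cnj c * ip Z g (?I B)" for g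
      by (subst (1 2) ip_cnj) (simp add: ip_scale)
    ultimately show ?case by simp
  next
    case (add h h')
    have e: "ip Z (?U q (?I A)) h + ip Z (?U q (?I A)) h' = ip Z (?U q (?I A)) (\<lambda>z. h z + h' z)" if "nonsingular Z q" for q
      by (intro ip_add2[symmetric] add U_L2 pZ that indicator_L2 A)
    have "\<forall>\<^sub>F i in F. ip Z (?U (q i) (?I A)) h + ip Z (?U (q i) (?I A)) h' = ip Z (?U (q i) (?I A)) (\<lambda>z. h z + h' z)"
      using q by eventually_elim (rule e)
    with tendsto_add[OF add(3,4)] show ?case unfolding e[OF q0] by (rule Lim_transform_eventually)
  next
    case (limit h)
    show ?case
    proof (rule tendstoI)
      fix e :: real assume e: "e > 0"
      obtain h' where h': "h' \<in> L2_fun Z" "dst Z h h' < e / 3"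
        "((\<lambda>i. ip Z (?U (q i) (?I A)) h') \<longlongrightarrow> ip Z (?U q0 (?I A)) h') F"
        using limit(2)[of "e / 3"] e by auto
      have "(LINT z|Z. (cmod (?I A z))\<^sup>2) = (LINT z|Z. ind A z)"
        by (intro Bochner_Integration.integral_cong refl) (auto simp: indicator_def)
      then have le1: "nrm Z (?I A) \<le> 1" using A by (simp add: nrm_def)
      \<comment> \<open>The operators are isometric and indicators have norm at most 1, so the error
        is uniform along the filter.\<close>
      have b: "cmod (ip Z (?U q (?I A)) h - ip Z (?U q (?I A)) h') < e / 3" if q: "nonsingular Z q" for q
      proof -
        have UL: "?U q (?I A) \<in> L2_fun Z" by (intro U_L2 pZ q indicator_L2 A)
        have "cmod (ip Z (?U q (?I A)) h - ip Z (?U q (?I A)) h') \<le> nrm Z (?U q (?I A)) * dst Z h h'"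
          unfolding ip_diff2[OF limit(1) h'(1) UL, symmetric] by (intro L2_Cauchy_Schwarz UL L2_diff limit h')
        also have "\<dots> \<le> 1 * dst Z h h'"
          using le1 U_nrm[OF pZ q indicator_L2[OF pZ A]] by (intro mult_right_mono nrm_nonneg) simp
        finally show ?thesis using h'(2) by simp
      qed
      have "\<forall>\<^sub>F i in F. dist (ip Z (?U (q i) (?I A)) h') (ip Z (?U q0 (?I A)) h') < e / 3"
        using h'(3) e by (intro tendstoD) auto
      then show "\<forall>\<^sub>F i in F. dist (ip Z (?U (q i) (?I A)) h) (ip Z (?U q0 (?I A)) h) < e"
        using q
      proof eventually_elim
        case (elim i)
        show ?case
          using elim(1) b[OF elim(2)] b[OF q0] unfolding dist_norm by norm
      qed
    qed
  qed
  show ?thesis using Z f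
  proof (induction rule: L2_induct)
    case (indicator c A)
    have iL: "?I A \<in> L2_fun Z" by (rule indicator_L2[OF pZ indicator])
    \<comment> \<open>Expansion of the squared distance between two isometric images of one vector;
      weak convergence sends the cross term to the squared norm.\<close>
    have e: "2 * (nrm Z (?I A))\<^sup>2 - 2 * Re (ip Z (?U p (?I A)) (?U q0 (?I A))) = (dst Z (?U p (?I A)) (?U q0 (?I A)))\<^sup>2"
      if p: "nonsingular Z p" for p
    proof -
      note UL = U_L2[OF pZ p iL, of s] U_L2[OF pZ q0 iL, of s]
      have "(dst Z (?U p (?I A)) (?U q0 (?I A)))\<^sup>2 =
        Re (ip Z (\<lambda>z. ?U p (?I A) z - ?U q0 (?I A) z) (\<lambda>z. ?U p (?I A) z - ?U q0 (?I A) z))"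
        by (simp only: ip_self Re_complex_of_real)
      also have "\<dots> = Re (ip Z (?U p (?I A)) (?U p (?I A))) - Re (ip Z (?U p (?I A)) (?U q0 (?I A)))
        - (Re (ip Z (?U q0 (?I A)) (?U p (?I A))) - Re (ip Z (?U q0 (?I A)) (?U q0 (?I A))))"
        by (simp only: ip_diff[OF UL L2_diff[OF UL]] ip_diff2[OF UL UL(1)] ip_diff2[OF UL UL(2)] minus_complex.sel)
      also have "Re (ip Z (?U q0 (?I A)) (?U p (?I A))) = Re (ip Z (?U p (?I A)) (?U q0 (?I A)))"
        by (subst ip_cnj) simp
      finally show ?thesis unfolding ip_self U_nrm[OF pZ p iL] U_nrm[OF pZ q0 iL] Re_complex_of_real by linarith
    qed
    have "((\<lambda>i. 2 * (nrm Z (?I A))\<^sup>2 - 2 * Re (ip Z (?U (q i) (?I A)) (?U q0 (?I A)))) \<longlongrightarrow>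
        2 * (nrm Z (?I A))\<^sup>2 - 2 * Re (ip Z (?U q0 (?I A)) (?U q0 (?I A)))) F"
      by (intro tendsto_intros weak indicator U_L2 pZ q0 iL)
    moreover have "2 * (nrm Z (?I A))\<^sup>2 - 2 * Re (ip Z (?U q0 (?I A)) (?U q0 (?I A))) = 0"
      unfolding e[OF q0] by (simp add: nrm_def)
    moreover have "\<forall>\<^sub>F i in F. 2 * (nrm Z (?I A))\<^sup>2 - 2 * Re (ip Z (?U (q i) (?I A)) (?U q0 (?I A))) =
        (dst Z (?U (q i) (?I A)) (?U q0 (?I A)))\<^sup>2"
      using q by eventually_elim (rule e)
    ultimately have "((\<lambda>i. (dst Z (?U (q i) (?I A)) (?U q0 (?I A)))\<^sup>2) \<longlongrightarrow> 0) F"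
      using Lim_transform_eventually by fastforce
    from tendsto_mult_left[OF tendsto_real_sqrt[OF this], of "cmod c"]
    have "((\<lambda>i. cmod c * dst Z (?U (q i) (?I A)) (?U q0 (?I A))) \<longlongrightarrow> 0) F"
      by (simp add: nrm_nonneg)
    moreover have "nrm Z (\<lambda>z. ?U p (\<lambda>z. c * ?I A z) z - ?U q0 (\<lambda>z. c * ?I A z) z) = cmod c * dst Z (?U p (?I A)) (?U q0 (?I A))" for p
      unfolding nrm_scale[symmetric] by (simp only: U_op_def right_diff_distrib mult.assoc)
    ultimately show ?case by (simp only:)
  next
    case (add f g)
    show ?case
    proof (rule Lim_null_comparison)
      show "\<forall>\<^sub>F i in F. norm (nrm Z (\<lambda>z. ?U (q i) (\<lambda>z. f z + g z) z - ?U q0 (\<lambda>z. f z + g z) z))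
        \<le> dst Z (?U (q i) f) (?U q0 f) + dst Z (?U (q i) g) (?U q0 g)"
        using q
      proof eventually_elim
        case (elim i)
        have "nrm Z (\<lambda>z. ?U (q i) (\<lambda>z. f z + g z) z - ?U q0 (\<lambda>z. f z + g z) z) =
          nrm Z (\<lambda>z. (?U (q i) f z - ?U q0 f z) + (?U (q i) g z - ?U q0 g z))"
          by (simp add: U_op_def distrib_right algebra_simps)
        also have "\<dots> \<le> dst Z (?U (q i) f) (?U q0 f) + dst Z (?U (q i) g) (?U q0 g)"
          by (intro nrm_triangle L2_diff U_L2 pZ elim q0 add)
        finally show ?case by (simp add: nrm_nonneg)
      qed
      show "((\<lambda>i. dst Z (?U (q i) f) (?U q0 f) + dst Z (?U (q i) g) (?U q0 g)) \<longlongrightarrow> 0) F"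
        using tendsto_add[OF add(3,4)] by simp
    qed
  next
    case (limit f)
    show ?case
    proof (rule tendstoI)
      fix e :: real assume e: "e > 0"
      obtain g where g: "g \<in> L2_fun Z" "dst Z f g < e / 3"
        "((\<lambda>i. dst Z (?U (q i) g) (?U q0 g)) \<longlongrightarrow> 0) F"
        using limit(2)[of "e / 3"] e by auto
      have fg: "dst Z (?U p f) (?U p g) < e / 3" if p: "nonsingular Z p" for p
        using U_nrm[OF pZ p L2_diff[OF limit(1) g(1)], of s] g(2) by (simp add: U_diff[abs_def])
      have "\<forall>\<^sub>F i in F. dst Z (?U (q i) g) (?U q0 g) < e / 3"
        using g(3) e by (intro order_tendstoD(2)[where y = 0]) auto
      then show "\<forall>\<^sub>F i in F. dist (dst Z (?U (q i) f) (?U q0 f)) 0 < e"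
        using q
      proof eventually_elim
        case (elim i)
        note UL = U_L2[OF pZ elim(2) limit(1), of s] U_L2[OF pZ elim(2) g(1), of s] U_L2[OF pZ q0 g(1), of s] U_L2[OF pZ q0 limit(1), of s]
        have "dst Z (?U (q i) f) (?U q0 f) < e"
          using nrm_diff_triangle[OF UL(1,2,4)] nrm_diff_triangle[OF UL(2,3,4)] elim(1) fg[OF elim(2)] fg[OF q0]
            nrm_commute[of Z "?U q0 g" "?U q0 f"] by linarith
        then show ?case by (simp add: nrm_nonneg)
      qed
    qed
  qed
qed

text \<open>\<open>\<sigma> l\<close> carries the set where \<open>E\<close> and its preimage
  disagree onto the symmetric difference of \<open>E\<close> and its image; nonsingularity transfers
  nullity both ways.\<close>

lemma invariant_set_iff:
  assumes Z: "prob_space Z" and q: "\<forall>l\<in>L. nonsingular Z (\<sigma> l)"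
  shows "E \<in> invariant_sets Z \<sigma> L \<longleftrightarrow> E \<in> sets Z \<and> (\<forall>l\<in>L. AE z in Z. z \<in> E \<longleftrightarrow> \<sigma> l z \<in> E)"
proof -
  have "(E - \<sigma> l ` E) \<union> (\<sigma> l ` E - E) \<in> null_sets Z \<longleftrightarrow> (AE z in Z. z \<in> E \<longleftrightarrow> \<sigma> l z \<in> E)"
    if E: "E \<in> sets Z" and l: "l \<in> L" for l
  proof -
    let ?D = "(E - \<sigma> l ` E) \<union> (\<sigma> l ` E - E)" and ?M = "{z \<in> space Z. \<not> (z \<in> E \<longleftrightarrow> \<sigma> l z \<in> E)}"
    have ns: "bij_betw (\<sigma> l) (space Z) (space Z)" "\<And>N. N \<in> null_sets Z \<Longrightarrow> \<sigma> l ` N \<in> null_sets Z"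
      "\<And>N. N \<in> null_sets Z \<Longrightarrow> \<sigma> l -` N \<inter> space Z \<in> null_sets Z"
      using bspec[OF q l] by (auto simp: nonsingular_def)
    note [measurable] = ns_measurable(1)[OF Z bspec[OF q l]] E
    have sub: "E \<subseteq> space Z" by (rule sets.sets_into_space[OF E])
    have M: "?M \<in> sets Z" by measurable
    have inj: "\<sigma> l z \<in> \<sigma> l ` E \<longleftrightarrow> z \<in> E" if "z \<in> space Z" for z
      using ns(1) sub that unfolding bij_betw_def inj_on_def by blast
    have im: "\<sigma> l ` ?M = ?D"
    proof (intro equalityI subsetI)
      fix y assume y: "y \<in> ?D"
      then have "y \<in> space Z" using sub ns(1) unfolding bij_betw_def by blast
      then obtain z where z: "z \<in> space Z" "y = \<sigma> l z" using ns(1) unfolding bij_betw_def by blast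
      then show "y \<in> \<sigma> l ` ?M" using y inj[OF z(1)] by blast
    next
      fix y assume "y \<in> \<sigma> l ` ?M"
      then obtain z where "z \<in> space Z" "y = \<sigma> l z" "\<not> (z \<in> E \<longleftrightarrow> \<sigma> l z \<in> E)" by blast
      then show "y \<in> ?D" using inj[of z] by auto
    qed
    have vim: "\<sigma> l -` ?D \<inter> space Z = ?M" using inj by auto
    have "?D \<in> null_sets Z \<longleftrightarrow> ?M \<in> null_sets Z" using ns(2)[of ?M] ns(3)[of ?D] unfolding im vim by blast
    also have "\<dots> \<longleftrightarrow> (AE z in Z. z \<in> E \<longleftrightarrow> \<sigma> l z \<in> E)" by (rule AE_iff_null[OF M, symmetric])
    finally show ?thesis .
  qed
  then show ?thesis unfolding invariant_sets_def by blast
qed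

section \<open>Conditional expectation and invariant functions\<close>

lemma AE_eq_of_rat_less:
  fixes f g :: "'z \<Rightarrow> real"
  assumes "\<And>r::rat. AE z in Z. f z < of_rat r \<longleftrightarrow> g z < of_rat r" shows "AE z in Z. f z = g z"
proof -
  have "AE z in Z. \<forall>r::rat. f z < of_rat r \<longleftrightarrow> g z < of_rat r" using assms by (simp add: AE_all_countable)
  then show ?thesis
  proof eventually_elim
    case (elim z)
    show ?case
    proof (rule ccontr)
      assume "f z \<noteq> g z"
      then consider "f z < g z" | "g z < f z" by linarith
      then show False
      proof cases
        case 1
        from of_rat_dense[OF this] obtain r where "f z < of_rat r" "of_rat r < g z" by blast
        then show False using elim by (meson less_asym)
      next
        case 2
        from of_rat_dense[OF this] obtain r where "g z < of_rat r" "of_rat r < f z" by blast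
        then show False using elim by (meson less_asym)
      qed
    qed
  qed
qed

context
  fixes Z :: "'z measure" and Q :: "'w measure" and \<pi> \<sigma> and L :: "'g set" and A e
  assumes Z: "lebesgue_prob_space Z" and q: "\<forall>l\<in>L. nonsingular Z (\<sigma> l)"
    and quot: "is_quotient Z (invariant_sets Z \<sigma> L) Q \<pi>" and A: "A \<in> sets Z" and e: "is_cexp Z Q \<pi> A e"
begin

private lemma pZ: "prob_space Z"
  using Z by (simp add: lebesgue_prob_space_def)

private lemma quotD: "lebesgue_prob_space Q" "\<pi> \<in> measurable Z Q" "distr Z Q \<pi> = Q"
  using quot by (auto simp: is_quotient_def)

text \<open>\<open>e\<close> factors through the quotient map, so its sublevel sets at rational
  levels are invariant, and countably many of them determine it.\<close>

lemma cexp_invariant: assumes l: "l \<in> L" shows "AE z in Z. e (\<sigma> l z) = e z"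
proof (rule AE_eq_of_rat_less)
  fix r :: rat
  obtain \<alpha> where \<alpha>: "bfun Q \<alpha>" "e = (\<lambda>z. \<alpha> (\<pi> z))" using e unfolding is_cexp_def by blast
  have [measurable]: "\<alpha> \<in> borel_measurable Q" using \<alpha>(1) by (rule bfun_measurable)
  have "{y \<in> space Q. \<alpha> y < of_rat r} \<in> sets Q" by measurable
  then have E: "\<pi> -` {y \<in> space Q. \<alpha> y < of_rat r} \<inter> space Z \<in> invariant_sets Z \<sigma> L"
    using quot unfolding is_quotient_def by blast
  have eq: "z \<in> \<pi> -` {y \<in> space Q. \<alpha> y < of_rat r} \<inter> space Z \<longleftrightarrow> e z < of_rat r" if "z \<in> space Z" for z
    using that measurable_space[OF quotD(2)] by (simp add: \<alpha>(2))
  have "AE z in Z. z \<in> \<pi> -` {y \<in> space Q. \<alpha> y < of_rat r} \<inter> space Z \<longleftrightarrow> \<sigma> l z \<in> \<pi> -` {y \<in> space Q. \<alpha> y < of_rat r} \<inter> space Z"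
    using E l unfolding invariant_set_iff[OF pZ q] by blast
  then show "AE z in Z. e (\<sigma> l z) < of_rat r \<longleftrightarrow> e z < of_rat r"
    using AE_space
  proof eventually_elim
    case (elim z)
    then show ?case using eq[of z] eq[of "\<sigma> l z"] measurable_space[OF ns_measurable(1)[OF pZ bspec[OF q l]], of z] by blast
  qed
qed

text \<open>On invariant sets \<open>ind A\<close> and \<open>e\<close> have equal integrals. All
  preimages of Borel sets under an invariant \<open>g\<close> are invariant, so the distributions of
  \<open>g\<close> under the two weights coincide, and comparing their means gives the
  claim.\<close>

lemma cexp_integral:
  fixes g :: "'z \<Rightarrow> complex"
  assumes g: "integrable Z g" and inv: "\<And>l. l \<in> L \<Longrightarrow> AE z in Z. g (\<sigma> l z) = g z"
  shows "(LINT z|Z. ind A z *\<^sub>R g z) = (LINT z|Z. e z *\<^sub>R g z)"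
proof -
  interpret prob_space Z by (rule pZ)
  note b = cexp_bfun[OF Z quotD e]
  note [measurable] = A bfun_measurable[OF b(1)] borel_measurable_integrable[OF g] quotD(2)
  have e1: "0 \<le> e z + 1" for z using b(2)[of z] by linarith
  have gi: "integrable Z (\<lambda>z. c z *\<^sub>R g z)" if c: "bfun Z c" for c
  proof -
    obtain M where M: "0 \<le> M" "\<forall>z\<in>space Z. \<bar>c z\<bar> \<le> M" "c \<in> borel_measurable Z" using bfunD[OF c] by blast
    show ?thesis
    proof (rule Bochner_Integration.integrable_bound)
      show "integrable Z (\<lambda>z. M * cmod (g z))" using g by simp
      show "AE z in Z. norm (c z *\<^sub>R g z) \<le> norm (M * cmod (g z))"
        using M by (intro AE_I2) (auto simp: abs_mult intro!: mult_right_mono)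
    qed (use M in measurable)
  qed
  \<comment> \<open>Only \<open>\<bar>e z\<bar> \<le> 1\<close> is known, so 1 is added to make
    \<open>e\<close> a nonnegative weight, and likewise to \<open>ind A\<close>.\<close>
  have "distr (density Z (\<lambda>z. ennreal (ind A z + 1))) borel g = distr (density Z (\<lambda>z. ennreal (e z + 1))) borel g"
  proof (rule measure_eqI)
    fix D assume "D \<in> sets (distr (density Z (\<lambda>z. ennreal (ind A z + 1))) borel g)"
    then have D [measurable]: "D \<in> sets borel" by simp
    let ?E = "g -` D \<inter> space Z"
    have E: "?E \<in> sets Z" by measurable
    have "?E \<in> invariant_sets Z \<sigma> L"
      unfolding invariant_set_iff[OF pZ q]
    proof (intro conjI ballI E)
      fix l assume l: "l \<in> L"
      show "AE z in Z. z \<in> ?E \<longleftrightarrow> \<sigma> l z \<in> ?E" using inv[OF l] AE_space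
        by eventually_elim (use measurable_space[OF ns_measurable(1)[OF pZ bspec[OF q l]]] in auto)
    qed
    \<comment> \<open>An invariant set comes from the quotient modulo a null set, where the defining
      property of \<open>e\<close> applies.\<close>
    then obtain B where B: "B \<in> sets Q" "(?E - (\<pi> -` B \<inter> space Z)) \<union> ((\<pi> -` B \<inter> space Z) - ?E) \<in> null_sets Z"
      using quot unfolding is_quotient_def by blast
    have EB: "AE z in Z. ind ?E z = (ind B (\<pi> z) :: real)"
      using AE_not_in[OF B(2)] AE_space by eventually_elim (auto simp: indicator_def)
    have BQ: "bfun Q (ind B)" by (rule bfun_indicator[OF B(1)])
    have [measurable]: "B \<in> sets Q" by (rule B(1))
    have key: "(LINT z|Z. indicat_real A z * ind ?E z) = (LINT z|Z. e z * ind ?E z)"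
    proof -
      obtain \<alpha> where \<alpha>: "bfun Q \<alpha>" "e = (\<lambda>z. \<alpha> (\<pi> z))"
        "\<And>h. bfun Q h \<Longrightarrow> (LINT z|Z. indicat_real A z * h (\<pi> z)) = (LINT y|Q. \<alpha> y * h y)"
        using e unfolding is_cexp_def by blast
      have "(LINT z|Z. indicat_real A z * ind ?E z) = (LINT z|Z. indicat_real A z * ind B (\<pi> z))"
        by (rule integral_cong_AE) (use EB E in \<open>auto elim: eventually_mono\<close>)
      also have "\<dots> = (LINT y|Q. \<alpha> y * ind B y)" by (rule \<alpha>(3)[OF BQ])
      also have "\<dots> = (LINT z|Z. \<alpha> (\<pi> z) * ind B (\<pi> z))"
        by (rule integral_pi[OF Z quotD, symmetric, OF bfun_mult[OF \<alpha>(1) BQ]])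
      also have "\<dots> = (LINT z|Z. e z * ind ?E z)" unfolding \<alpha>(2)[symmetric] fun_cong[OF \<alpha>(2), symmetric]
        by (rule integral_cong_AE) (use EB E in \<open>auto elim: eventually_mono\<close>)
      finally show ?thesis .
    qed
    have "emeasure (distr (density Z (\<lambda>z. ennreal (c z + 1))) borel g) D = ennreal (LINT z|Z. (c z + 1) * ind ?E z)"
      if c: "bfun Z c" "\<And>z. 0 \<le> c z + 1" for c
    proof -
      have [measurable]: "c \<in> borel_measurable Z" by (rule bfun_measurable[OF c(1)])
      have i: "integrable Z (\<lambda>z. (c z + 1) * ind ?E z)"
        using bfun_integrable[OF finite_measure_axioms bfun_mult[OF c(1) bfun_indicator[OF E]]] bfun_integrable[OF finite_measure_axioms bfun_indicator[OF E]]
        by (simp add: distrib_right)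
      have "emeasure (distr (density Z (\<lambda>z. ennreal (c z + 1))) borel g) D = (\<integral>\<^sup>+z. ennreal (c z + 1) * ind ?E z \<partial>Z)"
        using E by (simp add: emeasure_distr emeasure_density)
      also have "\<dots> = (\<integral>\<^sup>+z. ennreal ((c z + 1) * ind ?E z) \<partial>Z)"
        by (intro nn_integral_cong) (auto simp: indicator_def)
      also have "\<dots> = ennreal (LINT z|Z. (c z + 1) * ind ?E z)"
        by (rule nn_integral_eq_integral[OF i]) (use c(2) in auto)
      finally show ?thesis .
    qed
    from this[OF bfun_indicator[OF A]] this[OF b(1) e1] key
    show "emeasure (distr (density Z (\<lambda>z. ennreal (ind A z + 1))) borel g) D =
      emeasure (distr (density Z (\<lambda>z. ennreal (e z + 1))) borel g) D"
      using bfun_integrable[OF finite_measure_axioms bfun_mult[OF bfun_indicator[OF A] bfun_indicator[OF E]]]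
        bfun_integrable[OF finite_measure_axioms bfun_mult[OF b(1) bfun_indicator[OF E]]] bfun_integrable[OF finite_measure_axioms bfun_indicator[OF E]]
      by (simp add: distrib_right)
  qed simp
  then have eq: "(LINT x|distr (density Z (\<lambda>z. ennreal (ind A z + 1))) borel g. x) =
    (LINT x|distr (density Z (\<lambda>z. ennreal (e z + 1))) borel g. x)" by simp
  have ds: "(LINT x|distr (density Z (\<lambda>z. ennreal (c z + 1))) borel g. x) = (LINT z|Z. (c z + 1) *\<^sub>R g z)"
    if [measurable]: "c \<in> borel_measurable Z" and c: "\<And>z. 0 \<le> c z + 1" for c
  proof -
    have "(LINT x|distr (density Z (\<lambda>z. ennreal (c z + 1))) borel g. x) = (LINT z|density Z (\<lambda>z. ennreal (c z + 1)). g z)"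
      by (rule integral_distr) measurable
    also have "\<dots> = (LINT z|Z. (c z + 1) *\<^sub>R g z)" by (rule integral_density) (auto simp: c)
    finally show ?thesis .
  qed
  have "(LINT z|Z. (ind A z + 1) *\<^sub>R g z) = (LINT z|Z. (e z + 1) *\<^sub>R g z)"
    by (rule trans[OF ds[symmetric] trans[OF eq ds]]) (use e1 in auto)
  then show ?thesis using gi[OF bfun_indicator[OF A]] gi[OF b(1)] g by (simp add: scaleR_add_left)
qed

end

section \<open>The representation in a model of \<open>L2\<close> and its fixed vectors\<close>

locale l2_rep = l2_model Z J R for Z :: "'z measure" and J :: "('z \<Rightarrow> complex) \<Rightarrow> 'h" and R +
  fixes G :: "('g, 'b) monoid_scheme" and T :: "'g topology" and \<sigma> :: "'g \<Rightarrow> 'z \<Rightarrow> 'z" and s :: real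
  assumes G: "topological_group G T" and Z: "lebesgue_prob_space Z" and act: "nonsingular_action G T Z \<sigma>"
begin

definition \<rho> :: "'g \<Rightarrow> 'h \<Rightarrow> 'h" where "\<rho> g \<Phi> = J (U_op Z s (\<sigma> g) (R \<Phi>))"

lemma ns: "g \<in> carrier G \<Longrightarrow> nonsingular Z (\<sigma> g)"
  using act by (simp add: nonsingular_action_def)

lemma U_in: "g \<in> carrier G \<Longrightarrow> f \<in> L2_fun Z \<Longrightarrow> U_op Z s (\<sigma> g) f \<in> L2_fun Z"
  by (rule U_L2[OF prob_space_axioms ns])

lemma rho_J: assumes g: "g \<in> carrier G" and f: "f \<in> L2_fun Z" shows "\<rho> g (J f) = J (U_op Z s (\<sigma> g) f)"
  unfolding \<rho>_def by (subst J_eq_iff) (intro U_in g R_L2 f U_cong[OF prob_space_axioms ns[OF g]] R_AE)+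

lemma rho_mult:
  assumes g: "g \<in> carrier G" and h: "h \<in> carrier G" and f: "f \<in> L2_fun Z"
  shows "\<rho> (g \<otimes>\<^bsub>G\<^esub> h) (J f) = \<rho> g (\<rho> h (J f))"
proof -
  interpret G: group G using G by (simp add: topological_group_def)
  have gh: "g \<otimes>\<^bsub>G\<^esub> h \<in> carrier G" using g h by simp
  have "AE z in Z. U_op Z s (\<sigma> (g \<otimes>\<^bsub>G\<^esub> h)) f z = U_op Z s (\<sigma> g) (U_op Z s (\<sigma> h) f) z"
    by (rule U_comp[OF prob_space_axioms ns[OF g] ns[OF h] ns[OF gh]])
      (use act g h in \<open>simp add: nonsingular_action_def\<close>)
  then show ?thesis by (simp add: rho_J g h gh f U_in J_eq_iff)
qed

text \<open>The unit acts as an almost everywhere idempotent map, and an injective idempotent is the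
  identity.\<close>

lemma rho_one: assumes f: "f \<in> L2_fun Z" shows "\<rho> \<one>\<^bsub>G\<^esub> (J f) = J f"
proof -
  interpret G: group G using G by (simp add: topological_group_def)
  let ?q = "\<sigma> \<one>\<^bsub>G\<^esub>"
  have o: "\<one>\<^bsub>G\<^esub> \<in> carrier G" by simp
  have "AE z in Z. ?q z = ?q (?q z)" using act o unfolding nonsingular_action_def by (metis G.r_one)
  then have id: "AE z in Z. ?q z = z" using AE_space
  proof eventually_elim
    case (elim z)
    then show ?case using ns[OF o] measurable_space[OF ns_measurable(1)[OF prob_space_axioms ns[OF o]]]
      unfolding nonsingular_def bij_betw_def inj_on_def by metis
  qed
  have "distr Z Z ?q = distr Z Z (\<lambda>z. z)"
    by (rule distr_cong_AE) (use id ns_measurable(1)[OF prob_space_axioms ns[OF o]] in auto)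
  then have "distr Z Z ?q = Z" by (simp add: distr_id2)
  from U_preserving[OF prob_space_axioms ns[OF o] this, of s f] id
  have "AE z in Z. U_op Z s ?q f z = f z" by eventually_elim simp
  then show ?thesis by (simp add: rho_J o f U_in J_eq_iff)
qed

lemma unitary: "unitary_rep G T H \<rho>"
proof -
  interpret G: group G using G by (simp add: topological_group_def)
  have TG: "topspace T = carrier G" using G by (simp add: topological_group_def)
  have oT: "openin T (carrier G)" using openin_topspace[of T] unfolding TG .
  from lebesgue_dense_sets[OF Z]
  obtain C :: "nat \<Rightarrow> 'z set" where C0: "(\<forall>n. C n \<in> sets Z) \<and> (\<forall>A\<in>sets Z. \<forall>e>0. \<exists>n. measure Z ((A - C n) \<union> (C n - A)) < e)" ..
  note C = C0[THEN conjunct1, rule_format] C0[THEN conjunct2, rule_format]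
  have sep: "separable_hilbert_space H"
  proof (rule separable_hilbert[of "range (simp_fun C)"])
    show "range (simp_fun C) \<subseteq> L2_fun Z" using simp_fun_L2[of Z C] prob_space_axioms C(1) by blast
    show "\<exists>g\<in>range (simp_fun C). dst Z f g < e" if "f \<in> L2_fun Z" "e > 0" for f e
      using simp_fun_dense[OF prob_space_axioms C that] by (auto simp: bex_simps)
  qed simp
  have hom: "\<rho> (g \<otimes>\<^bsub>G\<^esub> h) v = \<rho> g (\<rho> h v)" if "g \<in> carrier G" "h \<in> carrier G" "v \<in> hcarrier H" for g h v
    using that by (auto simp: hcarrier_H rho_mult)
  have inn: "\<rho> g v \<in> hcarrier H" if "g \<in> carrier G" "v \<in> hcarrier H" for g v
    using that by (auto simp: hcarrier_H rho_J U_in)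
  have one: "\<rho> \<one>\<^bsub>G\<^esub> v = v" if "v \<in> hcarrier H" for v
    using that by (auto simp: hcarrier_H rho_one)
  have bij: "bij_betw (\<rho> g) (hcarrier H) (hcarrier H)" if g: "g \<in> carrier G" for g
  proof (rule bij_betwI[where g = "\<rho> (inv\<^bsub>G\<^esub> g)"])
    have i: "inv\<^bsub>G\<^esub> g \<in> carrier G" using g by simp
    show "\<rho> (inv\<^bsub>G\<^esub> g) (\<rho> g v) = v" "\<rho> g (\<rho> (inv\<^bsub>G\<^esub> g) v) = v" if "v \<in> hcarrier H" for v
      using that g hom[OF i g that] hom[OF g i that] by (simp_all add: one)
  qed (use g inn in auto)
  have cont: "continuous_map T (htopology H) (\<lambda>g. \<rho> g v)" if "v \<in> hcarrier H" for v
    unfolding continuous_map_atin TG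
  proof
    fix g assume g: "g \<in> carrier G"
    obtain f where f: "f \<in> L2_fun Z" "v = J f" using \<open>v \<in> hcarrier H\<close> by (auto simp: hcarrier_H)
    have ev: "\<forall>\<^sub>F h in atin T g. h \<in> carrier G"
      unfolding eventually_atin using g oT by (intro disjI2 exI[of _ "carrier G"]) simp
    have "limitin (pol_topology Z Z) (\<lambda>h. pol_of Z (\<sigma> h)) (pol_of Z (\<sigma> g)) (atin T g)"
      using act g TG unfolding nonsingular_action_def continuous_map_atin by blast
    from U_strong_continuous[OF Z _ ns[OF g] this f(1), of s] eventually_mono[OF ev ns]
    have lim: "((\<lambda>h. dst Z (U_op Z s (\<sigma> h) f) (U_op Z s (\<sigma> g) f)) \<longlongrightarrow> 0) (atin T g)" by simp
    show "limitin (htopology H) (\<lambda>g. \<rho> g v) (\<rho> g v) (atin T g)"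
      unfolding Metric_space.limitin_metric[OF metric]
    proof (intro conjI allI impI)
      show "\<rho> g v \<in> hcarrier H" by (intro inn g that)
      fix e :: real assume "e > 0"
      with lim have "\<forall>\<^sub>F h in atin T g. dst Z (U_op Z s (\<sigma> h) f) (U_op Z s (\<sigma> g) f) < e"
        by (rule order_tendstoD(2))
      with ev show "\<forall>\<^sub>F h in atin T g. \<rho> h v \<in> hcarrier H \<and> hdist H (\<rho> h v) (\<rho> g v) < e"
        by eventually_elim (simp add: f rho_J g U_in hdist_J hcarrier_H)
    qed
  qed
  have lin: "\<rho> g (hplus H v w) = hplus H (\<rho> g v) (\<rho> g w)" "\<rho> g (hscale H c v) = hscale H c (\<rho> g v)"
    "hinner H (\<rho> g v) (\<rho> g w) = hinner H v w"
    if g: "g \<in> carrier G" and vw: "v \<in> hcarrier H" "w \<in> hcarrier H" for g v w c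
  proof -
    obtain f f' where f: "f \<in> L2_fun Z" "v = J f" "f' \<in> L2_fun Z" "w = J f'" using vw by (auto simp: hcarrier_H)
    have "U_op Z s (\<sigma> g) (\<lambda>z. f z + f' z) = (\<lambda>z. U_op Z s (\<sigma> g) f z + U_op Z s (\<sigma> g) f' z)"
      by (simp add: U_op_def distrib_right fun_eq_iff)
    then show "\<rho> g (hplus H v w) = hplus H (\<rho> g v) (\<rho> g w)"
      by (simp add: f hplus_J L2_add rho_J g U_in)
    have "U_op Z s (\<sigma> g) (\<lambda>z. c * f z) = (\<lambda>z. c * U_op Z s (\<sigma> g) f z)"
      by (simp add: U_op_def mult.assoc fun_eq_iff)
    then show "\<rho> g (hscale H c v) = hscale H c (\<rho> g v)"
      by (simp add: f hscale_J L2_scale rho_J g U_in)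
    show "hinner H (\<rho> g v) (\<rho> g w) = hinner H v w"
      by (simp add: f hinner_J rho_J g U_in U_ip[OF prob_space_axioms ns[OF g]])
  qed
  show ?thesis unfolding unitary_rep_def
    by (intro conjI ballI allI sep bij lin hom cont)
qed

definition invL2 :: "'g set \<Rightarrow> ('z \<Rightarrow> complex) set" where
  "invL2 L = {f \<in> L2_fun Z. \<forall>l\<in>L. AE z in Z. f (\<sigma> l z) = f z}"

context
  fixes L :: "'g set"
  assumes L: "L \<subseteq> carrier G" and pres: "\<And>l. l \<in> L \<Longrightarrow> distr Z Z (\<sigma> l) = Z"
begin

text \<open>Elements of \<open>L\<close> preserve the measure, so the weight is 1 almost everywhere
  and \<open>U_op\<close> is mere composition; the fixed vectors are the invariant functions for
  every \<open>s\<close>.\<close>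

lemma fixed_J: assumes f: "f \<in> L2_fun Z" shows "J f \<in> fixed_vectors H \<rho> L \<longleftrightarrow> f \<in> invL2 L"
proof -
  have "\<rho> l (J f) = J f \<longleftrightarrow> (AE z in Z. f (\<sigma> l z) = f z)" if l: "l \<in> L" for l
  proof -
    have lG: "l \<in> carrier G" using l L by blast
    note p = U_preserving[OF prob_space_axioms ns[OF lG] pres[OF l], of s f]
    show ?thesis unfolding rho_J[OF lG f] J_eq_iff[OF U_in[OF lG f] f]
    proof
      assume "AE z in Z. U_op Z s (\<sigma> l) f z = f z" with p show "AE z in Z. f (\<sigma> l z) = f z" by eventually_elim simp
    next
      assume "AE z in Z. f (\<sigma> l z) = f z" with p show "AE z in Z. U_op Z s (\<sigma> l) f z = f z" by eventually_elim simp
    qed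
  qed
  then show ?thesis using f by (simp add: fixed_vectors_def invL2_def hcarrier_H)
qed

lemma fixed_eq: "fixed_vectors H \<rho> L = J ` invL2 L"
proof -
  have "fixed_vectors H \<rho> L \<subseteq> J ` L2_fun Z" by (auto simp: fixed_vectors_def hcarrier_H)
  moreover have "invL2 L \<subseteq> L2_fun Z" by (auto simp: invL2_def)
  ultimately show ?thesis using fixed_J by blast
qed

text \<open>\<open>e\<close> is invariant and \<open>ind A - e\<close> is orthogonal to all
  invariant functions. A second candidate for the projection differs from \<open>e\<close> by an
  invariant function that is orthogonal to itself.\<close>

lemma orth_proj_indicator:
  assumes quot: "is_quotient Z (invariant_sets Z \<sigma> L) Q \<pi>" and A: "A \<in> sets Z" and e: "is_cexp Z Q \<pi> A e"
  shows "(\<lambda>z. complex_of_real (e z)) \<in> invL2 L"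
    and "g \<in> invL2 L \<Longrightarrow> ip Z (\<lambda>z. complex_of_real (ind A z) - complex_of_real (e z)) g = 0"
    and "orth_proj H (fixed_vectors H \<rho> L) (J (\<lambda>z. complex_of_real (ind A z))) = J (\<lambda>z. complex_of_real (e z))"
proof -
  let ?I = "\<lambda>z. complex_of_real (ind A z)" and ?e = "\<lambda>z. complex_of_real (e z)"
  have q: "\<forall>l\<in>L. nonsingular Z (\<sigma> l)" using L ns by blast
  have qD: "lebesgue_prob_space Q" "\<pi> \<in> measurable Z Q" "distr Z Q \<pi> = Q" using quot by (auto simp: is_quotient_def)
  have I: "?I \<in> L2_fun Z" by (rule indicator_L2[OF prob_space_axioms A])
  have eL: "?e \<in> L2_fun Z" by (rule L2_of_bfun[OF prob_space_axioms cexp_bfun(1)[OF Z qD e]])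
  have inv: "?e \<in> invL2 L" unfolding invL2_def using eL cexp_invariant[OF Z q quot A e] by simp
  then show "?e \<in> invL2 L" .
  have orth: "ip Z (\<lambda>z. ?I z - ?e z) g = 0" if g: "g \<in> invL2 L" for g
  proof -
    have gL: "g \<in> L2_fun Z" using g by (simp add: invL2_def)
    have "integrable Z (\<lambda>z. cmod (g z))" by (rule L1_le_nrm(2)[OF prob_space_axioms gL])
    then have gi: "integrable Z (\<lambda>z. cnj (g z))" using L2_measurable[OF gL] by (simp add: integrable_norm_iff)
    have gv: "AE z in Z. cnj (g (\<sigma> l z)) = cnj (g z)" if "l \<in> L" for l using g that by (simp add: invL2_def)
    have "ip Z ?I g = ip Z ?e g"
      using cexp_integral[OF Z q quot A e gi gv] by (simp add: ip_def scaleR_conv_of_real)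
    then show ?thesis by (simp add: ip_diff[OF I eL gL])
  qed
  then show "g \<in> invL2 L \<Longrightarrow> ip Z (\<lambda>z. ?I z - ?e z) g = 0" .
  show "orth_proj H (fixed_vectors H \<rho> L) (J ?I) = J ?e"
    unfolding orth_proj_def fixed_eq
  proof (rule the_equality)
    show "J ?e \<in> J ` invL2 L \<and> (\<forall>u\<in>J ` invL2 L. hinner H (hplus H (J ?I) (hscale H (- 1) (J ?e))) u = 0)"
    proof (intro conjI imageI inv ballI)
      fix u assume "u \<in> J ` invL2 L"
      then obtain g where g: "g \<in> invL2 L" "u = J g" by blast
      then have "g \<in> L2_fun Z" by (simp add: invL2_def)
      then show "hinner H (hplus H (J ?I) (hscale H (- 1) (J ?e))) u = 0"
        unfolding g(2) hdiff_J[OF I eL] using hinner_J[OF L2_diff[OF I eL]] orth[OF g(1)] by simp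
    qed
    fix w assume w: "w \<in> J ` invL2 L \<and> (\<forall>u\<in>J ` invL2 L. hinner H (hplus H (J ?I) (hscale H (- 1) w)) u = 0)"
    then obtain g where g: "g \<in> invL2 L" "w = J g" by blast
    have gL: "g \<in> L2_fun Z" using g by (simp add: invL2_def)
    let ?d = "\<lambda>z. ?e z - g z"
    have dL: "?d \<in> L2_fun Z" by (rule L2_diff[OF eL gL])
    have d: "?d \<in> invL2 L" unfolding invL2_def
    proof (intro CollectI conjI dL ballI)
      fix l assume "l \<in> L"
      then have "AE z in Z. ?e (\<sigma> l z) = ?e z" "AE z in Z. g (\<sigma> l z) = g z" using inv g(1) by (auto simp: invL2_def)
      then show "AE z in Z. ?e (\<sigma> l z) - g (\<sigma> l z) = ?e z - g z" by eventually_elim simp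
    qed
    have "ip Z (\<lambda>z. ?I z - g z) ?d = 0"
      using w d unfolding g(2) hdiff_J[OF I gL] using hinner_J[OF L2_diff[OF I gL] dL] by auto
    moreover have "ip Z (\<lambda>z. ?I z - ?e z) ?d = 0" by (rule orth[OF d])
    ultimately have "ip Z ?d ?d = 0" by (simp add: ip_diff[OF I gL dL] ip_diff[OF I eL dL] ip_diff[OF eL gL dL])
    then have "AE z in Z. ?d z = 0" using nrm_eq_0[OF dL] by (simp add: ip_self)
    then show "w = J ?e" unfolding g(2) by (subst J_eq_iff[OF gL eL]) (auto elim: eventually_mono)
  qed
qed

end

end

section \<open>Two models of \<open>L2\<close>: classes of functions and sequences\<close>

lemma L2_eq: "L2 Z = l2_space Z (L2_class Z) L2_repr"
  by (simp add: L2_def l2_space_def)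

lemma l2_model_L2: assumes Z: "prob_space Z" shows "l2_model Z (L2_class Z) L2_repr"
proof -
  interpret prob_space Z by (rule Z)
  have "L2_repr (L2_class Z f) \<in> L2_class Z f" if "f \<in> L2_fun Z" for f
    unfolding L2_repr_def by (rule someI[where P = "\<lambda>g. g \<in> L2_class Z f" and x = f]) (use that in \<open>simp add: L2_class_def\<close>)
  moreover have "L2_class Z f = L2_class Z g" if fg: "AE z in Z. f z = g z" for f g
  proof -
    have "(AE z in Z. h z = f z) \<longleftrightarrow> (AE z in Z. h z = g z)" for h
    proof
      assume "AE z in Z. h z = f z" with fg show "AE z in Z. h z = g z" by eventually_elim simp
    next
      assume "AE z in Z. h z = g z" with fg show "AE z in Z. h z = f z" by eventually_elim simp
    qed
    then show ?thesis by (simp add: L2_class_def)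
  qed
  ultimately show ?thesis by unfold_locales (auto simp: L2_class_def)
qed

text \<open>An element of \<open>L\<^sup>2\<close> is encoded by its integrals over a sequence of sets that is dense in the
  measure algebra.\<close>

lemma l2_model_exists:
  assumes Zl: "lebesgue_prob_space (Z :: 'z measure)"
  shows "\<exists>(J :: ('z \<Rightarrow> complex) \<Rightarrow> nat \<Rightarrow> complex) R. l2_model Z J R"
proof -
  have Z: "prob_space Z" using Zl by (simp add: lebesgue_prob_space_def)
  interpret prob_space Z by (rule Z)
  from lebesgue_dense_sets[OF Zl]
  obtain C :: "nat \<Rightarrow> 'z set" where C0: "(\<forall>n. C n \<in> sets Z) \<and> (\<forall>A\<in>sets Z. \<forall>e>0. \<exists>n. measure Z ((A - C n) \<union> (C n - A)) < e)" ..
  note C = C0[THEN conjunct1, rule_format] C0[THEN conjunct2, rule_format]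
  define J where "J f = (\<lambda>n. ip Z f (\<lambda>z. complex_of_real (ind (C n) z)))" for f
  define R where "R \<Phi> = (SOME f. f \<in> L2_fun Z \<and> J f = \<Phi>)" for \<Phi>
  note iL = indicator_L2[OF Z C(1)]
  \<comment> \<open>Equal codes make the difference orthogonal to every \<open>simp_fun\<close>;
    these are dense, so its norm is 0.\<close>
  have inj: "AE z in Z. f z = g z" if f: "f \<in> L2_fun Z" and g: "g \<in> L2_fun Z" and eq: "J f = J g" for f g
  proof -
    let ?d = "\<lambda>z. f z - g z"
    have d: "?d \<in> L2_fun Z" by (rule L2_diff[OF f g])
    have i0: "ip Z (\<lambda>z. complex_of_real (ind (C n) z)) ?d = 0" for n
      using fun_cong[OF eq, of n] by (subst ip_cnj) (simp add: J_def ip_diff[OF f g iL])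
    have s0: "ip Z (simp_fun C xs) ?d = 0" for xs
    proof (induction xs)
      case Nil
      then show ?case by (simp add: simp_fun_def[abs_def] ip_def)
    next
      case (Cons x xs)
      obtain p q n where x: "x = (p, q, n)" by (cases x)
      have "simp_fun C (x # xs) = (\<lambda>z. Complex (of_rat p) (of_rat q) * complex_of_real (ind (C n) z) + simp_fun C xs z)"
        by (simp add: simp_fun_def[abs_def] x indicator_def fun_eq_iff)
      then show ?case
        using ip_add[OF L2_scale[OF iL] simp_fun_L2[of Z C, OF Z C(1)] d] by (simp add: Cons ip_scale i0)
    qed
    have le: "(nrm Z ?d)\<^sup>2 \<le> e * nrm Z ?d" if e: "e > 0" for e
    proof -
      from simp_fun_dense[OF Z C d e] obtain xs where xs: "dst Z ?d (simp_fun C xs) < e" ..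
      have "ip Z (\<lambda>z. ?d z - simp_fun C xs z) ?d = complex_of_real ((nrm Z ?d)\<^sup>2)"
        using ip_diff[OF d simp_fun_L2[of Z C, OF Z C(1)] d, of xs] by (simp only: s0 ip_self diff_zero)
      then have "(nrm Z ?d)\<^sup>2 = cmod (ip Z (\<lambda>z. ?d z - simp_fun C xs z) ?d)" by (simp add: norm_power)
      also have "\<dots> \<le> dst Z ?d (simp_fun C xs) * nrm Z ?d"
        by (intro L2_Cauchy_Schwarz L2_diff[OF d] d simp_fun_L2[of Z C, OF Z C(1)])
      also have "\<dots> \<le> e * nrm Z ?d" using xs by (intro mult_right_mono nrm_nonneg) simp
      finally show ?thesis .
    qed
    have "nrm Z ?d = 0"
    proof (rule ccontr)
      assume "nrm Z ?d \<noteq> 0"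
      then have p: "0 < nrm Z ?d" using nrm_nonneg[of Z ?d] by simp
      \<comment> \<open>At half the norm the estimate says that the squared norm is at most half of
        itself.\<close>
      from le[of "nrm Z ?d / 2"] p show False by (simp add: power2_eq_square)
    qed
    then show ?thesis using nrm_eq_0[OF d] by simp
  qed
  have R: "R (J f) \<in> L2_fun Z \<and> J (R (J f)) = J f" if "f \<in> L2_fun Z" for f
    unfolding R_def by (rule someI[where P = "\<lambda>g. g \<in> L2_fun Z \<and> J g = J f" and x = f]) (use that in simp)
  have "l2_model Z J R"
  proof
    show "R (J f) \<in> L2_fun Z" "AE z in Z. R (J f) z = f z" if "f \<in> L2_fun Z" for f
      using R[OF that] inj[of "R (J f)" f] that by auto
    show "J f = J g" if "f \<in> L2_fun Z" "g \<in> L2_fun Z" "AE z in Z. f z = g z" for f g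
      unfolding J_def by (intro ext ip_cong that iL) simp
  qed
  then show ?thesis by blast
qed

section \<open>Weak limits and density from an exhaustive family\<close>

locale exhaustive_action =
  fixes G :: "('g, 'b) monoid_scheme" and T :: "'g topology"
    and K :: "'g set" and \<A> :: "'a set" and Kf :: "'a \<Rightarrow> 'g set" and \<gamma> :: "nat \<Rightarrow> 'a"
    and Z :: "'z measure" and \<sigma> :: "'g \<Rightarrow> 'z \<Rightarrow> 'z"
    and Q :: "'a \<Rightarrow> 'w measure" and \<pi> :: "'a \<Rightarrow> 'z \<Rightarrow> 'w" and s :: real
  assumes G: "topological_group G T" and MF: "M_family G T K \<A> Kf" and EX: "exhaustive G T \<A> Kf"
    and Z: "lebesgue_prob_space Z" and act: "nonsingular_action G T Z \<sigma>"
    and Kpres: "\<forall>k\<in>K. distr Z Z (\<sigma> k) = Z" and ES: "exhausting_seq G T \<A> Kf \<gamma>"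
    and adm: "admissible \<A> Kf (L2 Z) (\<lambda>g. T_op Z s (\<sigma> g))"
    and quot: "\<forall>\<alpha>\<in>\<A>. is_quotient Z (invariant_sets Z \<sigma> (Kf \<alpha>)) (Q \<alpha>) (\<pi> \<alpha>)"
begin

lemma Zp: "prob_space Z" using Z by (simp add: lebesgue_prob_space_def)

lemma quotD:
  assumes "\<alpha> \<in> \<A>" shows "lebesgue_prob_space (Q \<alpha>)" "\<pi> \<alpha> \<in> measurable Z (Q \<alpha>)" "distr Z (Q \<alpha>) (\<pi> \<alpha>) = Q \<alpha>"
  using quot assms by (auto simp: is_quotient_def)

lemma ns: "g \<in> carrier G \<Longrightarrow> nonsingular Z (\<sigma> g)"
  using act by (simp add: nonsingular_action_def)

lemma Kf_carrier: "\<alpha> \<in> \<A> \<Longrightarrow> Kf \<alpha> \<subseteq> carrier G"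
  using MF unfolding M_family_def closed_subgroup_def subgroup_def by blast

lemma Kf_pres: "\<alpha> \<in> \<A> \<Longrightarrow> l \<in> Kf \<alpha> \<Longrightarrow> distr Z Z (\<sigma> l) = Z"
  using MF Kpres unfolding M_family_def by blast

lemma gamma_in: "\<gamma> k \<in> \<A>"
  using ES by (simp add: exhausting_seq_def)

lemma l2_rep: "l2_model Z J R \<Longrightarrow> l2_rep Z J R G T \<sigma>"
  by (simp add: l2_rep_def l2_rep_axioms_def G Z act)

text \<open>The sequence given by exhaustiveness works for Hilbert spaces with carrier in
  \<open>nat \<Rightarrow> complex\<close>, so the coded model of \<open>L2\<close> is used. There
  the projection of \<open>ind A\<close> is \<open>e\<close>, and measure preserving elements act by
  composition.\<close>

lemma weak_limit:
  assumes \<alpha>: "\<alpha> \<in> \<A>"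
  shows "\<exists>\<theta> :: nat \<Rightarrow> 'g. (\<forall>j. \<theta> j \<in> Kf \<alpha>) \<and> (\<forall>A\<in>sets Z. \<forall>e b. is_cexp Z (Q \<alpha>) (\<pi> \<alpha>) A e \<longrightarrow> bfun Z b \<longrightarrow>
    (\<lambda>j. LINT z|Z. ind A (\<sigma> (\<theta> j) z) * b z) \<longlonglongrightarrow> (LINT z|Z. e z * b z))"
proof -
  obtain J :: "('z \<Rightarrow> complex) \<Rightarrow> nat \<Rightarrow> complex" and R where m: "l2_model Z J R" using l2_model_exists[OF Z] by blast
  interpret N: l2_rep Z J R G T \<sigma> s by (rule l2_rep[OF m])
  obtain \<theta> where \<theta>: "\<forall>j. \<theta> j \<in> Kf \<alpha>" "\<And>(H :: hilb) \<rho>. unitary_rep G T H \<rho> \<Longrightarrow>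
      \<forall>v\<in>hcarrier H. \<forall>w\<in>hcarrier H. (\<lambda>j. hinner H (\<rho> (\<theta> j) v) w)
        \<longlonglongrightarrow> hinner H (orth_proj H (fixed_vectors H \<rho> (Kf \<alpha>)) v) w"
    using EX \<alpha> unfolding exhaustive_def by metis
  note c = Kf_carrier[OF \<alpha>] Kf_pres[OF \<alpha>]
  have "(\<lambda>j. LINT z|Z. ind A (\<sigma> (\<theta> j) z) * b z) \<longlonglongrightarrow> (LINT z|Z. e z * b z)"
    if A: "A \<in> sets Z" and e: "is_cexp Z (Q \<alpha>) (\<pi> \<alpha>) A e" and b: "bfun Z b" for A e b
  proof -
    let ?I = "\<lambda>z. complex_of_real (ind A z)" and ?e = "\<lambda>z. complex_of_real (e z)" and ?b = "\<lambda>z. complex_of_real (b z)"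
    have I: "?I \<in> L2_fun Z" by (rule indicator_L2[OF Zp A])
    have bL: "?b \<in> L2_fun Z" by (rule L2_of_bfun[OF Zp b])
    have eL: "?e \<in> L2_fun Z" by (rule L2_of_bfun[OF Zp cexp_bfun(1)[OF Z quotD[OF \<alpha>] e]])
    have \<theta>c: "\<theta> j \<in> carrier G" for j using \<theta>(1) c(1) by blast
    have "(\<lambda>j. hinner N.H (N.\<rho> (\<theta> j) (J ?I)) (J ?b)) \<longlonglongrightarrow> hinner N.H (orth_proj N.H (fixed_vectors N.H N.\<rho> (Kf \<alpha>)) (J ?I)) (J ?b)"
      using \<theta>(2)[OF N.unitary] I bL by (simp add: N.hcarrier_H)
    moreover have "orth_proj N.H (fixed_vectors N.H N.\<rho> (Kf \<alpha>)) (J ?I) = J ?e"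
      by (rule N.orth_proj_indicator(3)[OF c(1) _ bspec[OF quot \<alpha>] A e]) (rule c(2))
    ultimately have "(\<lambda>j. ip Z (U_op Z s (\<sigma> (\<theta> j)) ?I) ?b) \<longlonglongrightarrow> ip Z ?e ?b"
      by (simp only: N.rho_J[OF \<theta>c I] N.hinner_J[OF N.U_in[OF \<theta>c I] bL] N.hinner_J[OF eL bL])
    then have lim: "(\<lambda>j. Re (ip Z (U_op Z s (\<sigma> (\<theta> j)) ?I) ?b)) \<longlonglongrightarrow> Re (ip Z ?e ?b)" by (rule tendsto_Re)
    have e': "Re (ip Z ?e ?b) = (LINT z|Z. e z * b z)"
      unfolding ip_def by (simp flip: of_real_mult)
    have "Re (ip Z (U_op Z s (\<sigma> (\<theta> j)) ?I) ?b) = (LINT z|Z. ind A (\<sigma> (\<theta> j) z) * b z)" for j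
    proof -
      note [measurable] = ns_measurable(1)[OF Zp ns[OF \<theta>c[of j]]] A bfun_measurable[OF b]
      have "ip Z (U_op Z s (\<sigma> (\<theta> j)) ?I) ?b = (LINT z|Z. complex_of_real (ind A (\<sigma> (\<theta> j) z) * b z))"
        unfolding ip_def
      proof (rule integral_cong_AE)
        show "(\<lambda>z. U_op Z s (\<sigma> (\<theta> j)) ?I z * cnj (?b z)) \<in> borel_measurable Z"
          by (rule borel_measurable_integrable[OF ip_integrable(1)[OF N.U_in[OF \<theta>c I] bL]])
        show "AE z in Z. U_op Z s (\<sigma> (\<theta> j)) ?I z * cnj (?b z) = complex_of_real (ind A (\<sigma> (\<theta> j) z) * b z)"
          using U_preserving[OF Zp ns[OF \<theta>c] c(2)[OF spec[OF \<theta>(1), of j]], of s ?I] by eventually_elim simp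
      qed measurable
      then show ?thesis by (simp only: integral_complex_of_real Re_complex_of_real)
    qed
    then show ?thesis using lim unfolding e' by simp
  qed
  then show ?thesis using \<theta>(1) by blast
qed

text \<open>Admissibility is assumed for classes and carried to the coded model, where the
  exhausting sequence yields density of the functions invariant under some
  \<open>Kf (\<gamma> j)\<close>. The conditional expectation is the best invariant approximation in
  \<open>L2\<close>, and \<open>L1\<close> norms are below \<open>L2\<close> norms.\<close>

lemma cexp_tendsto:
  assumes A: "A \<in> sets Z" and e: "\<And>k. is_cexp Z (Q (\<gamma> k)) (\<pi> (\<gamma> k)) A (e k)"
  shows "(\<lambda>k. LINT z|Z. \<bar>e k z - ind A z\<bar>) \<longlonglongrightarrow> 0"
proof -
  interpret M: l2_rep Z "L2_class Z" L2_repr G T \<sigma> s by (rule l2_rep[OF l2_model_L2[OF Zp]])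
  obtain J :: "('z \<Rightarrow> complex) \<Rightarrow> nat \<Rightarrow> complex" and R where m: "l2_model Z J R" using l2_model_exists[OF Z] by blast
  interpret N: l2_rep Z J R G T \<sigma> s by (rule l2_rep[OF m])
  have rho: "(\<lambda>g. T_op Z s (\<sigma> g)) = M.\<rho>" by (intro ext) (simp add: T_op_def M.\<rho>_def U_op_def[abs_def])
  have sub: "(\<Union>\<alpha>\<in>\<A>. M.invL2 (Kf \<alpha>)) \<subseteq> L2_fun Z" "(\<Union>j. M.invL2 (Kf (\<gamma> j))) \<subseteq> L2_fun Z"
    by (auto simp: M.invL2_def)
  have "circ_space \<A> Kf (L2 Z) (\<lambda>g. T_op Z s (\<sigma> g)) = L2_class Z ` (\<Union>\<alpha>\<in>\<A>. M.invL2 (Kf \<alpha>))"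
    unfolding circ_space_def rho L2_eq image_UN by (intro SUP_cong refl M.fixed_eq Kf_carrier Kf_pres)
  then have d: "\<forall>f\<in>L2_fun Z. \<forall>e>0. \<exists>g\<in>(\<Union>\<alpha>\<in>\<A>. M.invL2 (Kf \<alpha>)). dst Z f g < e"
    using adm M.closure_iff[OF sub(1)] unfolding admissible_def L2_eq by simp
  have "circ_space \<A> Kf N.H N.\<rho> = J ` (\<Union>\<alpha>\<in>\<A>. M.invL2 (Kf \<alpha>))"
    unfolding circ_space_def image_UN by (intro SUP_cong refl N.fixed_eq Kf_carrier Kf_pres)
  then have "admissible \<A> Kf N.H N.\<rho>" using d N.closure_iff[OF sub(1)] unfolding admissible_def by simp
  then have "htopology N.H closure_of (\<Union>j. fixed_vectors N.H N.\<rho> (Kf (\<gamma> j))) = hcarrier N.H"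
    by (rule ES[unfolded exhausting_seq_def, THEN conjunct2, rule_format, OF N.unitary])
  moreover have "(\<Union>j. fixed_vectors N.H N.\<rho> (Kf (\<gamma> j))) = J ` (\<Union>j. M.invL2 (Kf (\<gamma> j)))"
    unfolding image_UN by (intro SUP_cong refl N.fixed_eq Kf_carrier[OF gamma_in] Kf_pres[OF gamma_in])
  ultimately have D: "\<forall>f\<in>L2_fun Z. \<forall>e>0. \<exists>g\<in>(\<Union>j. M.invL2 (Kf (\<gamma> j))). dst Z f g < e"
    using N.closure_iff[OF sub(2)] by simp
  let ?I = "\<lambda>z. complex_of_real (ind A z)" and ?e = "\<lambda>k z. complex_of_real (e k z)"
  have I: "?I \<in> L2_fun Z" by (rule indicator_L2[OF Zp A])
  have eL: "?e k \<in> L2_fun Z" for k by (rule L2_of_bfun[OF Zp cexp_bfun(1)[OF Z quotD[OF gamma_in] e]])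
  have dec: "Kf (\<gamma> k) \<subseteq> Kf (\<gamma> j)" if "j \<le> k" for j k
    by (rule lift_Suc_antimono_le[of "\<lambda>k. Kf (\<gamma> k)", OF _ that])
      (rule ES[unfolded exhausting_seq_def, THEN conjunct1, rule_format, THEN conjunct2])
  have "(\<lambda>k. LINT z|Z. \<bar>e k z - ind A z\<bar>) \<longlonglongrightarrow> 0"
  proof (rule LIMSEQ_I)
    fix \<epsilon> :: real assume "\<epsilon> > 0"
    from D[rule_format, OF I this]
    obtain g where g0: "g \<in> (\<Union>j. M.invL2 (Kf (\<gamma> j)))" "dst Z ?I g < \<epsilon>" ..
    then obtain j where "g \<in> M.invL2 (Kf (\<gamma> j))" by (elim UN_E)
    note g = this g0(2)
    have gL: "g \<in> L2_fun Z" using g by (simp add: M.invL2_def)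
    have "(LINT z|Z. \<bar>e k z - ind A z\<bar>) < \<epsilon>" if k: "k \<ge> j" for k
    proof -
      \<comment> \<open>The subgroups decrease, so \<open>g\<close> remains a competitor for all
        later \<open>k\<close>.\<close>
      have gk: "g \<in> M.invL2 (Kf (\<gamma> k))" using g(1) dec[OF k] by (auto simp: M.invL2_def)
      have o1: "?e k \<in> M.invL2 (Kf (\<gamma> k))"
        by (rule M.orth_proj_indicator(1)[OF Kf_carrier[OF gamma_in] _ bspec[OF quot gamma_in] A e]) (rule Kf_pres[OF gamma_in])
      have o2: "ip Z (\<lambda>z. ?I z - ?e k z) h = 0" if "h \<in> M.invL2 (Kf (\<gamma> k))" for h
        by (rule M.orth_proj_indicator(2)[OF Kf_carrier[OF gamma_in] _ bspec[OF quot gamma_in] A e that]) (rule Kf_pres[OF gamma_in])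
      have dL: "(\<lambda>z. ?I z - ?e k z) \<in> L2_fun Z" by (rule L2_diff[OF I eL])
      \<comment> \<open>The error is orthogonal to \<open>e k\<close> and to \<open>g\<close>, so
        its squared norm is its inner product with \<open>ind A - g\<close>; the Cauchy-Schwarz
        inequality then compares the two distances.\<close>
      have "ip Z (\<lambda>z. ?I z - ?e k z) ?I = ip Z (\<lambda>z. ?I z - ?e k z) (\<lambda>z. ?I z - g z)"
        by (simp add: ip_diff2[OF I gL dL] o2[OF gk])
      moreover have "ip Z (\<lambda>z. ?I z - ?e k z) (\<lambda>z. ?I z - ?e k z) = ip Z (\<lambda>z. ?I z - ?e k z) ?I"
        by (simp only: ip_diff2[OF I eL dL] o2[OF o1] diff_zero)
      ultimately have "complex_of_real ((dst Z ?I (?e k))\<^sup>2) = ip Z (\<lambda>z. ?I z - ?e k z) (\<lambda>z. ?I z - g z)"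
        by (simp only: ip_self)
      then have "(dst Z ?I (?e k))\<^sup>2 = cmod (ip Z (\<lambda>z. ?I z - ?e k z) (\<lambda>z. ?I z - g z))" (is "?L37 = _")
        by (metis abs_of_nonneg norm_of_real zero_le_power2)
      also have "\<dots> \<le> dst Z ?I (?e k) * dst Z ?I g"
        by (rule L2_Cauchy_Schwarz(2)[OF dL L2_diff[OF I gL]])
      finally have sq: "?L37 \<le> dst Z ?I (?e k) * dst Z ?I g" .
      have le: "dst Z ?I (?e k) < \<epsilon>"
      proof (cases "dst Z ?I (?e k) = 0")
        case True
        then show ?thesis using \<open>\<epsilon> > 0\<close> by simp
      next
        case False
        then have "0 < dst Z ?I (?e k)" using nrm_nonneg by (simp add: order_less_le)
        then have "dst Z ?I (?e k) \<le> dst Z ?I g" using sq unfolding power2_eq_square by (rule mult_left_le_imp_le[rotated])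
        then show ?thesis using g(2) by simp
      qed
      have "(LINT z|Z. \<bar>e k z - ind A z\<bar>) = (LINT z|Z. cmod (?I z - ?e k z))"
        by (simp add: abs_minus_commute flip: of_real_diff)
      then show ?thesis using L1_le_nrm(1)[OF Zp dL] le by simp
    qed
    then show "\<exists>no. \<forall>k\<ge>no. norm ((LINT z|Z. \<bar>e k z - ind A z\<bar>) - 0) < \<epsilon>"
      by (intro exI[of _ j]) simp
  qed
  then show ?thesis .
qed

end

section \<open>Approximation in the closure of the group\<close>

text \<open>\<open>cond_density\<close> for the graph of \<open>q\<close>: the weight that
  \<open>A\<close> and \<open>f\<close> put on the source is expressed by a bounded density in the
  target variable.\<close>

lemma ns_cond_density:
  assumes Z: "prob_space Z" and q: "nonsingular Z q" and A: "A \<in> sets Z"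
    and f: "f \<in> borel_measurable Rpos" "\<And>t. 0 < t \<Longrightarrow> \<bar>f t\<bar> \<le> C * t"
  shows "\<exists>\<alpha>. bfun Z \<alpha> \<and> (\<forall>y. \<bar>\<alpha> y\<bar> \<le> C) \<and>
    (\<forall>h. bfun Z h \<longrightarrow> (LINT z|Z. ind A z * h (q z) * f (rn_der Z q z)) = (LINT y|Z. \<alpha> y * h y))"
proof -
  let ?u = "pol_of Z q"
  note uP = pol_of_Pol[OF Z q]
  note [measurable] = A f(1) Pol_fst[OF Z Z uP] Pol_t[OF Z Z uP]
  have m: "(\<lambda>z. ind A (fst z) * f (tc z)) \<in> borel_measurable ?u" by measurable
  have C: "0 \<le> C" using f(2)[of 1] by simp
  have le: "\<bar>ind A (fst z) * f (tc z)\<bar> \<le> C * tc z" if "z \<in> space ?u" for z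
    using that f(2)[of "tc z"] C by (auto simp: Pol_space[OF Z Z uP] indicator_def)
  have eq: "(LINT z|?u. ind A (fst z) * f (tc z) * h (yc z)) = (LINT z|Z. ind A z * h (q z) * f (rn_der Z q z))"
    if h: "bfun Z h" for h
    using pform_pol_of[OF Z q borel_measurable_indicator[OF A] bfun_measurable[OF h] f(1)]
    by (simp add: pform_def mult_ac)
  have "\<exists>\<alpha>. bfun Z \<alpha> \<and> (\<forall>y. \<bar>\<alpha> y\<bar> \<le> C) \<and>
      (\<forall>h. bfun Z h \<longrightarrow> (LINT z|?u. ind A (fst z) * f (tc z) * h (yc z)) = (LINT y|Z. \<alpha> y * h y))"
    by (rule cond_density[OF Z Z uP m]) (rule le)
  then show ?thesis by (simp only: eq cong: imp_cong)
qed

context exhaustive_action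
begin

abbreviation "orbit \<equiv> (\<lambda>g. pol_of Z (\<sigma> g)) ` carrier G"
abbreviation "\<mm> \<alpha> \<equiv> m_pol Z (Q \<alpha>) (\<pi> \<alpha>)"
abbreviation "pp \<equiv> pol_prod Z Z Z"

lemmas Pol_pp = comp_op_Pol[OF Zp Zp Zp pol_prod_comp_op(1)[OF Zp Zp Z]]

lemma limit_closure:
  assumes "limitin (pol_topology Z Z) p r sequentially" "\<And>k. p k \<in> pol_topology Z Z closure_of orbit"
  shows "r \<in> pol_topology Z Z closure_of orbit"
  by (rule limitin_closedin[OF assms(1) closedin_closure_of]) (use assms(2) in auto)

lemma orbit_closure: "g \<in> carrier G \<Longrightarrow> pol_of Z (\<sigma> g) \<in> pol_topology Z Z closure_of orbit"
  by (rule subsetD[OF closure_of_subset]) (auto simp: topspace_pol_topology[OF Zp Zp] intro: pol_of_Pol[OF Zp ns])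

lemma action_mult:
  assumes g: "g \<in> carrier G" and h: "h \<in> carrier G"
  shows "g \<otimes>\<^bsub>G\<^esub> h \<in> carrier G" "AE z in Z. \<sigma> (g \<otimes>\<^bsub>G\<^esub> h) z = \<sigma> h (\<sigma> g z)"
    "AE z in Z. rn_der Z (\<sigma> (g \<otimes>\<^bsub>G\<^esub> h)) z = rn_der Z (\<sigma> h) (\<sigma> g z) * rn_der Z (\<sigma> g) z"
proof -
  interpret G: group G using G by (simp add: topological_group_def)
  show gh: "g \<otimes>\<^bsub>G\<^esub> h \<in> carrier G" using g h by simp
  show eq: "AE z in Z. \<sigma> (g \<otimes>\<^bsub>G\<^esub> h) z = \<sigma> h (\<sigma> g z)" using act g h by (simp add: nonsingular_action_def)
  show "AE z in Z. rn_der Z (\<sigma> (g \<otimes>\<^bsub>G\<^esub> h)) z = rn_der Z (\<sigma> h) (\<sigma> g z) * rn_der Z (\<sigma> g) z"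
    by (rule ns_rn_chain[OF Zp ns[OF g] ns[OF h] ns[OF gh] eq])
qed

text \<open>\<open>\<theta> j\<close> has derivative 1 almost everywhere, so in either order the
  derivative of the product comes from \<open>g\<close> alone. Both statements thus reduce to the
  weak limit of composition with \<open>\<theta> j\<close>.\<close>

lemma orbit_times_m:
  assumes g: "g \<in> carrier G" and \<alpha>: "\<alpha> \<in> \<A>"
  shows "pp (pol_of Z (\<sigma> g)) (\<mm> \<alpha>) \<in> pol_topology Z Z closure_of orbit"
    and "pp (\<mm> \<alpha>) (pol_of Z (\<sigma> g)) \<in> pol_topology Z Z closure_of orbit"
proof -
  obtain \<theta> :: "nat \<Rightarrow> 'g" where \<theta>: "\<forall>j. \<theta> j \<in> Kf \<alpha>"
    and lim: "\<forall>A\<in>sets Z. \<forall>e b. is_cexp Z (Q \<alpha>) (\<pi> \<alpha>) A e \<longrightarrow> bfun Z b \<longrightarrow>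
      (\<lambda>j. LINT z|Z. ind A (\<sigma> (\<theta> j) z) * b z) \<longlonglongrightarrow> (LINT z|Z. e z * b z)"
    using weak_limit[OF \<alpha>] by (elim exE conjE)
  have \<theta>c: "\<theta> j \<in> carrier G" for j using \<theta> Kf_carrier[OF \<alpha>] by blast
  note q = quotD[OF \<alpha>]
  note mP = m_pol_Pol[OF Z q]
  note gP = pol_of_Pol[OF Zp ns[OF g]]
  have rn1: "AE z in Z. rn_der Z (\<sigma> (\<theta> j)) z = 1" for j
    by (rule ns_preserving[OF Zp ns[OF \<theta>c] Kf_pres[OF \<alpha>]]) (use \<theta> in blast)
  have "limitin (pol_topology Z Z) (\<lambda>j. pol_of Z (\<sigma> (g \<otimes>\<^bsub>G\<^esub> \<theta> j))) (pp (pol_of Z (\<sigma> g)) (\<mm> \<alpha>)) sequentially"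
  proof (rule limitin_polI[OF Zp Zp])
    fix A B f assume A: "A \<in> sets Z" and B: "B \<in> sets Z" and f: "ccont f"
    have fb: "bfun Rpos f" by (rule bounded_continuous_bfun[OF ccont_bounded_continuous[OF f]])
    obtain e where e: "is_cexp Z (Q \<alpha>) (\<pi> \<alpha>) B e" using cexp_exists[OF Z q B] by blast
    note eb = cexp_bfun(1)[OF Z q e]
    obtain C where C: "\<And>t. 0 < t \<Longrightarrow> \<bar>f t\<bar> \<le> C * t" using ccont_le_linear[OF f] by blast
    \<comment> \<open>\<open>a\<close> transports the weight of \<open>A\<close> and
      \<open>f\<close> through \<open>g\<close>, so that the test value becomes the integral of
      \<open>ind B (\<sigma> (\<theta> j) z)\<close> against a fixed bounded function.\<close>
    obtain a where a: "bfun Z a" and aD: "\<forall>h. bfun Z h \<longrightarrow> (LINT z|Z. ind A z * h (\<sigma> g z) * f (rn_der Z (\<sigma> g) z)) = (LINT y|Z. a y * h y)"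
      using ns_cond_density[OF Zp ns[OF g] A bfun_measurable[OF fb] C] by blast
    have "sform A B f (pol_of Z (\<sigma> (g \<otimes>\<^bsub>G\<^esub> \<theta> j))) = (LINT z|Z. ind B (\<sigma> (\<theta> j) z) * a z)" for j
    proof -
      note m = action_mult[OF g \<theta>c[of j]]
      note bB = bfun_comp[OF bfun_indicator[OF B] ns_measurable(1)[OF Zp ns[OF \<theta>c[of j]]]]
      note [measurable] = A B bfun_measurable[OF fb] ns_measurable(1)[OF Zp ns[OF m(1)]] ns_measurable(1)[OF Zp ns[OF g]] ns_measurable(1)[OF Zp ns[OF \<theta>c[of j]]]
      have [measurable]: "rn_der Z (\<sigma> h) \<in> measurable Z Rpos" if "h \<in> carrier G" for h
        using ns_rn_density[OF Zp ns[OF that]] by (simp add: measurable_Rpos_iff)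
      have [measurable]: "(\<lambda>z. f (rn_der Z (\<sigma> h) z)) \<in> borel_measurable Z" if "h \<in> carrier G" for h
        by (rule measurable_compose[OF _ bfun_measurable[OF fb]]) (use that in measurable)
      have "sform A B f (pol_of Z (\<sigma> (g \<otimes>\<^bsub>G\<^esub> \<theta> j))) =
          (LINT z|Z. ind A z * ind B (\<sigma> (g \<otimes>\<^bsub>G\<^esub> \<theta> j) z) * f (rn_der Z (\<sigma> (g \<otimes>\<^bsub>G\<^esub> \<theta> j)) z))"
        by (rule pform_pol_of[OF Zp ns[OF m(1)]]) (use A B bfun_measurable[OF fb] in auto)
      also have "\<dots> = (LINT z|Z. ind A z * ind B (\<sigma> (\<theta> j) (\<sigma> g z)) * f (rn_der Z (\<sigma> g) z))"
      proof (rule integral_cong_AE)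
        show "AE z in Z. ind A z * ind B (\<sigma> (g \<otimes>\<^bsub>G\<^esub> \<theta> j) z) * f (rn_der Z (\<sigma> (g \<otimes>\<^bsub>G\<^esub> \<theta> j)) z) =
          ind A z * ind B (\<sigma> (\<theta> j) (\<sigma> g z)) * f (rn_der Z (\<sigma> g) z)"
          using m(2,3) ns_AE[OF Zp ns[OF g] rn1[of j]] by eventually_elim simp
      qed (use m(1) g in measurable)
      also have "\<dots> = (LINT z|Z. a z * ind B (\<sigma> (\<theta> j) z))" using aD bB by blast
      finally show ?thesis by (simp add: mult.commute)
    qed
    moreover have "sform A B f (pp (pol_of Z (\<sigma> g)) (\<mm> \<alpha>)) = (LINT z|Z. e z * a z)"
    proof -
      have "sform A B f (pp (pol_of Z (\<sigma> g)) (\<mm> \<alpha>)) = pform (ind A) e f (pol_of Z (\<sigma> g))"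
        by (rule m_pol_right[OF Z q gP A B fb e])
      also have "\<dots> = (LINT z|Z. ind A z * e (\<sigma> g z) * f (rn_der Z (\<sigma> g) z))"
        by (rule pform_pol_of[OF Zp ns[OF g] borel_measurable_indicator[OF A] bfun_measurable[OF eb] bfun_measurable[OF fb]])
      also have "\<dots> = (LINT z|Z. a z * e z)" using aD eb by blast
      finally show ?thesis by (simp add: mult.commute)
    qed
    ultimately show "(\<lambda>j. sform A B f (pol_of Z (\<sigma> (g \<otimes>\<^bsub>G\<^esub> \<theta> j)))) \<longlonglongrightarrow>
        sform A B f (pp (pol_of Z (\<sigma> g)) (\<mm> \<alpha>))"
      using lim B e a by simp
  qed (intro Pol_pp gP mP always_eventually allI pol_of_Pol[OF Zp ns] action_mult g \<theta>c)+
  then show "pp (pol_of Z (\<sigma> g)) (\<mm> \<alpha>) \<in> pol_topology Z Z closure_of orbit"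
    by (rule limit_closure) (intro orbit_closure action_mult g \<theta>c)
  have "limitin (pol_topology Z Z) (\<lambda>j. pol_of Z (\<sigma> (\<theta> j \<otimes>\<^bsub>G\<^esub> g))) (pp (\<mm> \<alpha>) (pol_of Z (\<sigma> g))) sequentially"
  proof (rule limitin_polI[OF Zp Zp])
    fix A B f assume A: "A \<in> sets Z" and B: "B \<in> sets Z" and f: "ccont f"
    have fb: "bfun Rpos f" by (rule bounded_continuous_bfun[OF ccont_bounded_continuous[OF f]])
    obtain e where e: "is_cexp Z (Q \<alpha>) (\<pi> \<alpha>) A e" using cexp_exists[OF Z q A] by blast
    note eb = cexp_bfun[OF Z q e]
    have rnm: "rn_der Z (\<sigma> h) \<in> measurable Z Rpos" if "h \<in> carrier G" for h
      using ns_rn_density[OF Zp ns[OF that]] by (simp add: measurable_Rpos_iff)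
    \<comment> \<open>With \<open>\<theta> j\<close> acting first, the function composed with it is
      \<open>k\<close>, which is bounded but in general no indicator.\<close>
    define k where "k z = ind B (\<sigma> g z) * f (rn_der Z (\<sigma> g) z)" for z
    have kb: "bfun Z k" unfolding k_def
      by (intro bfun_mult bfun_comp[OF bfun_indicator[OF B] ns_measurable(1)[OF Zp ns[OF g]]] bfun_comp[OF fb rnm[OF g]])
    \<comment> \<open>\<open>a j\<close> is the image of \<open>ind A\<close> under the adjoint of
      composition with \<open>\<theta> j\<close>. Its bound by 1, uniform in \<open>j\<close>,
      allows the weak limit to be extended from indicators to \<open>k\<close>.\<close>
    have "\<exists>a. bfun Z a \<and> (\<forall>y. \<bar>a y\<bar> \<le> 1) \<and>
        (\<forall>h. bfun Z h \<longrightarrow> (LINT z|Z. ind A z * h (\<sigma> (\<theta> j) z)) = (LINT y|Z. a y * h y))" for j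
    proof -
      obtain a where a: "bfun Z a" "\<forall>y. \<bar>a y\<bar> \<le> 1"
        "\<forall>h. bfun Z h \<longrightarrow> (LINT z|Z. ind A z * h (\<sigma> (\<theta> j) z) * rn_der Z (\<sigma> (\<theta> j)) z) = (LINT y|Z. a y * h y)"
        using ns_cond_density[OF Zp ns[OF \<theta>c[of j]] A, of "\<lambda>t. t" 1] by auto
      have "(LINT z|Z. ind A z * h (\<sigma> (\<theta> j) z)) = (LINT z|Z. ind A z * h (\<sigma> (\<theta> j) z) * rn_der Z (\<sigma> (\<theta> j)) z)"
        if h: "bfun Z h" for h
      proof (rule integral_cong_AE)
        note [measurable] = A bfun_measurable[OF bfun_comp[OF h ns_measurable(1)[OF Zp ns[OF \<theta>c[of j]]]]] ns_rn_density(1)[OF Zp ns[OF \<theta>c[of j]]]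
        show "(\<lambda>z. ind A z * h (\<sigma> (\<theta> j) z)) \<in> borel_measurable Z" "(\<lambda>z. ind A z * h (\<sigma> (\<theta> j) z) * rn_der Z (\<sigma> (\<theta> j)) z) \<in> borel_measurable Z"
          by measurable
        show "AE z in Z. ind A z * h (\<sigma> (\<theta> j) z) = ind A z * h (\<sigma> (\<theta> j) z) * rn_der Z (\<sigma> (\<theta> j)) z"
          using rn1[of j] by eventually_elim simp
      qed
      then show ?thesis using a by (intro exI[of _ a]) simp
    qed
    then obtain a where a: "\<And>j. bfun Z (a j)" "\<And>j y. \<bar>a j y\<bar> \<le> 1"
      "\<And>j h. bfun Z h \<Longrightarrow> (LINT z|Z. ind A z * h (\<sigma> (\<theta> j) z)) = (LINT y|Z. a j y * h y)" by metis
    have fin: "finite_measure Z" using Zp by (rule prob_space.finite_measure)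
    have ak: "(\<lambda>j. LINT y|Z. a j y * k y) \<longlonglongrightarrow> (LINT y|Z. e y * k y)"
    proof (rule blin_tendsto[where L = "\<lambda>j b. LINT y|Z. a j y * b y" and L' = "\<lambda>b. LINT y|Z. e y * b y" and Y = Z and K = "1 * measure Z (space Z)"])
      show "\<forall>\<^sub>F j in sequentially. blin Z (1 * measure Z (space Z)) (\<lambda>b. LINT y|Z. a j y * b y)"
        by (intro always_eventually allI blin_integral[OF fin a(1)] a(2)) simp
      show "blin Z (1 * measure Z (space Z)) (\<lambda>b. LINT y|Z. e y * b y)" by (rule blin_integral[OF fin eb(1)]) (simp_all add: eb(2))
      fix D assume D: "D \<in> sets Z"
      obtain d where d: "is_cexp Z (Q \<alpha>) (\<pi> \<alpha>) D d" using cexp_exists[OF Z q D] by blast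
      \<comment> \<open>On indicators adjointness leads back to the known limit; it produces the
        conditional expectation of \<open>ind D\<close>, which self-adjointness moves to
        \<open>A\<close>.\<close>
      have "(\<lambda>j. LINT z|Z. ind D (\<sigma> (\<theta> j) z) * ind A z) \<longlonglongrightarrow> (LINT z|Z. d z * ind A z)"
        using lim D d bfun_indicator[OF A] by blast
      then show "(\<lambda>j. LINT y|Z. a j y * ind D y) \<longlonglongrightarrow> (LINT y|Z. e y * ind D y)"
        unfolding a(3)[OF bfun_indicator[OF D], symmetric] cexp_sym[OF Z q e d] by (simp add: mult.commute)
    qed (rule kb)
    have "sform A B f (pol_of Z (\<sigma> (\<theta> j \<otimes>\<^bsub>G\<^esub> g))) = (LINT y|Z. a j y * k y)" for j
    proof -
      note m = action_mult[OF \<theta>c[of j] g]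
      note b1 = bfun_mult[OF bfun_mult[OF bfun_indicator[OF A] bfun_comp[OF bfun_indicator[OF B] ns_measurable(1)[OF Zp ns[OF m(1)]]]] bfun_comp[OF fb rnm[OF m(1)]]]
      note b2 = bfun_mult[OF bfun_indicator[OF A] bfun_comp[OF kb ns_measurable(1)[OF Zp ns[OF \<theta>c[of j]]]]]
      have "sform A B f (pol_of Z (\<sigma> (\<theta> j \<otimes>\<^bsub>G\<^esub> g))) =
          (LINT z|Z. ind A z * ind B (\<sigma> (\<theta> j \<otimes>\<^bsub>G\<^esub> g) z) * f (rn_der Z (\<sigma> (\<theta> j \<otimes>\<^bsub>G\<^esub> g)) z))"
        by (rule pform_pol_of[OF Zp ns[OF m(1)]]) (use A B bfun_measurable[OF fb] in auto)
      also have "\<dots> = (LINT z|Z. ind A z * k (\<sigma> (\<theta> j) z))"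
      proof (rule integral_cong_AE)
        show "AE z in Z. ind A z * ind B (\<sigma> (\<theta> j \<otimes>\<^bsub>G\<^esub> g) z) * f (rn_der Z (\<sigma> (\<theta> j \<otimes>\<^bsub>G\<^esub> g)) z) = ind A z * k (\<sigma> (\<theta> j) z)"
          using m(2,3) rn1[of j] by eventually_elim (simp add: k_def)
      qed (use bfun_measurable[OF b1] bfun_measurable[OF b2] in auto)
      also have "\<dots> = (LINT y|Z. a j y * k y)" by (rule a(3)[OF kb])
      finally show ?thesis .
    qed
    moreover have "sform A B f (pp (\<mm> \<alpha>) (pol_of Z (\<sigma> g))) = (LINT y|Z. e y * k y)"
    proof -
      have "sform A B f (pp (\<mm> \<alpha>) (pol_of Z (\<sigma> g))) = pform e (ind B) f (pol_of Z (\<sigma> g))"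
        by (rule m_pol_left[OF Z q gP A B fb e])
      also have "\<dots> = (LINT z|Z. e z * ind B (\<sigma> g z) * f (rn_der Z (\<sigma> g) z))"
        by (rule pform_pol_of[OF Zp ns[OF g] bfun_measurable[OF eb(1)] borel_measurable_indicator[OF B] bfun_measurable[OF fb]])
      finally show ?thesis by (simp add: k_def mult.assoc)
    qed
    ultimately show "(\<lambda>j. sform A B f (pol_of Z (\<sigma> (\<theta> j \<otimes>\<^bsub>G\<^esub> g)))) \<longlonglongrightarrow>
        sform A B f (pp (\<mm> \<alpha>) (pol_of Z (\<sigma> g)))"
      using ak by simp
  qed (intro Pol_pp gP mP always_eventually allI pol_of_Pol[OF Zp ns] action_mult g \<theta>c)+
  then show "pp (\<mm> \<alpha>) (pol_of Z (\<sigma> g)) \<in> pol_topology Z Z closure_of orbit"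
    by (rule limit_closure) (intro orbit_closure action_mult g \<theta>c)
qed

text \<open>Multiplication by \<open>m_pol\<close> on either side is continuous and maps the orbit
  into its closure, so it maps the closure into itself.\<close>

lemma closure_times_m:
  assumes r: "r \<in> pol_topology Z Z closure_of orbit" and \<alpha>: "\<alpha> \<in> \<A>"
  shows "pp (pp (\<mm> \<alpha>) r) (\<mm> \<alpha>) \<in> pol_topology Z Z closure_of orbit"
proof -
  have mP: "\<mm> \<alpha> \<in> Pol Z Z" by (rule m_pol_Pol[OF Z quotD[OF \<alpha>]])
  have cl: "F ` (pol_topology Z Z closure_of orbit) \<subseteq> pol_topology Z Z closure_of orbit"
    if "continuous_map (pol_topology Z Z) (pol_topology Z Z) F" "F ` orbit \<subseteq> pol_topology Z Z closure_of orbit" for F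
    using continuous_map_image_closure_subset[OF that(1), of orbit] closure_of_mono[OF that(2), of "pol_topology Z Z"] by simp
  have "(\<lambda>v. pp (\<mm> \<alpha>) v) ` (pol_topology Z Z closure_of orbit) \<subseteq> pol_topology Z Z closure_of orbit"
    using pol_prod_comp_op(2)[OF Zp Zp Z] mP orbit_times_m(2)[OF _ \<alpha>] unfolding is_pol_product_def by (intro cl) blast+
  moreover have "(\<lambda>u. pp u (\<mm> \<alpha>)) ` (pol_topology Z Z closure_of orbit) \<subseteq> pol_topology Z Z closure_of orbit"
    using pol_prod_comp_op(2)[OF Zp Zp Z] mP orbit_times_m(1)[OF _ \<alpha>] unfolding is_pol_product_def by (intro cl) blast+
  ultimately show ?thesis using r by blast
qed

text \<open>By \<open>m_pol_both\<close> the test values of the truncations are those of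
  \<open>r\<close> at conditional expectations, which converge to the indicators in
  \<open>L1\<close>.\<close>

lemma tendsto_truncation:
  assumes r: "r \<in> Pol Z Z"
  shows "limitin (pol_topology Z Z) (\<lambda>k. pp (pp (\<mm> (\<gamma> k)) r) (\<mm> (\<gamma> k))) r sequentially"
proof (rule limitin_polI[OF Zp Zp r])
  fix A B f assume A: "A \<in> sets Z" and B: "B \<in> sets Z" and f: "ccont f"
  have fb: "bfun Rpos f" by (rule bounded_continuous_bfun[OF ccont_bounded_continuous[OF f]])
  note q = quotD[OF gamma_in]
  have "\<forall>k. \<exists>e. is_cexp Z (Q (\<gamma> k)) (\<pi> (\<gamma> k)) A e" "\<forall>k. \<exists>e. is_cexp Z (Q (\<gamma> k)) (\<pi> (\<gamma> k)) B e"
    using cexp_exists[OF Z q] A B by blast+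
  then obtain e e' where e: "\<And>k. is_cexp Z (Q (\<gamma> k)) (\<pi> (\<gamma> k)) A (e k)" and e': "\<And>k. is_cexp Z (Q (\<gamma> k)) (\<pi> (\<gamma> k)) B (e' k)"
    by metis
  have "(\<lambda>k. pform (e k) (e' k) f r) \<longlonglongrightarrow> sform A B f r"
    by (rule pform_L1_tendsto[OF Zp r f cexp_bfun[OF Z q e] cexp_bfun[OF Z q e'] bfun_indicator[OF A] _ bfun_indicator[OF B] _
          cexp_tendsto[OF A e] cexp_tendsto[OF B e']]) (auto simp: indicator_def)
  then show "(\<lambda>k. sform A B f (pp (pp (\<mm> (\<gamma> k)) r) (\<mm> (\<gamma> k)))) \<longlonglongrightarrow> sform A B f r"
    by (simp add: m_pol_both[OF Z q r A B fb e e'])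
qed (intro always_eventually allI Pol_pp r m_pol_Pol[OF Z quotD[OF gamma_in]])

end

theorem theorem3p2:
  fixes G :: "('g, 'b) monoid_scheme" and T :: "'g topology"
    and K :: "'g set" and \<A> :: "'a set" and Kf :: "'a \<Rightarrow> 'g set" and \<gamma> :: "nat \<Rightarrow> 'a"
    and Z :: "'z measure" and \<sigma> :: "'g \<Rightarrow> 'z \<Rightarrow> 'z"
    and Q :: "'a \<Rightarrow> 'w measure" and \<pi> :: "'a \<Rightarrow> 'z \<Rightarrow> 'w"
    and s :: real and \<rr> :: "('z \<times> 'z \<times> real) measure"
  assumes "topological_group G T" and "separable_space T"
    and "M_family G T K \<A> Kf" and "exhaustive G T \<A> Kf"
    and "lebesgue_prob_space Z" and "nonsingular_action G T Z \<sigma>"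
    and "\<forall>k\<in>K. distr Z Z (\<sigma> k) = Z"
    and "exhausting_seq G T \<A> Kf \<gamma>"
    and "admissible \<A> Kf (L2 Z) (\<lambda>g. T_op Z s (\<sigma> g))"
    and "\<forall>\<alpha>\<in>\<A>. is_quotient Z (invariant_sets Z \<sigma> (Kf \<alpha>)) (Q \<alpha>) (\<pi> \<alpha>)"
    and "\<rr> \<in> Pol Z Z"
  shows "\<rr> \<in> pol_topology Z Z closure_of (\<lambda>g. pol_of Z (\<sigma> g)) ` carrier G \<longleftrightarrow>
    (\<forall>k. let m = m_pol Z (Q (\<gamma> k)) (\<pi> (\<gamma> k)) in
       pol_prod Z Z Z (pol_prod Z Z Z m \<rr>) m
         \<in> pol_topology Z Z closure_of (\<lambda>g. pol_of Z (\<sigma> g)) ` carrier G)"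
proof -
  interpret exhaustive_action G T K \<A> Kf \<gamma> Z \<sigma> Q \<pi> s
    using assms by unfold_locales
  \<comment> \<open>One direction is stability of the closure under truncation; in the other,
    \<open>\<rr>\<close> is the limit of its truncations and the closure is closed.\<close>
  show ?thesis
    using closure_times_m[OF _ gamma_in] limit_closure[OF tendsto_truncation[OF assms(11)]]
    by (auto simp: Let_def)
qed

end
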